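(* Let $g,h$ be non-negative integers, and let $R$ be a set of $3g+h$ red points and $B$ a set of $3h+g$ blue points in the plane such that $R\cup B$ is in general position and some line separates $R$ from $B$. Then a $K_{1,3}$-covering of $R\cup B$ can be computed in $O(N\log N)$ time, where $N=4(g+h)$.
   Context: General position: no three points collinear. A $K_{1,3}$-covering of a set $X$ of red and blue points is a partition of $X$ into subsets of size $4$, each consisting of one point (the center) of one color and three points of the other color, such that the straight-line segments joining each center to the three other points of its subset are pairwise non-crossing (no two of these segments intersect except at a common endpoint). *)

theory Defs
  imports
    "HOL-Analysis.Analysis"
    "HOL-Library.Disjoint_Sets"
    "HOL-Library.Landau_Symbols"
begin

type_synonym point = "real \<times> real"

definition general_position :: "point set \<Rightarrow> bool" where
  "general_position X \<longleftrightarrow>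
     (\<forall>p\<in>X. \<forall>q\<in>X. \<forall>r\<in>X. p \<noteq> q \<and> p \<noteq> r \<and> q \<noteq> r \<longrightarrow> \<not> collinear {p, q, r})"

definition separated_by_line :: "point set \<Rightarrow> point set \<Rightarrow> bool" where
  "separated_by_line R B \<longleftrightarrow>
     (\<exists>a c. a \<noteq> 0 \<and> (\<forall>r\<in>R. a \<bullet> r < c) \<and> (\<forall>b\<in>B. c < a \<bullet> b))"

definition star_center :: "point set \<Rightarrow> point set \<Rightarrow> point set \<Rightarrow> point \<Rightarrow> bool" where
  "star_center R B S c \<longleftrightarrow>
     c \<in> S \<and> (c \<in> R \<and> S - {c} \<subseteq> B \<or> c \<in> B \<and> S - {c} \<subseteq> R)"

definition star_edges :: "point set \<Rightarrow> point set \<Rightarrow> point set set \<Rightarrow> (point \<times> point) set" where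
  "star_edges R B P = {(c, p). \<exists>S\<in>P. star_center R B S c \<and> p \<in> S - {c}}"

definition K13_covering :: "point set \<Rightarrow> point set \<Rightarrow> point set set \<Rightarrow> bool" where
  "K13_covering R B P \<longleftrightarrow>
     partition_on (R \<union> B) P \<and>
     (\<forall>S\<in>P. card S = 4 \<and> (\<exists>c. star_center R B S c)) \<and>
     (\<forall>(c, p) \<in> star_edges R B P. \<forall>(c', p') \<in> star_edges R B P. (c, p) \<noteq> (c', p') \<longrightarrow>
        closed_segment c p \<inter> closed_segment c' p' \<subseteq> {c, p} \<inter> {c', p'})"

text \<open>
  Running time refers to the real RAM. Programs are while programs over finitely many named
  arrays of unbounded length, holding either natural numbers, which can also serve as addresses,
  or exact real numbers; a scalar variable is a cell of an array with a constant address.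
  Every operation, memory access and test has cost 1. Three restrictions keep the unit cost
  assumption reasonable: there is no rounding and no other conversion from reals to naturals,
  naturals can only be added and subtracted, and the only literals are integers. Subtraction of naturals is truncated and
  division by 0 yields 0; both conditions can also be tested explicitly.
\<close>

record ram =
  nats :: "string \<Rightarrow> nat \<Rightarrow> nat"
  reals :: "string \<Rightarrow> nat \<Rightarrow> real"

datatype nexp =
    NLit nat
  | NGet string nexp
  | NAdd nexp nexp
  | NSub nexp nexp

datatype rexp =
    RLit int
  | RGet string nexp
  | RAdd rexp rexp
  | RSub rexp rexp
  | RMul rexp rexp
  | RDiv rexp rexp

datatype bexp =
    NLess nexp nexp
  | RLess rexp rexp
  | BNot bexp
  | BAnd bexp bexp

datatype com =
    Skip
  | NSet string nexp nexp
  | RSet string nexp rexp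
  | Seq com com
  | Cond bexp com com
  | While bexp com

primrec nval :: "nexp \<Rightarrow> ram \<Rightarrow> nat" where
  "nval (NLit n) s = n"
| "nval (NGet a i) s = nats s a (nval i s)"
| "nval (NAdd e f) s = nval e s + nval f s"
| "nval (NSub e f) s = nval e s - nval f s"

primrec rval :: "rexp \<Rightarrow> ram \<Rightarrow> real" where
  "rval (RLit k) s = real_of_int k"
| "rval (RGet a i) s = reals s a (nval i s)"
| "rval (RAdd e f) s = rval e s + rval f s"
| "rval (RSub e f) s = rval e s - rval f s"
| "rval (RMul e f) s = rval e s * rval f s"
| "rval (RDiv e f) s = rval e s / rval f s"

primrec bval :: "bexp \<Rightarrow> ram \<Rightarrow> bool" where
  "bval (NLess e f) s = (nval e s < nval f s)"
| "bval (RLess e f) s = (rval e s < rval f s)"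
| "bval (BNot b) s = (\<not> bval b s)"
| "bval (BAnd b c) s = (bval b s \<and> bval c s)"

primrec ncost :: "nexp \<Rightarrow> nat" where
  "ncost (NLit n) = 1"
| "ncost (NGet a i) = 1 + ncost i"
| "ncost (NAdd e f) = 1 + ncost e + ncost f"
| "ncost (NSub e f) = 1 + ncost e + ncost f"

primrec rcost :: "rexp \<Rightarrow> nat" where
  "rcost (RLit k) = 1"
| "rcost (RGet a i) = 1 + ncost i"
| "rcost (RAdd e f) = 1 + rcost e + rcost f"
| "rcost (RSub e f) = 1 + rcost e + rcost f"
| "rcost (RMul e f) = 1 + rcost e + rcost f"
| "rcost (RDiv e f) = 1 + rcost e + rcost f"

primrec bcost :: "bexp \<Rightarrow> nat" where
  "bcost (NLess e f) = 1 + ncost e + ncost f"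
| "bcost (RLess e f) = 1 + rcost e + rcost f"
| "bcost (BNot b) = 1 + bcost b"
| "bcost (BAnd b c) = 1 + bcost b + bcost c"

text \<open>\<open>exec c s t s'\<close>: started in \<open>s\<close>, program \<open>c\<close> halts in \<open>s'\<close> after time \<open>t\<close>.\<close>

inductive exec :: "com \<Rightarrow> ram \<Rightarrow> nat \<Rightarrow> ram \<Rightarrow> bool" where
  Skip: "exec Skip s 1 s"
| NSet: "exec (NSet a i e) s (1 + ncost i + ncost e)
          (s\<lparr>nats := (nats s)(a := (nats s a)(nval i s := nval e s))\<rparr>)"
| RSet: "exec (RSet a i e) s (1 + ncost i + rcost e)
          (s\<lparr>reals := (reals s)(a := (reals s a)(nval i s := rval e s))\<rparr>)"
| Seq: "exec c s t s' \<Longrightarrow> exec d s' u s'' \<Longrightarrow> exec (Seq c d) s (t + u) s''"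
| CondTrue: "bval b s \<Longrightarrow> exec c s t s' \<Longrightarrow> exec (Cond b c d) s (1 + bcost b + t) s'"
| CondFalse: "\<not> bval b s \<Longrightarrow> exec d s t s' \<Longrightarrow> exec (Cond b c d) s (1 + bcost b + t) s'"
| WhileFalse: "\<not> bval b s \<Longrightarrow> exec (While b c) s (1 + bcost b) s"
| WhileTrue: "bval b s \<Longrightarrow> exec c s t s' \<Longrightarrow> exec (While b c) s' u s'' \<Longrightarrow>
          exec (While b c) s (1 + bcost b + t + u) s''"

inductive_cases exec_elims:
  "exec Skip s t s'" "exec (NSet a i e) s t s'" "exec (RSet a i e) s t s'"
  "exec (Seq c d) s t s'" "exec (Cond b c d) s t s'" "exec (While b c) s t s'"

lemma exec_deterministic:
  "exec c s t s' \<Longrightarrow> exec c s u s'' \<Longrightarrow> u = t \<and> s'' = s'"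
proof (induction arbitrary: u s'' rule: exec.induct)
  case (Skip s)
  then show ?case by (auto elim: exec_elims(1))
next
  case (NSet a i e s)
  then show ?case by (auto elim: exec_elims(2))
next
  case (RSet a i e s)
  then show ?case by (auto elim: exec_elims(3))
next
  case (Seq c s t s' d v s3)
  from Seq.prems obtain t1 m u1 where "exec c s t1 m" "exec d m u1 s''" "u = t1 + u1"
    by (rule exec_elims(4))
  then show ?case using Seq.IH by metis
next
  case (CondTrue b s c t s' d)
  from CondTrue.prems CondTrue.hyps obtain t1 where "exec c s t1 s''" "u = 1 + bcost b + t1"
    by (auto elim: exec_elims(5))
  then show ?case using CondTrue.IH by metis
next
  case (CondFalse b s d t s' c)
  from CondFalse.prems CondFalse.hyps obtain t1 where "exec d s t1 s''" "u = 1 + bcost b + t1"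
    by (auto elim: exec_elims(5))
  then show ?case using CondFalse.IH by metis
next
  case (WhileFalse b s c)
  from WhileFalse.prems show ?case
    by (rule exec_elims(6)) (use WhileFalse.hyps in simp_all)
next
  case (WhileTrue b s c t s' v s3)
  from WhileTrue.prems obtain t1 m u1
    where "exec c s t1 m" "exec (While b c) m u1 s''" "u = 1 + bcost b + t1 + u1"
    by (rule exec_elims(6)) (use WhileTrue.hyps(1) in simp_all)
  then show ?case using WhileTrue.IH by metis
qed

text \<open>
  The red and the blue points are given by their coordinates, in arbitrary order, together with
  their numbers; all other cells are initially 0. The separating line is not part of the input.
\<close>

definition input_ram :: "point list \<Rightarrow> point list \<Rightarrow> ram" where
  "input_ram rs bs =
     \<lparr>nats = (\<lambda>a i.
        if a = ''red_count'' \<and> i = 0 then length rs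
        else if a = ''blue_count'' \<and> i = 0 then length bs
        else 0),
      reals = (\<lambda>a i.
        if a = ''red_x'' \<and> i < length rs then fst (rs ! i)
        else if a = ''red_y'' \<and> i < length rs then snd (rs ! i)
        else if a = ''blue_x'' \<and> i < length bs then fst (bs ! i)
        else if a = ''blue_y'' \<and> i < length bs then snd (bs ! i)
        else 0)\<rparr>"

text \<open>
  The input points are numbered consecutively, the red ones first. The array \<open>out\<close> lists the
  members of the computed family of sets, each by the numbers of four points.
\<close>

definition output_family :: "point list \<Rightarrow> point list \<Rightarrow> ram \<Rightarrow> point set set \<Rightarrow> bool" where
  "output_family rs bs s P \<longleftrightarrow>
     (let ps = rs @ bs; n = length ps; out = nats s ''out'' in
       (\<forall>i<n. out i < n) \<and>
       P = (\<lambda>k. (\<lambda>j. ps ! out (4 * k + j)) ` {..<4}) ` {..<n div 4})"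

end

theory Submission
  imports Defs "HOL-Library.Discrete_Functions"
begin

text \<open>
  Draw the separating line vertically and look at the bridge, the edge of the upper hull of
  \<open>R \<union> B\<close> that joins a red point to a blue one. Remove three times its endpoint of one colour,
  recomputing the bridge each time, and then its endpoint of the other colour. The first three
  points lie strictly above the last bridge line and all remaining points below it, so this line
  meets the star of the four points only in the point removed last and the hull of the remaining
  points only in the other endpoint. Hence different stars do not cross. The counts \<open>3g + h\<close> and
  \<open>3h + g\<close> allow \<open>g\<close> stars with three red leaves and \<open>h\<close> with three blue ones.

  A separating direction is the normal of the edge of the convex hull of \<open>R - B\<close> that is hit by
  the vector between the two centroids; merging the hulls of \<open>R\<close> and \<open>- B\<close> by slope finds it.
  After sorting across that direction, the bridge is the root of a balanced hierarchy of upper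
  hulls stored as linked lists, each block keeping the bridge between its two halves. Under
  deletions a point only ever enters the hull of a block, so each of the \<open>O(log N)\<close> levels costs
  amortised \<open>O(1)\<close> steps per point.
\<close>

text \<open>Two devices carry the proof. Points get odd indices, and sentinels far below all points
  get the even ones. Every block then has hull ends even if it is empty, a leaf is at most one point
  between two sentinels, and a hull vertex remains a hull vertex in each smaller block around it.
  The price is that a parent's hull must skip the sentinel shared by its halves, and that the
  sentinels have to lie under every line through two points wherever the true hull of the points is
  wanted.

  A bridge endpoint is a vertex at every level. Its removal opens one gap in one list per level,
  between its two neighbours, and two walkers close the gap from both sides. Each step but the last
  puts a new vertex on a hull, so the number of points that are off the hull of their block is the
  potential of the level.

  The search for the direction reuses the hierarchy. The blue points are reflected in a point and so
  moved to the right of the red ones; the halves of the root then hold the upper hulls of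
  \<open>R\<close> and of \<open>- B\<close>, and the wanted edge is the one at which the sum of two
  abscissae passes a fixed value.\<close>

definition nupd :: "string \<Rightarrow> nat \<Rightarrow> nat \<Rightarrow> ram \<Rightarrow> ram" where
  "nupd a i v s = s\<lparr>nats := (nats s)(a := (nats s a)(i := v))\<rparr>"

definition rupd :: "string \<Rightarrow> nat \<Rightarrow> real \<Rightarrow> ram \<Rightarrow> ram" where
  "rupd a i v s = s\<lparr>reals := (reals s)(a := (reals s a)(i := v))\<rparr>"

lemma upd_simps [simp]:
  "nats (nupd a i v s) = (nats s)(a := (nats s a)(i := v))"
  "reals (nupd a i v s) = reals s"
  "reals (rupd a i r s) = (reals s)(a := (reals s a)(i := r))"
  "nats (rupd a i r s) = nats s"
  by (simp_all add: nupd_def rupd_def)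

abbreviation NV :: "string \<Rightarrow> nexp" where "NV a \<equiv> NGet a (NLit 0)"
abbreviation RV :: "string \<Rightarrow> rexp" where "RV a \<equiv> RGet a (NLit 0)"
abbreviation NLet :: "string \<Rightarrow> nexp \<Rightarrow> com" (infix "::=" 62) where "a ::= e \<equiv> NSet a (NLit 0) e"
abbreviation RLet :: "string \<Rightarrow> rexp \<Rightarrow> com" (infix "::=r" 62) where "a ::=r e \<equiv> RSet a (NLit 0) e"
notation Seq (infixr ";;" 60)

section \<open>Total correctness with running times\<close>

definition wp :: "com \<Rightarrow> ram \<Rightarrow> (nat \<Rightarrow> ram \<Rightarrow> bool) \<Rightarrow> bool" where
  "wp c s Q \<longleftrightarrow> (\<exists>t s'. exec c s t s' \<and> Q t s')"

definition runs :: "com \<Rightarrow> ram \<Rightarrow> nat \<Rightarrow> (ram \<Rightarrow> bool) \<Rightarrow> bool" where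
  "runs c s T Q \<longleftrightarrow> wp c s (\<lambda>t s'. t \<le> T \<and> Q s')"

text \<open>Determinism of \<open>exec\<close> makes this an equation and not just an implication.
  With the rules that follow, the simplifier can run straight-line code symbolically.\<close>

lemma wp_Skip: "wp Skip s Q = Q 1 s"
  unfolding wp_def by (metis exec.Skip exec_deterministic)

lemma wp_NSet: "wp (NSet a i e) s Q = Q (1 + ncost i + ncost e) (nupd a (nval i s) (nval e s) s)"
  unfolding wp_def nupd_def by (metis exec.NSet exec_deterministic)

lemma wp_RSet: "wp (RSet a i r) s Q = Q (1 + ncost i + rcost r) (rupd a (nval i s) (rval r s) s)"
  unfolding wp_def rupd_def by (metis exec.RSet exec_deterministic)

lemma wp_Seq: "wp (Seq c d) s Q = wp c s (\<lambda>t s'. wp d s' (\<lambda>u. Q (t + u)))"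
  unfolding wp_def using exec.Seq by (blast elim: exec_elims(4))

lemma wp_Cond: "wp (Cond b c d) s Q =
     (if bval b s then wp c s (\<lambda>t. Q (1 + bcost b + t)) else wp d s (\<lambda>t. Q (1 + bcost b + t)))"
  unfolding wp_def using exec.CondTrue exec.CondFalse by (auto elim!: exec_elims(5)) blast+

lemmas wp_simps = wp_Skip wp_NSet wp_RSet wp_Seq wp_Cond

lemma runs_conseq:
  "runs c s T Q \<Longrightarrow> T \<le> T' \<Longrightarrow> (\<And>s'. Q s' \<Longrightarrow> Q' s') \<Longrightarrow> runs c s T' Q'"
  unfolding runs_def wp_def by (meson le_trans)

lemma runs_Seq:
  "runs c s T1 Q1 \<Longrightarrow> (\<And>s'. Q1 s' \<Longrightarrow> runs d s' T2 Q) \<Longrightarrow> T1 + T2 \<le> T \<Longrightarrow> runs (c ;; d) s T Q"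
  unfolding runs_def wp_def by (meson add_mono exec.Seq le_trans)

lemma runs_Cond:
  assumes "bval b s \<Longrightarrow> runs c s T Q" "\<not> bval b s \<Longrightarrow> runs d s T Q" "1 + bcost b + T \<le> T'"
  shows "runs (Cond b c d) s T' Q"
  using assms unfolding runs_def wp_simps
  by (auto simp: wp_def split: if_splits) (metis Suc_le_mono add_left_mono le_trans)+

primrec nmods :: "com \<Rightarrow> string set" where
  "nmods Skip = {}"
| "nmods (NSet a i e) = {a}"
| "nmods (RSet a i e) = {}"
| "nmods (Seq c d) = nmods c \<union> nmods d"
| "nmods (Cond b c d) = nmods c \<union> nmods d"
| "nmods (While b c) = nmods c"

primrec rmods :: "com \<Rightarrow> string set" where
  "rmods Skip = {}"
| "rmods (NSet a i e) = {}"
| "rmods (RSet a i e) = {a}"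
| "rmods (Seq c d) = rmods c \<union> rmods d"
| "rmods (Cond b c d) = rmods c \<union> rmods d"
| "rmods (While b c) = rmods c"

text \<open>A purely syntactic frame condition. It relieves loop invariants of everything that a
  body never assigns.\<close>

definition agree :: "com \<Rightarrow> ram \<Rightarrow> ram \<Rightarrow> bool" where
  "agree c s s' \<longleftrightarrow> (\<forall>a. a \<notin> nmods c \<longrightarrow> nats s' a = nats s a) \<and> (\<forall>a. a \<notin> rmods c \<longrightarrow> reals s' a = reals s a)"

lemma agree_refl [simp]: "agree c s s"
  by (simp add: agree_def)

lemma agree_trans: "agree c s s' \<Longrightarrow> agree c s' s'' \<Longrightarrow> agree c s s''"
  by (simp add: agree_def)

lemma exec_agree: "exec c s t s' \<Longrightarrow> agree c s s'"
  by (induction rule: exec.induct) (auto simp: agree_def)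

lemma agreeN: "agree c s s' \<Longrightarrow> a \<notin> nmods c \<Longrightarrow> nats s' a = nats s a"
  and agreeR: "agree c s s' \<Longrightarrow> a \<notin> rmods c \<Longrightarrow> reals s' a = reals s a"
  by (simp_all add: agree_def)

lemma runs_agree: "runs c s T Q \<Longrightarrow> runs c s T (\<lambda>s'. Q s' \<and> agree c s s')"
  unfolding runs_def wp_def using exec_agree by blast

lemma runs_Seq_agree:
  "runs c s T1 Q1 \<Longrightarrow> (\<And>s'. Q1 s' \<Longrightarrow> agree c s s' \<Longrightarrow> runs d s' T2 Q) \<Longrightarrow> T1 + T2 \<le> T \<Longrightarrow> runs (c ;; d) s T Q"
  by (rule runs_Seq[OF runs_agree]) auto

lemma runs_straight: "wp c s (\<lambda>t s'. t \<le> T \<and> Q s') \<Longrightarrow> runs c s T Q"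
  by (simp add: runs_def)

text \<open>The potential \<open>\<mu>\<close> bounds the remaining time, so it also serves as the termination measure.\<close>

lemma runs_While:
  assumes I: "I s"
    and step: "\<And>s'. I s' \<Longrightarrow> agree c s s' \<Longrightarrow> bval b s' \<Longrightarrow>
      \<exists>T. runs c s' T (\<lambda>s''. I s'' \<and> 1 + bcost b + T + \<mu> s'' \<le> \<mu> s')"
    and fin: "\<And>s'. I s' \<Longrightarrow> agree c s s' \<Longrightarrow> \<not> bval b s' \<Longrightarrow> Q s'"
    and T: "\<mu> s + 1 + bcost b \<le> T"
  shows "runs (While b c) s T Q"
proof -
  have "\<exists>t s''. exec (While b c) s' t s'' \<and> t \<le> \<mu> s' + 1 + bcost b \<and> Q s''"
    if "I s'" "agree c s s'" for s'
    using that
  proof (induction "\<mu> s'" arbitrary: s' rule: less_induct)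
    case less
    show ?case
    proof (cases "bval b s'")
      case False
      then show ?thesis using fin[OF less.prems] exec.WhileFalse[of b s' c] by force
    next
      case True
      from step[OF less.prems True] obtain T t s1 where s1: "exec c s' t s1" "t \<le> T" "I s1"
        "1 + bcost b + T + \<mu> s1 \<le> \<mu> s'" unfolding runs_def wp_def by blast
      have ag: "agree c s s1" using less.prems(2) exec_agree[OF s1(1)] agree_trans by blast
      have "\<mu> s1 < \<mu> s'" using s1(4) by simp
      from less.hyps[OF this s1(3) ag] obtain u s2 where "exec (While b c) s1 u s2"
        "u \<le> \<mu> s1 + 1 + bcost b" "Q s2" by blast
      then have "exec (While b c) s' (1 + bcost b + t + u) s2" "1 + bcost b + t + u \<le> \<mu> s' + 1 + bcost b"
        using exec.WhileTrue[OF True s1(1)] s1 by auto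
      then show ?thesis using \<open>Q s2\<close> by blast
    qed
  qed
  from this[OF I] show ?thesis using T unfolding runs_def wp_def by (auto intro: order_trans)
qed

definition For :: "string \<Rightarrow> nexp \<Rightarrow> com \<Rightarrow> com" where
  "For i e c = While (NLess (NV i) e) (c ;; i ::= NAdd (NV i) (NLit 1))"

lemma For_mods [simp]: "nmods (For i e c) = insert i (nmods c)" "rmods (For i e c) = rmods c"
  by (auto simp: For_def)

text \<open>Each round pays \<open>T k\<close> for the body, \<open>ncost e + 4\<close> for the
  guard and 6 for the increment; the last \<open>ncost e + 4\<close> is the failing guard. The body
  has to establish the invariant for the state after the increment.\<close>

lemma runs_For:
  assumes lo: "nats s i 0 = lo" "lo \<le> hi" and I: "I lo s"
    and e: "\<And>k s'. I k s' \<Longrightarrow> agree (For i e c) s s' \<Longrightarrow> nval e s' = hi"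
    and step: "\<And>k s'. I k s' \<Longrightarrow> agree (For i e c) s s' \<Longrightarrow> lo \<le> k \<Longrightarrow> k < hi \<Longrightarrow> nats s' i 0 = k \<Longrightarrow>
      runs c s' (T k) (\<lambda>s''. nats s'' i 0 = k \<and> I (Suc k) (nupd i 0 (Suc k) s''))"
    and Tot: "(\<Sum>k=lo..<hi. T k + ncost e + 10) + ncost e + 4 \<le> Tot"
  shows "runs (For i e c) s Tot (\<lambda>s'. I hi s' \<and> nats s' i 0 = hi)"
  unfolding For_def
proof (rule runs_While[where I = "\<lambda>s'. I (nats s' i 0) s' \<and> lo \<le> nats s' i 0 \<and> nats s' i 0 \<le> hi"
      and \<mu> = "\<lambda>s'. \<Sum>k=nats s' i 0..<hi. T k + ncost e + 10"])
  let ?c = "c ;; i ::= NAdd (NV i) (NLit 1)"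
  fix s' assume Is: "I (nats s' i 0) s' \<and> lo \<le> nats s' i 0 \<and> nats s' i 0 \<le> hi" and ag: "agree ?c s s'"
  have ag': "agree (For i e c) s s'" using ag by (simp add: For_def agree_def)
  have ev: "nval e s' = hi" using e Is ag' by blast
  show "I hi s' \<and> nats s' i 0 = hi" if "\<not> bval (NLess (NV i) e) s'"
  proof -
    have "nats s' i 0 = hi" using that Is ev by auto
    then show ?thesis using Is by metis
  qed
  assume "bval (NLess (NV i) e) s'"
  then have lt: "nats s' i 0 < hi" using ev by simp
  let ?k = "nats s' i 0"
  have 1: "runs c s' (T ?k) (\<lambda>s''. nats s'' i 0 = ?k \<and> I (Suc ?k) (nupd i 0 (Suc ?k) s''))"
    using step[of ?k s'] Is ag' lt by blast
  have sum: "(\<Sum>k=?k..<hi. T k + ncost e + 10) = (T ?k + ncost e + 10) + (\<Sum>k=Suc ?k..<hi. T k + ncost e + 10)"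
    using lt by (simp add: sum.atLeast_Suc_lessThan)
  show "\<exists>T'. runs ?c s' T' (\<lambda>s''. (I (nats s'' i 0) s'' \<and> lo \<le> nats s'' i 0 \<and> nats s'' i 0 \<le> hi) \<and>
          1 + bcost (NLess (NV i) e) + T' + (\<Sum>k=nats s'' i 0..<hi. T k + ncost e + 10)
          \<le> (\<Sum>k=?k..<hi. T k + ncost e + 10))"
    apply (rule exI[of _ "T ?k + 6"])
    apply (rule runs_Seq[OF 1, of _ 6])
     apply (rule runs_straight)
    using Is lt by (auto simp: wp_simps sum)
qed (use lo I Tot in auto)

section \<open>Upper hulls of indexed points\<close>

text \<open>The name abbreviates "consecutive"; hull edges are pairs of this kind.\<close>

definition cons :: "nat set \<Rightarrow> nat \<Rightarrow> nat \<Rightarrow> bool" where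
  "cons T i j \<longleftrightarrow> i \<in> T \<and> j \<in> T \<and> i < j \<and> (\<forall>k\<in>T. \<not> (i < k \<and> k < j))"

lemma cons_succ_exists:
  assumes "finite T" "a \<in> T" "e \<in> T" "a < e"
  shows "\<exists>x. cons T a x \<and> x \<le> e"
proof -
  let ?U = "{j \<in> T. a < j}"
  have f: "finite ?U" "?U \<noteq> {}" using assms by auto
  have "Min ?U \<in> ?U" using Min_in[OF f] .
  moreover have "Min ?U \<le> k" if "k \<in> T" "a < k" for k using that f by simp
  ultimately have "cons T a (Min ?U)" using assms(2) unfolding cons_def by (metis (no_types, lifting) mem_Collect_eq leD)
  moreover have "Min ?U \<le> e" using assms f by simp
  ultimately show ?thesis by blast
qed

lemma cons_pred_exists:
  assumes "finite T" "c \<in> T" "s \<in> T" "s < c"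
  shows "\<exists>y. cons T y c \<and> s \<le> y"
proof -
  let ?U = "{j \<in> T. j < c}"
  have f: "finite ?U" "?U \<noteq> {}" using assms by auto
  have "Max ?U \<in> ?U" using Max_in[OF f] .
  moreover have "k \<le> Max ?U" if "k \<in> T" "k < c" for k using that f by simp
  ultimately have "cons T (Max ?U) c" using assms(2) unfolding cons_def by (metis (no_types, lifting) mem_Collect_eq leD)
  moreover have "s \<le> Max ?U" using assms f by simp
  ultimately show ?thesis by blast
qed

text \<open>Twice the signed area of a triangle. For \<open>X a < X b\<close> it is positive exactly
  if \<open>c\<close> lies above the line \<open>a b\<close>, which is how it is read
  throughout.\<close>

definition ori :: "(nat \<Rightarrow> real) \<Rightarrow> (nat \<Rightarrow> real) \<Rightarrow> nat \<Rightarrow> nat \<Rightarrow> nat \<Rightarrow> real" where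
  "ori X Y a b c = (X b - X a) * (Y c - Y a) - (Y b - Y a) * (X c - X a)"

text \<open>The map that keeps the abscissa and replaces the ordinate by \<open>ori X Y a b\<close>
  is a shear followed by a scaling by \<open>X b - X a\<close>. Areas are therefore multiplied by
  that factor, and any orientation can be computed from heights over a base line
  \<open>a b\<close>.\<close>

lemma ori_affine:
  "(X b - X a) * ori X Y j k i =
     (X k - X j) * ori X Y a b i - (X k - X i) * ori X Y a b j - (X i - X j) * ori X Y a b k"
  unfolding ori_def by algebra

lemma ori_self [simp]: "ori X Y a b a = 0" "ori X Y a b b = 0"
  by (simp_all add: ori_def)

text \<open>Indices are ordered by abscissa, so a vertex is an index strictly above all chords that
  span it. The first and the last index qualify vacuously, and points inside a hull edge do not
  qualify.\<close>

definition UH :: "(nat \<Rightarrow> real) \<Rightarrow> (nat \<Rightarrow> real) \<Rightarrow> nat set \<Rightarrow> nat set" where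
  "UH X Y T = {i \<in> T. \<forall>j\<in>T. \<forall>k\<in>T. j < i \<and> i < k \<longrightarrow> 0 < ori X Y j k i}"

text \<open>A block: the points strictly between two sentinels \<open>s\<close> and
  \<open>e\<close>, together with these sentinels.\<close>

definition TT :: "nat set \<Rightarrow> nat \<Rightarrow> nat \<Rightarrow> nat set" where
  "TT A s e = insert s (insert e (A \<inter> {s<..<e}))"

lemma UH_sub: "UH X Y T \<subseteq> T"
  by (auto simp: UH_def)

lemma finite_TT [simp]: "finite (TT A s e)"
  by (simp add: TT_def)

lemma UH_ends: "s < e \<Longrightarrow> s \<in> UH X Y (TT A s e)" "s < e \<Longrightarrow> e \<in> UH X Y (TT A s e)"
  by (auto simp: UH_def TT_def)

lemma TT_delete: "i \<noteq> s \<Longrightarrow> i \<noteq> e \<Longrightarrow> TT (A - {i}) s e = TT A s e - {i}"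
  by (auto simp: TT_def)

text \<open>\<open>G\<close> holds the sentinels, all on one horizontal line below the points
  \<open>S\<close>. They bound the blocks, and neighbouring blocks share one.\<close>

locale plane =
  fixes X Y :: "nat \<Rightarrow> real" and G S :: "nat set" and H :: real
  assumes mono: "i \<in> G \<union> S \<Longrightarrow> j \<in> G \<union> S \<Longrightarrow> i < j \<Longrightarrow> X i < X j"
    and gapY: "g \<in> G \<Longrightarrow> Y g = - H"
    and ptY: "p \<in> S \<Longrightarrow> - H < Y p"
begin

abbreviation "h \<equiv> ori X Y"
abbreviation "hl A s e \<equiv> UH X Y (TT A s e)"

lemma Yge: "i \<in> G \<union> S \<Longrightarrow> - H \<le> Y i"
  using gapY ptY by force

lemma ori_pos_iff:
  assumes "{a, b, i, j, k} \<subseteq> G \<union> S" "a < b"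
  shows "0 < h j k i \<longleftrightarrow> (X k - X i) * h a b j + (X i - X j) * h a b k < (X k - X j) * h a b i"
proof -
  have "0 < X b - X a" using mono assms by simp
  then have "0 < h j k i \<longleftrightarrow> 0 < (X b - X a) * h j k i" by (simp add: zero_less_mult_iff)
  then show ?thesis using ori_affine[of X b a Y j k i] by auto
qed

text \<open>The point over the edge \<open>a b\<close> at greatest height, leftmost among ties, would itself be a hull vertex.\<close>

lemma edge_supports:
  assumes T: "finite T" "T \<subseteq> G \<union> S" and ab: "cons (UH X Y T) a b" and i: "i \<in> T"
  shows "h a b i \<le> 0"
proof -
  have aU: "a \<in> UH X Y T" "b \<in> UH X Y T" "a < b" and nob: "\<And>k. k \<in> UH X Y T \<Longrightarrow> \<not> (a < k \<and> k < b)"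
    using ab by (auto simp: cons_def)
  have aT: "a \<in> T" "b \<in> T" using aU UH_sub by blast+
  have iff: "0 < h j k i \<longleftrightarrow> (X k - X i) * h a b j + (X i - X j) * h a b k < (X k - X j) * h a b i"
    if "i \<in> T" "j \<in> T" "k \<in> T" for i j k
    using ori_pos_iff[of a b i j k] that aT T aU(3) by blast
  have lt: "X i < X j" if "i \<in> T" "j \<in> T" "i < j" for i j using mono that T by blast
  \<comment> \<open>The vertex \<open>a\<close> is strictly above the chord from \<open>j\<close> to
    \<open>z\<close>. If \<open>z\<close> is not below the line \<open>a b\<close>, then
    \<open>j\<close> has to be.\<close>
  have left: "h a b j < 0" if j: "j \<in> T" "j < a" and z: "z \<in> T" "a < z" "0 \<le> h a b z" for j z
  proof -
    have "0 < h j z a" using aU(1) j z unfolding UH_def by blast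
    then have "(X z - X a) * h a b j + (X a - X j) * h a b z < 0"
      using iff[of a j z] aT j z by simp
    moreover have "0 \<le> (X a - X j) * h a b z" using lt[of j a] j z aT by simp
    ultimately have "(X z - X a) * h a b j < 0" by linarith
    then show ?thesis using lt[of a z] aT z by (simp add: mult_less_0_iff)
  qed
  have right: "h a b k < 0" if k: "k \<in> T" "b < k" and z: "z \<in> T" "z < b" "0 \<le> h a b z" for k z
  proof -
    have "0 < h z k b" using aU(2) k z unfolding UH_def by blast
    then have "(X k - X b) * h a b z + (X b - X z) * h a b k < 0"
      using iff[of b z k] aT k z by simp
    moreover have "0 \<le> (X k - X b) * h a b z" using lt[of b k] k z aT by simp
    ultimately have "(X b - X z) * h a b k < 0" by linarith
    then show ?thesis using lt[of z b] aT z by (simp add: mult_less_0_iff)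
  qed
  have between: "h a b i \<le> 0" if i: "i \<in> T" "a < i" "i < b" for i
  proof (rule ccontr)
    assume "\<not> h a b i \<le> 0"
    let ?U = "T \<inter> {a<..<b}"
    have fU: "finite ?U" "?U \<noteq> {}" using T i by auto
    define mx where "mx = Max (h a b ` ?U)"
    have mxU: "h a b z \<le> mx" if "z \<in> ?U" for z unfolding mx_def using fU that by simp
    let ?V = "{z \<in> ?U. h a b z = mx}"
    have "mx \<in> h a b ` ?U" unfolding mx_def using fU by (intro Max_in) auto
    then have fV: "finite ?V" "?V \<noteq> {}" using fU by auto
    define w where "w = Min ?V"
    have w: "w \<in> ?V" unfolding w_def using Min_in[OF fV] .
    have wmin: "w \<le> z" if "z \<in> ?V" for z unfolding w_def using fV that by simp
    have mx0: "0 < mx" using mxU[of i] i \<open>\<not> h a b i \<le> 0\<close> by auto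
    have wT: "w \<in> T" "a < w" "w < b" "h a b w = mx" using w by auto
    have all_le: "h a b z \<le> mx" if "z \<in> T" for z
    proof -
      consider "z < a" | "z = a" | "z = b" | "b < z" | "a < z \<and> z < b" by linarith
      then show ?thesis
        by cases (use left[of z w] right[of z w] wT mx0 mxU that in auto)
    qed
    have lt_w: "h a b z < mx" if "z \<in> T" "z < w" for z
    proof -
      have "h a b z \<noteq> mx"
      proof
        assume eq: "h a b z = mx"
        have "\<not> z < a" using left[of z w] that wT mx0 eq by auto
        moreover have "z \<noteq> a" using eq mx0 by auto
        ultimately have "z \<in> ?V" using that wT eq by auto
        then show False using wmin that by force
      qed
      then show ?thesis using all_le that by fastforce
    qed
    have "w \<in> UH X Y T"
      unfolding UH_def
    proof (safe)
      fix j k assume jk: "j \<in> T" "k \<in> T" "j < w" "w < k"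
      have "(X k - X w) * h a b j < (X k - X w) * mx"
        using lt_w[of j] lt[of w k] jk wT by simp
      moreover have "(X w - X j) * h a b k \<le> (X w - X j) * mx"
        using all_le[of k] lt[of j w] jk wT by (intro mult_left_mono) auto
      ultimately have "(X k - X w) * h a b j + (X w - X j) * h a b k < (X k - X j) * mx"
        by (simp add: algebra_simps)
      then show "0 < h j k w" using iff[of w j k] jk wT by simp
    qed (use wT in auto)
    then show False using nob wT by blast
  qed
  consider "i < a" | "i = a" | "a < i \<and> i < b" | "i = b" | "b < i" by linarith
  then show ?thesis
    by cases (use left[of i b] right[of i a] between i aT aU(3) in auto)
qed

text \<open>If \<open>i\<close> is at least as high as \<open>j\<close>, it is above every
  descending chord from \<open>j\<close>. Otherwise a nearer sentinel only makes the chord fall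
  faster.\<close>

lemma shrink_right:
  assumes "0 < h j e i" "j < i" "i < e'" "e' \<le> e" "e \<in> G" "e' \<in> G" "i \<in> S" "j \<in> G \<union> S"
  shows "0 < h j e' i"
proof -
  have x: "X j < X i" "X i < X e'" "X e' \<le> X e" "- H < Y i" "- H \<le> Y j" "Y e = - H" "Y e' = - H"
    using assms mono[of j i] mono[of i e'] mono[of e' e] Yge ptY gapY by (auto simp: le_less)
  show ?thesis
  proof (cases "Y j \<le> Y i")
    case True
    have "0 \<le> (X e' - X j) * (Y i - Y j)" using x True by simp
    moreover have "0 \<le> (H + Y j) * (X i - X j)" using x by simp
    moreover have "0 < (X e' - X j) * (Y i - Y j) \<or> 0 < (H + Y j) * (X i - X j)"
      using x by (cases "Y j = - H") auto
    ultimately show ?thesis unfolding ori_def using x by (auto simp: algebra_simps)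
  next
    case False
    have "(X e - X j) * (Y i - Y j) \<le> (X e' - X j) * (Y i - Y j)"
      using x False by (intro mult_right_mono_neg) auto
    then show ?thesis using assms(1) unfolding ori_def using x by simp
  qed
qed

lemma shrink_left:
  assumes "0 < h s k i" "s' < i" "i < k" "s \<le> s'" "s \<in> G" "s' \<in> G" "i \<in> S" "k \<in> G \<union> S"
  shows "0 < h s' k i"
proof -
  have x: "X s' < X i" "X i < X k" "X s \<le> X s'" "- H < Y i" "- H \<le> Y k" "Y s = - H" "Y s' = - H"
    using assms mono[of s' i] mono[of i k] mono[of s s'] Yge ptY gapY by (auto simp: le_less)
  have eq: "h z k i = (X k - X i) * (Y i + H) + (X i - X z) * (Y i - Y k)" if "Y z = - H" for z
    unfolding ori_def that by (simp add: algebra_simps)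
  show ?thesis
  proof (cases "Y k \<le> Y i")
    case True
    have "0 < (X k - X i) * (Y i + H)" "0 \<le> (X i - X s') * (Y i - Y k)" using x True by auto
    then show ?thesis unfolding eq[OF x(7)] by (rule add_pos_nonneg)
  next
    case False
    have "(X i - X s) * (Y i - Y k) \<le> (X i - X s') * (Y i - Y k)"
      using x False by (intro mult_right_mono_neg) auto
    then show ?thesis using assms(1) eq x by simp
  qed
qed

text \<open>This is more than heredity to subsets, because the smaller block has sentinels of its
  own that the larger one does not contain. Chords ending in them are compared with chords to the
  outer sentinels, which are then moved inwards.\<close>

lemma hull_nested:
  assumes "s \<le> s'" "s' < e'" "e' \<le> e" "{s, s', e, e'} \<subseteq> G" "A \<subseteq> S"
    and i: "i \<in> hl A s e" "i \<in> A" "s' < i" "i < e'"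
  shows "i \<in> hl A s' e'"
proof -
  have iS: "i \<in> S" using assms by blast
  have "0 < h j k i" if jk: "j \<in> TT A s' e'" "k \<in> TT A s' e'" "j < i" "i < k" for j k
  proof -
    \<comment> \<open>Each inner sentinel is exchanged for the outer one on its side; points stay as
      they are.\<close>
    define j0 where "j0 = (if j = s' then s else j)"
    define k0 where "k0 = (if k = e' then e else k)"
    have jj: "j \<in> A \<inter> {s'<..<e'} \<or> j = s'" "k \<in> A \<inter> {s'<..<e'} \<or> k = e'"
      using jk i by (auto simp: TT_def)
    then have "j0 \<in> TT A s e" "k0 \<in> TT A s e" "j0 < i" "i < k0"
      using assms jk unfolding j0_def k0_def TT_def by auto
    then have "0 < h j0 k0 i" using i(1) unfolding UH_def by blast
    moreover have "j0 \<in> G \<union> S" "k \<in> G \<union> S" using jj assms unfolding j0_def by auto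
    ultimately have "0 < h j0 k i"
      unfolding k0_def using shrink_right[of j0 e i e'] \<open>j0 < i\<close> jk(4) assms(3,4) iS by (auto split: if_splits)
    then show ?thesis
      unfolding j0_def using shrink_left[of s k i s'] jk(3,4) assms(1,4) iS \<open>k \<in> G \<union> S\<close> by (auto split: if_splits)
  qed
  moreover have "i \<in> TT A s' e'" using i by (simp add: TT_def)
  ultimately show ?thesis unfolding UH_def by blast
qed

text \<open>A supporting line through \<open>x\<close> certifies a vertex. It may touch points
  before \<open>x\<close>, such as \<open>a\<close>, but has to pass strictly over the later ones: a
  chord with both ends on the line would run through \<open>x\<close>.\<close>

lemma UH_I_line:
  assumes T: "T \<subseteq> G \<union> S" "x \<in> T" "a \<in> T" "a < x"
    and lo: "\<And>j. j \<in> T \<Longrightarrow> j < x \<Longrightarrow> h a x j \<le> 0"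
    and hi: "\<And>k. k \<in> T \<Longrightarrow> x < k \<Longrightarrow> h a x k < 0"
  shows "x \<in> UH X Y T"
  unfolding UH_def
proof (safe)
  fix j k assume jk: "j \<in> T" "k \<in> T" "j < x" "x < k"
  have X: "X j < X x" "X x < X k" using jk T mono by blast+
  have "(X k - X x) * h a x j \<le> 0" using lo[OF jk(1,3)] X by (simp add: mult_le_0_iff)
  moreover have "(X x - X j) * h a x k < 0" using hi[OF jk(2,4)] X by (simp add: mult_less_0_iff)
  ultimately show "0 < h j k x"
    using ori_pos_iff[of a x x j k] T jk by (auto simp: subset_iff)
qed (use T in auto)

lemma UH_I_line':
  assumes T: "T \<subseteq> G \<union> S" "y \<in> T" "c \<in> T" "y < c"
    and lo: "\<And>j. j \<in> T \<Longrightarrow> j < y \<Longrightarrow> h y c j < 0"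
    and hi: "\<And>k. k \<in> T \<Longrightarrow> y < k \<Longrightarrow> h y c k \<le> 0"
  shows "y \<in> UH X Y T"
  unfolding UH_def
proof (safe)
  fix j k assume jk: "j \<in> T" "k \<in> T" "j < y" "y < k"
  have X: "X j < X y" "X y < X k" using jk T mono by blast+
  have "(X k - X y) * h y c j < 0" using lo[OF jk(1,3)] X by (simp add: mult_less_0_iff)
  moreover have "(X y - X j) * h y c k \<le> 0" using hi[OF jk(2,4)] X by (simp add: mult_le_0_iff)
  ultimately show "0 < h j k y"
    using ori_pos_iff[of y c y j k] T jk by (auto simp: subset_iff)
qed (use T in auto)

end

lemma ori_swap:
  "ori X Y b a c = - ori X Y a b c" "ori X Y a c b = - ori X Y a b c" "ori X Y c b a = - ori X Y a b c"
  unfolding ori_def by algebra+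

text \<open>The ordinate of the line \<open>a b\<close> at the abscissa \<open>v\<close>. It is
  needed to compare two lines above the middle sentinel.\<close>

definition lnv :: "(nat \<Rightarrow> real) \<Rightarrow> (nat \<Rightarrow> real) \<Rightarrow> nat \<Rightarrow> nat \<Rightarrow> real \<Rightarrow> real" where
  "lnv X Y a b v = Y a + (Y b - Y a) * (v - X a) / (X b - X a)"

lemma lnv_slope: "lnv X Y a b v = Y a + (Y b - Y a) / (X b - X a) * (v - X a)"
  by (simp add: lnv_def)

lemma ori_lnv: "X a \<noteq> X b \<Longrightarrow> ori X Y a b z = (X b - X a) * (Y z - lnv X Y a b (X z))"
  unfolding ori_def lnv_def by (simp add: field_simps)

text \<open>Both lines are affine in the abscissa, so comparisons at two places pass to convex
  combinations of them.\<close>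

lemma lnv_interpolate:
  assumes "m < k" "k < c" "lnv X Y p q m \<le> lnv X Y a b m" "lnv X Y p q c < lnv X Y a b c"
  shows "lnv X Y p q k < lnv X Y a b k"
proof -
  have aff: "(c - m) * lnv X Y a b k = (c - k) * lnv X Y a b m + (k - m) * lnv X Y a b c" for a b
    unfolding lnv_slope by algebra
  have "(c - k) * lnv X Y p q m \<le> (c - k) * lnv X Y a b m" using assms by (intro mult_left_mono) auto
  moreover have "(k - m) * lnv X Y p q c < (k - m) * lnv X Y a b c" using assms by simp
  ultimately have "(c - m) * lnv X Y p q k < (c - m) * lnv X Y a b k" unfolding aff by linarith
  then show ?thesis using assms by simp
qed

lemma lnv_interpolate':
  assumes "c < k" "k < m" "lnv X Y p q m < lnv X Y a b m" "lnv X Y p q c < lnv X Y a b c"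
  shows "lnv X Y p q k < lnv X Y a b k"
proof -
  have aff: "(m - c) * lnv X Y a b k = (m - k) * lnv X Y a b c + (k - c) * lnv X Y a b m" for a b
    unfolding lnv_slope by algebra
  have "(m - k) * lnv X Y p q c < (m - k) * lnv X Y a b c" using assms by simp
  moreover have "(k - c) * lnv X Y p q m < (k - c) * lnv X Y a b m" using assms by simp
  ultimately have "(m - c) * lnv X Y p q k < (m - c) * lnv X Y a b k" unfolding aff by linarith
  then show ?thesis using assms by simp
qed

context plane begin

text \<open>Seen from \<open>a\<close>, the point \<open>x\<close> rises above the direction of
  \<open>c\<close> and \<open>k\<close> does not, so \<open>k\<close> is below the ray through
  \<open>x\<close>.\<close>

lemma turn_right:
  assumes "{a, x, c, k} \<subseteq> G \<union> S" "a < x" "x < k" "a < c" "0 < h a c x" "h a c k \<le> 0"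
  shows "h a x k < 0"
proof -
  have "X a < X x" "X x < X k" "X a < X c" using assms mono by auto
  then have "0 < (X k - X a) * h a c x" "(X x - X a) * h a c k \<le> 0" "0 < X c - X a"
    using assms by (simp_all add: mult_le_0_iff)
  then have "0 < (X c - X a) * h a k x" using ori_affine[of X c a Y a k x] by simp
  then show ?thesis using \<open>0 < X c - X a\<close> ori_swap(2)[of X Y a k x] by (simp add: zero_less_mult_iff mult_less_0_iff)
qed

lemma turn_left:
  assumes "{a, y, c, k} \<subseteq> G \<union> S" "y < c" "k < y" "a < c" "0 < h a c y" "h a c k \<le> 0"
  shows "h y c k < 0"
proof -
  have "X y < X c" "X k < X y" "X a < X c" using assms mono by auto
  then have "0 < (X c - X k) * h a c y" "(X c - X y) * h a c k \<le> 0" "0 < X c - X a"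
    using assms by (simp_all add: mult_le_0_iff)
  then have "0 < (X c - X a) * h k c y" using ori_affine[of X c a Y k c y] by simp
  then show ?thesis using \<open>0 < X c - X a\<close> ori_swap(3)[of X Y k c y] by (simp add: zero_less_mult_iff mult_less_0_iff)
qed

text \<open>As \<open>y\<close> is not above the line \<open>a c\<close>, the line
  \<open>y c\<close> runs at or under it everywhere to the left of \<open>c\<close>, and
  \<open>k\<close> is not above \<open>y c\<close>.\<close>

lemma below_right:
  assumes "{a, y, c, k} \<subseteq> G \<union> S" "y < c" "a < k" "k < c" "h a c y \<le> 0" "h y c k \<le> 0"
  shows "h a c k \<le> 0"
proof -
  have X: "X y < X c" "X a < X k" "X k < X c" using assms mono by auto
  have "0 \<le> h y c a" using assms ori_swap(3)[of X Y y c a] by simp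
  then have "(X c - X a) * h y c k \<le> 0" "0 \<le> (X c - X k) * h y c a"
    using assms X by (simp_all add: mult_le_0_iff)
  then have "(X c - X y) * h a c k \<le> 0" using ori_affine[of X c y Y a c k] by simp
  then show ?thesis using X by (simp add: mult_le_0_iff)
qed

lemma below_left:
  assumes "{a, x, c, k} \<subseteq> G \<union> S" "a < x" "a < k" "k < c" "h a c x \<le> 0" "h a x k \<le> 0"
  shows "h a c k \<le> 0"
proof -
  have X: "X a < X x" "X a < X k" "X k < X c" using assms mono by auto
  have "0 \<le> h a x c" using assms ori_swap(2)[of X Y a x c] by simp
  then have "(X c - X a) * h a x k \<le> 0" "0 \<le> (X k - X a) * h a x c"
    using assms X by (simp_all add: mult_le_0_iff)
  then have "(X x - X a) * h a c k \<le> 0" using ori_affine[of X x a Y a c k] by simp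
  then show ?thesis using X by (simp add: mult_le_0_iff)
qed

text \<open>Both ends of the chord have at least the height of the sentinels. This keeps a walker
  from stepping onto the middle sentinel.\<close>

lemma gap_not_above:
  assumes "{a, c} \<subseteq> G \<union> S" "g \<in> G" "a < g" "g < c"
  shows "h a c g \<le> 0"
proof -
  have X: "X a < X g" "X g < X c" using assms mono by auto
  have "(X c - X g) * (- H - Y a) \<le> 0" "(X g - X a) * (- H - Y c) \<le> 0"
    using X Yge[of a] Yge[of c] assms by (auto simp: mult_le_0_iff)
  moreover have "h a c g = (X c - X g) * (- H - Y a) + (X g - X a) * (- H - Y c)"
    unfolding ori_def gapY[OF assms(2)] by (simp add: algebra_simps)
  ultimately show ?thesis by linarith
qed

end

text \<open>The setting for computing the hull \<open>T\<close> of a block from the hulls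
  \<open>CL\<close> and \<open>CR\<close> of its halves. The sentinel \<open>mid\<close> ends both
  half hulls but is absent from the parent's block.\<close>

locale merge = plane +
  fixes A :: "nat set" and s mid e :: nat
  assumes gaps: "s \<in> G" "mid \<in> G" "e \<in> G" and sme: "s < mid" "mid < e" and AS: "A \<subseteq> S"
begin

abbreviation "tt \<equiv> TT A s e"
abbreviation "T \<equiv> hl A s e"
abbreviation "CL \<equiv> hl A s mid"
abbreviation "CR \<equiv> hl A mid e"

lemma GS_disj: "g \<in> G \<Longrightarrow> g \<notin> S"
  using gapY ptY by force

lemma tt_sub: "tt \<subseteq> G \<union> S" "TT A s mid \<subseteq> G \<union> S" "TT A mid e \<subseteq> G \<union> S"
  using gaps AS by (auto simp: TT_def)

lemma T_tt: "i \<in> T \<Longrightarrow> i \<in> tt" using UH_sub by blast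

lemma mid_notin: "mid \<notin> tt"
  using GS_disj gaps AS sme by (auto simp: TT_def)

lemma tt_left: "i \<in> tt \<Longrightarrow> i < mid \<Longrightarrow> i \<in> TT A s mid"
  and tt_right: "i \<in> tt \<Longrightarrow> mid < i \<Longrightarrow> i \<in> TT A mid e"
  and tt_range: "i \<in> tt \<Longrightarrow> s \<le> i \<and> i \<le> e"
  using sme by (auto simp: TT_def)

lemma CL_tt: "i \<in> CL \<Longrightarrow> i \<noteq> mid \<Longrightarrow> i \<in> tt \<and> i < mid"
  and CR_tt: "i \<in> CR \<Longrightarrow> i \<noteq> mid \<Longrightarrow> i \<in> tt \<and> mid < i"
  using UH_sub[of X Y "TT A s mid"] UH_sub[of X Y "TT A mid e"] sme by (auto simp: TT_def)

lemma T_left: "i \<in> T \<Longrightarrow> i < mid \<Longrightarrow> i \<in> CL"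
  and T_right: "i \<in> T \<Longrightarrow> mid < i \<Longrightarrow> i \<in> CR"
proof -
  assume i: "i \<in> T"
  have iA: "i = s \<or> i = e \<or> i \<in> A \<and> s < i \<and> i < e" using T_tt[OF i] by (auto simp: TT_def)
  show "i \<in> CL" if "i < mid"
    using iA hull_nested[of s s mid e A i] UH_ends(1)[OF sme(1)] that gaps sme AS i by auto
  show "i \<in> CR" if "mid < i"
    using iA hull_nested[of s mid e e A i] UH_ends(2)[OF sme(2)] that gaps sme AS i by auto
qed

text \<open>These pairs are exactly the links that a walker can follow in the lists of the two
  halves.\<close>

definition child :: "nat \<Rightarrow> nat \<Rightarrow> bool" where
  "child i j \<longleftrightarrow> cons CL i j \<or> cons CR i j"

lemma child_succ:
  assumes "a \<in> T" "a < e"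
  shows "\<exists>x. child a x"
proof (cases "a < mid")
  case True
  then show ?thesis using cons_succ_exists[of CL a mid] T_left[OF assms(1)] UH_ends(2)[OF sme(1)]
    finite_subset[OF UH_sub finite_TT] unfolding child_def by blast
next
  case False
  then have "mid < a" using mid_notin T_tt[OF assms(1)] by (metis linorder_neqE_nat)
  then show ?thesis using cons_succ_exists[of CR a e] T_right[OF assms(1)] UH_ends(2)[OF sme(2)] assms
    finite_subset[OF UH_sub finite_TT] unfolding child_def by blast
qed

lemma child_pred:
  assumes "c \<in> T" "s < c"
  shows "\<exists>y. child y c"
proof (cases "c < mid")
  case True
  then show ?thesis using cons_pred_exists[of CL c s] T_left[OF assms(1)] UH_ends(1)[OF sme(1)] assms
    finite_subset[OF UH_sub finite_TT] unfolding child_def by blast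
next
  case False
  then have "mid < c" using mid_notin T_tt[OF assms(1)] by (metis linorder_neqE_nat)
  then show ?thesis using cons_pred_exists[of CR c mid] T_right[OF assms(1)] UH_ends(1)[OF sme(2)] assms
    finite_subset[OF UH_sub finite_TT] unfolding child_def by blast
qed

lemma consL: "cons CL i j \<Longrightarrow> i \<in> CL \<and> j \<in> CL \<and> i < j \<and> s \<le> i \<and> j \<le> mid"
  and consR: "cons CR i j \<Longrightarrow> i \<in> CR \<and> j \<in> CR \<and> i < j \<and> mid \<le> i \<and> j \<le> e"
  using UH_sub[of X Y "TT A s mid"] UH_sub[of X Y "TT A mid e"] sme by (auto simp: TT_def cons_def)

lemma child_supports:
  assumes "child p r"
  shows "p < r"
    and "p < mid \<Longrightarrow> r \<le> mid \<and> cons CL p r"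
    and "mid < r \<Longrightarrow> mid \<le> p \<and> cons CR p r"
    and "k \<in> tt \<Longrightarrow> p < mid \<Longrightarrow> k < mid \<Longrightarrow> h p r k \<le> 0"
    and "k \<in> tt \<Longrightarrow> mid < r \<Longrightarrow> mid < k \<Longrightarrow> h p r k \<le> 0"
proof -
  show "p < r" using assms by (auto simp: child_def cons_def)
  show L: "p < mid \<Longrightarrow> r \<le> mid \<and> cons CL p r" using assms consL consR unfolding child_def by (meson leD)
  show R: "mid < r \<Longrightarrow> mid \<le> p \<and> cons CR p r" using assms consL consR unfolding child_def by (meson leD)
  show "k \<in> tt \<Longrightarrow> p < mid \<Longrightarrow> k < mid \<Longrightarrow> h p r k \<le> 0"
    using edge_supports[of "TT A s mid" p r k] L tt_left tt_sub(2) by simp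
  show "k \<in> tt \<Longrightarrow> mid < r \<Longrightarrow> mid < k \<Longrightarrow> h p r k \<le> 0"
    using edge_supports[of "TT A mid e" p r k] R tt_right tt_sub(3) by simp
qed

context
  fixes a c x y
  assumes ac: "a \<in> T" "c \<in> T" "a < c" and x: "child a x" and y: "child y c"
begin

lemma ac_tt: "a \<in> tt" "c \<in> tt" "a \<noteq> mid" "c \<noteq> mid" "{a, c} \<subseteq> G \<union> S"
  using T_tt ac mid_notin tt_sub(1) by (metis, metis, metis, metis, blast)

text \<open>A candidate above the chord cannot pass \<open>c\<close>, since \<open>c\<close> is
  itself in the list if it is in the same half. It cannot be \<open>mid\<close>, since a sentinel is
  not above a chord. So an advance stays in its half.\<close>

lemma x_up:
  assumes "0 < h a c x"
  shows "x < c" "x \<in> tt" "x \<noteq> mid" "(a < mid \<and> x < mid \<and> x \<in> CL) \<or> (mid < a \<and> mid < x \<and> x \<in> CR)"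
proof -
  have "x \<noteq> c" using assms by auto
  have *: "x < c \<and> x \<in> tt \<and> x \<noteq> mid \<and> ((a < mid \<and> x < mid \<and> x \<in> CL) \<or> (mid < a \<and> mid < x \<and> x \<in> CR))"
  proof (cases "a < mid")
    case True
    then have xL: "cons CL a x" "x \<le> mid" using child_supports(2)[OF x] by auto
    have "x < c"
    proof (cases "c < mid")
      case True
      then have "\<not> c < x" using xL(1) T_left[OF ac(2)] ac(3) by (auto simp: cons_def)
      then show ?thesis using \<open>x \<noteq> c\<close> by simp
    qed (use xL ac_tt in auto)
    moreover have "x \<noteq> mid"
      using gap_not_above[of a c mid] True ac_tt gaps assms calculation by force
    ultimately show ?thesis using xL True CL_tt consL by blast
  next
    case False
    then have am: "mid < a" using ac_tt by auto
    then have xR: "cons CR a x" using x consL unfolding child_def by (meson leD less_trans)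
    then have "\<not> c < x" using T_right[OF ac(2)] ac(3) am by (auto simp: cons_def)
    then show ?thesis using \<open>x \<noteq> c\<close> am xR CR_tt consR[OF xR] by force
  qed
  then show "x < c" "x \<in> tt" "x \<noteq> mid" "(a < mid \<and> x < mid \<and> x \<in> CL) \<or> (mid < a \<and> mid < x \<and> x \<in> CR)"
    by auto
qed

lemma y_up:
  assumes "0 < h a c y"
  shows "a < y" "y \<in> tt" "y \<noteq> mid" "(c < mid \<and> y < mid \<and> y \<in> CL) \<or> (mid < c \<and> mid < y \<and> y \<in> CR)"
proof -
  have "y \<noteq> a" using assms by auto
  have *: "a < y \<and> y \<in> tt \<and> y \<noteq> mid \<and> ((c < mid \<and> y < mid \<and> y \<in> CL) \<or> (mid < c \<and> mid < y \<and> y \<in> CR))"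
  proof (cases "mid < c")
    case True
    then have yR: "cons CR y c" "mid \<le> y" using child_supports(3)[OF y] by auto
    have "a < y"
    proof (cases "mid < a")
      case True
      then have "\<not> y < a" using yR(1) T_right[OF ac(1)] ac(3) by (auto simp: cons_def)
      then show ?thesis using \<open>y \<noteq> a\<close> by simp
    qed (use yR ac_tt in auto)
    moreover have "y \<noteq> mid"
      using gap_not_above[of a c mid] True ac_tt gaps assms calculation by force
    ultimately show ?thesis using yR True CR_tt consR by blast
  next
    case False
    then have cm: "c < mid" using ac_tt by auto
    then have yL: "cons CL y c" using y consR unfolding child_def by (meson leD less_trans)
    then have "\<not> y < a" using T_left[OF ac(1)] ac(3) cm by (auto simp: cons_def)
    then show ?thesis using \<open>y \<noteq> a\<close> cm yL CL_tt consL[OF yL] by force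
  qed
  then show "a < y" "y \<in> tt" "y \<noteq> mid" "(c < mid \<and> y < mid \<and> y \<in> CL) \<or> (mid < c \<and> mid < y \<and> y \<in> CR)"
    by auto
qed

text \<open>The line \<open>a x\<close> is shown to support the parent's block. In the half of
  \<open>a\<close> the half hull does this, and points beyond \<open>c\<close> are under the line
  \<open>a c\<close>. A point \<open>k\<close> between \<open>mid\<close> and \<open>c\<close> is
  not above the line \<open>y c\<close>; if both candidates rise, that line is not above
  \<open>a x\<close> at \<open>mid\<close> and is strictly below it at \<open>c\<close>, hence
  strictly below it at \<open>k\<close>.\<close>

lemma advance_left:
  assumes up: "0 < h a c x" and alt: "h a c y \<le> 0 \<or> lnv X Y y c (X mid) \<le> lnv X Y a x (X mid)"
  shows "x \<in> T"
proof (rule UH_I_line[OF tt_sub(1) x_up(2)[OF up] ac_tt(1) child_supports(1)[OF x]])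
  note xu = x_up[OF up]
  have ax: "a < x" by (rule child_supports(1)[OF x])
  fix j assume j: "j \<in> tt" "j < x"
  consider "j < a" | "j = a" | "a < j" by linarith
  then show "h a x j \<le> 0"
  proof cases
    case 1
    then have "0 < h j x a" using ac(1) j xu(2) ax unfolding UH_def by blast
    then show ?thesis using ori_swap(3)[of X Y a j x] ori_swap(3)[of X Y j x a] by simp
  next
    case 3
    then show ?thesis using xu(4) j child_supports(4,5)[OF x j(1)] by auto
  qed auto
next
  note xu = x_up[OF up]
  have ax: "a < x" by (rule child_supports(1)[OF x])
  fix k assume k: "k \<in> tt" "x < k"
  have sub: "{a, x, c, k} \<subseteq> G \<union> S" using ac_tt(5) xu(2) k tt_sub(1) by blast
  have kmid: "k \<noteq> mid" using k mid_notin by auto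
  show "h a x k < 0"
  proof (cases "(a < mid) = (k < mid)")
    case True
    have "0 < h a k x"
    proof (cases "a < mid")
      case T1: True
      then have "a \<in> TT A s mid" "k \<in> TT A s mid" using True k ac_tt tt_left by auto
      then show ?thesis using xu(4) T1 ax k(2) unfolding UH_def by auto
    next
      case F1: False
      then have "a \<in> TT A mid e" "k \<in> TT A mid e" using True k ac_tt tt_right kmid by auto
      then show ?thesis using xu(4) F1 ax k(2) unfolding UH_def by auto
    qed
    then show ?thesis using ori_swap(2)[of X Y a k x] by simp
  next
    case False
    then have am: "a < mid" "mid < k" using ax k kmid by auto
    show ?thesis
    proof (cases "k < c")
      case False
      then have "h a c k \<le> 0"
      proof (cases "k = c")
        case False
        then have "0 < h a k c" using \<open>\<not> k < c\<close> ac ac_tt k unfolding UH_def by auto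
        then show ?thesis using ori_swap(2)[of X Y a k c] by simp
      qed simp
      then show ?thesis using turn_right[OF sub ax k(2) ac(3) up] by simp
    next
      case kc: True
      then have yk: "h y c k \<le> 0" using child_supports(5)[OF y k(1)] am by auto
      from alt show ?thesis
      proof
        assume "h a c y \<le> 0"
        moreover have "y < c" "y \<in> G \<union> S"
          using child_supports(1,3)[OF y] less_trans[OF am(2) kc] consR UH_sub[of X Y "TT A mid e"] tt_sub(3) by blast+
        ultimately have "h a c k \<le> 0" using below_right[of a y c k] yk sub kc am by auto
        then show ?thesis using turn_right[OF sub ax k(2) ac(3) up] by simp
      next
        assume le: "lnv X Y y c (X mid) \<le> lnv X Y a x (X mid)"
        have yc: "y < c" "y \<in> G \<union> S"
          using child_supports(1,3)[OF y] less_trans[OF am(2) kc] consR UH_sub[of X Y "TT A mid e"] tt_sub(3) by blast+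
        have xs: "X y < X c" "X a < X x" "X mid < X k" "X k < X c"
          using mono sub yc ax am kc gaps by blast+
        have "h a x c < 0" using up ori_swap(2)[of X Y a c x] by simp
        then have "Y c < lnv X Y a x (X c)" using xs ori_lnv[of X a x Y c] by (simp add: mult_less_0_iff)
        moreover have "lnv X Y y c (X c) = Y c" using xs by (simp add: lnv_def)
        ultimately have "lnv X Y y c (X k) < lnv X Y a x (X k)"
          using lnv_interpolate[OF xs(3,4) le] by simp
        moreover have "Y k \<le> lnv X Y y c (X k)" using yk xs ori_lnv[of X y c Y k] by (simp add: mult_le_0_iff)
        ultimately show ?thesis using xs ori_lnv[of X a x Y k] by (simp add: mult_less_0_iff)
      qed
    qed
  qed
qed

text \<open>The mirror image, with a strict comparison at \<open>mid\<close>. When both candidates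
  rise above the chord, exactly one of the two lemmas applies, and ties go to the left
  walker.\<close>

lemma advance_right:
  assumes up: "0 < h a c y" and alt: "h a c x \<le> 0 \<or> lnv X Y a x (X mid) < lnv X Y y c (X mid)"
  shows "y \<in> T"
proof (rule UH_I_line'[OF tt_sub(1) y_up(2)[OF up] ac_tt(2) child_supports(1)[OF y]])
  note yu = y_up[OF up]
  have yc: "y < c" by (rule child_supports(1)[OF y])
  fix k assume k: "k \<in> tt" "y < k"
  consider "c < k" | "k = c" | "k < c" by linarith
  then show "h y c k \<le> 0"
  proof cases
    case 1
    then have "0 < h y k c" using ac(2) k yu(2) yc unfolding UH_def by blast
    then show ?thesis using ori_swap(2)[of X Y y k c] by simp
  next
    case 3
    then show ?thesis using yu(4) k child_supports(4,5)[OF y k(1)] by auto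
  qed auto
next
  note yu = y_up[OF up]
  have yc: "y < c" by (rule child_supports(1)[OF y])
  fix k assume k: "k \<in> tt" "k < y"
  have sub: "{a, y, c, k} \<subseteq> G \<union> S" using ac_tt(5) yu(2) k tt_sub(1) by blast
  have kmid: "k \<noteq> mid" using k mid_notin by auto
  show "h y c k < 0"
  proof (cases "(c < mid) = (k < mid)")
    case True
    have "0 < h k c y"
    proof (cases "c < mid")
      case T1: True
      then have "c \<in> TT A s mid" "k \<in> TT A s mid" using True k ac_tt tt_left by auto
      then show ?thesis using yu(4) T1 yc k(2) unfolding UH_def by auto
    next
      case F1: False
      then have "c \<in> TT A mid e" "k \<in> TT A mid e" using True k ac_tt tt_right kmid by auto
      then show ?thesis using yu(4) F1 yc k(2) unfolding UH_def by auto
    qed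
    then show ?thesis using ori_swap(3)[of X Y y c k] by simp
  next
    case False
    then have cm: "mid < c" "k < mid" using yc k kmid ac_tt(4) by auto
    show ?thesis
    proof (cases "a < k")
      case False
      then have "h a c k \<le> 0"
      proof (cases "k = a")
        case False
        then have "0 < h k c a" using \<open>\<not> a < k\<close> ac ac_tt k unfolding UH_def by auto
        then show ?thesis using ori_swap(3)[of X Y a c k] by simp
      qed simp
      then show ?thesis using turn_left[OF sub yc k(2) ac(3) up] by simp
    next
      case ak: True
      then have xk: "h a x k \<le> 0" using child_supports(4)[OF x k(1)] cm by auto
      have ax: "a < x" "x \<in> G \<union> S"
        using child_supports(1,2)[OF x] less_trans[OF ak cm(2)] consL UH_sub[of X Y "TT A s mid"] tt_sub(2) by blast+
      from alt show ?thesis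
      proof
        assume "h a c x \<le> 0"
        then have "h a c k \<le> 0" using below_left[of a x c k] xk sub ax ak cm by auto
        then show ?thesis using turn_left[OF sub yc k(2) ac(3) up] by simp
      next
        assume le: "lnv X Y a x (X mid) < lnv X Y y c (X mid)"
        have xs: "X y < X c" "X a < X x" "X k < X mid" "X a < X k"
          using mono sub ax yc cm ak gaps by blast+
        have "h y c a < 0" using up ori_swap(3)[of X Y a c y] by simp
        then have "Y a < lnv X Y y c (X a)" using xs ori_lnv[of X y c Y a] by (simp add: mult_less_0_iff)
        moreover have "lnv X Y a x (X a) = Y a" by (simp add: lnv_def)
        ultimately have "lnv X Y a x (X k) < lnv X Y y c (X k)"
          using lnv_interpolate'[OF xs(4,3) le] by simp
        moreover have "Y k \<le> lnv X Y a x (X k)" using xk xs ori_lnv[of X a x Y k] by (simp add: mult_le_0_iff)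
        ultimately show ?thesis using xs ori_lnv[of X y c Y k] by (simp add: mult_less_0_iff)
      qed
    qed
  qed
qed

text \<open>In a single half, a vertex between \<open>a\<close> and \<open>c\<close> would put
  \<open>x\<close> between them as well, and \<open>x\<close> would rise above the chord. If the
  chord spans \<open>mid\<close>, everything between is not above \<open>a x\<close> or not above
  \<open>y c\<close>, and both lines run at or under the chord there.\<close>

lemma finish:
  assumes "h a c x \<le> 0" "h a c y \<le> 0"
  shows "cons T a c"
  unfolding cons_def
proof (intro conjI ballI notI)
  fix k assume kT: "k \<in> T" and k: "a < k \<and> k < c"
  have ktt: "k \<in> tt" "k \<noteq> mid" using T_tt[OF kT] mid_notin by auto
  have up: "0 < h a c k" using kT k ac_tt unfolding UH_def by blast
  have sub: "{a, c, k} \<subseteq> G \<union> S" using ac_tt(5) ktt tt_sub(1) by blast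
  consider "c < mid" | "mid < a" | "a < mid" "mid < c" using ac_tt ac(3) by fastforce
  then show False
  proof cases
    case 1
    have xL: "cons CL a x" using child_supports(2)[OF x] 1 ac(3) by auto
    have "k \<in> CL" "c \<in> CL" using T_left kT ac(2) 1 k by auto
    then have "x < c" using xL k by (auto simp: cons_def)
    moreover have "x \<in> CL" "a \<in> TT A s mid" "c \<in> TT A s mid" using consL[OF xL] 1 ac ac_tt tt_left by auto
    ultimately have "0 < h a c x" using consL[OF xL] unfolding UH_def by blast
    then show False using assms by simp
  next
    case 2
    have xL: "cons CR a x" using x consL 2 unfolding child_def by (meson leD less_trans)
    have "k \<in> CR" "c \<in> CR" using T_right kT ac(2,3) 2 k by auto
    then have "x < c" using xL k by (auto simp: cons_def)
    moreover have "x \<in> CR" "a \<in> TT A mid e" "c \<in> TT A mid e" using consR[OF xL] 2 ac ac_tt tt_right by auto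
    ultimately have "0 < h a c x" using consR[OF xL] unfolding UH_def by blast
    then show False using assms by simp
  next
    case 3
    show False
    proof (cases "k < mid")
      case True
      have ax: "a < x" "x \<in> G \<union> S"
        using child_supports(1,2)[OF x] 3 consL UH_sub[of X Y "TT A s mid"] tt_sub(2) by blast+
      have "h a x k \<le> 0" using child_supports(4)[OF x ktt(1)] 3 True by auto
      then show False using below_left[of a x c k] ax sub k assms up by auto
    next
      case False
      have yc: "y < c" "y \<in> G \<union> S"
        using child_supports(1,3)[OF y] 3 consR UH_sub[of X Y "TT A mid e"] tt_sub(3) by blast+
      have "h y c k \<le> 0" using child_supports(5)[OF y ktt(1)] 3 False ktt by auto
      then show False using below_right[of a y c k] yc sub k assms up by auto
    qed
  qed
qed (use ac in auto)

end

end

context plane begin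

text \<open>Only chords ending in the deleted point could have excluded \<open>j\<close> before. But
  \<open>j\<close> is above the chord from \<open>p\<close> to \<open>a\<close>, and
  \<open>a\<close> is above the chord from \<open>p\<close> to \<open>i\<close>.\<close>

lemma delete_left:
  assumes t: "t \<subseteq> G \<union> S" and a: "a \<in> UH X Y t" "a < i" and i: "i \<in> t"
    and j: "j \<in> UH X Y (t - {i})" "j \<le> a"
  shows "j \<in> UH X Y t"
proof (cases "j = a")
  case False
  then have ja: "j < a" using j by simp
  have "0 < h p k j" if pk: "p \<in> t" "k \<in> t" "p < j" "j < k" for p k
  proof (cases "k = i")
    case True
    have sub: "{p, a, i, j} \<subseteq> G \<union> S" "a \<in> t" using t pk a i j UH_sub by blast+
    have 1: "0 < h p a j" using j(1) pk a sub(2) ja unfolding UH_def by auto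
    have 2: "0 < h p i a" using a i pk ja unfolding UH_def by auto
    have xs: "X p < X a" "X p < X i" "X p < X j" using mono sub pk ja a by auto
    have "0 < (X i - X p) * h p a j" "0 < (X j - X p) * h p i a" using 1 2 xs by auto
    then have "0 < (X a - X p) * h p i j"
      using ori_affine[of X a p Y p i j] ori_swap(2)[of X Y p i a] by simp
    then show ?thesis using xs True by (simp add: zero_less_mult_iff)
  next
    case False
    then show ?thesis using j(1) pk ja a unfolding UH_def by auto
  qed
  then show ?thesis using j(1) unfolding UH_def by auto
qed (use a in simp)

lemma delete_right:
  assumes t: "t \<subseteq> G \<union> S" and c: "c \<in> UH X Y t" "i < c" and i: "i \<in> t"
    and j: "j \<in> UH X Y (t - {i})" "c \<le> j"
  shows "j \<in> UH X Y t"
proof (cases "j = c")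
  case False
  then have jc: "c < j" using j by simp
  have "0 < h p k j" if pk: "p \<in> t" "k \<in> t" "p < j" "j < k" for p k
  proof (cases "p = i")
    case True
    have sub: "{k, c, i, j} \<subseteq> G \<union> S" "c \<in> t" using t pk c i j UH_sub by blast+
    have 1: "0 < h c k j" using j(1) pk c sub(2) jc unfolding UH_def by auto
    have 2: "0 < h i k c" using c i pk jc unfolding UH_def by auto
    have xs: "X c < X k" "X i < X k" "X j < X k" using mono sub pk jc c by auto
    have "0 < (X k - X i) * h c k j" "0 < (X k - X j) * h i k c" using 1 2 xs by auto
    then have "0 < (X k - X c) * h i k j"
      using ori_affine[of X k c Y i k j] ori_swap(3)[of X Y c k i] by simp
    then show ?thesis using xs True by (simp add: zero_less_mult_iff)
  next
    case False
    then show ?thesis using j(1) pk jc c unfolding UH_def by auto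
  qed
  then show ?thesis using j(1) unfolding UH_def by auto
qed (use c in simp)

lemma delete_keeps: "UH X Y t - {i} \<subseteq> UH X Y (t - {i})"
  by (auto simp: UH_def)

text \<open>A deletion changes the hull only between the two neighbours of the deleted vertex, so
  the rest of the list can be kept.\<close>

lemma cons_delete:
  assumes t: "t \<subseteq> G \<union> S" and i: "i \<in> t" and ai: "cons (UH X Y t) a i" and ic: "cons (UH X Y t) i c"
    and jk: "cons (UH X Y (t - {i})) j k"
  shows "(cons (UH X Y t) j k \<and> (k \<le> a \<or> c \<le> j)) \<or> (a \<le> j \<and> k \<le> c)"
proof -
  have aT: "a \<in> UH X Y t" "c \<in> UH X Y t" "a < i" "i < c" using ai ic by (auto simp: cons_def)
  then have "a \<in> UH X Y (t - {i})" "c \<in> UH X Y (t - {i})" using delete_keeps[of t i] by auto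
  then have "k \<le> a \<or> a \<le> j" "c \<le> j \<or> k \<le> c" using jk by (auto simp: cons_def)
  moreover have "cons (UH X Y t) j k" if "k \<le> a"
    using that jk delete_left[OF t aT(1,3) i] delete_keeps[of t i] aT unfolding cons_def by force
  moreover have "cons (UH X Y t) j k" if "c \<le> j"
    using that jk delete_right[OF t aT(2,4) i] delete_keeps[of t i] aT unfolding cons_def by force
  ultimately show ?thesis by blast
qed

end

section \<open>Linked lists of hull vertices\<close>

text \<open>A doubly linked list with next array \<open>n\<close> and previous array
  \<open>q\<close>. The lists of all blocks and levels share these two arrays; a level is selected
  by its base address \<open>b\<close>. Cells of indices off the hull are arbitrary.\<close>

definition lst :: "(nat \<Rightarrow> nat) \<Rightarrow> (nat \<Rightarrow> nat) \<Rightarrow> nat \<Rightarrow> nat set \<Rightarrow> bool" where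
  "lst n q b T \<longleftrightarrow> (\<forall>i j. cons T i j \<longrightarrow> n (b + i) = j \<and> q (b + j) = i)"

abbreviation rx :: "string \<Rightarrow> rexp" where "rx z \<equiv> RGet ''X'' (NV z)"
abbreviation ry :: "string \<Rightarrow> rexp" where "ry z \<equiv> RGet ''Y'' (NV z)"

definition oriE :: "string \<Rightarrow> string \<Rightarrow> string \<Rightarrow> rexp" where
  "oriE a b c = RSub (RMul (RSub (rx b) (rx a)) (RSub (ry c) (ry a))) (RMul (RSub (ry b) (ry a)) (RSub (rx c) (rx a)))"

definition lnE :: "string \<Rightarrow> string \<Rightarrow> string \<Rightarrow> rexp" where
  "lnE a b m = RAdd (ry a) (RDiv (RMul (RSub (ry b) (ry a)) (RSub (rx m) (rx a))) (RSub (rx b) (rx a)))"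

definition upE :: "string \<Rightarrow> bexp" where
  "upE z = RLess (RLit 0) (oriE ''a'' ''c'' z)"

definition link :: "string \<Rightarrow> string \<Rightarrow> com" where
  "link i j = (NSet ''n'' (NAdd (NV ''b'') (NV i)) (NV j) ;; NSet ''q'' (NAdd (NV ''b'') (NV j)) (NV i))"

text \<open>The candidates \<open>x\<close> and \<open>y\<close> are read from the lists of the
  halves at base \<open>b0\<close>; the parent's links are written at base \<open>b\<close>. A
  walker that advances leaves a final edge of the parent's hull behind.\<close>

definition walk_body :: com where
  "walk_body =
    (''x'' ::= NGet ''n'' (NAdd (NV ''b0'') (NV ''a'')) ;;
     ''y'' ::= NGet ''q'' (NAdd (NV ''b0'') (NV ''c'')) ;;
     Cond (BAnd (upE ''x'') (BNot (BAnd (upE ''y'') (RLess (lnE ''a'' ''x'' ''m'') (lnE ''y'' ''c'' ''m'')))))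
       (link ''a'' ''x'' ;; ''a'' ::= NV ''x'')
       (Cond (upE ''y'') (link ''y'' ''c'' ;; ''c'' ::= NV ''y'')
         (link ''a'' ''c'' ;; ''done'' ::= NLit 1)))"

definition walk :: com where
  "walk = (''done'' ::= NLit 0 ;; While (NLess (NV ''done'') (NLit 1)) walk_body)"

lemma oriE_val: "rval (oriE a b c) s =
    ori (reals s ''X'') (reals s ''Y'') (nats s a 0) (nats s b 0) (nats s c 0)"
  by (simp add: oriE_def ori_def)

lemma lnE_val: "rval (lnE a b m) s =
    lnv (reals s ''X'') (reals s ''Y'') (nats s a 0) (nats s b 0) (reals s ''X'' (nats s m 0))"
  by (simp add: lnE_def lnv_def)

lemma E_cost: "rcost (oriE a b c) = 31" "rcost (lnE a b m) = 27" "bcost (upE z) = 33"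
  by (simp_all add: oriE_def lnE_def upE_def)

lemma walk_mods [simp]:
  "nmods walk = {''done'', ''x'', ''y'', ''n'', ''q'', ''a'', ''c''}" "rmods walk = {}"
  by (auto simp: walk_def walk_body_def link_def)

lemma walk_body_mods [simp]:
  "nmods walk_body = {''done'', ''x'', ''y'', ''n'', ''q'', ''a'', ''c''}" "rmods walk_body = {}"
  by (auto simp: walk_body_def link_def)

context merge begin

text \<open>Inside \<open>a0\<close> to \<open>c0\<close> the list is already right outside of
  \<open>a\<close> to \<open>c\<close>, and nothing beyond is written. If the range spans
  \<open>mid\<close>, the walkers stay on their sides, so that the pair they end with is the bridge
  of the block.\<close>

definition walk_inv :: "nat \<Rightarrow> nat \<Rightarrow> nat \<Rightarrow> (nat \<Rightarrow> nat) \<Rightarrow> (nat \<Rightarrow> nat) \<Rightarrow> nat \<Rightarrow> nat \<Rightarrow> (nat \<Rightarrow> nat) \<Rightarrow> (nat \<Rightarrow> nat) \<Rightarrow> bool" where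
  "walk_inv b a0 c0 n q a c n' q' \<longleftrightarrow> a \<in> T \<and> c \<in> T \<and> a < c \<and> a0 \<le> a \<and> c \<le> c0 \<and>
     (a0 < mid \<and> mid < c0 \<longrightarrow> a < mid \<and> mid < c) \<and>
     (\<forall>i j. cons T i j \<and> (a0 \<le> i \<and> j \<le> a \<or> c \<le> i \<and> j \<le> c0) \<longrightarrow> n' (b + i) = j \<and> q' (b + j) = i) \<and>
     (\<forall>z. z < b + a0 \<or> b + c0 \<le> z \<longrightarrow> n' z = n z) \<and>
     (\<forall>z. z \<le> b + a0 \<or> b + c0 < z \<longrightarrow> q' z = q z)"

definition walk_post :: "nat \<Rightarrow> nat \<Rightarrow> nat \<Rightarrow> (nat \<Rightarrow> nat) \<Rightarrow> (nat \<Rightarrow> nat) \<Rightarrow> nat \<Rightarrow> nat \<Rightarrow> (nat \<Rightarrow> nat) \<Rightarrow> (nat \<Rightarrow> nat) \<Rightarrow> bool" where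
  "walk_post b a0 c0 n q a c n' q' \<longleftrightarrow> cons T a c \<and> a0 \<le> a \<and> c \<le> c0 \<and>
     (a0 < mid \<and> mid < c0 \<longrightarrow> a < mid \<and> mid < c) \<and>
     (\<forall>i j. cons T i j \<and> a0 \<le> i \<and> j \<le> c0 \<longrightarrow> n' (b + i) = j \<and> q' (b + j) = i) \<and>
     (\<forall>z. z < b + a0 \<or> b + c0 \<le> z \<longrightarrow> n' z = n z) \<and>
     (\<forall>z. z \<le> b + a0 \<or> b + c0 < z \<longrightarrow> q' z = q z)"

lemma cons_le: "cons T i j \<Longrightarrow> z \<in> T \<Longrightarrow> i < z \<Longrightarrow> j \<le> z"
  by (auto simp: cons_def)

lemma cons_ge: "cons T i j \<Longrightarrow> z \<in> T \<Longrightarrow> z < j \<Longrightarrow> z \<le> i"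
  by (auto simp: cons_def)

lemma cons_unique: "cons T i j \<Longrightarrow> cons T i j' \<Longrightarrow> j = j'" "cons T i j \<Longrightarrow> cons T i' j \<Longrightarrow> i = i'"
  unfolding cons_def by (meson linorder_neqE_nat)+

lemma inv_advance_left:
  assumes I: "walk_inv b a0 c0 n q a c n' q'" and x: "x \<in> T" "cons T a x" "x < c"
    and side: "a < mid \<Longrightarrow> x < mid"
  shows "walk_inv b a0 c0 n q x c (n'(b + a := x)) (q'(b + x := a))"
proof -
  have ax: "a < x" using x(2) by (simp add: cons_def)
  have 1: "(n'(b + a := x)) (b + i) = j \<and> (q'(b + x := a)) (b + j) = i"
    if ij: "cons T i j" and r: "a0 \<le> i \<and> j \<le> x \<or> c \<le> i \<and> j \<le> c0" for i j
  proof (cases "i = a")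
    case True
    then show ?thesis using cons_unique(1)[OF ij, of x] x by simp
  next
    case False
    then have "j \<noteq> x" using cons_unique(2)[OF ij, of a] x by auto
    have "j \<le> a \<or> c \<le> i"
      using r ij x \<open>j \<noteq> x\<close> False cons_le[OF ij, of a] cons_ge[OF x(2), of j] I
      unfolding walk_inv_def cons_def by (metis le_neq_implies_less linorder_le_less_linear order.trans)
    then show ?thesis using I ij r False \<open>j \<noteq> x\<close> ax x(3) unfolding walk_inv_def by auto
  qed
  show ?thesis
    using I x ax side 1 unfolding walk_inv_def by auto
qed

lemma inv_advance_right:
  assumes I: "walk_inv b a0 c0 n q a c n' q'" and y: "y \<in> T" "cons T y c" "a < y"
    and side: "mid < c \<Longrightarrow> mid < y"
  shows "walk_inv b a0 c0 n q a y (n'(b + y := c)) (q'(b + c := y))"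
proof -
  have yc: "y < c" using y(2) by (simp add: cons_def)
  have 1: "(n'(b + y := c)) (b + i) = j \<and> (q'(b + c := y)) (b + j) = i"
    if ij: "cons T i j" and r: "a0 \<le> i \<and> j \<le> a \<or> y \<le> i \<and> j \<le> c0" for i j
  proof (cases "i = y")
    case True
    then show ?thesis using cons_unique(1)[OF ij, of c] y by simp
  next
    case False
    then have "j \<noteq> c" using cons_unique(2)[OF ij, of y] y by auto
    have "j \<le> a \<or> c \<le> i"
      using r ij y \<open>j \<noteq> c\<close> False cons_le[OF ij, of c] cons_le[OF y(2), of i] I
      unfolding walk_inv_def cons_def by (metis le_neq_implies_less linorder_le_less_linear order.trans)
    then show ?thesis using I ij r False \<open>j \<noteq> c\<close> yc y(3) unfolding walk_inv_def by auto
  qed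
  show ?thesis
    using I y yc side 1 unfolding walk_inv_def by auto
qed

lemma inv_finish:
  assumes I: "walk_inv b a0 c0 n q a c n' q'" and ac: "cons T a c"
  shows "walk_post b a0 c0 n q a c (n'(b + a := c)) (q'(b + c := a))"
proof -
  have 1: "(n'(b + a := c)) (b + i) = j \<and> (q'(b + c := a)) (b + j) = i"
    if ij: "cons T i j" and r: "a0 \<le> i \<and> j \<le> c0" for i j
  proof (cases "i = a")
    case True
    then show ?thesis using cons_unique(1)[OF ij, of c] ac by simp
  next
    case False
    then have "j \<noteq> c" using cons_unique(2)[OF ij, of a] ac by auto
    have "j \<le> a \<or> c \<le> i"
      using cons_le[OF ij, of a] cons_le[OF ac, of i] ij ac False unfolding cons_def by (metis linorder_neqE_nat)
    then show ?thesis using I ij r False \<open>j \<noteq> c\<close> unfolding walk_inv_def cons_def by auto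
  qed
  show ?thesis
    using I ac 1 unfolding walk_inv_def walk_post_def by (auto simp: cons_def)
qed

text \<open>Every vertex of the parent is a vertex of its half. A parent's vertex inside a link of a
  half would therefore interrupt that link already there.\<close>

lemma child_is_cons:
  assumes "a \<in> T" "c \<in> T" "a < c" "child a x" "x \<in> T"
  shows "cons T a x"
proof -
  have "k \<in> CL \<or> k \<in> CR" if "k \<in> T" for k
    using T_left T_right that T_tt mid_notin by (metis linorder_neqE_nat)
  have "\<not> (a < k \<and> k < x)" if k: "k \<in> T" for k
  proof
    assume ak: "a < k \<and> k < x"
    have km: "k \<noteq> mid" using T_tt[OF k] mid_notin by auto
    from \<open>child a x\<close>[unfolded child_def] show False
    proof
      assume L: "cons CL a x"
      then have "k < mid" using consL[OF L] ak by auto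
      then show False using T_left[OF k] L ak by (auto simp: cons_def)
    next
      assume R: "cons CR a x"
      then have "mid < k" using consR[OF R] ak by auto
      then show False using T_right[OF k] R ak by (auto simp: cons_def)
    qed
  qed
  moreover have "a < x" using assms(4) by (auto simp: child_def cons_def)
  ultimately show ?thesis using assms unfolding cons_def by blast
qed

text \<open>The time is proportional to the number of vertices strictly between the starting pair.
  The pair may be any two vertices of the hull to be computed: the outer sentinels when building,
  the neighbours of the removed point when deleting.\<close>

lemma walk_runs:
  assumes X: "reals s0 ''X'' = X" "reals s0 ''Y'' = Y"
    and sc: "nats s0 ''a'' 0 = a0" "nats s0 ''c'' 0 = c0" "nats s0 ''m'' 0 = mid"
      "nats s0 ''b'' 0 = b" "nats s0 ''b0'' 0 = b0" "b0 + e < b + s"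
    and lists: "lst (nats s0 ''n'') (nats s0 ''q'') b0 CL" "lst (nats s0 ''n'') (nats s0 ''q'') b0 CR"
    and ac: "a0 \<in> T" "c0 \<in> T" "a0 < c0"
    and tot: "300 * card (T \<inter> {a0<..<c0}) + 310 \<le> Tot"
  shows "runs walk s0 Tot (\<lambda>s'. walk_post b a0 c0 (nats s0 ''n'') (nats s0 ''q'')
           (nats s' ''a'' 0) (nats s' ''c'' 0) (nats s' ''n'') (nats s' ''q''))"
  unfolding walk_def
proof (rule runs_Seq[where ?Q1.0 = "\<lambda>s'. s' = nupd ''done'' 0 0 s0" and ?T1.0 = 3])
  show "runs (''done'' ::= NLit 0) s0 3 (\<lambda>s'. s' = nupd ''done'' 0 0 s0)"
    by (simp add: runs_def wp_simps)
  show "3 + (300 * card (T \<inter> {a0<..<c0}) + 307) \<le> Tot" using tot by simp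
  fix s1 assume s1: "s1 = nupd ''done'' 0 0 s0"
  let ?n = "nats s0 ''n''" and ?q = "nats s0 ''q''"
  let ?W = "\<lambda>P s'. P b a0 c0 ?n ?q (nats s' ''a'' 0) (nats s' ''c'' 0) (nats s' ''n'') (nats s' ''q'')"
  have finT: "finite T" using finite_subset[OF UH_sub finite_TT] .
  show "runs (While (NLess (NV ''done'') (NLit 1)) walk_body) s1 (300 * card (T \<inter> {a0<..<c0}) + 307) (?W walk_post)"
  proof (rule runs_While[where I = "\<lambda>s'. if nats s' ''done'' 0 = 0 then ?W walk_inv s' else ?W walk_post s'"
        \<comment> \<open>A step with its guard costs at most 300. The additional 300 pay for the
          final step, which only links \<open>a\<close> to \<open>c\<close>.\<close>
        and \<mu> = "\<lambda>s'. if nats s' ''done'' 0 = 0 then 300 * card (T \<inter> {nats s' ''a'' 0<..<nats s' ''c'' 0}) + 300 else 0"])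
    show "if nats s1 ''done'' 0 = 0 then ?W walk_inv s1 else ?W walk_post s1"
      using ac s1 sc by (auto simp: walk_inv_def cons_def)
    fix s2 assume I: "if nats s2 ''done'' 0 = 0 then ?W walk_inv s2 else ?W walk_post s2"
      and ag: "agree walk_body s1 s2"
    show "?W walk_post s2" if "\<not> bval (NLess (NV ''done'') (NLit 1)) s2" using I that by auto
    assume "bval (NLess (NV ''done'') (NLit 1)) s2"
    then have d: "nats s2 ''done'' 0 = 0" by simp
    then have Iv: "?W walk_inv s2" using I by simp
    define a c x y where "a = nats s2 ''a'' 0" and "c = nats s2 ''c'' 0"
      and "x = nats s2 ''n'' (b0 + a)" and "y = nats s2 ''q'' (b0 + c)"
    have Iv': "walk_inv b a0 c0 ?n ?q a c (nats s2 ''n'') (nats s2 ''q'')" using Iv by (simp add: a_def c_def)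
    then have aT: "a \<in> T" "c \<in> T" "a < c" by (auto simp: walk_inv_def)
    have fr: "nats s2 ''b'' 0 = b" "nats s2 ''b0'' 0 = b0" "nats s2 ''m'' 0 = mid"
      "reals s2 ''X'' = X" "reals s2 ''Y'' = Y"
      using agreeN[OF ag] agreeR[OF ag] sc X by (simp_all add: s1)
    have rng: "s \<le> a0" "s \<le> a" "c \<le> e" using tt_range T_tt ac aT by auto
    \<comment> \<open>The cells of the halves have smaller addresses than all cells written, so the
      walk still reads their original contents.\<close>
    have old: "nats s2 ''n'' (b0 + i) = ?n (b0 + i)" "nats s2 ''q'' (b0 + i) = ?q (b0 + i)" if "i \<le> e" for i
    proof -
      have "b0 + i < b + a0" using that sc(6) rng by linarith
      then show "nats s2 ''n'' (b0 + i) = ?n (b0 + i)" "nats s2 ''q'' (b0 + i) = ?q (b0 + i)"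
        using Iv' unfolding walk_inv_def by auto
    qed
    obtain x' where x': "child a x'" using child_succ[of a] aT rng by (meson less_le_trans)
    obtain y' where y': "child y' c" using child_pred[of c] aT rng by (meson le_less_trans)
    have "?n (b0 + a) = x'" using x' lists unfolding child_def lst_def by blast
    then have x: "child a x" using old(1)[of a] aT rng x' by (simp add: x_def)
    have "?q (b0 + c) = y'" using y' lists unfolding child_def lst_def by blast
    then have y: "child y c" using old(2)[of c] aT rng y' by (simp add: y_def)
    let ?P = "\<lambda>s''. (if nats s'' ''done'' 0 = 0 then ?W walk_inv s'' else ?W walk_post s'') \<and>
      (if nats s'' ''done'' 0 = 0 then 300 * card (T \<inter> {nats s'' ''a'' 0<..<nats s'' ''c'' 0}) + 300 else 0) + 300
      \<le> (if nats s2 ''done'' 0 = 0 then 300 * card (T \<inter> {nats s2 ''a'' 0<..<nats s2 ''c'' 0}) + 300 else 0)"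
    have bx: "bval (upE ''x'') (nupd ''y'' 0 y (nupd ''x'' 0 x s2)) \<longleftrightarrow> 0 < h a c x"
      and "by": "bval (upE ''y'') (nupd ''y'' 0 y (nupd ''x'' 0 x s2)) \<longleftrightarrow> 0 < h a c y"
      and bl: "rval (lnE ''a'' ''x'' ''m'') (nupd ''y'' 0 y (nupd ''x'' 0 x s2)) = lnv X Y a x (X mid)"
         "rval (lnE ''y'' ''c'' ''m'') (nupd ''y'' 0 y (nupd ''x'' 0 x s2)) = lnv X Y y c (X mid)"
      by (simp_all add: upE_def oriE_val lnE_val fr a_def c_def)
    have "runs walk_body s2 280 ?P"
    proof (cases "0 < h a c x \<and> \<not> (0 < h a c y \<and> lnv X Y a x (X mid) < lnv X Y y c (X mid))")
      case True
      then have "x \<in> T" using advance_left[OF aT x y] by auto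
      have cx: "cons T a x" using child_is_cons[OF aT x \<open>x \<in> T\<close>] .
      have xc: "x < c" "a < mid \<Longrightarrow> x < mid" using x_up[OF aT x y] True by auto
      have J: "walk_inv b a0 c0 ?n ?q x c ((nats s2 ''n'')(b + a := x)) ((nats s2 ''q'')(b + x := a))"
        using inv_advance_left[OF Iv' \<open>x \<in> T\<close> cx xc] .
      have "T \<inter> {x<..<c} \<subset> T \<inter> {a<..<c}" using cx xc \<open>x \<in> T\<close> by (auto simp: cons_def)
      then have "card (T \<inter> {x<..<c}) < card (T \<inter> {a<..<c})" using finT by (intro psubset_card_mono) auto
      then have K: "300 * card (T \<inter> {x<..<c}) + 300 + 300 \<le> 300 * card (T \<inter> {a<..<c}) + 300" by simp
      show ?thesis unfolding runs_def walk_body_def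
        using True J K d
        by (simp add: wp_simps bx "by" bl link_def fr d E_cost a_def[symmetric] c_def[symmetric] x_def[symmetric] y_def[symmetric])
    next
      case False
      note F1 = False
      show ?thesis
      proof (cases "0 < h a c y")
        case True
        then have "y \<in> T" using advance_right[OF aT x y] F1 by force
        have yc: "a < y" "mid < c \<Longrightarrow> mid < y" using y_up[OF aT x y] True by auto
        have cy: "cons T y c"
        proof -
          have "\<not> (y < k \<and> k < c)" if k: "k \<in> T" for k
          proof
            assume ak: "y < k \<and> k < c"
            from y[unfolded child_def] show False
            proof
              assume L: "cons CL y c"
              then have "k < mid" using consL[OF L] ak by auto
              then show False using T_left[OF k] L ak by (auto simp: cons_def)
            next
              assume R: "cons CR y c"
              then have "mid < k" using consR[OF R] ak by auto
              then show False using T_right[OF k] R ak by (auto simp: cons_def)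
            qed
          qed
          then show ?thesis using \<open>y \<in> T\<close> aT child_supports(1)[OF y] by (auto simp: cons_def)
        qed
        have J: "walk_inv b a0 c0 ?n ?q a y ((nats s2 ''n'')(b + y := c)) ((nats s2 ''q'')(b + c := y))"
          using inv_advance_right[OF Iv' \<open>y \<in> T\<close> cy yc] .
        have "T \<inter> {a<..<y} \<subset> T \<inter> {a<..<c}" using cy yc \<open>y \<in> T\<close> by (auto simp: cons_def)
        then have "card (T \<inter> {a<..<y}) < card (T \<inter> {a<..<c})" using finT by (intro psubset_card_mono) auto
        then have K: "300 * card (T \<inter> {a<..<y}) + 300 + 300 \<le> 300 * card (T \<inter> {a<..<c}) + 300" by simp
        show ?thesis unfolding runs_def walk_body_def
          using True F1 J K d
          by (auto simp: wp_simps bx "by" bl link_def fr d E_cost a_def[symmetric] c_def[symmetric] x_def[symmetric] y_def[symmetric])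
      next
        case False
        then have cx: "cons T a c" using finish[OF aT x y] F1 by force
        have J: "walk_post b a0 c0 ?n ?q a c ((nats s2 ''n'')(b + a := c)) ((nats s2 ''q'')(b + c := a))"
          using inv_finish[OF Iv' cx] .
        show ?thesis unfolding runs_def walk_body_def
          using False F1 J d
          by (simp add: wp_simps bx "by" bl link_def fr d E_cost a_def[symmetric] c_def[symmetric] x_def[symmetric] y_def[symmetric])
      qed
    qed
    then show "\<exists>Ta. runs walk_body s2 Ta (\<lambda>s''.
        (if nats s'' ''done'' 0 = 0 then ?W walk_inv s'' else ?W walk_post s'') \<and>
        1 + bcost (NLess (NV ''done'') (NLit 1)) + Ta +
        (if nats s'' ''done'' 0 = 0 then 300 * card (T \<inter> {nats s'' ''a'' 0<..<nats s'' ''c'' 0}) + 300 else 0)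
        \<le> (if nats s2 ''done'' 0 = 0 then 300 * card (T \<inter> {nats s2 ''a'' 0<..<nats s2 ''c'' 0}) + 300 else 0))"
      by (intro exI[of _ 280]) (erule runs_conseq, auto)
  qed (use s1 sc in auto)
qed

end

section \<open>Deletions in the hierarchy of hulls\<close>

text \<open>The width of a block in indices. A leaf has width 2: a sentinel at each even end and
  room for one point at the odd index between.\<close>

definition wd :: "nat \<Rightarrow> nat" where "wd \<delta> = 2 ^ (\<delta> + 1)"

lemma wd_simps: "wd 0 = 2" "wd (Suc \<delta>) = 2 * wd \<delta>" "0 < wd \<delta>" "even (wd \<delta>)"
  by (simp_all add: wd_def)

locale lev = plane +
  fixes D :: nat
  assumes Gdef: "G = {g. even g \<and> g \<le> wd D}" and Sodd: "S \<subseteq> {i. odd i \<and> i < wd D}"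
begin

definition W :: nat where "W = wd D + 1"

text \<open>The lists of all blocks of a level lie in a stretch of \<open>W\<close> cells, one for
  each index from 0 to \<open>wd D\<close>.\<close>

definition levelok :: "(nat \<Rightarrow> nat) \<Rightarrow> (nat \<Rightarrow> nat) \<Rightarrow> nat set \<Rightarrow> nat \<Rightarrow> bool" where
  "levelok n q A \<delta> \<longleftrightarrow> (\<forall>k < 2 ^ (D - \<delta>). lst n q (\<delta> * W) (hl A (k * wd \<delta>) (Suc k * wd \<delta>)))"

text \<open>The machine can only add and subtract naturals, so the middle of the block around each
  index is tabulated for every level.\<close>

definition gok :: "(nat \<Rightarrow> nat) \<Rightarrow> nat \<Rightarrow> bool" where
  "gok g \<delta> \<longleftrightarrow> (\<forall>k < 2 ^ (D - \<delta>). \<forall>i. k * wd \<delta> < i \<and> i < Suc k * wd \<delta> \<longrightarrow> g (\<delta> * W + i) = k * wd \<delta> + 2 ^ \<delta>)"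

definition onh :: "nat \<Rightarrow> nat set \<Rightarrow> nat set" where
  "onh \<delta> A = {j \<in> A. j \<in> hl A (j div wd \<delta> * wd \<delta>) (Suc (j div wd \<delta>) * wd \<delta>)}"

text \<open>The potential of a level: points that are not vertices of the hull of their own block. A
  deletion never turns a remaining vertex into a non-vertex.\<close>

definition pot :: "nat \<Rightarrow> nat set \<Rightarrow> nat" where "pot \<delta> A = card (A - onh \<delta> A)"

lemma wd_total: "\<delta> \<le> D \<Longrightarrow> 2 ^ (D - \<delta>) * wd \<delta> = wd D"
  by (simp add: wd_def flip: power_add)

lemma block_le: "\<delta> \<le> D \<Longrightarrow> k < 2 ^ (D - \<delta>) \<Longrightarrow> Suc k * wd \<delta> \<le> wd D"
  using wd_total[of \<delta>] by (metis Suc_leI mult_le_mono1)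

lemma finS: "finite S"
  using Sodd by (rule finite_subset) auto

lemma gap_block: "\<delta> \<le> D \<Longrightarrow> k \<le> 2 ^ (D - \<delta>) \<Longrightarrow> k * wd \<delta> \<in> G"
  using wd_total[of \<delta>] wd_simps(4)[of \<delta>] unfolding Gdef by (auto intro: mult_le_mono1 order_trans)

lemma odd_in_block:
  assumes "odd i" "i < wd D" "\<delta> \<le> D"
  shows "i div wd \<delta> < 2 ^ (D - \<delta>)" "i div wd \<delta> * wd \<delta> < i" "i < Suc (i div wd \<delta>) * wd \<delta>"
proof -
  show "i div wd \<delta> < 2 ^ (D - \<delta>)"
    using assms(2) wd_total[OF assms(3)] by (simp add: less_mult_imp_div_less)
  have "i div wd \<delta> * wd \<delta> \<le> i" by simp
  moreover have "i div wd \<delta> * wd \<delta> \<noteq> i" using assms(1) wd_simps(4)[of \<delta>] by (metis even_mult_iff)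
  ultimately show "i div wd \<delta> * wd \<delta> < i" by (rule le_neq_implies_less)
  show "i < Suc (i div wd \<delta>) * wd \<delta>" using wd_simps(3)[of \<delta>]
    by (metis dividend_less_div_times mult_Suc add.commute)
qed

lemma block_unique:
  assumes "k * wd \<delta> < i" "i < Suc k * wd \<delta>" shows "i div wd \<delta> = k"
  using assms by (intro div_nat_eqI) (auto simp: mult.commute)

lemma other_block:
  assumes "k \<noteq> k'" shows "Suc k' * wd \<delta> \<le> k * wd \<delta> \<or> Suc k * wd \<delta> \<le> k' * wd \<delta>"
  using assms by (metis Suc_leI linorder_neqE_nat mult_le_mono1)

lemma levelok_cong:
  assumes "levelok n q A \<delta>" "\<delta> \<le> D" "\<And>z. z \<le> wd D \<Longrightarrow> n' (\<delta> * W + z) = n (\<delta> * W + z)"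
    "\<And>z. z \<le> wd D \<Longrightarrow> q' (\<delta> * W + z) = q (\<delta> * W + z)"
  shows "levelok n' q' A \<delta>"
  unfolding levelok_def lst_def
proof (intro allI impI)
  fix k i j assume k: "k < 2 ^ (D - \<delta>)" and c: "cons (hl A (k * wd \<delta>) (Suc k * wd \<delta>)) i j"
  have "j \<in> TT A (k * wd \<delta>) (Suc k * wd \<delta>)" "i < j" using c UH_sub by (auto simp: cons_def)
  then have "j \<le> Suc k * wd \<delta>" "i < j" by (auto simp: TT_def)
  then have "i \<le> wd D" "j \<le> wd D" using block_le[OF assms(2) k] by auto
  then show "n' (\<delta> * W + i) = j \<and> q' (\<delta> * W + j) = i"
    using assms k c unfolding levelok_def lst_def by auto
qed

lemma merge_block:
  assumes "1 \<le> \<delta>" "\<delta> \<le> D" "k < 2 ^ (D - \<delta>)" "A \<subseteq> S"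
  shows "merge X Y G S H A (k * wd \<delta>) (k * wd \<delta> + 2 ^ \<delta>) (Suc k * wd \<delta>)"
proof -
  obtain d where d: "\<delta> = Suc d" using assms(1) by (cases \<delta>) auto
  have "2 ^ (D - d) = (2::nat) * 2 ^ (D - \<delta>)" using assms(2) d
    by (metis Suc_diff_Suc Suc_le_lessD power_Suc)
  then have "(2 * k + 1) * wd d \<in> G" using gap_block[of d "2 * k + 1"] assms d by auto
  moreover have "(2 * k + 1) * wd d = k * wd \<delta> + 2 ^ \<delta>" by (simp add: d wd_def algebra_simps)
  moreover have "k * wd \<delta> \<in> G" "Suc k * wd \<delta> \<in> G" 
    using gap_block[of \<delta> k] gap_block[of \<delta> "Suc k"] assms Suc_leI[OF assms(3)] by simp_all
  moreover have "k * wd \<delta> < k * wd \<delta> + 2 ^ \<delta>" "k * wd \<delta> + 2 ^ \<delta> < Suc k * wd \<delta>" by (auto simp: wd_def)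
  ultimately show ?thesis using assms(4) by unfold_locales auto
qed

lemma child_lists:
  assumes "1 \<le> \<delta>" "\<delta> \<le> D" "k < 2 ^ (D - \<delta>)" "levelok n q A (\<delta> - 1)"
  shows "lst n q ((\<delta> - 1) * W) (hl A (k * wd \<delta>) (k * wd \<delta> + 2 ^ \<delta>))"
    "lst n q ((\<delta> - 1) * W) (hl A (k * wd \<delta> + 2 ^ \<delta>) (Suc k * wd \<delta>))"
proof -
  obtain d where d: "\<delta> = Suc d" using assms(1) by (cases \<delta>) auto
  \<comment> \<open>The halves of block \<open>k\<close> are the blocks \<open>2 * k\<close> and
    \<open>2 * k + 1\<close> one level below.\<close>
  have e: "k * wd \<delta> = 2 * k * wd d" "k * wd \<delta> + 2 ^ \<delta> = Suc (2 * k) * wd d" "Suc k * wd \<delta> = Suc (Suc (2 * k)) * wd d"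
    by (simp_all add: d wd_def algebra_simps)
  have "2 ^ (D - d) = (2::nat) * 2 ^ (D - \<delta>)" using assms(2) d
    by (metis Suc_diff_Suc Suc_le_lessD power_Suc)
  then have "2 * k < 2 ^ (D - d)" "Suc (2 * k) < 2 ^ (D - d)" using assms(3) by auto
  then have "lst n q (d * W) (hl A (2 * k * wd d) (Suc (2 * k) * wd d))"
    "lst n q (d * W) (hl A (Suc (2 * k) * wd d) (Suc (Suc (2 * k)) * wd d))"
    using assms(4) unfolding levelok_def d diff_Suc_1 by blast+
  moreover have "\<delta> - 1 = d" using d by simp
  ultimately show "lst n q ((\<delta> - 1) * W) (hl A (k * wd \<delta>) (k * wd \<delta> + 2 ^ \<delta>))"
    "lst n q ((\<delta> - 1) * W) (hl A (k * wd \<delta> + 2 ^ \<delta>) (Suc k * wd \<delta>))"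
    unfolding e(2) by (simp_all only: e(1,3))
qed

lemma hl_delete_keeps: "odd i \<Longrightarrow> even s \<Longrightarrow> even e \<Longrightarrow> hl A s e - {i} \<subseteq> hl (A - {i}) s e"
  using TT_delete[of i s e A] delete_keeps[of "TT A s e" i] by (metis)

text \<open>The vertices that appear between \<open>a\<close> and \<open>c\<close> were off the hull
  before, because \<open>a\<close>, \<open>i\<close>, \<open>c\<close> were consecutive. They and
  the points that are still off the hull are disjoint parts of the old off-hull set.\<close>

lemma pot_delete:
  assumes A: "A \<subseteq> S" "i \<in> A" and d: "\<delta> \<le> D" and k: "k = i div wd \<delta>"
    and a: "cons (hl A (k * wd \<delta>) (Suc k * wd \<delta>)) a i" "cons (hl A (k * wd \<delta>) (Suc k * wd \<delta>)) i c"
  shows "card (hl (A - {i}) (k * wd \<delta>) (Suc k * wd \<delta>) \<inter> {a<..<c}) + pot \<delta> (A - {i}) \<le> pot \<delta> A"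
proof -
  let ?E = "hl (A - {i}) (k * wd \<delta>) (Suc k * wd \<delta>) \<inter> {a<..<c}"
  have i: "odd i" "i < wd D" using A Sodd by auto
  have fin: "finite A" using A finS finite_subset by blast
  have E1: "j \<in> A - {i} \<and> j div wd \<delta> = k" if "j \<in> ?E" for j
  proof -
    have "j \<in> TT (A - {i}) (k * wd \<delta>) (Suc k * wd \<delta>)" "a < j" "j < c" using that UH_sub by auto
    moreover have "k * wd \<delta> \<le> a" "c \<le> Suc k * wd \<delta>"
    proof -
      have "a \<in> TT A (k * wd \<delta>) (Suc k * wd \<delta>)" "c \<in> TT A (k * wd \<delta>) (Suc k * wd \<delta>)"
        using a UH_sub by (auto simp: cons_def)
      then show "k * wd \<delta> \<le> a" "c \<le> Suc k * wd \<delta>" using wd_simps(3)[of \<delta>] by (auto simp: TT_def)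
    qed
    ultimately have "j \<in> A - {i}" "k * wd \<delta> < j" "j < Suc k * wd \<delta>" by (auto simp: TT_def)
    then show ?thesis using block_unique by blast
  qed
  have 1: "?E \<subseteq> A - onh \<delta> A"
  proof
    fix j assume j: "j \<in> ?E"
    have "j \<notin> hl A (k * wd \<delta>) (Suc k * wd \<delta>)"
      using a j E1[OF j] unfolding cons_def by (metis DiffE IntD2 greaterThanLessThan_iff insertI1 linorder_neqE_nat)
    then show "j \<in> A - onh \<delta> A" using E1[OF j] by (auto simp: onh_def)
  qed
  have 2: "?E \<inter> (A - {i} - onh \<delta> (A - {i})) = {}"
    using E1 by (auto simp: onh_def)
  have 3: "A - {i} - onh \<delta> (A - {i}) \<subseteq> A - onh \<delta> A"
  proof
    fix j assume j: "j \<in> A - {i} - onh \<delta> (A - {i})"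
    then have "j \<notin> hl A (j div wd \<delta> * wd \<delta>) (Suc (j div wd \<delta>) * wd \<delta>)"
      using hl_delete_keeps[OF i(1), of "j div wd \<delta> * wd \<delta>" "Suc (j div wd \<delta>) * wd \<delta>" A] wd_simps(4)[of \<delta>]
      by (auto simp: onh_def)
    then show "j \<in> A - onh \<delta> A" using j by (auto simp: onh_def)
  qed
  have "card ?E + card (A - {i} - onh \<delta> (A - {i})) = card (?E \<union> (A - {i} - onh \<delta> (A - {i})))"
    using 2 fin finite_subset[OF 1] by (intro card_Un_disjoint[symmetric]) auto
  also have "\<dots> \<le> card (A - onh \<delta> A)" using 1 3 fin by (intro card_mono) auto
  finally show ?thesis by (simp add: pot_def)
qed

text \<open>Index \<open>2 ^ D\<close> is the middle sentinel of the root. Red points will be placed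
  before it and blue points after it.\<close>

definition bridge :: "nat set \<Rightarrow> nat \<Rightarrow> nat \<Rightarrow> bool" where
  "bridge A a c \<longleftrightarrow> cons (hl A 0 (wd D)) a c \<and> a < 2 ^ D \<and> 2 ^ D < c"

end

definition delete_level :: com where
  "delete_level =
    (''b0'' ::= NV ''b'' ;; ''b'' ::= NAdd (NV ''b'') (NV ''W'') ;;
     ''a'' ::= NGet ''q'' (NAdd (NV ''b'') (NV ''i'')) ;;
     ''c'' ::= NGet ''n'' (NAdd (NV ''b'') (NV ''i'')) ;;
     ''m'' ::= NGet ''g'' (NAdd (NV ''b'') (NV ''i'')) ;; walk)"

text \<open>A leaf that contains a point has all three of its indices on its hull, so at level 0
  unlinking is enough. The higher levels are repaired from the bottom up, since each walk reads the
  level below.\<close>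

definition delete_pt :: com where
  "delete_pt =
    (NSet ''n'' (NGet ''q'' (NV ''i'')) (NGet ''n'' (NV ''i'')) ;;
     NSet ''q'' (NGet ''n'' (NV ''i'')) (NGet ''q'' (NV ''i'')) ;;
     ''b'' ::= NLit 0 ;; ''d'' ::= NLit 1 ;;
     For ''d'' (NAdd (NV ''D'') (NLit 1)) delete_level)"

lemma delete_mods [simp]:
  "nmods delete_level = {''b0'', ''b'', ''a'', ''c'', ''m'', ''done'', ''x'', ''y'', ''n'', ''q''}" "rmods delete_level = {}"
  "nmods delete_pt = {''d'', ''b0'', ''b'', ''a'', ''c'', ''m'', ''done'', ''x'', ''y'', ''n'', ''q''}" "rmods delete_pt = {}"
  by (auto simp: delete_level_def delete_pt_def)

context lev begin

lemma base_delete: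
  assumes A: "A \<subseteq> S" "i \<in> A" and ok: "levelok n q A 0"
  shows "levelok (n(q i := n i)) (q(n i := q i)) (A - {i}) 0" "q i = i - 1" "n i = i + 1"
proof -
  have io: "odd i" "i < wd D" using A Sodd by auto
  then obtain j where j: "i = 2 * j + 1" by (metis oddE)
  have jk: "j < 2 ^ D" using io j by (simp add: wd_def)
  let ?T = "hl A (2 * j) (2 * j + 2)"
  have tt: "TT A (2 * j) (2 * j + 2) = {2 * j, i, 2 * j + 2}" using A j by (auto simp: TT_def)
  have g: "2 * j \<in> G" "2 * j + 2 \<in> G" using jk by (auto simp: Gdef wd_def)
  have "0 < h (2 * j) (2 * j + 2) i"
  proof -
    have "X (2 * j) < X (2 * j + 2)" using mono[of "2 * j" "2 * j + 2"] g by simp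
    moreover have "- H < Y i" using A ptY by auto
    ultimately show ?thesis unfolding ori_def using gapY g by simp
  qed
  then have UHeq: "?T = {2 * j, i, 2 * j + 2}" unfolding UH_def tt using j by auto
  have l: "lst n q 0 ?T" using ok jk unfolding levelok_def wd_simps by (auto simp: mult.commute)
  have "cons ?T (2 * j) i" "cons ?T i (2 * j + 2)" unfolding UHeq cons_def using j by auto
  then have nq: "q i = 2 * j" "n i = 2 * j + 2" using l unfolding lst_def by (metis add_0)+
  then show "q i = i - 1" "n i = i + 1" using j by auto
  show "levelok (n(q i := n i)) (q(n i := q i)) (A - {i}) 0"
    unfolding levelok_def lst_def wd_simps
  proof (intro allI impI)
    fix k x y assume k: "k < 2 ^ (D - 0)" and c: "cons (hl (A - {i}) (k * 2) (Suc k * 2)) x y"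
    have r: "x \<in> TT (A - {i}) (k * 2) (Suc k * 2)" "y \<in> TT (A - {i}) (k * 2) (Suc k * 2)" "x < y"
      using c UH_sub by (auto simp: cons_def)
    show "(n(q i := n i)) (0 * W + x) = y \<and> (q(n i := q i)) (0 * W + y) = x"
    proof (cases "k = j")
      case True
      then have "TT (A - {i}) (k * 2) (Suc k * 2) = {2 * j, 2 * j + 2}" using j by (auto simp: TT_def)
      then have "x = 2 * j" "y = 2 * j + 2" using r by auto
      then show ?thesis using nq by simp
    next
      case False
      have "TT (A - {i}) (k * 2) (Suc k * 2) = TT A (k * 2) (Suc k * 2)" using j False by (auto simp: TT_def)
      then have "n x = y \<and> q y = x" using ok k c unfolding levelok_def lst_def wd_simps by auto
      moreover have "x \<noteq> 2 * j" "y \<noteq> 2 * j + 2" using r False by (auto simp: TT_def)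
      ultimately show ?thesis using nq by simp
    qed
  qed
qed

text \<open>Away from the gap the old links stay valid by \<open>cons_delete\<close>, and in the gap
  the walk has written new ones. Other levels are safe because their address ranges are
  disjoint.\<close>

lemma delete_level_ok:
  assumes A: "A \<subseteq> S" "i \<in> A" and d: "1 \<le> \<delta>" "\<delta> \<le> D" and k: "k = i div wd \<delta>"
    and a: "cons (hl A (k * wd \<delta>) (Suc k * wd \<delta>)) a0 i" "cons (hl A (k * wd \<delta>) (Suc k * wd \<delta>)) i c0"
    and ok: "levelok n q A \<delta>"
    and w: "merge.walk_post X Y (A - {i}) (k * wd \<delta>) (k * wd \<delta> + 2 ^ \<delta>) (Suc k * wd \<delta>) (\<delta> * W) a0 c0 n q a c n' q'"
  shows "levelok n' q' (A - {i}) \<delta>"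
    and "\<And>\<delta>' B. \<delta>' \<le> D \<Longrightarrow> \<delta>' \<noteq> \<delta> \<Longrightarrow> levelok n q B \<delta>' \<Longrightarrow> levelok n' q' B \<delta>'"
proof -
  let ?s = "k * wd \<delta>" and ?e = "Suc k * wd \<delta>"
  have io: "odd i" "i < wd D" using A Sodd by auto
  note ib = odd_in_block[OF io d(2), folded k]
  interpret merge X Y G S H "A - {i}" ?s "?s + 2 ^ \<delta>" ?e
    using merge_block[OF d ib(1)] A by blast
  have tsub: "TT A ?s ?e \<subseteq> G \<union> S" using gaps A by (auto simp: TT_def)
  have del: "TT (A - {i}) ?s ?e = TT A ?s ?e - {i}" using ib by (intro TT_delete) auto
  have itt: "i \<in> TT A ?s ?e" using ib A by (auto simp: TT_def)
  have "a0 \<in> TT A ?s ?e" "c0 \<in> TT A ?s ?e" using a UH_sub by (auto simp: cons_def)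
  then have rng: "?s \<le> a0" "c0 \<le> ?e" using sme by (auto simp: TT_def)
  note w' = w[unfolded walk_post_def]
  have eD: "?e \<le> wd D" using block_le[OF d(2) ib(1)] .
  show "levelok n' q' (A - {i}) \<delta>"
    unfolding levelok_def lst_def
  proof (intro allI impI)
    fix k' x y assume k': "k' < 2 ^ (D - \<delta>)" and c: "cons (hl (A - {i}) (k' * wd \<delta>) (Suc k' * wd \<delta>)) x y"
    show "n' (\<delta> * W + x) = y \<and> q' (\<delta> * W + y) = x"
    proof (cases "k' = k")
      case True
      have c': "cons (UH X Y (TT A ?s ?e - {i})) x y" using c True del by simp
      have xy: "x < y" using c by (simp add: cons_def)
      from cons_delete[OF tsub itt a c'] show ?thesis
      proof
        assume h: "cons (hl A ?s ?e) x y \<and> (y \<le> a0 \<or> c0 \<le> x)"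
        then have "n (\<delta> * W + x) = y \<and> q (\<delta> * W + y) = x" using ok ib(1) unfolding levelok_def lst_def by blast
        then show ?thesis using w' h xy by auto
      next
        assume "a0 \<le> x \<and> y \<le> c0"
        then show ?thesis using w' c True by blast
      qed
    next
      case False
      have "x \<in> TT (A - {i}) (k' * wd \<delta>) (Suc k' * wd \<delta>)" "y \<in> TT (A - {i}) (k' * wd \<delta>) (Suc k' * wd \<delta>)"
        using c UH_sub by (auto simp: cons_def)
      then have xy: "k' * wd \<delta> \<le> x" "x < y" "y \<le> Suc k' * wd \<delta>" using c by (auto simp: TT_def cons_def)
      have "TT (A - {i}) (k' * wd \<delta>) (Suc k' * wd \<delta>) = TT A (k' * wd \<delta>) (Suc k' * wd \<delta>)"
        using ib other_block[OF False, of \<delta>] by (auto simp: TT_def)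
      then have "n (\<delta> * W + x) = y \<and> q (\<delta> * W + y) = x" using ok k' c unfolding levelok_def lst_def by auto
      moreover have "y \<le> a0 \<or> c0 \<le> x" using other_block[OF False, of \<delta>] rng xy by linarith
      ultimately show ?thesis using w' xy by auto
    qed
  qed
  fix \<delta>' B assume dd: "\<delta>' \<le> D" "\<delta>' \<noteq> \<delta>" and o: "levelok n q B \<delta>'"
  show "levelok n' q' B \<delta>'"
  proof (rule levelok_cong[OF o dd(1)])
    fix z assume z: "z \<le> wd D"
    have "\<delta>' * W + z < \<delta> * W + a0 \<or> \<delta> * W + c0 < \<delta>' * W + z"
    proof (cases "\<delta>' < \<delta>")
      case True
      then have "\<delta>' * W + W \<le> \<delta> * W" by (metis Suc_leI mult_le_mono1 mult_Suc add.commute)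
      then show ?thesis using z W_def by linarith
    next
      case False
      then have "\<delta> * W + W \<le> \<delta>' * W" using dd by (metis Suc_leI mult_le_mono1 mult_Suc add.commute linorder_neqE_nat)
      then show ?thesis using eD rng W_def by linarith
    qed
    then show "n' (\<delta>' * W + z) = n (\<delta>' * W + z)" "q' (\<delta>' * W + z) = q (\<delta>' * W + z)"
      using w' by auto
  qed
qed

definition treeok :: "ram \<Rightarrow> nat set \<Rightarrow> bool" where
  "treeok s A \<longleftrightarrow> reals s ''X'' = X \<and> reals s ''Y'' = Y \<and> nats s ''W'' 0 = W \<and> nats s ''D'' 0 = D \<and>
     (\<forall>\<delta>\<le>D. levelok (nats s ''n'') (nats s ''q'') A \<delta>) \<and> (\<forall>\<delta>. 1 \<le> \<delta> \<and> \<delta> \<le> D \<longrightarrow> gok (nats s ''g'') \<delta>)"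

lemma delete_pt_runs:
  assumes A: "A \<subseteq> S" "i \<in> A" and t: "treeok s0 A" and i: "nats s0 ''i'' 0 = i"
    and root: "cons (hl A 0 (wd D)) a1 i" "cons (hl A 0 (wd D)) i c1" "a1 < 2 ^ D" "2 ^ D < c1" and D: "1 \<le> D"
    and Tot: "(\<Sum>\<delta>=1..<Suc D. 300 * (pot \<delta> A - pot \<delta> (A - {i})) + 400) + 50 \<le> Tot"
  shows "runs delete_pt s0 Tot (\<lambda>s'. treeok s' (A - {i}) \<and> bridge (A - {i}) (nats s' ''a'' 0) (nats s' ''c'' 0))"
proof -
  have io: "odd i" "i < wd D" using A Sodd by auto
  let ?A = "A - {i}"
  let ?n = "nats s0 ''n''" and ?q = "nats s0 ''q''"
  have lev: "levelok ?n ?q A \<delta>" if "\<delta> \<le> D" for \<delta> using t that by (simp add: treeok_def)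
  note b0 = base_delete[OF A lev[of 0, simplified]]
  have im: "i - 1 \<noteq> i" using io by (cases i) auto
  define s1 where "s1 = nupd ''d'' 0 1 (nupd ''b'' 0 0 (nupd ''q'' (?n i) (?q i) (nupd ''n'' (?q i) (?n i) s0)))"
  have "runs (NSet ''n'' (NGet ''q'' (NV ''i'')) (NGet ''n'' (NV ''i'')) ;;
     NSet ''q'' (NGet ''n'' (NV ''i'')) (NGet ''q'' (NV ''i'')) ;;
     ''b'' ::= NLit 0 ;; ''d'' ::= NLit 1) s0 24 (\<lambda>s'. s' = s1)"
    unfolding runs_def s1_def using im i b0 by (simp add: wp_simps)
  note R1 = this
  \<comment> \<open>Levels below \<open>d\<close> already describe the smaller set, levels from
    \<open>d\<close> on still the old one.\<close>
  define I where "I = (\<lambda>d (s :: ram). nats s ''b'' 0 = (d - 1) * W \<and>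
      (\<forall>\<delta><d. \<delta> \<le> D \<longrightarrow> levelok (nats s ''n'') (nats s ''q'') ?A \<delta>) \<and>
      (\<forall>\<delta>\<le>D. d \<le> \<delta> \<longrightarrow> levelok (nats s ''n'') (nats s ''q'') A \<delta>) \<and>
      (d = Suc D \<longrightarrow> bridge ?A (nats s ''a'' 0) (nats s ''c'' 0)))"
  have R2: "runs (For ''d'' (NAdd (NV ''D'') (NLit 1)) delete_level) s1
     ((\<Sum>\<delta>=1..<Suc D. (300 * (pot \<delta> A - pot \<delta> ?A) + 386) + ncost (NAdd (NV ''D'') (NLit 1)) + 10) + 20)
     (\<lambda>s'. I (Suc D) s' \<and> nats s' ''d'' 0 = Suc D)"
  \<comment> \<open>With the 14 that the loop itself costs per round, 386 makes the 400 of the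
    claim.\<close>
  proof (rule runs_For[where T = "\<lambda>\<delta>. 300 * (pot \<delta> A - pot \<delta> ?A) + 386" and lo = 1])
    show "nats s1 ''d'' 0 = 1" "1 \<le> Suc D" by (simp_all add: s1_def)
    show "I 1 s1" unfolding I_def
    proof (intro conjI allI impI)
      show "nats s1 ''b'' 0 = (1 - 1) * W" by (simp add: s1_def)
      show "levelok (nats s1 ''n'') (nats s1 ''q'') ?A \<delta>" if "\<delta> < 1" for \<delta>
        using b0(1) that by (simp add: s1_def)
      show "levelok (nats s1 ''n'') (nats s1 ''q'') A \<delta>" if "\<delta> \<le> D" "1 \<le> \<delta>" for \<delta>
      proof (rule levelok_cong[OF lev[OF that(1)] that(1)])
        fix z
        have "i + 1 < W" using io by (simp add: W_def)
        then have "i + 1 < \<delta> * W + z" using that(2) by (metis le_add1 le_trans less_le_trans mult_le_mono1 mult_1)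
        then show "nats s1 ''n'' (\<delta> * W + z) = ?n (\<delta> * W + z)" "nats s1 ''q'' (\<delta> * W + z) = ?q (\<delta> * W + z)"
          using b0(2,3) by (auto simp: s1_def)
      qed
    qed (use D in auto)
  next
    fix k s' assume "agree (For ''d'' (NAdd (NV ''D'') (NLit 1)) delete_level) s1 s'"
    from agreeN[OF this] show "nval (NAdd (NV ''D'') (NLit 1)) s' = Suc D"
      using t by (simp add: s1_def treeok_def)
  next
    fix d s2 assume I: "I d s2" and ag: "agree (For ''d'' (NAdd (NV ''D'') (NLit 1)) delete_level) s1 s2"
      and d: "1 \<le> d" "d < Suc D" "nats s2 ''d'' 0 = d"
    have dD: "d \<le> D" using d by simp
    let ?k = "i div wd d"
    let ?s = "?k * wd d" and ?e = "Suc ?k * wd d"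
    note ib = odd_in_block[OF io dD]
    interpret merge X Y G S H ?A ?s "?s + 2 ^ d" ?e
      using merge_block[OF d(1) dD ib(1)] A by blast
    \<comment> \<open>Being a vertex of the root, the removed point is by \<open>hull_nested\<close>
      a vertex of its block at this level too. So it has two list neighbours between which the walk
      can run.\<close>
    have "0 \<in> G" "wd D \<in> G" by (auto simp: Gdef wd_simps)
    then have iT: "i \<in> hl A ?s ?e"
      using hull_nested[of 0 ?s ?e "wd D" A i] block_le[OF dD ib(1)] root(1) gaps sme A ib by (auto simp: cons_def)
    have fin: "finite (hl A ?s ?e)" using finite_subset[OF UH_sub finite_TT] .
    obtain a0 where a0: "cons (hl A ?s ?e) a0 i"
      using cons_pred_exists[OF fin iT UH_ends(1)] sme ib by (metis less_trans)
    obtain c0 where c0: "cons (hl A ?s ?e) i c0"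
      using cons_succ_exists[OF fin iT UH_ends(2)] sme ib by (metis less_trans)
    have del: "TT ?A ?s ?e = TT A ?s ?e - {i}" using ib by (intro TT_delete) auto
    have ac: "a0 \<in> hl ?A ?s ?e" "c0 \<in> hl ?A ?s ?e" "a0 < c0"
      using a0 c0 delete_keeps[of "TT A ?s ?e" i] unfolding del cons_def by auto
    have fr: "nats s2 ''W'' 0 = W" "nats s2 ''D'' 0 = D" "reals s2 ''X'' = X" "reals s2 ''Y'' = Y" "nats s2 ''i'' 0 = i"
      "nats s2 ''g'' = nats s0 ''g''"
      using agreeN[OF ag] agreeR[OF ag] t i by (simp_all add: s1_def treeok_def)
    have lA: "levelok (nats s2 ''n'') (nats s2 ''q'') A d" using I dD by (simp add: I_def)
    have lA': "levelok (nats s2 ''n'') (nats s2 ''q'') ?A (d - 1)" using I d by (simp add: I_def)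
    have bd: "(d - 1) * W + W = d * W" using d by (cases d) auto
    have va: "nats s2 ''q'' (d * W + i) = a0" "nats s2 ''n'' (d * W + i) = c0"
      using lA a0 c0 ib(1) unfolding levelok_def lst_def by blast+
    have vm: "nats s0 ''g'' (d * W + i) = ?s + 2 ^ d"
      using t dD d(1) ib unfolding treeok_def gok_def by blast
    define s3 where "s3 = nupd ''m'' 0 (?s + 2 ^ d) (nupd ''c'' 0 c0 (nupd ''a'' 0 a0
        (nupd ''b'' 0 (d * W) (nupd ''b0'' 0 ((d - 1) * W) s2))))"
    have bb: "nats s2 ''b'' 0 = (d - 1) * W" using I by (simp add: I_def)
    have Q1: "runs (''b0'' ::= NV ''b'' ;; ''b'' ::= NAdd (NV ''b'') (NV ''W'') ;;
       ''a'' ::= NGet ''q'' (NAdd (NV ''b'') (NV ''i'')) ;;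
       ''c'' ::= NGet ''n'' (NAdd (NV ''b'') (NV ''i'')) ;;
       ''m'' ::= NGet ''g'' (NAdd (NV ''b'') (NV ''i''))) s2 60 (\<lambda>s'. s' = s3)"
      unfolding runs_def s3_def by (simp add: wp_simps fr bb bd[simplified] va vm)
    have cl: "lst (nats s2 ''n'') (nats s2 ''q'') ((d - 1) * W) CL" "lst (nats s2 ''n'') (nats s2 ''q'') ((d - 1) * W) CR"
      using child_lists[OF d(1) dD ib(1) lA'] by auto
    have W1: "(d - 1) * W + ?e < d * W + ?s"
      using bd block_le[OF dD ib(1)] unfolding W_def by linarith
    let ?E = "card (T \<inter> {a0<..<c0})"
    have Q2: "runs walk s3 (300 * ?E + 310) (\<lambda>s'. walk_post (d * W) a0 c0 (nats s3 ''n'') (nats s3 ''q'')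
           (nats s' ''a'' 0) (nats s' ''c'' 0) (nats s' ''n'') (nats s' ''q''))"
      by (rule walk_runs[where ?b0.0 = "(d - 1) * W"]) (use cl ac W1 fr in \<open>simp_all add: s3_def\<close>)
    have E: "?E + pot d ?A \<le> pot d A" using pot_delete[OF A dD refl a0 c0] .
    have "runs delete_level s2 (300 * (pot d A - pot d ?A) + 386)
        (\<lambda>s'. nats s' ''d'' 0 = d \<and> I (Suc d) (nupd ''d'' 0 (Suc d) s'))"
    proof -
      have "runs ((''b0'' ::= NV ''b'' ;; ''b'' ::= NAdd (NV ''b'') (NV ''W'') ;;
       ''a'' ::= NGet ''q'' (NAdd (NV ''b'') (NV ''i'')) ;;
       ''c'' ::= NGet ''n'' (NAdd (NV ''b'') (NV ''i'')) ;;
       ''m'' ::= NGet ''g'' (NAdd (NV ''b'') (NV ''i''))) ;; walk) s2 (300 * (pot d A - pot d ?A) + 386)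
        (\<lambda>s'. nats s' ''d'' 0 = d \<and> I (Suc d) (nupd ''d'' 0 (Suc d) s'))"
      proof (rule runs_Seq[OF Q1])
        show "60 + (300 * ?E + 310) \<le> 300 * (pot d A - pot d ?A) + 386" using E by auto
        fix s' assume "s' = s3"
        show "runs walk s' (300 * ?E + 310) (\<lambda>s'. nats s' ''d'' 0 = d \<and> I (Suc d) (nupd ''d'' 0 (Suc d) s'))"
          unfolding \<open>s' = s3\<close>
        proof (rule runs_conseq[OF runs_agree[OF Q2]])
          fix s4 assume s4: "walk_post (d * W) a0 c0 (nats s3 ''n'') (nats s3 ''q'')
           (nats s4 ''a'' 0) (nats s4 ''c'' 0) (nats s4 ''n'') (nats s4 ''q'') \<and> agree walk s3 s4"
          have w4: "walk_post (d * W) a0 c0 (nats s2 ''n'') (nats s2 ''q'')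
            (nats s4 ''a'' 0) (nats s4 ''c'' 0) (nats s4 ''n'') (nats s4 ''q'')" using s4 by (simp add: s3_def)
          have n4: "nats s4 ''d'' 0 = d" "nats s4 ''b'' 0 = d * W"
            using agreeN[OF conjunct2[OF s4]] d(3) by (simp_all add: s3_def)
          note L = delete_level_ok[OF A d(1) dD refl a0 c0 lA w4]
          \<comment> \<open>At the top the block is the whole range. The neighbours of the removed
            point straddle its middle by assumption, so the pair the walk ends with is the new
            bridge.\<close>
          have br: "bridge ?A (nats s4 ''a'' 0) (nats s4 ''c'' 0)" if "d = D"
          proof -
            have "i div wd D = 0" using io by simp
            then have e: "?s = 0" "?e = wd D" using that by auto
            have "a0 = a1" "c0 = c1" using a0 c0 root(1,2) unfolding e cons_def by (metis linorder_neqE_nat)+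
            then show ?thesis using w4[unfolded walk_post_def] root(3,4) that unfolding bridge_def e by auto
          qed
          show "nats s4 ''d'' 0 = d \<and> I (Suc d) (nupd ''d'' 0 (Suc d) s4)"
            unfolding I_def
          proof (intro conjI allI impI)
            fix \<delta> assume "\<delta> < Suc d" "\<delta> \<le> D"
            then show "levelok (nats (nupd ''d'' 0 (Suc d) s4) ''n'') (nats (nupd ''d'' 0 (Suc d) s4) ''q'') ?A \<delta>"
              using L(1) L(2)[of \<delta> ?A] I unfolding I_def by (cases "\<delta> = d") auto
          next
            fix \<delta> assume "\<delta> \<le> D" "Suc d \<le> \<delta>"
            then show "levelok (nats (nupd ''d'' 0 (Suc d) s4) ''n'') (nats (nupd ''d'' 0 (Suc d) s4) ''q'') A \<delta>"
              using L(2)[of \<delta> A] I unfolding I_def by auto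
          qed (use n4 br in auto)
        qed simp
      qed
      then show ?thesis unfolding delete_level_def runs_def by (simp add: wp_simps add.assoc)
    qed
    then show "runs delete_level s2 (300 * (pot d A - pot d ?A) + 386)
        (\<lambda>s'. nats s' ''d'' 0 = d \<and> I (Suc d) (nupd ''d'' 0 (Suc d) s'))" .
  qed simp
  have "runs ((NSet ''n'' (NGet ''q'' (NV ''i'')) (NGet ''n'' (NV ''i'')) ;;
     NSet ''q'' (NGet ''n'' (NV ''i'')) (NGet ''q'' (NV ''i'')) ;;
     ''b'' ::= NLit 0 ;; ''d'' ::= NLit 1) ;; For ''d'' (NAdd (NV ''D'') (NLit 1)) delete_level) s0 Tot
     (\<lambda>s'. treeok s' ?A \<and> bridge ?A (nats s' ''a'' 0) (nats s' ''c'' 0))"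
  proof (rule runs_Seq[OF R1])
    fix s' assume "s' = s1"
    show "runs (For ''d'' (NAdd (NV ''D'') (NLit 1)) delete_level) s'
      ((\<Sum>\<delta>=1..<Suc D. (300 * (pot \<delta> A - pot \<delta> ?A) + 386) + ncost (NAdd (NV ''D'') (NLit 1)) + 10) + 20)
      (\<lambda>s'. treeok s' ?A \<and> bridge ?A (nats s' ''a'' 0) (nats s' ''c'' 0))"
      unfolding \<open>s' = s1\<close>
    proof (rule runs_conseq[OF runs_agree[OF R2]])
      fix s5 assume s5: "(I (Suc D) s5 \<and> nats s5 ''d'' 0 = Suc D) \<and> agree (For ''d'' (NAdd (NV ''D'') (NLit 1)) delete_level) s1 s5"
      then have ag: "agree (For ''d'' (NAdd (NV ''D'') (NLit 1)) delete_level) s1 s5" by simp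
      have "nats s5 ''W'' 0 = W" "nats s5 ''D'' 0 = D" "reals s5 ''X'' = X" "reals s5 ''Y'' = Y" "nats s5 ''g'' = nats s0 ''g''"
        using agreeN[OF ag] agreeR[OF ag] t by (simp_all add: s1_def treeok_def)
      then show "treeok s5 ?A \<and> bridge ?A (nats s5 ''a'' 0) (nats s5 ''c'' 0)"
        using s5 t unfolding I_def treeok_def by auto
    qed simp
  qed (use Tot in \<open>simp add: add.commute add.left_commute\<close>)
  then show ?thesis unfolding delete_pt_def runs_def by (simp add: wp_simps add.assoc)
qed

end

section \<open>Building the hierarchy\<close>

definition build_block :: com where
  "build_block =
    (''m'' ::= NAdd (NV ''s'') (NV ''w'') ;; ''e'' ::= NAdd (NV ''m'') (NV ''w'') ;; ''j'' ::= NV ''s'' ;;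
     For ''j'' (NV ''e'') (NSet ''g'' (NAdd (NV ''b'') (NV ''j'')) (NV ''m'')) ;;
     ''a'' ::= NV ''s'' ;; ''c'' ::= NV ''e'' ;; walk ;; ''s'' ::= NV ''e'')"

text \<open>\<open>w\<close> is half the current block width. Doubling it from level to level gives
  all block boundaries and middles by additions alone.\<close>

definition build_level :: com where
  "build_level =
    (''b0'' ::= NV ''b'' ;; ''b'' ::= NAdd (NV ''b'') (NV ''W'') ;; ''s'' ::= NLit 0 ;;
     While (NLess (NV ''s'') (NV ''E'')) build_block ;; ''w'' ::= NAdd (NV ''w'') (NV ''w''))"

definition build :: com where
  "build = (''b'' ::= NLit 0 ;; ''w'' ::= NLit 2 ;; ''d'' ::= NLit 1 ;;
     For ''d'' (NAdd (NV ''D'') (NLit 1)) build_level)"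

lemma build_mods [simp]:
  "nmods build_block = {''m'', ''e'', ''j'', ''g'', ''a'', ''c'', ''s'', ''done'', ''x'', ''y'', ''n'', ''q''}" "rmods build_block = {}"
  "nmods build_level = {''b0'', ''b'', ''w'', ''m'', ''e'', ''j'', ''g'', ''a'', ''c'', ''s'', ''done'', ''x'', ''y'', ''n'', ''q''}"
  "rmods build_level = {}"
  "nmods build = {''d'', ''b0'', ''b'', ''w'', ''m'', ''e'', ''j'', ''g'', ''a'', ''c'', ''s'', ''done'', ''x'', ''y'', ''n'', ''q''}"
  "rmods build = {}"
  by (auto simp: build_block_def build_level_def build_def)

context lev begin

lemma block_addr:
  assumes "\<delta> \<le> D" "k < 2 ^ (D - \<delta>)" "cons (hl A (k * wd \<delta>) (Suc k * wd \<delta>)) x y"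
  shows "k * wd \<delta> \<le> x" "x < y" "y \<le> Suc k * wd \<delta>"
proof -
  have "x \<in> TT A (k * wd \<delta>) (Suc k * wd \<delta>)" "y \<in> TT A (k * wd \<delta>) (Suc k * wd \<delta>)" "x < y"
    using assms(3) UH_sub by (auto simp: cons_def)
  then show "k * wd \<delta> \<le> x" "x < y" "y \<le> Suc k * wd \<delta>" by (auto simp: TT_def)
qed

text \<open>The first \<open>k\<close> blocks of level \<open>d\<close> are finished. The last
  clause remembers the pair with which the latest walk ended; at the top level, which has one block,
  it is the initial bridge.\<close>

definition partlevel :: "nat \<Rightarrow> nat \<Rightarrow> ram \<Rightarrow> bool" where
  "partlevel d k s \<longleftrightarrow> k \<le> 2 ^ (D - d) \<and> nats s ''s'' 0 = k * wd d \<and>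
     (\<forall>\<delta><d. levelok (nats s ''n'') (nats s ''q'') S \<delta>) \<and>
     (\<forall>\<delta><d. 1 \<le> \<delta> \<longrightarrow> gok (nats s ''g'') \<delta>) \<and>
     (\<forall>k'<k. lst (nats s ''n'') (nats s ''q'') (d * W) (hl S (k' * wd d) (Suc k' * wd d))) \<and>
     (\<forall>k'<k. \<forall>i. k' * wd d < i \<and> i < Suc k' * wd d \<longrightarrow> nats s ''g'' (d * W + i) = k' * wd d + 2 ^ d) \<and>
     (\<forall>k'. k = Suc k' \<longrightarrow> cons (hl S (k' * wd d) (Suc k' * wd d)) (nats s ''a'' 0) (nats s ''c'' 0) \<and>
        nats s ''a'' 0 < k' * wd d + 2 ^ d \<and> k' * wd d + 2 ^ d < nats s ''c'' 0)"

lemma build_block_runs: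
  assumes d: "1 \<le> d" "d \<le> D" and k: "k < 2 ^ (D - d)" and I: "partlevel d k s0"
    and sc: "nats s0 ''b'' 0 = d * W" "nats s0 ''b0'' 0 = (d - 1) * W" "nats s0 ''w'' 0 = 2 ^ d"
      "reals s0 ''X'' = X" "reals s0 ''Y'' = Y"
  shows "runs build_block s0 (440 * wd d) (partlevel d (Suc k))"
proof -
  let ?s = "k * wd d" and ?e = "Suc k * wd d"
  interpret merge X Y G S H S ?s "?s + 2 ^ d" ?e using merge_block[OF d k] by blast
  have bd: "(d - 1) * W + W = d * W" using d by (cases d) auto
  \<comment> \<open>At width 4 or more the additive costs of a block are absorbed by a multiple of
    its width.\<close>
  have wd4: "4 \<le> wd d" using d by (cases d) (auto simp: wd_def)
  have we: "?s + 2 ^ d + 2 ^ d = wd d + ?s" by (simp add: wd_def)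
  define s1 where "s1 = nupd ''j'' 0 ?s (nupd ''e'' 0 ?e (nupd ''m'' 0 (?s + 2 ^ d) s0))"
  have ss: "nats s0 ''s'' 0 = ?s" using I by (simp add: partlevel_def)
  let ?F = "For ''j'' (NV ''e'') (NSet ''g'' (NAdd (NV ''b'') (NV ''j'')) (NV ''m''))"
  have R1: "runs (''m'' ::= NAdd (NV ''s'') (NV ''w'') ;; ''e'' ::= NAdd (NV ''m'') (NV ''w'') ;; ''j'' ::= NV ''s'') s0 30 (\<lambda>s'. s' = s1)"
    unfolding runs_def s1_def using ss sc by (simp add: wp_simps we)
  let ?J = "\<lambda>j s. \<forall>z. nats s ''g'' z = (if d * W + ?s \<le> z \<and> z < d * W + j then ?s + 2 ^ d else nats s0 ''g'' z)"
  have R2: "runs ?F s1 (20 * wd d + 10) (\<lambda>s'. ?J ?e s' \<and> nats s' ''j'' 0 = ?e)"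
  proof (rule runs_For[where T = "\<lambda>_. 8" and lo = ?s])
    fix j s' assume "agree ?F s1 s'"
    from agreeN[OF this] show "nval (NV ''e'') s' = ?e" by (simp add: s1_def)
  next
    fix j s' assume J: "?J j s'" and ag: "agree ?F s1 s'" and j: "?s \<le> j" "j < ?e" "nats s' ''j'' 0 = j"
    have fr: "nats s' ''b'' 0 = d * W" "nats s' ''m'' 0 = ?s + 2 ^ d"
      using agreeN[OF ag] sc by (simp_all add: s1_def)
    show "runs (NSet ''g'' (NAdd (NV ''b'') (NV ''j'')) (NV ''m'')) s' 8
      (\<lambda>s''. nats s'' ''j'' 0 = j \<and> ?J (Suc j) (nupd ''j'' 0 (Suc j) s''))"
      unfolding runs_def using J j fr by (auto simp: wp_simps)
  next
    have "(\<Sum>ka = ?s..<?e. 8 + ncost (NV ''e'') + 10) = 20 * wd d" by (simp add: algebra_simps)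
    then show "(\<Sum>ka = ?s..<?e. 8 + ncost (NV ''e'') + 10) + ncost (NV ''e'') + 4 \<le> 20 * wd d + 10" by simp
  qed (use sme in \<open>auto simp: s1_def\<close>)
  have finT: "finite T" using finite_subset[OF UH_sub finite_TT] .
  have "card (T \<inter> {?s<..<?e}) \<le> card {?s<..<?e}" by (intro card_mono) auto
  also have "\<dots> \<le> wd d" by simp
  finally have cT: "card (T \<inter> {?s<..<?e}) \<le> wd d" .
  have seT: "?s \<in> T" "?e \<in> T" using UH_ends sme by (auto intro: less_trans)
  have "runs ((''m'' ::= NAdd (NV ''s'') (NV ''w'') ;; ''e'' ::= NAdd (NV ''m'') (NV ''w'') ;; ''j'' ::= NV ''s'') ;;
     ?F ;; (''a'' ::= NV ''s'' ;; ''c'' ::= NV ''e'') ;; walk ;; ''s'' ::= NV ''e'') s0 (440 * wd d) (partlevel d (Suc k))"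
  proof (rule runs_Seq[OF R1])
    fix s' assume "s' = s1"
    show "runs (?F ;; (''a'' ::= NV ''s'' ;; ''c'' ::= NV ''e'') ;; walk ;; ''s'' ::= NV ''e'') s' (440 * wd d - 30) (partlevel d (Suc k))"
      unfolding \<open>s' = s1\<close>
    proof (rule runs_Seq_agree[OF R2])
      fix s2 assume s2: "?J ?e s2 \<and> nats s2 ''j'' 0 = ?e" and ag2: "agree ?F s1 s2"
      define s3 where "s3 = nupd ''c'' 0 ?e (nupd ''a'' 0 ?s s2)"
      have fr2: "nats s2 ''s'' 0 = ?s" "nats s2 ''e'' 0 = ?e" "nats s2 ''m'' 0 = ?s + 2 ^ d" "nats s2 ''b'' 0 = d * W"
        "nats s2 ''b0'' 0 = (d - 1) * W" "reals s2 ''X'' = X" "reals s2 ''Y'' = Y" "nats s2 ''n'' = nats s0 ''n''" "nats s2 ''q'' = nats s0 ''q''"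
        using agreeN[OF ag2] agreeR[OF ag2] sc ss by (simp_all add: s1_def)
      have R3: "runs (''a'' ::= NV ''s'' ;; ''c'' ::= NV ''e'') s2 10 (\<lambda>s'. s' = s3)"
        unfolding runs_def s3_def by (simp add: wp_simps fr2)
      show "runs ((''a'' ::= NV ''s'' ;; ''c'' ::= NV ''e'') ;; walk ;; ''s'' ::= NV ''e'') s2 (300 * wd d + 330) (partlevel d (Suc k))"
      proof (rule runs_Seq[OF R3])
        fix s' assume "s' = s3"
        have l1: "levelok (nats s0 ''n'') (nats s0 ''q'') S (d - 1)" using I d by (simp add: partlevel_def)
        have W1: "(d - 1) * W + ?e < d * W + ?s" using bd block_le[OF d(2) k] unfolding W_def by linarith
        have R4: "runs walk s3 (300 * wd d + 310) (\<lambda>s'. walk_post (d * W) ?s ?e (nats s3 ''n'') (nats s3 ''q'')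
           (nats s' ''a'' 0) (nats s' ''c'' 0) (nats s' ''n'') (nats s' ''q''))"
        proof (rule walk_runs[where ?b0.0 = "(d - 1) * W"])
          show "300 * card (T \<inter> {?s<..<?e}) + 310 \<le> 300 * wd d + 310" using cT by simp
        qed (use child_lists[OF d k l1] seT W1 sme fr2 in \<open>simp_all add: s3_def\<close>)
        show "runs (walk ;; ''s'' ::= NV ''e'') s' (300 * wd d + 320) (partlevel d (Suc k))"
          unfolding \<open>s' = s3\<close>
        proof (rule runs_Seq_agree[OF R4])
          fix s4 assume w4: "walk_post (d * W) ?s ?e (nats s3 ''n'') (nats s3 ''q'')
            (nats s4 ''a'' 0) (nats s4 ''c'' 0) (nats s4 ''n'') (nats s4 ''q'')" and ag4: "agree walk s3 s4"
          have fr4: "nats s4 ''e'' 0 = ?e" "nats s4 ''g'' = nats s2 ''g''"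
            using agreeN[OF ag4] fr2 by (simp_all add: s3_def)
          have w: "walk_post (d * W) ?s ?e (nats s0 ''n'') (nats s0 ''q'')
            (nats s4 ''a'' 0) (nats s4 ''c'' 0) (nats s4 ''n'') (nats s4 ''q'')" using w4 fr2 by (simp add: s3_def)
          note w' = w[unfolded walk_post_def]
          have low: "\<delta> * W + z < d * W" if "\<delta> < d" "z \<le> wd D" for \<delta> z
          proof -
            have "\<delta> * W + W \<le> d * W" using that by (metis Suc_leI mult_le_mono1 mult_Suc add.commute)
            then show ?thesis using that W_def by linarith
          qed
          have L1: "levelok (nats s4 ''n'') (nats s4 ''q'') S \<delta>" if "\<delta> < d" for \<delta>
          proof (rule levelok_cong[of "nats s0 ''n''" "nats s0 ''q''"])
            fix z assume "z \<le> wd D"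
            then have "\<delta> * W + z < d * W" using low that by simp
            then have "\<delta> * W + z < d * W + ?s" by linarith
            then show "nats s4 ''n'' (\<delta> * W + z) = nats s0 ''n'' (\<delta> * W + z)" "nats s4 ''q'' (\<delta> * W + z) = nats s0 ''q'' (\<delta> * W + z)"
              using w' by auto
          qed (use I that d in \<open>auto simp: partlevel_def\<close>)
          have L2: "gok (nats s4 ''g'') \<delta>" if "\<delta> < d" "1 \<le> \<delta>" for \<delta>
            unfolding gok_def
          proof (intro allI impI)
            fix k' i assume k': "k' < 2 ^ (D - \<delta>)" and i: "k' * wd \<delta> < i \<and> i < Suc k' * wd \<delta>"
            have "i \<le> wd D" using i block_le[of \<delta> k'] k' that d by linarith
            then have "\<delta> * W + i < d * W" using low that by simp
            then have "nats s4 ''g'' (\<delta> * W + i) = nats s0 ''g'' (\<delta> * W + i)" using s2 fr4 by auto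
            then show "nats s4 ''g'' (\<delta> * W + i) = k' * wd \<delta> + 2 ^ \<delta>"
              using I that k' i unfolding partlevel_def gok_def by auto
          qed
          have L3: "lst (nats s4 ''n'') (nats s4 ''q'') (d * W) (hl S (k' * wd d) (Suc k' * wd d))" if "k' < Suc k" for k'
            unfolding lst_def
          proof (intro allI impI)
            fix x y assume c: "cons (hl S (k' * wd d) (Suc k' * wd d)) x y"
            have k'2: "k' < 2 ^ (D - d)" using that k by simp
            note r = block_addr[OF d(2) k'2 c]
            show "nats s4 ''n'' (d * W + x) = y \<and> nats s4 ''q'' (d * W + y) = x"
            proof (cases "k' = k")
              case True
              then show ?thesis using w' c r by blast
            next
              case False
              then have kk: "k' < k" using that by simp
              then have "Suc k' * wd d \<le> k * wd d" by (intro mult_le_mono1) simp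
              then have "y \<le> ?s" using r by linarith
              then have "nats s4 ''n'' (d * W + x) = nats s0 ''n'' (d * W + x)" "nats s4 ''q'' (d * W + y) = nats s0 ''q'' (d * W + y)"
                using w' r by auto
              then show ?thesis using I kk c unfolding partlevel_def lst_def by auto
            qed
          qed
          have L4: "nats s4 ''g'' (d * W + i) = k' * wd d + 2 ^ d" if "k' < Suc k" "k' * wd d < i" "i < Suc k' * wd d" for k' i
          proof (cases "k' = k")
            case True
            then show ?thesis using s2 fr4 that by auto
          next
            case False
            then have kk: "k' < k" using that by simp
            then have "Suc k' * wd d \<le> k * wd d" by (intro mult_le_mono1) simp
            then have "i < ?s" using that by linarith
            then have "nats s4 ''g'' (d * W + i) = nats s0 ''g'' (d * W + i)" using s2 fr4 by auto
            then show ?thesis using I that kk unfolding partlevel_def by auto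
          qed
          have L5: "cons (hl S ?s ?e) (nats s4 ''a'' 0) (nats s4 ''c'' 0)" "nats s4 ''a'' 0 < ?s + 2 ^ d" "?s + 2 ^ d < nats s4 ''c'' 0"
            using w' sme by auto
          show "runs (''s'' ::= NV ''e'') s4 10 (partlevel d (Suc k))"
            unfolding runs_def partlevel_def using L1 L2 L3 L4 L5 k fr4 by (simp add: wp_simps)
        qed simp
      qed simp
    qed (use wd4 in simp)
  qed (use wd4 in simp)
  then show ?thesis unfolding build_block_def runs_def by (simp add: wp_simps add.assoc)
qed

text \<open>A block costs time linear in its width and the widths of a level add up to
  \<open>wd D\<close>, so each level is linear.\<close>

lemma build_runs:
  assumes base: "levelok (nats s0 ''n'') (nats s0 ''q'') S 0" and D: "1 \<le> D"
    and sc: "nats s0 ''W'' 0 = W" "nats s0 ''D'' 0 = D" "nats s0 ''E'' 0 = wd D" "reals s0 ''X'' = X" "reals s0 ''Y'' = Y"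
  shows "runs build s0 (D * (450 * wd D + 100) + 50) (\<lambda>s'. treeok s' S \<and> bridge S (nats s' ''a'' 0) (nats s' ''c'' 0))"
proof -
  define s1 where "s1 = nupd ''d'' 0 1 (nupd ''w'' 0 2 (nupd ''b'' 0 0 s0))"
  let ?F = "For ''d'' (NAdd (NV ''D'') (NLit 1)) build_level"
  define I where "I = (\<lambda>d (s :: ram). nats s ''b'' 0 = (d - 1) * W \<and> nats s ''w'' 0 = 2 ^ d \<and>
      (\<forall>\<delta><d. levelok (nats s ''n'') (nats s ''q'') S \<delta>) \<and>
      (\<forall>\<delta><d. 1 \<le> \<delta> \<longrightarrow> gok (nats s ''g'') \<delta>) \<and>
      (d = Suc D \<longrightarrow> bridge S (nats s ''a'' 0) (nats s ''c'' 0)))"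
  have R1: "runs (''b'' ::= NLit 0 ;; ''w'' ::= NLit 2 ;; ''d'' ::= NLit 1) s0 12 (\<lambda>s'. s' = s1)"
    unfolding runs_def s1_def by (simp add: wp_simps)
  have R2: "runs ?F s1 (D * (450 * wd D + 100) + 30) (\<lambda>s'. I (Suc D) s' \<and> nats s' ''d'' 0 = Suc D)"
  proof (rule runs_For[where T = "\<lambda>_. 450 * wd D + 80" and lo = 1])
    show "I 1 s1" using base D by (simp add: I_def s1_def)
  next
    fix d s' assume "agree ?F s1 s'"
    from agreeN[OF this] show "nval (NAdd (NV ''D'') (NLit 1)) s' = Suc D" using sc by (simp add: s1_def)
  next
    fix d s2 assume I: "I d s2" and ag: "agree ?F s1 s2" and d: "1 \<le> d" "d < Suc D" "nats s2 ''d'' 0 = d"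
    have dD: "d \<le> D" using d by simp
    have bd: "(d - 1) * W + W = d * W" using d by (cases d) auto
    have fr: "nats s2 ''W'' 0 = W" "nats s2 ''E'' 0 = wd D" "reals s2 ''X'' = X" "reals s2 ''Y'' = Y"
      using agreeN[OF ag] agreeR[OF ag] sc by (simp_all add: s1_def)
    define s3 where "s3 = nupd ''s'' 0 0 (nupd ''b'' 0 (d * W) (nupd ''b0'' 0 ((d - 1) * W) s2))"
    have Q1: "runs (''b0'' ::= NV ''b'' ;; ''b'' ::= NAdd (NV ''b'') (NV ''W'') ;; ''s'' ::= NLit 0) s2 20 (\<lambda>s'. s' = s3)"
      unfolding runs_def s3_def using I fr bd[simplified] by (simp add: wp_simps I_def)
    have Q2: "runs (While (NLess (NV ''s'') (NV ''E'')) build_block) s3 (450 * wd D + 20) (partlevel d (2 ^ (D - d)))"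
    proof (rule runs_While[where I = "\<lambda>s. \<exists>k. partlevel d k s" and \<mu> = "\<lambda>s. 450 * (wd D - nats s ''s'' 0)"])
      show "\<exists>k. partlevel d k s3" using I by (intro exI[of _ 0]) (auto simp: partlevel_def I_def s3_def)
      fix s4 assume "\<exists>k. partlevel d k s4" and ag4: "agree build_block s3 s4"
      then obtain k where k: "partlevel d k s4" by blast
      have fr4: "nats s4 ''E'' 0 = wd D" "nats s4 ''b'' 0 = d * W" "nats s4 ''b0'' 0 = (d - 1) * W" "nats s4 ''w'' 0 = 2 ^ d"
        "reals s4 ''X'' = X" "reals s4 ''Y'' = Y"
        using agreeN[OF ag4] agreeR[OF ag4] I fr by (simp_all add: s3_def I_def)
      have sv: "nats s4 ''s'' 0 = k * wd d" and kle: "k \<le> 2 ^ (D - d)" using k by (auto simp: partlevel_def)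
      have iff: "k * wd d < wd D \<longleftrightarrow> k < 2 ^ (D - d)"
        unfolding wd_total[OF dD, symmetric] using wd_simps(3)[of d] by (simp add: mult_less_cancel2)
      show "partlevel d (2 ^ (D - d)) s4" if "\<not> bval (NLess (NV ''s'') (NV ''E'')) s4"
      proof -
        have "k = 2 ^ (D - d)" using that iff kle sv fr4 by simp
        then show ?thesis using k by simp
      qed
      assume "bval (NLess (NV ''s'') (NV ''E'')) s4"
      then have kl: "k < 2 ^ (D - d)" using iff sv fr4 by simp
      show "\<exists>T. runs build_block s4 T (\<lambda>s''. (\<exists>k. partlevel d k s'') \<and>
          1 + bcost (NLess (NV ''s'') (NV ''E'')) + T + 450 * (wd D - nats s'' ''s'' 0) \<le> 450 * (wd D - nats s4 ''s'' 0))"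
      proof (intro exI[of _ "440 * wd d"], rule runs_conseq[OF build_block_runs[OF d(1) dD kl k fr4(2-)]])
        fix s5 assume p5: "partlevel d (Suc k) s5"
        have "nats s5 ''s'' 0 = k * wd d + wd d" using p5 by (simp add: partlevel_def)
        moreover have "k * wd d + wd d \<le> wd D" using block_le[OF dD kl] by simp
        moreover have "2 \<le> wd d" using wd_simps(3,4)[of d] by (cases "wd d = 1") auto
        ultimately show "(\<exists>k. partlevel d k s5) \<and>
          1 + bcost (NLess (NV ''s'') (NV ''E'')) + 440 * wd d + 450 * (wd D - nats s5 ''s'' 0) \<le> 450 * (wd D - nats s4 ''s'' 0)"
          using p5 sv by auto
      qed simp
    qed (use fr in \<open>simp add: s3_def\<close>)
    have "runs ((''b0'' ::= NV ''b'' ;; ''b'' ::= NAdd (NV ''b'') (NV ''W'') ;; ''s'' ::= NLit 0) ;;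
        While (NLess (NV ''s'') (NV ''E'')) build_block ;; ''w'' ::= NAdd (NV ''w'') (NV ''w'')) s2 (450 * wd D + 80)
        (\<lambda>s''. nats s'' ''d'' 0 = d \<and> I (Suc d) (nupd ''d'' 0 (Suc d) s''))"
    proof (rule runs_Seq[OF Q1])
      fix s' assume "s' = s3"
      show "runs (While (NLess (NV ''s'') (NV ''E'')) build_block ;; ''w'' ::= NAdd (NV ''w'') (NV ''w'')) s' (450 * wd D + 50)
        (\<lambda>s''. nats s'' ''d'' 0 = d \<and> I (Suc d) (nupd ''d'' 0 (Suc d) s''))"
        unfolding \<open>s' = s3\<close>
      proof (rule runs_Seq_agree[OF Q2])
        fix s5 assume p: "partlevel d (2 ^ (D - d)) s5" and ag5: "agree (While (NLess (NV ''s'') (NV ''E'')) build_block) s3 s5"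
        have fr5: "nats s5 ''d'' 0 = d" "nats s5 ''w'' 0 = 2 ^ d" "nats s5 ''b'' 0 = d * W"
          using agreeN[OF ag5] d I by (simp_all add: s3_def I_def)
        have l: "levelok (nats s5 ''n'') (nats s5 ''q'') S \<delta>" "1 \<le> \<delta> \<longrightarrow> gok (nats s5 ''g'') \<delta>" if "\<delta> < Suc d" for \<delta>
          using p that unfolding partlevel_def by (cases "\<delta> = d"; auto simp: levelok_def gok_def)+
        have br: "bridge S (nats s5 ''a'' 0) (nats s5 ''c'' 0)" if "d = D"
          using p that unfolding partlevel_def bridge_def by auto
        show "runs (''w'' ::= NAdd (NV ''w'') (NV ''w'')) s5 10 (\<lambda>s''. nats s'' ''d'' 0 = d \<and> I (Suc d) (nupd ''d'' 0 (Suc d) s''))"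
          unfolding runs_def I_def using l br fr5 by (simp add: wp_simps)
      qed simp
    qed simp
    then show "runs build_level s2 (450 * wd D + 80) (\<lambda>s''. nats s'' ''d'' 0 = d \<and> I (Suc d) (nupd ''d'' 0 (Suc d) s''))"
      unfolding build_level_def runs_def by (simp add: wp_simps add.assoc)
  qed (simp_all add: s1_def algebra_simps)
  have "runs ((''b'' ::= NLit 0 ;; ''w'' ::= NLit 2 ;; ''d'' ::= NLit 1) ;; ?F) s0 (D * (450 * wd D + 100) + 50)
     (\<lambda>s'. treeok s' S \<and> bridge S (nats s' ''a'' 0) (nats s' ''c'' 0))"
  proof (rule runs_Seq[OF R1])
    fix s' assume "s' = s1"
    show "runs ?F s' (D * (450 * wd D + 100) + 30) (\<lambda>s'. treeok s' S \<and> bridge S (nats s' ''a'' 0) (nats s' ''c'' 0))"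
      unfolding \<open>s' = s1\<close>
    proof (rule runs_conseq[OF runs_agree[OF R2]])
      fix s5 assume s5: "(I (Suc D) s5 \<and> nats s5 ''d'' 0 = Suc D) \<and> agree ?F s1 s5"
      then have ag: "agree ?F s1 s5" by simp
      have "nats s5 ''W'' 0 = W" "nats s5 ''D'' 0 = D" "reals s5 ''X'' = X" "reals s5 ''Y'' = Y"
        using agreeN[OF ag] agreeR[OF ag] sc by (simp_all add: s1_def)
      then show "treeok s5 S \<and> bridge S (nats s5 ''a'' 0) (nats s5 ''c'' 0)"
        using s5 unfolding I_def treeok_def by auto
    qed simp
  qed simp
  then show ?thesis unfolding build_def runs_def by (simp add: wp_simps add.assoc)
qed

end

section \<open>Tournament sort\<close>

definition lex :: "(nat \<Rightarrow> real) \<Rightarrow> (nat \<Rightarrow> real) \<Rightarrow> nat \<Rightarrow> nat \<Rightarrow> bool" where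
  "lex x y i j \<longleftrightarrow> x i < x j \<or> \<not> x j < x i \<and> y i < y j"

text \<open>The winner of a game. The number \<open>N\<close> marks an empty slot, which loses to
  every real player.\<close>

definition bet :: "nat \<Rightarrow> (nat \<Rightarrow> nat \<Rightarrow> bool) \<Rightarrow> nat \<Rightarrow> nat \<Rightarrow> nat" where
  "bet N ls l r = (if \<not> (l < N \<and> \<not> (r < N \<and> ls r l)) then r else l)"

definition leaves :: "nat \<Rightarrow> nat set \<Rightarrow> (nat \<Rightarrow> nat) \<Rightarrow> bool" where
  "leaves N A T \<longleftrightarrow> (\<forall>i<N. T (N + i) = (if i \<in> A then i else N))"

text \<open>The tree is stored as in a heap: node \<open>v\<close> has the children
  \<open>v + v\<close> and \<open>v + v + 1\<close>, and the leaves begin at \<open>N\<close>, for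
  any \<open>N\<close>. The node \<open>w\<close> is exempt because its result may be out of date;
  \<open>w = 0\<close> exempts nobody, as long as \<open>lo\<close> is positive.\<close>

definition played :: "nat \<Rightarrow> (nat \<Rightarrow> nat \<Rightarrow> bool) \<Rightarrow> nat \<Rightarrow> nat \<Rightarrow> (nat \<Rightarrow> nat) \<Rightarrow> bool" where
  "played N ls w lo T \<longleftrightarrow> (\<forall>v. lo \<le> v \<and> v < N \<and> v \<noteq> w \<longrightarrow> T v = bet N ls (T (v + v)) (T (v + v + 1)))"

locale lex_distinct =
  fixes N :: nat and x y :: "nat \<Rightarrow> real"
  assumes dist: "i < N \<Longrightarrow> j < N \<Longrightarrow> i \<noteq> j \<Longrightarrow> x i \<noteq> x j \<or> y i \<noteq> y j"
begin

abbreviation "ls \<equiv> lex x y"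

lemma ls_trans: "ls i j \<Longrightarrow> ls j k \<Longrightarrow> ls i k"
  by (auto simp: lex_def)

lemma ls_total: "i < N \<Longrightarrow> j < N \<Longrightarrow> i \<noteq> j \<Longrightarrow> ls i j \<or> ls j i"
  using dist[of i j] by (auto simp: lex_def)

text \<open>The order extended by empty slots as greatest elements, so that results can be chained
  from a leaf up to the root.\<close>

definition ble :: "nat \<Rightarrow> nat \<Rightarrow> bool" where
  "ble a b \<longleftrightarrow> N \<le> b \<or> a < N \<and> (a = b \<or> ls a b)"

lemma ble_trans: "ble a b \<Longrightarrow> ble b c \<Longrightarrow> ble a c"
  unfolding ble_def using ls_trans by (meson leD)

lemma bet_ble: "ble (bet N ls l r) l" "ble (bet N ls l r) r"
proof -
  have "l = r \<or> ls l r \<or> ls r l" if "l < N" "r < N" using ls_total that by blast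
  then show "ble (bet N ls l r) l" "ble (bet N ls l r) r" unfolding ble_def bet_def by auto
qed

text \<open>Descending from the root, every node is at least as large as its parent, so the root
  bounds all leaves. Ascending from the leaves, every entry is a remaining player or empty.\<close>

lemma root_least:
  assumes L: "leaves N A T" and P: "played N ls 0 1 T" and A: "A \<subseteq> {..<N}" "A \<noteq> {}"
  shows "T 1 \<in> A" "\<And>j. j \<in> A \<Longrightarrow> j \<noteq> T 1 \<Longrightarrow> ls (T 1) j"
proof -
  have N: "0 < N" using A by auto
  have vals: "T v \<in> insert N A" if "1 \<le> v" "v < 2 * N" for v
    using that
  proof (induction "2 * N - v" arbitrary: v rule: less_induct)
    case less
    show ?case
    proof (cases "v < N")
      case True
      then have "T v = bet N ls (T (v + v)) (T (v + v + 1))" using P less.prems unfolding played_def by auto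
      moreover have "T (v + v) \<in> insert N A" "T (v + v + 1) \<in> insert N A"
        using less.hyps[of "v + v"] less.hyps[of "v + v + 1"] less.prems True by auto
      ultimately show ?thesis by (auto simp: bet_def)
    next
      case False
      then have "T v = (if v - N \<in> A then v - N else N)" using L less.prems unfolding leaves_def
        by (metis add.commute diff_add less_diff_conv2 mult_2 not_less le_add_diff_inverse)
      then show ?thesis by auto
    qed
  qed
  have root: "ble (T 1) (T v)" if "1 \<le> v" "v < 2 * N" for v
    using that
  proof (induction v rule: less_induct)
    case (less v)
    show ?case
    proof (cases "v = 1")
      case True
      then show ?thesis using vals[of 1] A N by (auto simp: ble_def)
    next
      case False
      let ?p = "v div 2"
      have p: "1 \<le> ?p" "?p < N" "?p < v" using less.prems False by auto
      have "T ?p = bet N ls (T (?p + ?p)) (T (?p + ?p + 1))" using P p unfolding played_def by auto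
      moreover have "v = ?p + ?p \<or> v = ?p + ?p + 1" by linarith
      ultimately have "ble (T ?p) (T v)" using bet_ble by metis
      moreover have "ble (T 1) (T ?p)" using less.IH[of ?p] p by auto
      ultimately show ?thesis using ble_trans by blast
    qed
  qed
  have leaf: "ble (T 1) j" if "j \<in> A" for j
    using root[of "N + j"] that A L N unfolding leaves_def by (auto simp: subset_iff)
  obtain j where "j \<in> A" using A by auto
  then have "T 1 < N" using leaf[of j] A by (auto simp: ble_def)
  then show "T 1 \<in> A" using vals[of 1] N by auto
  show "ls (T 1) j" if "j \<in> A" "j \<noteq> T 1" for j using leaf[OF that(1)] that A by (auto simp: ble_def)
qed

end

abbreviation kxE :: "string \<Rightarrow> rexp" where "kxE z \<equiv> RGet ''kx'' (NV z)"
abbreviation kyE :: "string \<Rightarrow> rexp" where "kyE z \<equiv> RGet ''ky'' (NV z)"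

definition lexE :: bexp where
  "lexE = BNot (BAnd (BNot (RLess (kxE ''r'') (kxE ''l''))) (BNot (BAnd (BNot (RLess (kxE ''l'') (kxE ''r''))) (RLess (kyE ''r'') (kyE ''l'')))))"

lemma lexE_val: "bval lexE s \<longleftrightarrow> lex (reals s ''kx'') (reals s ''ky'') (nats s ''r'' 0) (nats s ''l'' 0)"
  by (auto simp: lexE_def lex_def)

lemma lexE_cost: "bcost lexE = 27"
  by (simp add: lexE_def)

definition play :: com where
  "play =
    (''l'' ::= NGet ''t'' (NAdd (NV ''u'') (NV ''u'')) ;;
     ''r'' ::= NGet ''t'' (NAdd (NAdd (NV ''u'') (NV ''u'')) (NLit 1)) ;;
     Cond (BNot (BAnd (NLess (NV ''l'') (NV ''N'')) (BNot (BAnd (NLess (NV ''r'') (NV ''N''))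
         lexE))))
       (NSet ''t'' (NV ''u'') (NV ''r'')) (NSet ''t'' (NV ''u'') (NV ''l'')))"

definition climb :: com where
  "climb = While (NLess (NLit 1) (NV ''u'')) (''u'' ::= NGet ''f'' (NV ''u'') ;; play)"

definition pop :: com where
  "pop = (NSet ''o'' (NV ''z'') (NGet ''t'' (NLit 1)) ;; ''u'' ::= NAdd (NV ''N'') (NGet ''t'' (NLit 1)) ;;
     NSet ''t'' (NV ''u'') (NV ''N'') ;; climb)"

text \<open>The array \<open>f\<close> tabulates the parent of each node, because a node number
  cannot be halved directly. The initial games are played from the last inner node to the root, and
  then the winner is removed \<open>N\<close> times.\<close>

definition sort_pts :: com where
  "sort_pts =
    (''v'' ::= NLit 1 ;;
     For ''v'' (NV ''N'') (NSet ''f'' (NAdd (NV ''v'') (NV ''v'')) (NV ''v'') ;;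
       NSet ''f'' (NAdd (NAdd (NV ''v'') (NV ''v'')) (NLit 1)) (NV ''v'')) ;;
     ''v'' ::= NLit 0 ;;
     For ''v'' (NV ''N'') (NSet ''t'' (NAdd (NV ''N'') (NV ''v'')) (NV ''v'')) ;;
     ''v'' ::= NLit 1 ;;
     For ''v'' (NV ''N'') (''u'' ::= NSub (NV ''N'') (NV ''v'') ;; play) ;;
     ''z'' ::= NLit 0 ;;
     For ''z'' (NV ''N'') pop)"

lemma sort_mods [simp]:
  "nmods play = {''l'', ''r'', ''t''}" "rmods play = {}"
  "nmods climb = {''u'', ''l'', ''r'', ''t''}" "rmods climb = {}"
  "nmods pop = {''o'', ''u'', ''l'', ''r'', ''t''}" "rmods pop = {}"
  "nmods sort_pts = {''v'', ''f'', ''z'', ''o'', ''u'', ''l'', ''r'', ''t''}" "rmods sort_pts = {}"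
  by (auto simp: play_def climb_def pop_def sort_pts_def)

definition sorted_out :: "nat \<Rightarrow> (nat \<Rightarrow> nat \<Rightarrow> bool) \<Rightarrow> (nat \<Rightarrow> nat) \<Rightarrow> bool" where
  "sorted_out N ls ot \<longleftrightarrow> (\<forall>r<N. ot r < N) \<and> (\<forall>r r'. r < r' \<and> r' < N \<longrightarrow> ls (ot r) (ot r'))"

text \<open>Both branches cost the same, which is why the time is an exact constant.\<close>

lemma play_wp:
  "wp play s Q \<longleftrightarrow> (let u = nats s ''u'' 0; l = nats s ''t'' (u + u); r = nats s ''t'' (u + u + 1) in
     Q 65 (nupd ''t'' u (bet (nats s ''N'' 0) (lex (reals s ''kx'') (reals s ''ky'')) l r) (nupd ''r'' 0 r (nupd ''l'' 0 l s))))"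
  unfolding play_def Let_def by (simp add: wp_simps bet_def lexE_val lexE_cost)

context lex_distinct begin

text \<open>Only games on the path from the changed leaf to the root are replayed.
  \<open>floor_log\<close> of the node number is the depth and drops by one per step.\<close>

lemma climb_runs:
  assumes N: "nats s0 ''N'' 0 = N" "reals s0 ''kx'' = x" "reals s0 ''ky'' = y"
    and f: "\<And>v. 2 \<le> v \<Longrightarrow> v < 2 * N \<Longrightarrow> nats s0 ''f'' v = v div 2"
    and L: "leaves N A (nats s0 ''t'')" and P: "played N ls (nats s0 ''u'' 0 div 2) 1 (nats s0 ''t'')"
    and u: "1 \<le> nats s0 ''u'' 0" "nats s0 ''u'' 0 < 2 * N"
  shows "runs climb s0 (100 * floor_log (2 * N) + 10) (\<lambda>s'. leaves N A (nats s' ''t'') \<and> played N ls 0 1 (nats s' ''t''))"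
  unfolding climb_def
proof (rule runs_While[where I = "\<lambda>s. leaves N A (nats s ''t'') \<and> played N ls (nats s ''u'' 0 div 2) 1 (nats s ''t'') \<and>
      1 \<le> nats s ''u'' 0 \<and> nats s ''u'' 0 < 2 * N" and \<mu> = "\<lambda>s. 100 * floor_log (nats s ''u'' 0)"])
  fix s1 assume I: "leaves N A (nats s1 ''t'') \<and> played N ls (nats s1 ''u'' 0 div 2) 1 (nats s1 ''t'') \<and>
      1 \<le> nats s1 ''u'' 0 \<and> nats s1 ''u'' 0 < 2 * N" and ag: "agree (''u'' ::= NGet ''f'' (NV ''u'') ;; play) s0 s1"
  show "leaves N A (nats s1 ''t'') \<and> played N ls 0 1 (nats s1 ''t'')" if "\<not> bval (NLess (NLit 1) (NV ''u'')) s1"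
  proof -
    have "nats s1 ''u'' 0 = 1" using that I by auto
    then have "nats s1 ''u'' 0 div 2 = 0" by simp
    then show ?thesis using I by metis
  qed
  assume "bval (NLess (NLit 1) (NV ''u'')) s1"
  then have u2: "2 \<le> nats s1 ''u'' 0" by simp
  let ?u = "nats s1 ''u'' 0" and ?t = "nats s1 ''t''"
  have fr: "nats s1 ''N'' 0 = N" "reals s1 ''kx'' = x" "reals s1 ''ky'' = y" "nats s1 ''f'' = nats s0 ''f''"
    using agreeN[OF ag] agreeR[OF ag] N by simp_all
  define p where "p = ?u div 2"
  have p: "1 \<le> p" "p < N" using u2 I unfolding p_def by auto
  have fu: "nats s1 ''f'' ?u = p" using f[of ?u] u2 I fr p_def by simp
  have fl: "floor_log ?u = Suc (floor_log p)" unfolding p_def using floor_log_rec[OF u2] .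
  define t' where "t' = ?t(p := bet N ls (?t (p + p)) (?t (p + p + 1)))"
  have "leaves N A t'" using I p unfolding t'_def leaves_def by auto
  \<comment> \<open>The parent of \<open>p\<close> is the only node that reads the entry just
    changed, so it becomes the exempt one.\<close>
  moreover have "played N ls (p div 2) 1 t'"
    unfolding played_def
  proof (intro allI impI)
    fix v assume v: "1 \<le> v \<and> v < N \<and> v \<noteq> p div 2"
    have "v + v \<noteq> p" "v + v + 1 \<noteq> p" using v by auto
    moreover have "p \<noteq> p + p" "p \<noteq> Suc (p + p)" using p by auto
    ultimately show "t' v = bet N ls (t' (v + v)) (t' (v + v + 1))"
      using I v unfolding played_def t'_def p_def[symmetric] by (cases "v = p") auto
  qed
  ultimately show "\<exists>T. runs (''u'' ::= NGet ''f'' (NV ''u'') ;; play) s1 T (\<lambda>s''. (leaves N A (nats s'' ''t'') \<and>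
      played N ls (nats s'' ''u'' 0 div 2) 1 (nats s'' ''t'') \<and> 1 \<le> nats s'' ''u'' 0 \<and> nats s'' ''u'' 0 < 2 * N) \<and>
      1 + bcost (NLess (NLit 1) (NV ''u'')) + T + 100 * floor_log (nats s'' ''u'' 0) \<le> 100 * floor_log (nats s1 ''u'' 0))"
    using p fl by (intro exI[of _ 90]) (simp add: runs_def wp_simps play_wp Let_def fr(1-3) fu t'_def)
next
  have "floor_log (nats s0 ''u'' 0) \<le> floor_log (2 * N)" using u by (intro floor_log_le_iff) auto
  then show "100 * floor_log (nats s0 ''u'' 0) + 1 + bcost (NLess (NLit 1) (NV ''u'')) \<le> 100 * floor_log (2 * N) + 10" by simp
qed (use L P u in auto)

lemma sort_runs:
  assumes N: "nats s0 ''N'' 0 = N" "reals s0 ''kx'' = x" "reals s0 ''ky'' = y" and N1: "1 \<le> N"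
  shows "runs sort_pts s0 (N * (100 * floor_log (2 * N) + 300) + 100) (\<lambda>s'. sorted_out N ls (nats s' ''o''))"
proof -
  let ?F1 = "For ''v'' (NV ''N'') (NSet ''f'' (NAdd (NV ''v'') (NV ''v'')) (NV ''v'') ;;
       NSet ''f'' (NAdd (NAdd (NV ''v'') (NV ''v'')) (NLit 1)) (NV ''v''))"
  let ?F2 = "For ''v'' (NV ''N'') (NSet ''t'' (NAdd (NV ''N'') (NV ''v'')) (NV ''v''))"
  let ?F3 = "For ''v'' (NV ''N'') (''u'' ::= NSub (NV ''N'') (NV ''v'') ;; play)"
  let ?F4 = "For ''z'' (NV ''N'') pop"
  define s1 where "s1 = nupd ''v'' 0 1 s0"
  have R1: "runs (''v'' ::= NLit 1) s0 5 (\<lambda>s'. s' = s1)" by (simp add: runs_def wp_simps s1_def)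
  have R2: "runs ?F1 s1 (N * 40 + 10) (\<lambda>s'. (\<forall>v. 2 \<le> v \<and> v < N + N \<longrightarrow> nats s' ''f'' v = v div 2) \<and> nats s' ''v'' 0 = N)"
  proof (rule runs_For[where T = "\<lambda>_. 25" and lo = 1 and I = "\<lambda>k s. \<forall>v. 2 \<le> v \<and> v < k + k \<longrightarrow> nats s ''f'' v = v div 2"])
    fix k s' assume "agree ?F1 s1 s'"
    from agreeN[OF this] show "nval (NV ''N'') s' = N" using N by (simp add: s1_def)
  next
    fix k and s' :: ram assume I: "\<forall>v. 2 \<le> v \<and> v < k + k \<longrightarrow> nats s' ''f'' v = v div 2" and k: "nats s' ''v'' 0 = k"
    have "v < k + k \<or> v = k + k \<or> v = k + k + 1" if "v < Suc k + Suc k" for v using that by auto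
    then show "runs (NSet ''f'' (NAdd (NV ''v'') (NV ''v'')) (NV ''v'') ;;
       NSet ''f'' (NAdd (NAdd (NV ''v'') (NV ''v'')) (NLit 1)) (NV ''v'')) s' 25
      (\<lambda>s''. nats s'' ''v'' 0 = k \<and> (\<forall>v. 2 \<le> v \<and> v < Suc k + Suc k \<longrightarrow> nats (nupd ''v'' 0 (Suc k) s'') ''f'' v = v div 2))"
      using I k by (auto simp: runs_def wp_simps)
  qed (use N1 in \<open>auto simp: s1_def\<close>)
  have R3: "runs ?F2 s (N * 40 + 10) (\<lambda>s'. leaves N {..<N} (nats s' ''t'') \<and> nats s' ''v'' 0 = N)"
    if s: "nats s ''v'' 0 = 0" "nats s ''N'' 0 = N" for s
  proof -
    have "runs ?F2 s (N * 40 + 10) (\<lambda>s'. (\<forall>i<N. nats s' ''t'' (N + i) = i) \<and> nats s' ''v'' 0 = N)"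
    proof (rule runs_For[where T = "\<lambda>_. 25" and lo = 0 and I = "\<lambda>k s. \<forall>i<k. nats s ''t'' (N + i) = i"])
      fix k s' assume "agree ?F2 s s'"
      from agreeN[OF this] show "nval (NV ''N'') s' = N" using s by simp
    next
      fix k s' assume I: "\<forall>i<k. nats s' ''t'' (N + i) = i" and ag: "agree ?F2 s s'" and k: "nats s' ''v'' 0 = k"
      show "runs (NSet ''t'' (NAdd (NV ''N'') (NV ''v'')) (NV ''v'')) s' 25
        (\<lambda>s''. nats s'' ''v'' 0 = k \<and> (\<forall>i<Suc k. nats (nupd ''v'' 0 (Suc k) s'') ''t'' (N + i) = i))"
        using I k agreeN[OF ag] s by (auto simp: runs_def wp_simps less_Suc_eq)
    qed (use s in auto)
    then show ?thesis by (rule runs_conseq) (auto simp: leaves_def)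
  qed
  have R4: "runs ?F3 s (N * 120 + 10) (\<lambda>s'. (leaves N {..<N} (nats s' ''t'') \<and> played N ls 0 (N + 1 - N) (nats s' ''t'')) \<and> nats s' ''v'' 0 = N)"
    if s: "nats s ''v'' 0 = 1" "nats s ''N'' 0 = N" "leaves N {..<N} (nats s ''t'')" "reals s ''kx'' = x" "reals s ''ky'' = y" for s
  proof (rule runs_For[where T = "\<lambda>_. 95" and lo = 1 and
        I = "\<lambda>k s. leaves N {..<N} (nats s ''t'') \<and> played N ls 0 (N + 1 - k) (nats s ''t'')"])
    fix k s' assume "agree ?F3 s s'"
    from agreeN[OF this] show "nval (NV ''N'') s' = N" using s by simp
  next
    fix k s' assume I: "leaves N {..<N} (nats s' ''t'') \<and> played N ls 0 (N + 1 - k) (nats s' ''t'')"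
      and ag: "agree ?F3 s s'" and k: "1 \<le> k" "k < N" "nats s' ''v'' 0 = k"
    have fr: "nats s' ''N'' 0 = N" "reals s' ''kx'' = x" "reals s' ''ky'' = y"
      using agreeN[OF ag] agreeR[OF ag] s by simp_all
    let ?u = "N - k" and ?t = "nats s' ''t''"
    define t' where "t' = ?t(?u := bet N ls (?t (?u + ?u)) (?t (?u + ?u + 1)))"
    have "leaves N {..<N} t'" using I k unfolding leaves_def t'_def by auto
    moreover have "played N ls 0 (N - k) t'"
      unfolding played_def
    proof (intro allI impI)
      fix v assume v: "N - k \<le> v \<and> v < N \<and> v \<noteq> 0"
      then have "v + v \<noteq> ?u" "v + v + 1 \<noteq> ?u" by auto
      moreover have "?u + ?u \<noteq> ?u" "Suc (?u + ?u) \<noteq> ?u" using k by auto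
      ultimately show "t' v = bet N ls (t' (v + v)) (t' (v + v + 1))"
        using I v k unfolding played_def t'_def by (cases "v = ?u") auto
    qed
    ultimately show "runs (''u'' ::= NSub (NV ''N'') (NV ''v'') ;; play) s' 95
      (\<lambda>s''. nats s'' ''v'' 0 = k \<and> leaves N {..<N} (nats (nupd ''v'' 0 (Suc k) s'') ''t'') \<and>
        played N ls 0 (N + 1 - Suc k) (nats (nupd ''v'' 0 (Suc k) s'') ''t''))"
      using k by (simp add: runs_def wp_simps play_wp Let_def fr t'_def)
  qed (use s N1 in \<open>auto simp: played_def\<close>)
  let ?L = "100 * floor_log (2 * N)"
  let ?I = "\<lambda>z s. leaves N ({..<N} - nats s ''o'' ` {..<z}) (nats s ''t'') \<and> played N ls 0 1 (nats s ''t'') \<and>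
      (\<forall>r<z. nats s ''o'' r < N \<and> (\<forall>j\<in>{..<N} - nats s ''o'' ` {..<z}. ls (nats s ''o'' r) j)) \<and>
      (\<forall>r r'. r < r' \<and> r' < z \<longrightarrow> ls (nats s ''o'' r) (nats s ''o'' r'))"
  have R5: "runs ?F4 s (N * (?L + 60) + 10) (\<lambda>s'. ?I N s' \<and> nats s' ''z'' 0 = N)"
    if s: "nats s ''z'' 0 = 0" "nats s ''N'' 0 = N" "leaves N {..<N} (nats s ''t'')" "played N ls 0 1 (nats s ''t'')"
      "reals s ''kx'' = x" "reals s ''ky'' = y" "\<forall>v. 2 \<le> v \<and> v < N + N \<longrightarrow> nats s ''f'' v = v div 2" for s
  proof (rule runs_For[where T = "\<lambda>_. ?L + 45" and lo = 0 and I = ?I])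
    fix k s' assume "agree ?F4 s s'"
    from agreeN[OF this] show "nval (NV ''N'') s' = N" using s by simp
  next
    fix k s' assume I: "?I k s'" and ag: "agree ?F4 s s'" and k: "0 \<le> k" "k < N" "nats s' ''z'' 0 = k"
    have fr: "nats s' ''N'' 0 = N" "reals s' ''kx'' = x" "reals s' ''ky'' = y" "nats s' ''f'' = nats s ''f''"
      using agreeN[OF ag] agreeR[OF ag] s by simp_all
    let ?A = "{..<N} - nats s' ''o'' ` {..<k}"
    have "card (nats s' ''o'' ` {..<k}) \<le> k" by (metis card_image_le card_lessThan finite_lessThan)
    then have "\<not> {..<N} \<subseteq> nats s' ''o'' ` {..<k}" using k
      by (metis card_lessThan card_mono finite_imageI finite_lessThan leD le_less_trans)
    then have Ane: "?A \<noteq> {}" by auto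
    define i where "i = nats s' ''t'' 1"
    have i: "i \<in> ?A" "\<And>j. j \<in> ?A \<Longrightarrow> j \<noteq> i \<Longrightarrow> ls i j"
      using root_least[of ?A "nats s' ''t''"] I Ane unfolding i_def by auto
    have iN: "i < N" using i by auto
    define s1 where "s1 = nupd ''t'' (N + i) N (nupd ''u'' 0 (N + i) (nupd ''o'' k i s'))"
    have Q1: "runs (NSet ''o'' (NV ''z'') (NGet ''t'' (NLit 1)) ;; ''u'' ::= NAdd (NV ''N'') (NGet ''t'' (NLit 1)) ;;
      NSet ''t'' (NV ''u'') (NV ''N'')) s' 25 (\<lambda>s'. s' = s1)"
      unfolding runs_def s1_def by (simp add: wp_simps fr k i_def)
    have Q2: "runs climb s1 (?L + 10) (\<lambda>s'. leaves N (?A - {i}) (nats s' ''t'') \<and> played N ls 0 1 (nats s' ''t''))"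
    proof (rule climb_runs)
      show "leaves N (?A - {i}) (nats s1 ''t'')" using I i iN unfolding leaves_def s1_def by auto
      show "played N ls (nats s1 ''u'' 0 div 2) 1 (nats s1 ''t'')"
        unfolding played_def
      proof (intro allI impI)
        fix v assume v: "1 \<le> v \<and> v < N \<and> v \<noteq> nats s1 ''u'' 0 div 2"
        then have "v + v \<noteq> N + i" "Suc (v + v) \<noteq> N + i" "v \<noteq> N + i" by (auto simp: s1_def)
        then show "nats s1 ''t'' v = bet N ls (nats s1 ''t'' (v + v)) (nats s1 ''t'' (v + v + 1))"
          using I v unfolding played_def s1_def by auto
      qed
    qed (use fr s iN N1 in \<open>auto simp: s1_def\<close>)
    have "runs ((NSet ''o'' (NV ''z'') (NGet ''t'' (NLit 1)) ;; ''u'' ::= NAdd (NV ''N'') (NGet ''t'' (NLit 1)) ;;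
      NSet ''t'' (NV ''u'') (NV ''N'')) ;; climb) s' (?L + 45) (\<lambda>s''. nats s'' ''z'' 0 = k \<and> ?I (Suc k) (nupd ''z'' 0 (Suc k) s''))"
    proof (rule runs_Seq[OF Q1])
      fix s2 assume "s2 = s1"
      show "runs climb s2 (?L + 10) (\<lambda>s''. nats s'' ''z'' 0 = k \<and> ?I (Suc k) (nupd ''z'' 0 (Suc k) s''))"
        unfolding \<open>s2 = s1\<close>
      proof (rule runs_conseq[OF runs_agree[OF Q2]])
        fix s3 assume s3: "(leaves N (?A - {i}) (nats s3 ''t'') \<and> played N ls 0 1 (nats s3 ''t'')) \<and> agree climb s1 s3"
        have o: "nats s3 ''o'' = (nats s' ''o'')(k := i)" "nats s3 ''z'' 0 = k"
          using agreeN[OF conjunct2[OF s3]] k by (simp_all add: s1_def)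
        have im: "{..<N} - nats s3 ''o'' ` {..<Suc k} = ?A - {i}" unfolding o by (auto simp: lessThan_Suc)
        have "\<forall>r<Suc k. nats s3 ''o'' r < N \<and> (\<forall>j\<in>?A - {i}. ls (nats s3 ''o'' r) j)"
          using I i iN unfolding o by (auto simp: less_Suc_eq)
        moreover have "\<forall>r r'. r < r' \<and> r' < Suc k \<longrightarrow> ls (nats s3 ''o'' r) (nats s3 ''o'' r')"
          using I i unfolding o by (auto simp: less_Suc_eq)
        ultimately show "nats s3 ''z'' 0 = k \<and> ?I (Suc k) (nupd ''z'' 0 (Suc k) s3)"
          using s3 o(2) im by simp
      qed simp
    qed simp
    then show "runs pop s' (?L + 45) (\<lambda>s''. nats s'' ''z'' 0 = k \<and> ?I (Suc k) (nupd ''z'' 0 (Suc k) s''))"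
      unfolding pop_def runs_def by (simp add: wp_simps add.assoc)
  qed (use s in \<open>auto simp: algebra_simps\<close>)
  show ?thesis unfolding sort_pts_def
  proof (rule runs_Seq[OF R1])
    fix s' assume "s' = s1"
    show "runs (?F1 ;; ''v'' ::= NLit 0 ;; ?F2 ;; ''v'' ::= NLit 1 ;; ?F3 ;; ''z'' ::= NLit 0 ;; ?F4) s'
       (N * (?L + 300) + 90) (\<lambda>s'. sorted_out N ls (nats s' ''o''))"
      unfolding \<open>s' = s1\<close>
    proof (rule runs_Seq_agree[OF R2])
      fix s2 assume s2: "(\<forall>v. 2 \<le> v \<and> v < N + N \<longrightarrow> nats s2 ''f'' v = v div 2) \<and> nats s2 ''v'' 0 = N" and ag2: "agree ?F1 s1 s2"
      have fr2: "nats s2 ''N'' 0 = N" "reals s2 ''kx'' = x" "reals s2 ''ky'' = y"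
        using agreeN[OF ag2] agreeR[OF ag2] N by (simp_all add: s1_def)
      show "runs (''v'' ::= NLit 0 ;; ?F2 ;; ''v'' ::= NLit 1 ;; ?F3 ;; ''z'' ::= NLit 0 ;; ?F4) s2
         (N * (?L + 260) + 80) (\<lambda>s'. sorted_out N ls (nats s' ''o''))"
      proof (rule runs_Seq[where ?Q1.0 = "\<lambda>s'. s' = nupd ''v'' 0 0 s2" and ?T1.0 = 5])
        fix s3 assume s3: "s3 = nupd ''v'' 0 0 s2"
        show "runs (?F2 ;; ''v'' ::= NLit 1 ;; ?F3 ;; ''z'' ::= NLit 0 ;; ?F4) s3
           (N * (?L + 260) + 70) (\<lambda>s'. sorted_out N ls (nats s' ''o''))"
        proof (rule runs_Seq_agree[OF R3])
          fix s4 assume s4: "leaves N {..<N} (nats s4 ''t'') \<and> nats s4 ''v'' 0 = N" and ag4: "agree ?F2 s3 s4"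
          have fr4: "nats s4 ''N'' 0 = N" "reals s4 ''kx'' = x" "reals s4 ''ky'' = y" "nats s4 ''f'' = nats s2 ''f''"
            using agreeN[OF ag4] agreeR[OF ag4] fr2 s3 by simp_all
          show "runs (''v'' ::= NLit 1 ;; ?F3 ;; ''z'' ::= NLit 0 ;; ?F4) s4
             (N * (?L + 200) + 50) (\<lambda>s'. sorted_out N ls (nats s' ''o''))"
          proof (rule runs_Seq[where ?Q1.0 = "\<lambda>s'. s' = nupd ''v'' 0 1 s4" and ?T1.0 = 5])
            fix s5 assume s5: "s5 = nupd ''v'' 0 1 s4"
            show "runs (?F3 ;; ''z'' ::= NLit 0 ;; ?F4) s5
               (N * (?L + 200) + 40) (\<lambda>s'. sorted_out N ls (nats s' ''o''))"
            proof (rule runs_Seq_agree[OF R4])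
              fix s6 assume s6: "(leaves N {..<N} (nats s6 ''t'') \<and> played N ls 0 (N + 1 - N) (nats s6 ''t'')) \<and> nats s6 ''v'' 0 = N"
                and ag6: "agree ?F3 s5 s6"
              have fr6: "nats s6 ''N'' 0 = N" "reals s6 ''kx'' = x" "reals s6 ''ky'' = y" "nats s6 ''f'' = nats s2 ''f''"
                using agreeN[OF ag6] agreeR[OF ag6] fr4 s5 by simp_all
              show "runs (''z'' ::= NLit 0 ;; ?F4) s6 (N * (?L + 60) + 20) (\<lambda>s'. sorted_out N ls (nats s' ''o''))"
              proof (rule runs_Seq[where ?Q1.0 = "\<lambda>s'. s' = nupd ''z'' 0 0 s6" and ?T1.0 = 5])
                fix s7 assume "s7 = nupd ''z'' 0 0 s6"
                then show "runs ?F4 s7 (N * (?L + 60) + 10) (\<lambda>s'. sorted_out N ls (nats s' ''o''))"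
                  using s6 fr6 s2 by (intro runs_conseq[OF R5]) (auto simp: sorted_out_def)
              qed (simp_all add: runs_def wp_simps)
            qed (use s5 s4 fr4 in \<open>auto simp: algebra_simps\<close>)
          qed (simp_all add: runs_def wp_simps)
        qed (use s3 fr2 in \<open>auto simp: algebra_simps\<close>)
      qed (simp_all add: runs_def wp_simps)
    qed (auto simp: algebra_simps)
  qed simp
qed

end

section \<open>Coordinates of points and sentinels\<close>

text \<open>A small shear makes the abscissae distinct. The sentinels between the points are put so low
  that they lie below every line through two of the points.\<close>

definition gauge :: com where
  "gauge =
    (''Q'' ::=r RLit 1 ;; ''ep'' ::=r RLit 1 ;; ''z'' ::= NLit 0 ;;
     For ''z'' (NV ''N'')
       (''i'' ::= NGet ''o'' (NV ''z'') ;;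
        ''Q'' ::=r RAdd (RV ''Q'') (RMul (kyE ''i'') (kyE ''i'')) ;;
        Cond (NLess (NLit 0) (NV ''z''))
          (''l'' ::= NGet ''o'' (NSub (NV ''z'') (NLit 1)) ;;
           Cond (RLess (kxE ''l'') (kxE ''i'')) (''dv'' ::=r RSub (kxE ''i'') (kxE ''l'')) (''dv'' ::=r RSub (kyE ''i'') (kyE ''l'')) ;;
           Cond (RLess (RV ''dv'') (RV ''ep'')) (''ep'' ::=r RV ''dv'') Skip)
          Skip) ;;
     ''eps'' ::=r RDiv (RV ''ep'') (RAdd (RV ''Q'') (RV ''Q'')))"

definition shE :: rexp where "shE = RAdd (kxE ''i'') (RMul (RV ''eps'') (kyE ''i''))"

text \<open>Slot \<open>j\<close> consists of the sentinel \<open>2 * j\<close> and the place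
  \<open>2 * j + 1\<close> for a point. In an occupied slot the sentinel goes halfway between the
  previous abscissa and that of the point; in an empty slot it advances by 1.\<close>

definition place1 :: com where
  "place1 =
    (''a'' ::= NAdd (NV ''j'') (NV ''j'') ;; ''c'' ::= NAdd (NV ''a'') (NLit 1) ;; ''e'' ::= NAdd (NV ''a'') (NLit 2) ;;
     Cond (BAnd (BNot (NLess (NV ''j'') (NV ''lo''))) (NLess (NV ''z'') (NV ''N'')))
       (''i'' ::= NGet ''o'' (NV ''z'') ;; ''nx'' ::=r shE ;;
        RSet ''X'' (NV ''a'') (RDiv (RAdd (RV ''cur'') (RV ''nx'')) (RLit 2)) ;;
        RSet ''X'' (NV ''c'') (RV ''nx'') ;; RSet ''Y'' (NV ''c'') (kyE ''i'') ;; NSet ''p'' (NV ''c'') (NV ''i'') ;;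
        ''cur'' ::=r RV ''nx'' ;; ''z'' ::= NAdd (NV ''z'') (NLit 1) ;;
        NSet ''n'' (NV ''a'') (NV ''c'') ;; NSet ''q'' (NV ''c'') (NV ''a'') ;;
        NSet ''n'' (NV ''c'') (NV ''e'') ;; NSet ''q'' (NV ''e'') (NV ''c''))
       (''cur'' ::=r RAdd (RV ''cur'') (RLit 1) ;; RSet ''X'' (NV ''a'') (RV ''cur'') ;;
        NSet ''n'' (NV ''a'') (NV ''e'') ;; NSet ''q'' (NV ''e'') (NV ''a'')))"

text \<open>The first abscissa is chosen so far to the left that the empty slots before the first
  point, fewer than \<open>pr\<close>, fit in with steps of 1. \<open>H\<close> is determined only
  when the total width is known; see \<open>place_runs\<close> for its value.\<close>

definition place :: com where
  "place =
    (''i'' ::= NGet ''o'' (NLit 0) ;;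
     ''cur'' ::=r RSub (RSub shE (RV ''pr'')) (RLit 1) ;;
     ''z'' ::= NLit 0 ;; ''j'' ::= NLit 0 ;;
     For ''j'' (NV ''P'') place1 ;;
     RSet ''X'' (NV ''E'') (RAdd (RV ''cur'') (RLit 1)) ;;
     ''H'' ::=r RAdd (RAdd (RLit 1) (RV ''Q''))
        (RDiv (RMul (RV ''Q'') (RSub (RGet ''X'' (NV ''E'')) (RGet ''X'' (NLit 0)))) (RMul (RV ''ep'') (RV ''eps''))) ;;
     ''j'' ::= NLit 0 ;;
     For ''j'' (NAdd (NV ''P'') (NLit 1)) (RSet ''Y'' (NAdd (NV ''j'') (NV ''j'')) (RSub (RLit 0) (RV ''H''))))"

lemma coord_mods [simp]:
  "nmods gauge = {''i'', ''l'', ''z''}" "rmods gauge = {''Q'', ''ep'', ''eps'', ''dv''}"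
  "nmods place1 = {''a'', ''c'', ''e'', ''i'', ''p'', ''z'', ''n'', ''q''}" "rmods place1 = {''nx'', ''X'', ''Y'', ''cur''}"
  "nmods place = {''a'', ''c'', ''e'', ''i'', ''p'', ''z'', ''n'', ''q'', ''j''}" "rmods place = {''nx'', ''X'', ''Y'', ''cur'', ''H''}"
  by (auto simp: gauge_def place1_def place_def)

text \<open>\<open>e\<close> is at most the gap between any two consecutive points, measured in
  \<open>x\<close> where these differ and in \<open>y\<close> otherwise. The sum of squares in
  \<open>Q\<close> is an upper bound for ordinates that needs no absolute values.\<close>

definition gauged :: "nat \<Rightarrow> (nat \<Rightarrow> real) \<Rightarrow> (nat \<Rightarrow> real) \<Rightarrow> (nat \<Rightarrow> nat) \<Rightarrow> real \<Rightarrow> real \<Rightarrow> bool" where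
  "gauged N x y ot Q e \<longleftrightarrow> Q = 1 + (\<Sum>r<N. (y (ot r))\<^sup>2) \<and> 0 < e \<and> e \<le> 1 \<and>
     (\<forall>r. 0 < r \<and> r < N \<longrightarrow> (if x (ot (r - 1)) < x (ot r) then e \<le> x (ot r) - x (ot (r - 1)) else e \<le> y (ot r) - y (ot (r - 1))))"

lemma gauge_runs:
  assumes s: "nats s0 ''N'' 0 = N" "nats s0 ''o'' = ot" "reals s0 ''kx'' = x" "reals s0 ''ky'' = y"
    and so: "sorted_out N (lex x y) ot"
  shows "runs gauge s0 (N * 120 + 60) (\<lambda>s'. gauged N x y ot (reals s' ''Q'' 0) (reals s' ''ep'' 0) \<and>
     reals s' ''eps'' 0 = reals s' ''ep'' 0 / (2 * reals s' ''Q'' 0))"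
proof -
  let ?c = "''i'' ::= NGet ''o'' (NV ''z'') ;;
        ''Q'' ::=r RAdd (RV ''Q'') (RMul (kyE ''i'') (kyE ''i'')) ;;
        Cond (NLess (NLit 0) (NV ''z''))
          (''l'' ::= NGet ''o'' (NSub (NV ''z'') (NLit 1)) ;;
           Cond (RLess (kxE ''l'') (kxE ''i'')) (''dv'' ::=r RSub (kxE ''i'') (kxE ''l'')) (''dv'' ::=r RSub (kyE ''i'') (kyE ''l'')) ;;
           Cond (RLess (RV ''dv'') (RV ''ep'')) (''ep'' ::=r RV ''dv'') Skip)
          Skip"
  let ?F = "For ''z'' (NV ''N'') (?c)"
  define s1 where "s1 = nupd ''z'' 0 0 (rupd ''ep'' 0 1 (rupd ''Q'' 0 1 s0))"
  have R1: "runs (''Q'' ::=r RLit 1 ;; ''ep'' ::=r RLit 1 ;; ''z'' ::= NLit 0) s0 20 (\<lambda>s'. s' = s1)"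
    by (simp add: runs_def wp_simps s1_def)
  let ?I = "\<lambda>z s. gauged z x y ot (reals s ''Q'' 0) (reals s ''ep'' 0)"
  have R2: "runs ?F s1 (N * 120 + 10) (\<lambda>s'. ?I N s' \<and> nats s' ''z'' 0 = N)"
  proof (rule runs_For[where T = "\<lambda>_. 100" and lo = 0])
    fix k s' assume "agree ?F s1 s'"
    from agreeN[OF this] show "nval (NV ''N'') s' = N" using s by (simp add: s1_def)
  next
    fix k s2 assume I: "?I k s2" and ag: "agree ?F s1 s2" and k: "0 \<le> k" "k < N" "nats s2 ''z'' 0 = k"
    have fr: "nats s2 ''o'' = ot" "reals s2 ''kx'' = x" "reals s2 ''ky'' = y"
      using agreeN[OF ag] agreeR[OF ag] s by (simp_all add: s1_def)
    let ?Q = "reals s2 ''Q'' 0" and ?e = "reals s2 ''ep'' 0"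
    define d where "d = (if x (ot (k - 1)) < x (ot k) then x (ot k) - x (ot (k - 1)) else y (ot k) - y (ot (k - 1)))"
    have dpos: "0 < d" if "0 < k"
    proof -
      have "lex x y (ot (k - 1)) (ot k)" using so k that unfolding sorted_out_def by auto
      then show ?thesis by (auto simp: d_def lex_def)
    qed
    have G: "gauged (Suc k) x y ot (?Q + y (ot k) * y (ot k)) (if 0 < k \<and> d < ?e then d else ?e)"
      using I dpos unfolding gauged_def by (auto simp: power2_eq_square d_def less_Suc_eq)
    show "runs (?c) s2 100 (\<lambda>s''. nats s'' ''z'' 0 = k \<and> ?I (Suc k) (nupd ''z'' 0 (Suc k) s''))"
      using G k by (cases "0 < k"; cases "x (ot (k - 1)) < x (ot k)"; cases "d < ?e"; simp add: runs_def wp_simps fr d_def)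
  qed (use s in \<open>auto simp: s1_def gauged_def\<close>)
  have "runs ((''Q'' ::=r RLit 1 ;; ''ep'' ::=r RLit 1 ;; ''z'' ::= NLit 0) ;; ?F ;; ''eps'' ::=r RDiv (RV ''ep'') (RAdd (RV ''Q'') (RV ''Q'')))
    s0 (N * 120 + 60) (\<lambda>s'. gauged N x y ot (reals s' ''Q'' 0) (reals s' ''ep'' 0) \<and>
     reals s' ''eps'' 0 = reals s' ''ep'' 0 / (2 * reals s' ''Q'' 0))"
    apply (rule runs_Seq[OF R1, where ?T2.0 = "N * 120 + 30"])
     apply (simp only:)
     apply (rule runs_Seq[OF R2, where ?T2.0 = "15"])
      apply (simp_all add: runs_def wp_simps)
    done
  then show ?thesis unfolding gauge_def runs_def by (simp add: wp_simps add.assoc)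
qed

text \<open>\<open>Q\<close> bounds all ordinates and their differences, so the shear moves
  consecutive points by at most \<open>e / 2\<close> relative to each other. A gap in
  \<open>x\<close> keeps at least \<open>e / 2\<close>, which is at least \<open>e * eps\<close> as
  \<open>eps\<close> is at most 1/2. A tie in \<open>x\<close> is broken by at least
  \<open>eps * e\<close>.\<close>

lemma gauged_shear:
  assumes g: "gauged N x y ot Q e" and so: "sorted_out N (lex x y) ot" and eps: "eps = e / (2 * Q)"
  shows "0 < eps" "1 \<le> Q" "\<And>r. r < N \<Longrightarrow> \<bar>y (ot r)\<bar> \<le> Q"
    "\<And>r r'. r < r' \<Longrightarrow> r' < N \<Longrightarrow> \<bar>y (ot r') - y (ot r)\<bar> \<le> Q"
    "\<And>r r'. r < r' \<Longrightarrow> r' < N \<Longrightarrow> e * eps \<le> (x (ot r') + eps * y (ot r')) - (x (ot r) + eps * y (ot r))"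
proof -
  have Q: "Q = 1 + (\<Sum>r<N. (y (ot r))\<^sup>2)" and e: "0 < e" "e \<le> 1" using g by (auto simp: gauged_def)
  show Q1: "1 \<le> Q" using Q by (simp add: sum_nonneg)
  show ep: "0 < eps" using eps e Q1 by simp
  show y1: "\<bar>y (ot r)\<bar> \<le> Q" if "r < N" for r
  proof -
    have "(y (ot r))\<^sup>2 \<le> (\<Sum>r<N. (y (ot r))\<^sup>2)" using that by (intro member_le_sum) auto
    moreover have "\<bar>y (ot r)\<bar> \<le> 1 + (y (ot r))\<^sup>2"
      using sum_squares_bound[of "\<bar>y (ot r)\<bar>" 1] by (simp add: power2_abs)
    ultimately show ?thesis using Q by linarith
  qed
  show y2: "\<bar>y (ot r') - y (ot r)\<bar> \<le> Q" if "r < r'" "r' < N" for r r'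
  proof -
    have "(\<Sum>k\<in>{r, r'}. (y (ot k))\<^sup>2) \<le> (\<Sum>r<N. (y (ot r))\<^sup>2)" using that by (intro sum_mono2) auto
    then have "(y (ot r))\<^sup>2 + (y (ot r'))\<^sup>2 \<le> Q - 1" using that Q by simp
    moreover have "2 * \<bar>y (ot r)\<bar> \<le> 1 + (y (ot r))\<^sup>2" "2 * \<bar>y (ot r')\<bar> \<le> 1 + (y (ot r'))\<^sup>2"
      using sum_squares_bound[of "\<bar>y (ot r)\<bar>" 1] sum_squares_bound[of "\<bar>y (ot r')\<bar>" 1] by (simp_all add: power2_abs)
    ultimately show ?thesis using sum_nonneg[of "{..<N}" "\<lambda>r. (y (ot r))\<^sup>2"] by (smt (verit) zero_le_power2)
  qed
  define sh where "sh = (\<lambda>r. x (ot r) + eps * y (ot r))"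
  have step: "e * eps \<le> sh (Suc r) - sh r" if "Suc r < N" for r
  proof -
    have l: "lex x y (ot r) (ot (Suc r))" using so that unfolding sorted_out_def by auto
    have c: "if x (ot r) < x (ot (Suc r)) then e \<le> x (ot (Suc r)) - x (ot r) else e \<le> y (ot (Suc r)) - y (ot r)"
      using g that unfolding gauged_def by (metis diff_Suc_1 zero_less_Suc)
    show ?thesis
    proof (cases "x (ot r) < x (ot (Suc r))")
      case True
      have epQ: "eps * Q = e / 2" using Q1 eps by simp
      have "eps * (y (ot r) - y (ot (Suc r))) \<le> eps * Q"
        using y2[of r "Suc r"] that ep by (intro mult_left_mono) auto
      then have a1: "eps * y (ot r) - eps * y (ot (Suc r)) \<le> e / 2" by (simp add: epQ right_diff_distrib)
      have "eps * 1 \<le> eps * Q" using Q1 ep by (intro mult_left_mono) auto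
      then have "eps \<le> 1 / 2" using epQ e by linarith
      then have a2: "e * eps \<le> e * (1 / 2)" using e by (intro mult_left_mono) auto
      have a3: "e \<le> x (ot (Suc r)) - x (ot r)" using c True by simp
      show ?thesis unfolding sh_def using a1 a2 a3 by linarith
    next
      case False
      then have "x (ot r) = x (ot (Suc r))" "e \<le> y (ot (Suc r)) - y (ot r)" using l c by (auto simp: lex_def)
      then have "eps * e \<le> eps * (y (ot (Suc r)) - y (ot r))" using ep by (intro mult_left_mono) auto
      then show ?thesis using \<open>x (ot r) = x (ot (Suc r))\<close> by (simp add: sh_def algebra_simps)
    qed
  qed
  have pos: "0 < e * eps" using e ep by simp
  have "e * eps \<le> sh r' - sh r" if "r < r'" "r' < N" for r r'
    using that
  proof (induction r')
    case (Suc r')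
    show ?case
    proof (cases "r = r'")
      case True
      then show ?thesis using step Suc.prems by simp
    next
      case False
      then show ?thesis using Suc step[of r'] pos by force
    qed
  qed simp
  then show "\<And>r r'. r < r' \<Longrightarrow> r' < N \<Longrightarrow> e * eps \<le> (x (ot r') + eps * y (ot r')) - (x (ot r) + eps * y (ot r))"
    by (simp add: sh_def)
qed

text \<open>The leaf lists: a leaf links its two sentinels through its point if it has one, and
  directly otherwise.\<close>

definition base_links :: "nat set \<Rightarrow> nat \<Rightarrow> (nat \<Rightarrow> nat) \<Rightarrow> (nat \<Rightarrow> nat) \<Rightarrow> bool" where
  "base_links S j n q \<longleftrightarrow> (\<forall>k<j. if 2 * k + 1 \<in> S
      then n (2 * k) = 2 * k + 1 \<and> q (2 * k + 1) = 2 * k \<and> n (2 * k + 1) = 2 * k + 2 \<and> q (2 * k + 2) = 2 * k + 1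
      else n (2 * k) = 2 * k + 2 \<and> q (2 * k + 2) = 2 * k)"

lemma (in lev) base_level:
  assumes "base_links S (2 ^ D) n q"
  shows "levelok n q S 0"
  unfolding levelok_def lst_def
proof (intro allI impI)
  fix k i j assume k: "k < 2 ^ (D - 0)" and c: "cons (hl S (k * wd 0) (Suc k * wd 0)) i j"
  have r: "i \<in> TT S (2 * k) (2 * k + 2)" "j \<in> TT S (2 * k) (2 * k + 2)" "i < j"
    using c UH_sub unfolding cons_def wd_simps by (auto simp: mult.commute)
  have TTe: "TT S (2 * k) (2 * k + 2) = (if 2 * k + 1 \<in> S then {2 * k, 2 * k + 1, 2 * k + 2} else {2 * k, 2 * k + 2})"
  proof -
    have "{2 * k<..<2 * k + 2} = {2 * k + 1}" by auto
    then show ?thesis by (auto simp: TT_def)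
  qed
  have b: "if 2 * k + 1 \<in> S
      then n (2 * k) = 2 * k + 1 \<and> q (2 * k + 1) = 2 * k \<and> n (2 * k + 1) = 2 * k + 2 \<and> q (2 * k + 2) = 2 * k + 1
      else n (2 * k) = 2 * k + 2 \<and> q (2 * k + 2) = 2 * k"
    using assms k unfolding base_links_def by auto
  show "n (0 * W + i) = j \<and> q (0 * W + j) = i"
  proof (cases "2 * k + 1 \<in> S")
    case False
    then show ?thesis using r TTe b by auto
  next
    case True
    have g: "2 * k \<in> G" "2 * k + 2 \<in> G" using k by (auto simp: Gdef wd_def)
    have "X (2 * k) < X (2 * k + 2)" using mono[of "2 * k" "2 * k + 2"] g by simp
    moreover have "- H < Y (2 * k + 1)" using True ptY by auto
    ultimately have "0 < h (2 * k) (2 * k + 2) (2 * k + 1)" unfolding ori_def using gapY g by simp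
    then have "2 * k + 1 \<in> hl S (2 * k) (2 * k + 2)" unfolding UH_def TTe using True by auto
    moreover have "hl S (k * wd 0) (Suc k * wd 0) = hl S (2 * k) (2 * k + 2)" by (simp add: wd_simps mult.commute)
    ultimately have "\<not> (i < 2 * k + 1 \<and> 2 * k + 1 < j)" using c unfolding cons_def by auto
    then show ?thesis using r TTe b True by auto
  qed
qed

text \<open>As a congruence rule this keeps the simplifier from rewriting the continuation before the state is known.\<close>

lemma wp_cong: "s = s' \<Longrightarrow> wp c s Q = wp c s' Q"
  by simp

text \<open>The index of the point of rank \<open>r\<close> when the first \<open>lo\<close> slots
  are left empty.\<close>

definition pt :: "nat \<Rightarrow> nat \<Rightarrow> nat" where "pt lo r = 2 * (lo + r) + 1"

definition gapset :: "nat \<Rightarrow> nat set" where "gapset D = {g. even g \<and> g \<le> wd D}"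

lemma pt_image_iff: "2 * j + 1 \<in> pt lo ` {..<N} \<longleftrightarrow> lo \<le> j \<and> j < lo + N"
proof
  assume "lo \<le> j \<and> j < lo + N"
  then have "2 * j + 1 = pt lo (j - lo)" "j - lo < N" by (auto simp: pt_def)
  then show "2 * j + 1 \<in> pt lo ` {..<N}" by blast
qed (auto simp: pt_def)

text \<open>\<open>cur\<close> is the abscissa of the latest object. Its exact value is recorded
  before the first point and between points, which is what the comparison with the next point
  needs.\<close>

definition placed :: "nat \<Rightarrow> nat \<Rightarrow> nat \<Rightarrow> (nat \<Rightarrow> real) \<Rightarrow> (nat \<Rightarrow> real) \<Rightarrow> (nat \<Rightarrow> nat) \<Rightarrow> real \<Rightarrow> real \<Rightarrow> nat \<Rightarrow> ram \<Rightarrow> bool" where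
  "placed N P lo x y ot eps pr j s \<longleftrightarrow>
     nats s ''z'' 0 = min N (j - lo) \<and>
     (\<forall>r<min N (j - lo). reals s ''X'' (pt lo r) = x (ot r) + eps * y (ot r) \<and> reals s ''Y'' (pt lo r) = y (ot r) \<and> nats s ''p'' (pt lo r) = ot r) \<and>
     (\<forall>a b. a < b \<and> b < 2 * j \<and> (even a \<or> a \<in> pt lo ` {..<N}) \<and> (even b \<or> b \<in> pt lo ` {..<N}) \<longrightarrow> reals s ''X'' a < reals s ''X'' b) \<and>
     (\<forall>a < 2 * j. even a \<or> a \<in> pt lo ` {..<N} \<longrightarrow> reals s ''X'' a \<le> reals s ''cur'' 0) \<and>
     (j \<le> lo \<longrightarrow> reals s ''cur'' 0 = x (ot 0) + eps * y (ot 0) - pr - 1 + real j) \<and>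
     (lo < j \<and> j < lo + N \<longrightarrow> reals s ''cur'' 0 = x (ot (j - lo - 1)) + eps * y (ot (j - lo - 1))) \<and>
     base_links (pt lo ` {..<N}) j (nats s ''n'') (nats s ''q'')"

lemma placed_step:
  assumes I: "placed N P lo x y ot eps pr j s" and j: "j < P" "nats s ''j'' 0 = j"
    and s: "nats s ''N'' 0 = N" "nats s ''lo'' 0 = lo" "nats s ''o'' = ot" "reals s ''kx'' = x" "reals s ''ky'' = y"
      "reals s ''eps'' 0 = eps" and pr: "real P \<le> pr" and loP: "lo + N \<le> P"
    and inc: "\<And>r. Suc r < N \<Longrightarrow> x (ot r) + eps * y (ot r) < x (ot (Suc r)) + eps * y (ot (Suc r))"
  shows "runs place1 s 200 (\<lambda>s'. nats s' ''j'' 0 = j \<and> placed N P lo x y ot eps pr (Suc j) (nupd ''j'' 0 (Suc j) s'))"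
proof -
  let ?S = "pt lo ` {..<N}"
  let ?X = "reals s ''X''" and ?cur = "reals s ''cur'' 0" and ?n = "nats s ''n''" and ?q = "nats s ''q''"
  have z: "nats s ''z'' 0 = min N (j - lo)" using I by (simp add: placed_def)
  have cond: "(\<not> j < lo \<and> nats s ''z'' 0 < N) \<longleftrightarrow> 2 * j + 1 \<in> ?S"
    unfolding pt_image_iff z by auto
  have mono: "\<And>a b. a < b \<Longrightarrow> b < 2 * j \<Longrightarrow> even a \<or> a \<in> ?S \<Longrightarrow> even b \<or> b \<in> ?S \<Longrightarrow> ?X a < ?X b"
    and le: "\<And>a. a < 2 * j \<Longrightarrow> even a \<or> a \<in> ?S \<Longrightarrow> ?X a \<le> ?cur"
    and bl: "base_links ?S j ?n ?q"
    using I unfolding placed_def by blast+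
  have b2: "b < 2 * j \<or> b = 2 * j \<or> b = 2 * j + 1" if "b < 2 * Suc j" for b using that by auto
  show ?thesis
  proof (cases "2 * j + 1 \<in> ?S")
    case False
    define s' where "s' = nupd ''q'' (2 * j + 2) (2 * j) (nupd ''n'' (2 * j) (2 * j + 2) (rupd ''X'' (2 * j) (?cur + 1)
       (rupd ''cur'' 0 (?cur + 1) (nupd ''e'' 0 (2 * j + 2) (nupd ''c'' 0 (2 * j + 1) (nupd ''a'' 0 (2 * j) s))))))"
    have "wp place1 s (\<lambda>t s''. t \<le> 200 \<and> s'' = s')"
    proof -
      have "\<not> (\<not> j < lo \<and> nats s ''z'' 0 < N)" using False cond by blast
      then have "bval (BAnd (BNot (NLess (NV ''j'') (NV ''lo''))) (NLess (NV ''z'') (NV ''N'')))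
        (nupd ''e'' 0 (2 * j + 2) (nupd ''c'' 0 (2 * j + 1) (nupd ''a'' 0 (2 * j) s))) = False" by (simp add: j s)
      then show ?thesis unfolding place1_def s'_def by (simp add: wp_simps j s mult_2 del: bval.simps)
    qed
    moreover have "placed N P lo x y ot eps pr (Suc j) (nupd ''j'' 0 (Suc j) s')"
    proof -
      have nr: "\<not> (lo \<le> j \<and> j < lo + N)" using False pt_image_iff by blast
      have m: "min N (Suc j - lo) = min N (j - lo)" using nr by auto
      have X': "reals s' ''X'' = ?X(2 * j := ?cur + 1)" "reals s' ''cur'' 0 = ?cur + 1" "reals s' ''Y'' = reals s ''Y''"
        "nats s' ''p'' = nats s ''p''" "nats s' ''z'' 0 = nats s ''z'' 0"
        "nats s' ''n'' = ?n(2 * j := 2 * j + 2)" "nats s' ''q'' = ?q(2 * j + 2 := 2 * j)" by (auto simp: s'_def)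
      have odd1: "pt lo r \<noteq> 2 * j" for r by (simp add: pt_def) presburger
      have A3: "reals s' ''X'' a < reals s' ''X'' b" if "a < b" "b < 2 * Suc j" "even a \<or> a \<in> ?S" "even b \<or> b \<in> ?S" for a b
      proof -
        have "b \<noteq> 2 * j + 1" using that(4) False by auto
        then have "b < 2 * j \<or> b = 2 * j" using b2[OF that(2)] by blast
        then consider "b < 2 * j" | "b = 2 * j" by blast
        then show ?thesis
        proof cases
          case 1
          then show ?thesis using mono[OF that(1) 1 that(3,4)] that(1) unfolding X' by simp
        next
          case 2
          then show ?thesis using le[of a] that(1,3) unfolding X' by force
        qed
      qed
      have A4: "reals s' ''X'' a \<le> reals s' ''cur'' 0" if "a < 2 * Suc j" "even a \<or> a \<in> ?S" for a
      proof -
        have "a \<noteq> 2 * j + 1" using that(2) False by auto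
        then have "a < 2 * j \<or> a = 2 * j" using b2[OF that(1)] by blast
        then consider "a < 2 * j" | "a = 2 * j" by blast
        then show ?thesis using le[OF _ that(2)] unfolding X' by cases (simp_all add: add_increasing2)
      qed
      have A5: "base_links ?S (Suc j) (nats s' ''n'') (nats s' ''q'')"
        using bl False unfolding base_links_def X' by (auto simp: less_Suc_eq)
      have A6: "Suc j \<le> lo \<longrightarrow> reals s' ''cur'' 0 = x (ot 0) + eps * y (ot 0) - pr - 1 + real (Suc j)"
        using I unfolding placed_def X' by auto
      have A2: "\<forall>r<min N (j - lo). reals s' ''X'' (pt lo r) = x (ot r) + eps * y (ot r) \<and>
          reals s' ''Y'' (pt lo r) = y (ot r) \<and> nats s' ''p'' (pt lo r) = ot r"
        using I unfolding placed_def X' by (simp add: odd1)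
      have A7: "\<not> (lo < Suc j \<and> Suc j < lo + N)" using nr by auto
      show ?thesis unfolding placed_def m upd_simps(2)
      proof (intro conjI)
        show "nats (nupd ''j'' 0 (Suc j) s') ''z'' 0 = min N (j - lo)" using X'(5) z by simp
        show "\<forall>r<min N (j - lo). reals s' ''X'' (pt lo r) = x (ot r) + eps * y (ot r) \<and>
          reals s' ''Y'' (pt lo r) = y (ot r) \<and> nats (nupd ''j'' 0 (Suc j) s') ''p'' (pt lo r) = ot r" using A2 by simp
        show "base_links ?S (Suc j) (nats (nupd ''j'' 0 (Suc j) s') ''n'') (nats (nupd ''j'' 0 (Suc j) s') ''q'')" using A5 by simp
      qed (use A3 A4 A6 A7 in blast)+
    qed
    moreover have "nats s' ''j'' 0 = j" by (simp add: s'_def j)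
    ultimately show ?thesis unfolding runs_def wp_def by blast
  next
    case True
    then have lj: "lo \<le> j" "j < lo + N" using pt_image_iff by blast+
    define r where "r = j - lo"
    have r: "r < N" "j = lo + r" "pt lo r = 2 * j + 1" using lj by (auto simp: r_def pt_def)
    define sh where "sh = x (ot r) + eps * y (ot r)"
    have zr: "nats s ''z'' 0 = r" using z r by auto
    define s' where "s' = nupd ''q'' (2 * j + 2) (2 * j + 1) (nupd ''n'' (2 * j + 1) (2 * j + 2)
       (nupd ''q'' (2 * j + 1) (2 * j) (nupd ''n'' (2 * j) (2 * j + 1) (nupd ''z'' 0 (r + 1) (rupd ''cur'' 0 sh
       (nupd ''p'' (2 * j + 1) (ot r) (rupd ''Y'' (2 * j + 1) (y (ot r)) (rupd ''X'' (2 * j + 1) sh (rupd ''X'' (2 * j) ((?cur + sh) / 2)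
       (rupd ''nx'' 0 sh (nupd ''i'' 0 (ot r) (nupd ''e'' 0 (2 * j + 2) (nupd ''c'' 0 (2 * j + 1) (nupd ''a'' 0 (2 * j) s))))))))))))))"
    have "wp place1 s (\<lambda>t s''. t \<le> 200 \<and> s'' = s')"
    proof -
      have "\<not> j < lo \<and> nats s ''z'' 0 < N" using True cond by blast
      then have "bval (BAnd (BNot (NLess (NV ''j'') (NV ''lo''))) (NLess (NV ''z'') (NV ''N'')))
        (nupd ''e'' 0 (2 * j + 2) (nupd ''c'' 0 (2 * j + 1) (nupd ''a'' 0 (2 * j) s))) = True" by (simp add: j s)
      then show ?thesis unfolding place1_def s'_def shE_def sh_def by (simp add: wp_simps j s zr mult_2 del: bval.simps One_nat_def cong: wp_cong)
    qed
    moreover have "placed N P lo x y ot eps pr (Suc j) (nupd ''j'' 0 (Suc j) s')"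
    proof -
      have m: "min N (Suc j - lo) = Suc r" "min N (j - lo) = r" using r by auto
      \<comment> \<open>Before the first point \<open>cur\<close> has made at most \<open>pr\<close>
        unit steps from its start; afterwards it is the sheared abscissa of the preceding
        point.\<close>
      have cs: "?cur < sh"
      proof (cases "r = 0")
        case True
        then have "j \<le> lo" using r by simp
        then have "?cur = x (ot 0) + eps * y (ot 0) - pr - 1 + real j" using I by (simp add: placed_def)
        moreover have "real j \<le> pr" using pr j by linarith
        ultimately show ?thesis using True by (simp add: sh_def)
      next
        case False
        then have "lo < j" using r by simp
        then have "?cur = x (ot (j - lo - 1)) + eps * y (ot (j - lo - 1))" using I lj unfolding placed_def by blast
        moreover have "j - lo - 1 = r - 1" by (simp add: r_def)
        ultimately show ?thesis using inc[of "r - 1"] False r(1) by (simp add: sh_def)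
      qed
      have X': "reals s' ''X'' = ?X(2 * j := (?cur + sh) / 2, 2 * j + 1 := sh)" "reals s' ''cur'' 0 = sh"
        "reals s' ''Y'' = (reals s ''Y'')(2 * j + 1 := y (ot r))"
        "nats s' ''p'' = (nats s ''p'')(2 * j + 1 := ot r)" "nats s' ''z'' 0 = r + 1"
        "nats s' ''n'' = ?n(2 * j := 2 * j + 1, 2 * j + 1 := 2 * j + 2)"
        "nats s' ''q'' = ?q(2 * j + 1 := 2 * j, 2 * j + 2 := 2 * j + 1)" by (auto simp: s'_def)
      have A2: "reals s' ''X'' (pt lo i) = x (ot i) + eps * y (ot i) \<and> reals s' ''Y'' (pt lo i) = y (ot i) \<and> nats s' ''p'' (pt lo i) = ot i"
        if "i < Suc r" for i
      proof (cases "i = r")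
        case True
        then show ?thesis unfolding X' using r(3) by (simp add: sh_def)
      next
        case False
        then have "i < r" using that by simp
        then have "pt lo i \<noteq> 2 * j" "pt lo i \<noteq> 2 * j + 1" using r by (auto simp: pt_def)
        then show ?thesis unfolding X' using I \<open>i < r\<close> m(2) unfolding placed_def by auto
      qed
      have A3: "reals s' ''X'' a < reals s' ''X'' b" if "a < b" "b < 2 * Suc j" "even a \<or> a \<in> ?S" "even b \<or> b \<in> ?S" for a b
      proof -
        have la: "?X a < (?cur + sh) / 2 \<and> ?X a < sh" if "a < 2 * j"
          using le[OF that] \<open>even a \<or> a \<in> ?S\<close> cs by (auto simp: field_simps)
        from b2[OF that(2)] show ?thesis
        proof (elim disjE)
          assume "b < 2 * j" then show ?thesis using mono[of a b] that unfolding X' by auto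
        next
          assume "b = 2 * j" then show ?thesis using la that unfolding X' by auto
        next
          assume "b = 2 * j + 1"
          then have "a < 2 * j \<or> a = 2 * j" using that by auto
          then show ?thesis using la \<open>b = 2 * j + 1\<close> cs unfolding X' by (auto simp: field_simps)
        qed
      qed
      have A4: "reals s' ''X'' a \<le> reals s' ''cur'' 0" if "a < 2 * Suc j" "even a \<or> a \<in> ?S" for a
      proof -
        have "?X a \<le> sh" if "a < 2 * j" using le[OF that] \<open>even a \<or> a \<in> ?S\<close> cs by simp
        then show ?thesis using b2[OF that(1)] cs unfolding X' by (auto simp: field_simps)
      qed
      have A5: "base_links ?S (Suc j) (nats s' ''n'') (nats s' ''q'')"
        unfolding base_links_def
      proof (intro allI impI)
        fix k assume "k < Suc j"
        then consider "k < j" | "k = j" by linarith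
        then show "if 2 * k + 1 \<in> ?S
            then nats s' ''n'' (2 * k) = 2 * k + 1 \<and> nats s' ''q'' (2 * k + 1) = 2 * k \<and> nats s' ''n'' (2 * k + 1) = 2 * k + 2 \<and> nats s' ''q'' (2 * k + 2) = 2 * k + 1
            else nats s' ''n'' (2 * k) = 2 * k + 2 \<and> nats s' ''q'' (2 * k + 2) = 2 * k"
        proof cases
          case 1
          then have "2 * k \<noteq> 2 * j" "2 * k \<noteq> 2 * j + 1" "2 * k + 1 \<noteq> 2 * j" "2 * k + 1 \<noteq> 2 * j + 1" "2 * k + 1 \<noteq> 2 * j + 2"
            "2 * k + 2 \<noteq> 2 * j + 1" "2 * k + 2 \<noteq> 2 * j + 2" by presburger+
          moreover have "if 2 * k + 1 \<in> ?S
            then ?n (2 * k) = 2 * k + 1 \<and> ?q (2 * k + 1) = 2 * k \<and> ?n (2 * k + 1) = 2 * k + 2 \<and> ?q (2 * k + 2) = 2 * k + 1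
            else ?n (2 * k) = 2 * k + 2 \<and> ?q (2 * k + 2) = 2 * k" using bl 1 unfolding base_links_def by blast
          ultimately show ?thesis unfolding X' by (simp split: if_splits)
        next
          case 2
          then show ?thesis using True unfolding X' by simp
        qed
      qed
      have A6: "\<not> Suc j \<le> lo" using lj by simp
      have A7: "lo < Suc j \<and> Suc j < lo + N \<longrightarrow> reals s' ''cur'' 0 = x (ot (Suc j - lo - 1)) + eps * y (ot (Suc j - lo - 1))"
        unfolding X'(2) sh_def r_def using lj by simp
      show ?thesis unfolding placed_def m upd_simps(2)
      proof (intro conjI)
        show "nats (nupd ''j'' 0 (Suc j) s') ''z'' 0 = Suc r" using X'(5) by simp
        show "\<forall>i<Suc r. reals s' ''X'' (pt lo i) = x (ot i) + eps * y (ot i) \<and>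
          reals s' ''Y'' (pt lo i) = y (ot i) \<and> nats (nupd ''j'' 0 (Suc j) s') ''p'' (pt lo i) = ot i" using A2 by simp
        show "base_links ?S (Suc j) (nats (nupd ''j'' 0 (Suc j) s') ''n'') (nats (nupd ''j'' 0 (Suc j) s') ''q'')" using A5 by simp
      qed (use A3 A4 A6 A7 in blast)+
    qed
    moreover have "nats s' ''j'' 0 = j" by (simp add: s'_def j)
    ultimately show ?thesis unfolding runs_def wp_def by blast
  qed
qed

text \<open>The last clause puts every sentinel under every line through two points. This makes hull
  edges between points independent of the sentinels.\<close>

definition geometry :: "nat \<Rightarrow> nat \<Rightarrow> nat \<Rightarrow> (nat \<Rightarrow> real) \<Rightarrow> (nat \<Rightarrow> real) \<Rightarrow> (nat \<Rightarrow> nat) \<Rightarrow> ram \<Rightarrow> real \<Rightarrow> real \<Rightarrow> bool" where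
  "geometry D lo N x y ot s H eps \<longleftrightarrow>
     lev (reals s ''X'') (reals s ''Y'') (gapset D) (pt lo ` {..<N}) H D \<and> 0 < eps \<and>
     (\<forall>r<N. reals s ''X'' (pt lo r) = x (ot r) + eps * y (ot r) \<and> reals s ''Y'' (pt lo r) = y (ot r) \<and> nats s ''p'' (pt lo r) = ot r) \<and>
     (\<forall>j\<in>pt lo ` {..<N}. \<forall>k\<in>pt lo ` {..<N}. \<forall>g\<in>gapset D. j < k \<longrightarrow> ori (reals s ''X'') (reals s ''Y'') j k g < 0)"

lemma place_runs:
  assumes s: "nats s0 ''N'' 0 = N" "nats s0 ''lo'' 0 = lo" "nats s0 ''P'' 0 = 2 ^ D" "nats s0 ''E'' 0 = wd D"
      "nats s0 ''o'' = ot" "reals s0 ''kx'' = x" "reals s0 ''ky'' = y"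
      "reals s0 ''pr'' 0 = 2 ^ D" "reals s0 ''Q'' 0 = Q" "reals s0 ''ep'' 0 = e" "reals s0 ''eps'' 0 = eps"
    and g: "gauged N x y ot Q e" and so: "sorted_out N (lex x y) ot" and eps: "eps = e / (2 * Q)"
    and loP: "lo + N \<le> 2 ^ D" and N1: "1 \<le> N"
  shows "runs place s0 (2 ^ D * 260 + 200) (\<lambda>s'. (\<exists>H. geometry D lo N x y ot s' H eps) \<and>
    base_links (pt lo ` {..<N}) (2 ^ D) (nats s' ''n'') (nats s' ''q''))"
proof -
  let ?S = "pt lo ` {..<N}"
  note sh = gauged_shear[OF g so eps]
  have e0: "0 < e" using g by (simp add: gauged_def)
  have inc: "x (ot r) + eps * y (ot r) < x (ot (Suc r)) + eps * y (ot (Suc r))" if "Suc r < N" for r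
    using sh(5)[of r "Suc r"] that mult_pos_pos[OF e0 sh(1)] by linarith
  let ?F1 = "For ''j'' (NV ''P'') place1"
  let ?F2 = "For ''j'' (NAdd (NV ''P'') (NLit 1)) (RSet ''Y'' (NAdd (NV ''j'') (NV ''j'')) (RSub (RLit 0) (RV ''H'')))"
  let ?cur = "x (ot 0) + eps * y (ot 0) - 2 ^ D - 1"
  define s1 where "s1 = nupd ''j'' 0 0 (nupd ''z'' 0 0 (rupd ''cur'' 0 ?cur (nupd ''i'' 0 (ot 0) s0)))"
  have R1: "runs (''i'' ::= NGet ''o'' (NLit 0) ;; ''cur'' ::=r RSub (RSub shE (RV ''pr'')) (RLit 1) ;;
     ''z'' ::= NLit 0 ;; ''j'' ::= NLit 0) s0 40 (\<lambda>s'. s' = s1)"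
    by (simp add: runs_def wp_simps s1_def shE_def s)
  have R2: "runs ?F1 s1 (2 ^ D * 220 + 20) (\<lambda>s'. placed N (2 ^ D) lo x y ot eps (2 ^ D) (2 ^ D) s' \<and> nats s' ''j'' 0 = 2 ^ D)"
  proof (rule runs_For[where T = "\<lambda>_. 200" and lo = 0 and I = "placed N (2 ^ D) lo x y ot eps (2 ^ D)"])
    show "placed N (2 ^ D) lo x y ot eps (2 ^ D) 0 s1" by (auto simp: placed_def s1_def base_links_def)
  next
    fix k s' assume "agree ?F1 s1 s'"
    from agreeN[OF this] show "nval (NV ''P'') s' = 2 ^ D" using s by (simp add: s1_def)
  next
    fix k s' assume I: "placed N (2 ^ D) lo x y ot eps (2 ^ D) k s'" and ag: "agree ?F1 s1 s'" and k: "k < 2 ^ D" "nats s' ''j'' 0 = k"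
    have fr: "nats s' ''N'' 0 = N" "nats s' ''lo'' 0 = lo" "nats s' ''o'' = ot" "reals s' ''kx'' = x" "reals s' ''ky'' = y" "reals s' ''eps'' 0 = eps"
      using agreeN[OF ag] agreeR[OF ag] s by (simp_all add: s1_def)
    show "runs place1 s' 200 (\<lambda>s''. nats s'' ''j'' 0 = k \<and> placed N (2 ^ D) lo x y ot eps (2 ^ D) (Suc k) (nupd ''j'' 0 (Suc k) s''))"
      using placed_step[OF I k fr _ loP inc] by simp
  qed (simp_all add: s1_def)
  have "runs ((''i'' ::= NGet ''o'' (NLit 0) ;; ''cur'' ::=r RSub (RSub shE (RV ''pr'')) (RLit 1) ;;
     ''z'' ::= NLit 0 ;; ''j'' ::= NLit 0) ;; ?F1 ;;
     (RSet ''X'' (NV ''E'') (RAdd (RV ''cur'') (RLit 1)) ;;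
     ''H'' ::=r RAdd (RAdd (RLit 1) (RV ''Q''))
        (RDiv (RMul (RV ''Q'') (RSub (RGet ''X'' (NV ''E'')) (RGet ''X'' (NLit 0)))) (RMul (RV ''ep'') (RV ''eps''))) ;;
     ''j'' ::= NLit 0) ;; ?F2) s0 (2 ^ D * 260 + 200) (\<lambda>s'. (\<exists>H. geometry D lo N x y ot s' H eps) \<and>
        base_links ?S (2 ^ D) (nats s' ''n'') (nats s' ''q''))"
  proof (rule runs_Seq[OF R1, where ?T2.0 = "2 ^ D * 250 + 150"], simp only:, rule runs_Seq_agree[OF R2])
    fix s2 assume s2: "placed N (2 ^ D) lo x y ot eps (2 ^ D) (2 ^ D) s2 \<and> nats s2 ''j'' 0 = 2 ^ D" and ag2: "agree ?F1 s1 s2"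
    have fr2: "nats s2 ''E'' 0 = wd D" "reals s2 ''Q'' 0 = Q" "reals s2 ''ep'' 0 = e" "reals s2 ''eps'' 0 = eps" "nats s2 ''P'' 0 = 2 ^ D"
      using agreeN[OF ag2] agreeR[OF ag2] s by (simp_all add: s1_def)
    let ?X = "(reals s2 ''X'')(wd D := reals s2 ''cur'' 0 + 1)"
    define H where "H = 1 + Q + Q * (?X (wd D) - ?X 0) / (e * eps)"
    define s3 where "s3 = nupd ''j'' 0 0 (rupd ''H'' 0 H (rupd ''X'' (wd D) (reals s2 ''cur'' 0 + 1) s2))"
    have wdD: "wd D = 2 * 2 ^ D" by (simp add: wd_def)
    have R3: "runs (RSet ''X'' (NV ''E'') (RAdd (RV ''cur'') (RLit 1)) ;;
     ''H'' ::=r RAdd (RAdd (RLit 1) (RV ''Q''))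
        (RDiv (RMul (RV ''Q'') (RSub (RGet ''X'' (NV ''E'')) (RGet ''X'' (NLit 0)))) (RMul (RV ''ep'') (RV ''eps''))) ;;
     ''j'' ::= NLit 0) s2 60 (\<lambda>s'. s' = s3)"
      by (simp add: runs_def wp_simps s3_def fr2 H_def)
    let ?J = "\<lambda>k s. (\<forall>j<k. reals s ''Y'' (2 * j) = - H) \<and> (\<forall>z. odd z \<longrightarrow> reals s ''Y'' z = reals s2 ''Y'' z)"
    have R4: "runs ?F2 s3 (2 ^ D * 30 + 60) (\<lambda>s'. ?J (2 ^ D + 1) s' \<and> nats s' ''j'' 0 = 2 ^ D + 1)"
    proof (rule runs_For[where T = "\<lambda>_. 15" and lo = 0 and I = ?J])
      fix k s' assume "agree ?F2 s3 s'"
      from agreeN[OF this] show "nval (NAdd (NV ''P'') (NLit 1)) s' = 2 ^ D + 1" using fr2 by (simp add: s3_def)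
    next
      fix k s' assume J: "?J k s'" and ag: "agree ?F2 s3 s'" and k: "nats s' ''j'' 0 = k"
      have "reals s' ''H'' 0 = H" using agreeR[OF ag] by (simp add: s3_def)
      then show "runs (RSet ''Y'' (NAdd (NV ''j'') (NV ''j'')) (RSub (RLit 0) (RV ''H''))) s' 15
        (\<lambda>s''. nats s'' ''j'' 0 = k \<and> ?J (Suc k) (nupd ''j'' 0 (Suc k) s''))"
        using J k by (auto simp: runs_def wp_simps less_Suc_eq mult_2)
    qed (simp_all add: s3_def)
    show "runs ((RSet ''X'' (NV ''E'') (RAdd (RV ''cur'') (RLit 1)) ;;
     ''H'' ::=r RAdd (RAdd (RLit 1) (RV ''Q''))
        (RDiv (RMul (RV ''Q'') (RSub (RGet ''X'' (NV ''E'')) (RGet ''X'' (NLit 0)))) (RMul (RV ''ep'') (RV ''eps''))) ;;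
     ''j'' ::= NLit 0) ;; ?F2) s2 (2 ^ D * 30 + 130) (\<lambda>s'. (\<exists>H. geometry D lo N x y ot s' H eps) \<and>
        base_links ?S (2 ^ D) (nats s' ''n'') (nats s' ''q''))"
    proof (rule runs_Seq[OF R3, where ?T2.0 = "2 ^ D * 30 + 60"], simp only:, rule runs_conseq[OF runs_agree[OF R4]])
      fix s4 assume s4: "(?J (2 ^ D + 1) s4 \<and> nats s4 ''j'' 0 = 2 ^ D + 1) \<and> agree ?F2 s3 s4"
      note ag4 = conjunct2[OF s4]
      have fr4: "reals s4 ''X'' = ?X" "nats s4 ''n'' = nats s2 ''n''" "nats s4 ''q'' = nats s2 ''q''" "nats s4 ''p'' = nats s2 ''p''"
        using agreeN[OF ag4] agreeR[OF ag4] by (simp_all add: s3_def)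
      have mn: "min N (2 ^ D - lo) = N" using loP by simp
      have pts: "reals s2 ''X'' (pt lo r) = x (ot r) + eps * y (ot r) \<and> reals s2 ''Y'' (pt lo r) = y (ot r) \<and> nats s2 ''p'' (pt lo r) = ot r"
        if "r < N" for r using s2 that unfolding placed_def mn by blast
      have podd: "odd (pt lo r)" "pt lo r < wd D" if "r < N" for r using that loP by (auto simp: pt_def wdD)
      have Xp: "reals s4 ''X'' (pt lo r) = x (ot r) + eps * y (ot r)" "reals s4 ''Y'' (pt lo r) = y (ot r)" if "r < N" for r
        using pts[OF that] podd[OF that] s4 unfolding fr4 by auto
      have Yg: "reals s4 ''Y'' g = - H" if "g \<in> gapset D" for g
      proof -
        obtain j where "g = 2 * j" using \<open>g \<in> gapset D\<close> by (auto simp: gapset_def elim: evenE)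
        moreover have "j < 2 ^ D + 1" using \<open>g \<in> gapset D\<close> \<open>g = 2 * j\<close> by (auto simp: gapset_def wdD)
        ultimately show ?thesis using s4 by blast
      qed
      have used: "even a \<or> a \<in> ?S" "a \<le> wd D" if "a \<in> gapset D \<union> ?S" for a
        using that podd(2) by (auto simp: gapset_def intro: less_imp_le)
      have mono: "reals s4 ''X'' a < reals s4 ''X'' b" if "a \<in> gapset D \<union> ?S" "b \<in> gapset D \<union> ?S" "a < b" for a b
      proof (cases "b = wd D")
        case True
        then have "reals s2 ''X'' a \<le> reals s2 ''cur'' 0" using s2 used[OF that(1)] that(3) unfolding placed_def wdD by blast
        then show ?thesis using True that unfolding fr4 by simp
      next
        case False
        then have "b < wd D" using used(2)[OF that(2)] by simp
        then have "reals s2 ''X'' a < reals s2 ''X'' b" using s2 used(1)[OF that(1)] used(1)[OF that(2)] that(3) unfolding placed_def wdD by blast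
        then show ?thesis using False that \<open>b < wd D\<close> unfolding fr4 by simp
      qed
      have g0: "0 \<in> gapset D" "wd D \<in> gapset D" by (auto simp: gapset_def wdD)
      have rng: "?X 0 \<le> reals s4 ''X'' a" "reals s4 ''X'' a \<le> ?X (wd D)" if "a \<in> gapset D \<union> ?S" for a
        using mono[of 0 a] mono[of a "wd D"] used[OF that] that g0 unfolding fr4 by (cases "a = 0"; cases "a = wd D"; force)+
      define xr where "xr = ?X (wd D) - ?X 0"
      have xr0: "0 \<le> xr" using rng[of 0] g0 by (simp add: xr_def fr4)
      have dm: "0 < e * eps" using e0 sh(1) by simp
      have Q0: "0 \<le> Q" using sh(2) by simp
      have Hd: "H = 1 + Q + Q * xr / (e * eps)" by (simp add: H_def xr_def)
      have H1: "1 + Q \<le> H" unfolding Hd using Q0 xr0 dm by simp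
      \<comment> \<open>Two points are at least \<open>e * eps\<close> apart horizontally and at
        most \<open>Q\<close> vertically, and \<open>xr\<close> is the total width. The summand
        \<open>Q * xr / (e * eps)\<close> in \<open>H\<close> outweighs the steepest possible line
        over the whole width; the summand \<open>1 + Q\<close> covers the ordinate of
        \<open>j\<close> with room to spare.\<close>
      have far: "ori (reals s4 ''X'') (reals s4 ''Y'') j k gg < 0"
        if jk: "j \<in> ?S" "k \<in> ?S" "gg \<in> gapset D" "j < k" for j k gg
      proof -
        obtain r r' where r: "j = pt lo r" "k = pt lo r'" "r < N" "r' < N" using jk by auto
        have rr: "r < r'" using jk(4) r by (simp add: pt_def)
        let ?x = "reals s4 ''X''" and ?y = "reals s4 ''Y''"
        have d1: "e * eps \<le> ?x k - ?x j" using sh(5)[OF rr r(4)] Xp r by simp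
        have d2: "\<bar>?y k - ?y j\<bar> \<le> Q" using sh(4)[OF rr r(4)] Xp r by simp
        have d3: "\<bar>?x gg - ?x j\<bar> \<le> xr" using rng[of gg] rng[of j] jk unfolding xr_def by (simp add: abs_le_iff)
        have d4: "\<bar>?y j\<bar> \<le> Q" using sh(3)[OF r(3)] Xp r by simp
        have "\<bar>(?y k - ?y j) * (?x gg - ?x j)\<bar> \<le> Q * xr"
          unfolding abs_mult using d2 d3 Q0 by (intro mult_mono) auto
        then have b1: "- ((?y k - ?y j) * (?x gg - ?x j)) \<le> Q * xr" by linarith
        have b2: "1 + Q * xr / (e * eps) \<le> H + ?y j" using Hd d4 by linarith
        have "(e * eps) * (1 + Q * xr / (e * eps)) \<le> (?x k - ?x j) * (H + ?y j)"
          using d1 b2 dm Q0 xr0 by (intro mult_mono) auto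
        moreover have "(e * eps) * (1 + Q * xr / (e * eps)) = e * eps + Q * xr"
          using e0 sh(1) by (simp add: field_simps)
        ultimately have "e * eps + Q * xr \<le> (?x k - ?x j) * (H + ?y j)" by linarith
        moreover have "ori ?x ?y j k gg = - ((?x k - ?x j) * (H + ?y j)) - (?y k - ?y j) * (?x gg - ?x j)"
          unfolding ori_def Yg[OF jk(3)] by (simp add: algebra_simps)
        ultimately show ?thesis using b1 dm by linarith
      qed
      have "lev (reals s4 ''X'') (reals s4 ''Y'') (gapset D) ?S H D"
      proof unfold_locales
        show "reals s4 ''X'' i < reals s4 ''X'' j" if "i \<in> gapset D \<union> ?S" "j \<in> gapset D \<union> ?S" "i < j" for i j
          using mono that by blast
        show "reals s4 ''Y'' g = - H" if "g \<in> gapset D" for g using Yg that .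
        show "- H < reals s4 ''Y'' p" if p: "p \<in> ?S" for p
        proof -
          obtain r where "p = pt lo r" "r < N" using p by auto
          then show ?thesis using sh(3)[of r] Xp(2)[of r] H1 by (simp add: abs_le_iff)
        qed
        show "gapset D = {g. even g \<and> g \<le> wd D}" by (simp add: gapset_def)
        show "?S \<subseteq> {i. odd i \<and> i < wd D}" using podd by auto
      qed
      then have "geometry D lo N x y ot s4 H eps"
        unfolding geometry_def using far sh(1) Xp pts fr4(4) by simp
      moreover have "base_links ?S (2 ^ D) (nats s4 ''n'') (nats s4 ''q'')" using s2 unfolding fr4 placed_def by blast
      ultimately show "(\<exists>H. geometry D lo N x y ot s4 H eps) \<and> base_links ?S (2 ^ D) (nats s4 ''n'') (nats s4 ''q'')" by blast
    qed simp_all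
  qed simp_all
  then show ?thesis unfolding place_def runs_def by (simp add: wp_simps add.assoc)
qed

section \<open>A full pass, and the dimensions of the hierarchy\<close>

definition pass :: com where
  "pass = (sort_pts ;; gauge ;; place ;; build)"

lemma pass_mods [simp]:
  "nmods pass = {''v'', ''f'', ''z'', ''o'', ''u'', ''l'', ''r'', ''t'', ''i'', ''a'', ''c'', ''e'', ''p'', ''n'', ''q'', ''j'',
     ''d'', ''b0'', ''b'', ''w'', ''m'', ''g'', ''s'', ''done'', ''x'', ''y''}"
  "rmods pass = {''Q'', ''ep'', ''eps'', ''dv'', ''nx'', ''X'', ''Y'', ''cur'', ''H''}"
  by (auto simp: pass_def)

definition sized :: "nat \<Rightarrow> nat \<Rightarrow> nat \<Rightarrow> ram \<Rightarrow> bool" where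
  "sized D lo N s \<longleftrightarrow> nats s ''N'' 0 = N \<and> nats s ''lo'' 0 = lo \<and> nats s ''P'' 0 = 2 ^ D \<and> nats s ''E'' 0 = wd D \<and>
     nats s ''W'' 0 = wd D + 1 \<and> nats s ''D'' 0 = D \<and> reals s ''pr'' 0 = 2 ^ D"

definition arranged :: "nat \<Rightarrow> nat \<Rightarrow> nat \<Rightarrow> (nat \<Rightarrow> real) \<Rightarrow> (nat \<Rightarrow> real) \<Rightarrow> (nat \<Rightarrow> nat) \<Rightarrow> real \<Rightarrow> real \<Rightarrow> ram \<Rightarrow> bool" where
  "arranged D lo N x y ot H eps s \<longleftrightarrow> sorted_out N (lex x y) ot \<and> geometry D lo N x y ot s H eps \<and>
     lev.treeok (reals s ''X'') (reals s ''Y'') D s (pt lo ` {..<N}) \<and>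
     lev.bridge (reals s ''X'') (reals s ''Y'') D (pt lo ` {..<N}) (nats s ''a'' 0) (nats s ''c'' 0)"

lemma pass_runs:
  assumes s: "sized D lo N s0" "reals s0 ''kx'' = x" "reals s0 ''ky'' = y"
    and dist: "lex_distinct N x y" and loP: "lo + N \<le> 2 ^ D" and N1: "1 \<le> N" and D1: "1 \<le> D"
  shows "runs pass s0 (2500 * D * 2 ^ D) (\<lambda>s'. \<exists>ot H eps. arranged D lo N x y ot H eps s')"
proof -
  interpret lex_distinct N x y by (rule dist)
  let ?S = "pt lo ` {..<N}"
  have sz: "nats s0 ''N'' 0 = N" "nats s0 ''lo'' 0 = lo" "nats s0 ''P'' 0 = 2 ^ D" "nats s0 ''E'' 0 = wd D"
    "nats s0 ''W'' 0 = wd D + 1" "nats s0 ''D'' 0 = D" "reals s0 ''pr'' 0 = 2 ^ D"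
    using s(1) by (auto simp: sized_def)
  let ?Q = "\<lambda>s'. \<exists>ot H eps. arranged D lo N x y ot H eps s'"
  let ?t1 = "N * (100 * floor_log (2 * N) + 300) + 100"
  have "runs pass s0 (?t1 + ((N * 120 + 60) + ((2 ^ D * 260 + 200) + (D * (450 * wd D + 100) + 50)))) ?Q"
    unfolding pass_def
  proof (rule runs_Seq_agree[OF sort_runs[OF sz(1) s(2,3) N1] _ order.refl])
    fix s1 assume o1: "sorted_out N ls (nats s1 ''o'')" and ag1: "agree sort_pts s0 s1"
    have f1: "nats s1 ''N'' 0 = N" "nats s1 ''lo'' 0 = lo" "nats s1 ''P'' 0 = 2 ^ D" "nats s1 ''E'' 0 = wd D"
      "nats s1 ''W'' 0 = wd D + 1" "nats s1 ''D'' 0 = D" "reals s1 ''pr'' 0 = 2 ^ D" "reals s1 ''kx'' = x" "reals s1 ''ky'' = y"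
      using agreeN[OF ag1] agreeR[OF ag1] s sz by simp_all
    show "runs (gauge ;; place ;; build) s1 ((N * 120 + 60) + ((2 ^ D * 260 + 200) + (D * (450 * wd D + 100) + 50))) ?Q"
    proof (rule runs_Seq_agree[OF gauge_runs[OF f1(1) refl f1(8,9) o1] _ order.refl])
      fix s2 assume g2: "gauged N x y (nats s1 ''o'') (reals s2 ''Q'' 0) (reals s2 ''ep'' 0) \<and>
         reals s2 ''eps'' 0 = reals s2 ''ep'' 0 / (2 * reals s2 ''Q'' 0)" and ag2: "agree gauge s1 s2"
      have f2: "nats s2 ''N'' 0 = N" "nats s2 ''lo'' 0 = lo" "nats s2 ''P'' 0 = 2 ^ D" "nats s2 ''E'' 0 = wd D"
        "nats s2 ''W'' 0 = wd D + 1" "nats s2 ''D'' 0 = D" "reals s2 ''pr'' 0 = 2 ^ D" "reals s2 ''kx'' = x" "reals s2 ''ky'' = y"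
        "nats s2 ''o'' = nats s1 ''o''"
        using agreeN[OF ag2] agreeR[OF ag2] f1 by simp_all
      show "runs (place ;; build) s2 ((2 ^ D * 260 + 200) + (D * (450 * wd D + 100) + 50)) ?Q"
      proof (rule runs_Seq_agree[OF place_runs[OF f2(1-4,10,8,9,7) refl refl refl conjunct1[OF g2] o1 conjunct2[OF g2] loP N1] _ order.refl])
        fix s3 assume "(\<exists>H. geometry D lo N x y (nats s1 ''o'') s3 H (reals s2 ''eps'' 0)) \<and>
          base_links ?S (2 ^ D) (nats s3 ''n'') (nats s3 ''q'')" and ag3: "agree place s2 s3"
        then obtain H where H: "geometry D lo N x y (nats s1 ''o'') s3 H (reals s2 ''eps'' 0)"
          and bl: "base_links ?S (2 ^ D) (nats s3 ''n'') (nats s3 ''q'')" by blast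
        interpret lev "reals s3 ''X''" "reals s3 ''Y''" "gapset D" ?S H D using H by (simp add: geometry_def)
        have f3: "nats s3 ''W'' 0 = W" "nats s3 ''D'' 0 = D" "nats s3 ''E'' 0 = wd D"
          using agreeN[OF ag3] f2 by (simp_all add: W_def)
        show "runs build s3 (D * (450 * wd D + 100) + 50) ?Q"
        proof (rule runs_conseq[OF runs_agree[OF build_runs[OF base_level[OF bl] D1 f3 refl refl]]])
          fix s4 assume s4: "(treeok s4 ?S \<and> bridge ?S (nats s4 ''a'' 0) (nats s4 ''c'' 0)) \<and> agree build s3 s4"
          note ag4 = conjunct2[OF s4]
          have f4: "reals s4 ''X'' = reals s3 ''X''" "reals s4 ''Y'' = reals s3 ''Y''" "nats s4 ''p'' = nats s3 ''p''"
            using agreeN[OF ag4] agreeR[OF ag4] by simp_all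
          have "arranged D lo N x y (nats s1 ''o'') H (reals s2 ''eps'' 0) s4"
            unfolding arranged_def geometry_def f4 using H[unfolded geometry_def] s4 o1 by simp
          then show "?Q s4" by blast
        qed simp
      qed
    qed
  qed
  moreover have "?t1 + ((N * 120 + 60) + ((2 ^ D * 260 + 200) + (D * (450 * wd D + 100) + 50))) \<le> 2500 * D * 2 ^ D"
  proof -
    have NP: "N \<le> 2 ^ D" using loP by simp
    then have "floor_log (2 * N) \<le> floor_log (2 ^ Suc D)" by (intro floor_log_le_iff) simp
    then have fl: "100 * floor_log (2 * N) + 300 \<le> 100 * D + 400" by (simp only: floor_log_power)
    have a: "N * (100 * floor_log (2 * N) + 300) \<le> 2 ^ D * (100 * D + 400)" using NP fl by (rule mult_le_mono)
    have b: "2 \<le> (2::nat) ^ D" using D1 by (metis One_nat_def Suc_le_D one_le_power power_Suc mult_le_mono2 mult.right_neutral one_le_numeral)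
    have c: "2 ^ D \<le> D * 2 ^ D" "D * 2 \<le> D * 2 ^ D" "2 \<le> D * 2 ^ D" using D1 b by (auto intro: order_trans[OF b])
    have w: "D * (450 * wd D + 100) = 900 * (D * 2 ^ D) + 100 * D" by (simp add: wd_def algebra_simps)
    have a': "N * (100 * floor_log (2 * N) + 300) \<le> 100 * (D * 2 ^ D) + 400 * 2 ^ D" using a by (simp add: algebra_simps)
    show ?thesis unfolding w using a' NP c by linarith
  qed
  ultimately show ?thesis by (rule runs_conseq) simp_all
qed

text \<open>\<open>M\<close> is a power of two that is at least the size of either colour class.
  Leaving \<open>M - R\<close> slots empty in front lets the last red point end the left half and
  the first blue point begin the right half, so the middle sentinel separates the colours.
  \<open>pr\<close> is doubled along as the real counterpart of the slot number.\<close>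

definition sizes :: com where
  "sizes =
    (''R'' ::= NV ''red_count'' ;; ''B'' ::= NV ''blue_count'' ;; ''N'' ::= NAdd (NV ''R'') (NV ''B'') ;;
     ''M'' ::= NLit 1 ;; ''D'' ::= NLit 1 ;; ''pr'' ::=r RLit 2 ;;
     While (BNot (BAnd (BNot (NLess (NV ''M'') (NV ''R''))) (BNot (NLess (NV ''M'') (NV ''B'')))))
       (''M'' ::= NAdd (NV ''M'') (NV ''M'') ;; ''D'' ::= NAdd (NV ''D'') (NLit 1) ;; ''pr'' ::=r RAdd (RV ''pr'') (RV ''pr'')) ;;
     ''P'' ::= NAdd (NV ''M'') (NV ''M'') ;; ''E'' ::= NAdd (NV ''P'') (NV ''P'') ;;
     ''W'' ::= NAdd (NV ''E'') (NLit 1) ;; ''lo'' ::= NSub (NV ''M'') (NV ''R''))"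

lemma sizes_mods [simp]:
  "nmods sizes = {''R'', ''B'', ''N'', ''M'', ''D'', ''P'', ''E'', ''W'', ''lo''}" "rmods sizes = {''pr''}"
  by (auto simp: sizes_def)

lemma sizes_runs:
  assumes s: "nats s0 ''red_count'' 0 = R" "nats s0 ''blue_count'' 0 = B" and N1: "1 \<le> R" "1 \<le> B"
  shows "runs sizes s0 (100 * (R + B) + 100) (\<lambda>s'. \<exists>D. 1 \<le> D \<and> sized D (2 ^ (D - 1) - R) (R + B) s' \<and> R \<le> 2 ^ (D - 1) \<and> B \<le> 2 ^ (D - 1) \<and>
     2 ^ D \<le> 4 * (R + B) \<and> nats s' ''R'' 0 = R \<and> nats s' ''B'' 0 = B)"
proof -
  let ?b = "BNot (BAnd (BNot (NLess (NV ''M'') (NV ''R''))) (BNot (NLess (NV ''M'') (NV ''B''))))"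
  let ?c = "''M'' ::= NAdd (NV ''M'') (NV ''M'') ;; ''D'' ::= NAdd (NV ''D'') (NLit 1) ;; ''pr'' ::=r RAdd (RV ''pr'') (RV ''pr'')"
  define s1 where "s1 = rupd ''pr'' 0 2 (nupd ''D'' 0 1 (nupd ''M'' 0 1 (nupd ''N'' 0 (R + B) (nupd ''B'' 0 B (nupd ''R'' 0 R s0)))))"
  have R1: "runs (''R'' ::= NV ''red_count'' ;; ''B'' ::= NV ''blue_count'' ;; ''N'' ::= NAdd (NV ''R'') (NV ''B'') ;;
     ''M'' ::= NLit 1 ;; ''D'' ::= NLit 1 ;; ''pr'' ::=r RLit 2) s0 30 (\<lambda>s'. s' = s1)"
    by (simp add: runs_def wp_simps s1_def s)
  let ?I = "\<lambda>s. \<exists>k. nats s ''D'' 0 = Suc k \<and> nats s ''M'' 0 = 2 ^ k \<and> reals s ''pr'' 0 = 2 ^ Suc k \<and> 2 ^ k \<le> 2 * (R + B)"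
  have R2: "runs (While ?b ?c) s1 (80 * (R + B) + 20) (\<lambda>s. ?I s \<and> R \<le> nats s ''M'' 0 \<and> B \<le> nats s ''M'' 0)"
  proof (rule runs_While[where I = ?I and \<mu> = "\<lambda>s. 40 * (2 * (R + B) - nats s ''M'' 0)"])
    show "?I s1" using N1 by (intro exI[of _ 0]) (simp add: s1_def)
    fix s2 assume I: "?I s2" and ag: "agree ?c s1 s2"
    have f: "nats s2 ''R'' 0 = R" "nats s2 ''B'' 0 = B" using agreeN[OF ag] by (simp_all add: s1_def)
    show "?I s2 \<and> R \<le> nats s2 ''M'' 0 \<and> B \<le> nats s2 ''M'' 0" if "\<not> bval ?b s2" using that I f by auto
    assume "bval ?b s2"
    then have lt: "nats s2 ''M'' 0 < R + B" using f by auto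
    obtain k where k: "nats s2 ''D'' 0 = Suc k" "nats s2 ''M'' 0 = 2 ^ k" "reals s2 ''pr'' 0 = 2 ^ Suc k" using I by blast
    have k1: "1 \<le> (2::nat) ^ k" by simp
    show "\<exists>T. runs ?c s2 T (\<lambda>s''. ?I s'' \<and> 1 + bcost ?b + T + 40 * (2 * (R + B) - nats s'' ''M'' 0) \<le> 40 * (2 * (R + B) - nats s2 ''M'' 0))"
    proof (intro exI[of _ 22])
      have "2 ^ k + 2 ^ k \<le> 2 * (R + B)" using lt k by simp
      then have "40 + 40 * (2 * (R + B) - (2 ^ k + 2 ^ k)) \<le> 40 * (2 * (R + B) - 2 ^ k)" using k1 by linarith
      moreover have "\<exists>ka. Suc k = ka \<and> 2 ^ k + 2 ^ k = (2::nat) ^ ka \<and> 2 ^ Suc k + 2 ^ Suc k = (2::real) ^ Suc ka \<and> 2 ^ ka \<le> 2 * (R + B)"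
        using lt k by simp
      ultimately show "runs ?c s2 22 (\<lambda>s''. ?I s'' \<and> 1 + bcost ?b + 22 + 40 * (2 * (R + B) - nats s'' ''M'' 0) \<le> 40 * (2 * (R + B) - nats s2 ''M'' 0))"
        by (simp add: runs_def wp_simps k)
    qed
  qed (simp add: s1_def)
  let ?d = "''P'' ::= NAdd (NV ''M'') (NV ''M'') ;; ''E'' ::= NAdd (NV ''P'') (NV ''P'') ;;
     ''W'' ::= NAdd (NV ''E'') (NLit 1) ;; ''lo'' ::= NSub (NV ''M'') (NV ''R'')"
  have "runs ((''R'' ::= NV ''red_count'' ;; ''B'' ::= NV ''blue_count'' ;; ''N'' ::= NAdd (NV ''R'') (NV ''B'') ;;
     ''M'' ::= NLit 1 ;; ''D'' ::= NLit 1 ;; ''pr'' ::=r RLit 2) ;; While ?b ?c ;; ?d) s0 (100 * (R + B) + 100)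
    (\<lambda>s'. \<exists>D. 1 \<le> D \<and> sized D (2 ^ (D - 1) - R) (R + B) s' \<and> R \<le> 2 ^ (D - 1) \<and> B \<le> 2 ^ (D - 1) \<and>
     2 ^ D \<le> 4 * (R + B) \<and> nats s' ''R'' 0 = R \<and> nats s' ''B'' 0 = B)"
  proof (rule runs_Seq[OF R1, where ?T2.0 = "80 * (R + B) + 60"], simp only:, rule runs_Seq_agree[OF R2, where ?T2.0 = 40])
    fix s2 assume s2: "?I s2 \<and> R \<le> nats s2 ''M'' 0 \<and> B \<le> nats s2 ''M'' 0" and ag: "agree (While ?b ?c) s1 s2"
    have f: "nats s2 ''R'' 0 = R" "nats s2 ''B'' 0 = B" "nats s2 ''N'' 0 = R + B" using agreeN[OF ag] by (simp_all add: s1_def)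
    obtain k where k: "nats s2 ''D'' 0 = Suc k" "nats s2 ''M'' 0 = 2 ^ k" "reals s2 ''pr'' 0 = 2 ^ Suc k" "2 ^ k \<le> 2 * (R + B)"
      "R \<le> 2 ^ k" "B \<le> 2 ^ k" using s2 by auto
    show "runs ?d s2 40 (\<lambda>s'. \<exists>D. 1 \<le> D \<and> sized D (2 ^ (D - 1) - R) (R + B) s' \<and> R \<le> 2 ^ (D - 1) \<and> B \<le> 2 ^ (D - 1) \<and>
     2 ^ D \<le> 4 * (R + B) \<and> nats s' ''R'' 0 = R \<and> nats s' ''B'' 0 = B)"
      unfolding runs_def wp_simps sized_def using k f by (intro conjI exI[of _ "Suc k"]) (simp_all add: wd_def)
  qed simp_all
  then show ?thesis unfolding sizes_def runs_def by (simp add: wp_simps add.assoc)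
qed

section \<open>Finding the separating direction\<close>

text \<open>The abscissa without the shear, fetched through the original number of the
  point.\<close>

definition uE :: "string \<Rightarrow> rexp" where "uE z = RGet ''kx'' (NGet ''p'' (NV z))"

definition steeperE :: bexp where
  "steeperE = RLess (RMul (RSub (ry ''x'') (ry ''a'')) (RSub (rx ''y'') (rx ''c''))) (RMul (RSub (rx ''x'') (rx ''a'')) (RSub (ry ''y'') (ry ''c'')))"

text \<open>One step of merging two hulls by decreasing slope, that is, of walking along the upper
  hull of their Minkowski sum. The sentinels \<open>P\<close> and \<open>E\<close> signal an
  exhausted list. The edge taken is the result if the sum of the unsheared abscissae reaches
  \<open>S\<close> on it.\<close>

definition turn_body :: com where
  "turn_body =
    (''x'' ::= NGet ''n'' (NAdd (NV ''b'') (NV ''a'')) ;; ''y'' ::= NGet ''n'' (NAdd (NV ''b'') (NV ''c'')) ;;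
     Cond (BAnd (NLess (NV ''x'') (NV ''P'')) (BNot (BAnd (NLess (NV ''y'') (NV ''E'')) steeperE)))
       (Cond (RLess (RAdd (uE ''x'') (uE ''c'')) (RV ''S'')) (''a'' ::= NV ''x'')
         (''num'' ::=r RSub (ry ''x'') (ry ''a'') ;; ''den'' ::=r RSub (uE ''x'') (uE ''a'') ;; ''done'' ::= NLit 1))
       (Cond (RLess (RAdd (uE ''a'') (uE ''y'')) (RV ''S'')) (''c'' ::= NV ''y'')
         (''num'' ::=r RSub (ry ''y'') (ry ''c'') ;; ''den'' ::=r RSub (uE ''y'') (uE ''c'') ;; ''done'' ::= NLit 1)))"

text \<open>The base address of level \<open>D - 1\<close> is formed by repeated addition. The two
  blocks of that level are the halves of the root.\<close>

definition turn :: com where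
  "turn =
    (''b'' ::= NLit 0 ;; ''d'' ::= NLit 1 ;; For ''d'' (NV ''D'') (''b'' ::= NAdd (NV ''b'') (NV ''W'')) ;;
     ''a'' ::= NGet ''n'' (NV ''b'') ;; ''c'' ::= NGet ''n'' (NAdd (NV ''b'') (NV ''P'')) ;; ''done'' ::= NLit 0 ;;
     While (NLess (NV ''done'') (NLit 1)) turn_body)"

lemma turn_mods [simp]:
  "nmods turn_body = {''x'', ''y'', ''a'', ''c'', ''done''}" "rmods turn_body = {''num'', ''den''}"
  "nmods turn = {''b'', ''d'', ''x'', ''y'', ''a'', ''c'', ''done''}" "rmods turn = {''num'', ''den''}"
  by (auto simp: turn_body_def turn_def)

text \<open>Adds that the sentinels are far enough below, and that \<open>X\<close> is a shear of
  the abscissae \<open>U\<close>.\<close>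

locale far_lev = lev +
  fixes U :: "nat \<Rightarrow> real" and eps sm :: real
  assumes far: "j \<in> S \<Longrightarrow> k \<in> S \<Longrightarrow> g \<in> G \<Longrightarrow> j < k \<Longrightarrow> ori X Y j k g < 0"
    and shear: "i \<in> S \<Longrightarrow> X i = U i + eps * Y i"
begin

definition sl :: "nat \<Rightarrow> nat \<Rightarrow> real" where "sl a b = (Y b - Y a) / (X b - X a)"

lemma sl_ori:
  assumes "X a < X b"
  shows "ori X Y a b k \<le> 0 \<longleftrightarrow> Y k - Y a \<le> sl a b * (X k - X a)"
    and "ori X Y a b k \<le> 0 \<longleftrightarrow> Y k - Y b \<le> sl a b * (X k - X b)"
    and "ori X Y a b k < 0 \<longleftrightarrow> Y k - Y b < sl a b * (X k - X b)"
proof -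
  have e: "ori X Y a b k = (X b - X a) * (Y k - Y a - sl a b * (X k - X a))"
    "ori X Y a b k = (X b - X a) * (Y k - Y b - sl a b * (X k - X b))"
    using assms by (simp_all add: ori_def sl_def field_simps)
  show "ori X Y a b k \<le> 0 \<longleftrightarrow> Y k - Y a \<le> sl a b * (X k - X a)"
    unfolding e(1) using assms by (simp add: mult_le_0_iff)
  show "ori X Y a b k \<le> 0 \<longleftrightarrow> Y k - Y b \<le> sl a b * (X k - X b)"
    unfolding e(2) using assms by (simp add: mult_le_0_iff)
  show "ori X Y a b k < 0 \<longleftrightarrow> Y k - Y b < sl a b * (X k - X b)"
    unfolding e(2) using assms by (simp add: mult_less_0_iff)
qed

definition tangent :: "nat set \<Rightarrow> nat \<Rightarrow> real \<Rightarrow> bool" where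
  "tangent K c m \<longleftrightarrow> (\<forall>k\<in>K. Y k - Y c \<le> m * (X k - X c))"

context
  fixes s e assumes se: "s \<in> G" "e \<in> G" "s < e"
begin

abbreviation (input) "K \<equiv> S \<inter> {s<..<e}"
abbreviation (input) "HH \<equiv> hl S s e"

lemma KT: "K \<subseteq> TT S s e" "TT S s e \<subseteq> G \<union> S"
  using se by (auto simp: TT_def)

text \<open>The first point could be hidden only by a chord from the left sentinel to a later point.
  Such a chord would put the sentinel above a line through two points. Hence only the first and the
  last edge of a block's hull touch sentinels.\<close>

lemma end_on_hull:
  assumes i: "i \<in> K" and ext: "(\<forall>k\<in>K. i \<le> k) \<or> (\<forall>k\<in>K. k \<le> i)"
  shows "i \<in> HH"
proof -
  have iS: "i \<in> S" "s < i" "i < e" using i by auto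
  have ge: "0 < h s e i"
  proof -
    have "X s < X e" using mono[of s e] se by simp
    then show ?thesis unfolding ori_def using gapY se ptY[OF iS(1)] by simp
  qed
  have "0 < h j k i" if jk: "j \<in> TT S s e" "k \<in> TT S s e" "j < i" "i < k" for j k
  proof (cases "j = s \<and> k = e")
    case True
    then show ?thesis using ge by simp
  next
    case False
    from ext show ?thesis
    proof
      assume "\<forall>k\<in>K. i \<le> k"
      then have "j \<notin> K" using jk(3) by (meson leD)
      then have "j = s" "k \<in> S" using jk i False by (auto simp: TT_def)
      then show ?thesis using far[of i k s] iS jk se ori_swap(3)[of X Y i k s] by simp
    next
      assume "\<forall>k\<in>K. k \<le> i"
      then have "k \<notin> K" using jk(4) by (meson leD)
      then have "k = e" "j \<in> S" using jk i False by (auto simp: TT_def)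
      then show ?thesis using far[of j i e] iS jk se ori_swap(2)[of X Y j i e] by simp
    qed
  qed
  then show ?thesis using i KT unfolding UH_def by blast
qed

lemma cons_first:
  assumes "cons HH s a" "K \<noteq> {}"
  shows "a \<in> K" "\<And>k. k \<in> K \<Longrightarrow> a \<le> k"
proof -
  have f: "finite K" by simp
  have m: "Min K \<in> K" "\<And>k. k \<in> K \<Longrightarrow> Min K \<le> k" using Min_in[OF f assms(2)] Min_le[OF f] by blast+
  have "Min K \<in> HH" using end_on_hull[OF m(1)] m(2) by blast
  then have "a \<le> Min K" using assms(1) m(1) unfolding cons_def by force
  moreover have "a \<in> TT S s e" "s < a" using assms(1) UH_sub by (auto simp: cons_def)
  ultimately show aK: "a \<in> K" using m(1) by (auto simp: TT_def)
  show "a \<le> k" if "k \<in> K" for k using \<open>a \<le> Min K\<close> m(2)[OF that] by simp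
qed

lemma cons_last:
  assumes "cons HH a e" "K \<noteq> {}"
  shows "a \<in> K" "\<And>k. k \<in> K \<Longrightarrow> k \<le> a"
proof -
  have f: "finite K" by simp
  have m: "Max K \<in> K" "\<And>k. k \<in> K \<Longrightarrow> k \<le> Max K" using Max_in[OF f assms(2)] Max_ge[OF f] by blast+
  have "Max K \<in> HH" using end_on_hull[OF m(1)] m(2) by blast
  then have "Max K \<le> a" using assms(1) m(1) unfolding cons_def by force
  moreover have "a \<in> TT S s e" "a < e" using assms(1) UH_sub by (auto simp: cons_def)
  ultimately show aK: "a \<in> K" using m(1) by (auto simp: TT_def)
  show "k \<le> a" if "k \<in> K" for k using \<open>Max K \<le> a\<close> m(2)[OF that] by simp
qed

lemma cons_edge:
  assumes "cons HH a x" "a \<in> K" "x < e"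
  shows "x \<in> K" "a < x" "X a < X x" "tangent K a (sl a x)" "tangent K x (sl a x)"
proof -
  have "x \<in> TT S s e" "a < x" using assms UH_sub by (auto simp: cons_def)
  then show xK: "x \<in> K" "a < x" using assms by (auto simp: TT_def)
  then show X: "X a < X x" using mono[of a x] assms by auto
  have "h a x k \<le> 0" if "k \<in> K" for k
    using edge_supports[OF finite_TT KT(2) assms(1), of k] that KT(1) by blast
  then show "tangent K a (sl a x)" "tangent K x (sl a x)"
    using sl_ori[OF X] unfolding tangent_def by blast+
qed

lemma slope_decreases:
  assumes "cons HH a x" "a \<in> K" "cons HH x x'" "x < e" "x' < e"
  shows "sl x x' < sl a x"
proof -
  note e1 = cons_edge[OF assms(1,2,4)]
  note e2 = cons_edge[OF assms(3) e1(1) assms(5)]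
  have "x \<in> HH" using assms(1) by (simp add: cons_def)
  then have "0 < h a x' x" using assms(2) e1 e2 KT(1) unfolding UH_def by blast
  then have "h a x x' < 0" using ori_swap(2)[of X Y a x' x] by simp
  then have "Y x' - Y x < sl a x * (X x' - X x)" using sl_ori(3)[OF e1(3)] by simp
  then show ?thesis using e2(3) by (simp add: sl_def[of x] divide_less_eq mult.commute)
qed

end

abbreviation "mi \<equiv> (2::nat) ^ D"
abbreviation "KR \<equiv> S \<inter> {0<..<mi}"
abbreviation "KB \<equiv> S \<inter> {mi<..<wd D}"
abbreviation "HR \<equiv> hl S 0 mi"
abbreviation "HB \<equiv> hl S mi (wd D)"

lemma gR: "0 \<in> G" "mi \<in> G" "0 < mi" if "1 \<le> D"
  using that by (auto simp: Gdef wd_def)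

lemma gB: "mi \<in> G" "wd D \<in> G" "mi < wd D" if "1 \<le> D"
  using that by (auto simp: Gdef wd_def)

text \<open>The last two clauses say that what lies behind on one hull is compatible with the slope
  of the next edge on the other. What lies ahead is covered by comparing the two next
  slopes.\<close>

definition turn_inv :: "nat \<Rightarrow> nat \<Rightarrow> bool" where
  "turn_inv a c \<longleftrightarrow> a \<in> KR \<and> a \<in> HR \<and> c \<in> KB \<and> c \<in> HB \<and> U a + U c < sm \<and>
     (\<forall>x. cons HR a x \<and> x < mi \<longrightarrow> (\<forall>k\<in>KB. k < c \<longrightarrow> Y k - Y c \<le> sl a x * (X k - X c))) \<and>
     (\<forall>y. cons HB c y \<and> y < wd D \<longrightarrow> (\<forall>k\<in>KR. k < a \<longrightarrow> Y k - Y a \<le> sl c y * (X k - X a)))"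

definition supports :: "nat set \<Rightarrow> nat \<Rightarrow> real \<Rightarrow> real \<Rightarrow> bool" where
  "supports Z c num den \<longleftrightarrow> (\<forall>k\<in>Z. (Y k - Y c) * den \<le> num * (U k - U c))"

text \<open>The found edge belongs to one hull, and a line with its slope supports both. The sum of
  abscissae passes \<open>sm\<close> along it, so in the Minkowski sum it is the edge over
  \<open>sm\<close>.\<close>

definition turn_post :: "real \<Rightarrow> real \<Rightarrow> bool" where
  "turn_post num den \<longleftrightarrow> 0 < den \<and>
    ((\<exists>a x c. {a, x} \<subseteq> KR \<and> c \<in> KB \<and> num = Y x - Y a \<and> den = U x - U a \<and> U a + U c < sm \<and> sm \<le> U x + U c \<and>
        supports KR a num den \<and> supports KB c num den) \<or>
     (\<exists>c y a. {c, y} \<subseteq> KB \<and> a \<in> KR \<and> num = Y y - Y c \<and> den = U y - U c \<and> U a + U c < sm \<and> sm \<le> U a + U y \<and>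
        supports KB c num den \<and> supports KR a num den))"

text \<open>Multiplied out, the terms with \<open>eps\<close> on both sides are equal and cancel.
  Support found for the sheared points is thus exact support for the unsheared ones.\<close>

lemma tangent_supports:
  assumes "tangent Z c (sl a x)" "Z \<subseteq> S" "c \<in> S" "a \<in> S" "x \<in> S" "X a < X x"
  shows "supports Z c (Y x - Y a) (U x - U a)"
  unfolding supports_def
proof
  fix k assume k: "k \<in> Z"
  have "Y k - Y c \<le> (Y x - Y a) / (X x - X a) * (X k - X c)" using assms(1) k by (simp add: tangent_def sl_def)
  then have "(Y k - Y c) * (X x - X a) \<le> (Y x - Y a) * (X k - X c)" using assms(6) by (simp add: field_simps)
  moreover have "X k = U k + eps * Y k" "X c = U c + eps * Y c" "X x = U x + eps * Y x" "X a = U a + eps * Y a"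
    using shear assms k by auto
  ultimately show "(Y k - Y c) * (U x - U a) \<le> (Y x - Y a) * (U k - U c)" by (simp add: algebra_simps)
qed

lemma neg_mono: "d \<le> (0::real) \<Longrightarrow> m' \<le> m \<Longrightarrow> m * d \<le> m' * d"
  by (rule mult_right_mono_neg)

text \<open>Points before \<open>c\<close> are covered by the invariant. Points after it are under
  the next edge at \<open>c\<close>, whose slope is at most \<open>m\<close>.\<close>

lemma tangent_other:
  assumes D: "1 \<le> D"
    and inv: "\<And>k. k \<in> K' \<Longrightarrow> k < c \<Longrightarrow> Y k - Y c \<le> m * (X k - X c)"
    and se: "s \<in> G" "e \<in> G" "s < e" and K': "K' = S \<inter> {s<..<e}" and c: "c \<in> K'" "cons (hl S s e) c y"
    and cmp: "y < e \<Longrightarrow> sl c y \<le> m"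
  shows "tangent K' c m"
  unfolding tangent_def
proof
  fix k assume k: "k \<in> K'"
  consider "k < c" | "k = c" | "c < k" by linarith
  then show "Y k - Y c \<le> m * (X k - X c)"
  proof cases
    case 1 then show ?thesis using inv k by blast
  next
    case 3
    have ye: "y < e"
    proof (rule ccontr)
      assume "\<not> y < e"
      moreover have "y \<in> TT S s e" using c(2) UH_sub by (auto simp: cons_def)
      ultimately have "y = e" using se by (auto simp: TT_def)
      then show False using cons_last[OF se, of c] c k K' 3 by force
    qed
    have "Y k - Y c \<le> sl c y * (X k - X c)"
      using cons_edge(4)[OF se c(2) _ ye] c(1) K' k unfolding tangent_def by blast
    moreover have "sl c y * (X k - X c) \<le> m * (X k - X c)"
      using cmp[OF ye] mono[of c k] 3 k c K' by (intro mult_right_mono) (auto simp: less_imp_le)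
    ultimately show ?thesis by linarith
  qed auto
qed

lemma turn_step_red:
  assumes D: "1 \<le> D" and I: "turn_inv a c" and x: "cons HR a x" "x < mi" and y: "cons HB c y"
    and cmp: "y < wd D \<Longrightarrow> sl c y \<le> sl a x"
  shows "U x + U c < sm \<Longrightarrow> turn_inv x c"
    and "sm \<le> U x + U c \<Longrightarrow> turn_post (Y x - Y a) (U x - U a)"
proof -
  have aK: "a \<in> KR" "c \<in> KB" "U a + U c < sm" "c \<in> HB" using I by (auto simp: turn_inv_def)
  note ed = cons_edge[OF gR[OF D] x(1) aK(1) x(2)]
  have J1: "\<And>k. k \<in> KB \<Longrightarrow> k < c \<Longrightarrow> Y k - Y c \<le> sl a x * (X k - X c)"
    using I x unfolding turn_inv_def by blast
  show "turn_inv x c" if lt: "U x + U c < sm"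
    unfolding turn_inv_def
  proof (intro conjI allI impI ballI)
    show "x \<in> HR" using x(1) by (simp add: cons_def)
  next
    fix x' k assume x': "cons HR x x' \<and> x' < mi" and k: "k \<in> KB" "k < c"
    have "sl x x' \<le> sl a x" using slope_decreases[OF gR[OF D] x(1) aK(1) _ x(2)] x' by force
    then have "sl a x * (X k - X c) \<le> sl x x' * (X k - X c)" using mono[of k c] k aK by (intro neg_mono) auto
    then show "Y k - Y c \<le> sl x x' * (X k - X c)" using J1[OF k] by linarith
  next
    fix y' k assume y': "cons HB c y' \<and> y' < wd D" and k: "k \<in> KR" "k < x"
    have "y' = y" using y y' unfolding cons_def by (metis linorder_neqE_nat)
    then have "sl c y' \<le> sl a x" using cmp y' by simp
    then have "sl a x * (X k - X x) \<le> sl c y' * (X k - X x)" using mono[of k x] k ed(1) by (intro neg_mono) auto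
    then show "Y k - Y x \<le> sl c y' * (X k - X x)" using ed(5) k unfolding tangent_def by force
  qed (use aK ed lt in auto)
  show "turn_post (Y x - Y a) (U x - U a)" if ge: "sm \<le> U x + U c"
  proof -
    have "tangent KB c (sl a x)"
      using tangent_other[OF D J1 gB[OF D] refl aK(2) y cmp] .
    then have "supports KB c (Y x - Y a) (U x - U a)" "supports KR a (Y x - Y a) (U x - U a)"
      using tangent_supports[of _ _ a x] ed aK by auto
    \<comment> \<open>\<open>den\<close> is positive since the sum of abscissae is below
      \<open>sm\<close> at one end of the edge and not at the other. An edge whose unsheared ends
      share an abscissa is never selected.\<close>
    then show ?thesis unfolding turn_post_def using ge aK ed(1) by (intro conjI disjI1) (linarith, blast)
  qed
qed

lemma turn_step_blue:
  assumes D: "1 \<le> D" and I: "turn_inv a c" and y: "cons HB c y" "y < wd D" and x: "cons HR a x"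
    and cmp: "x < mi \<Longrightarrow> sl a x \<le> sl c y"
  shows "U a + U y < sm \<Longrightarrow> turn_inv a y"
    and "sm \<le> U a + U y \<Longrightarrow> turn_post (Y y - Y c) (U y - U c)"
proof -
  have aK: "a \<in> KR" "c \<in> KB" "U a + U c < sm" "a \<in> HR" using I by (auto simp: turn_inv_def)
  note ed = cons_edge[OF gB[OF D] y(1) aK(2) y(2)]
  have J1: "\<And>k. k \<in> KR \<Longrightarrow> k < a \<Longrightarrow> Y k - Y a \<le> sl c y * (X k - X a)"
    using I y unfolding turn_inv_def by blast
  show "turn_inv a y" if lt: "U a + U y < sm"
    unfolding turn_inv_def
  proof (intro conjI allI impI ballI)
    show "y \<in> HB" using y(1) by (simp add: cons_def)
  next
    fix y' k assume y': "cons HB y y' \<and> y' < wd D" and k: "k \<in> KR" "k < a"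
    have "sl y y' \<le> sl c y" using slope_decreases[OF gB[OF D] y(1) aK(2) _ y(2)] y' by force
    then have "sl c y * (X k - X a) \<le> sl y y' * (X k - X a)" using mono[of k a] k aK by (intro neg_mono) auto
    then show "Y k - Y a \<le> sl y y' * (X k - X a)" using J1[OF k] by linarith
  next
    fix x' k assume x': "cons HR a x' \<and> x' < mi" and k: "k \<in> KB" "k < y"
    have "x' = x" using x x' unfolding cons_def by (metis linorder_neqE_nat)
    then have "sl a x' \<le> sl c y" using cmp x' by simp
    then have "sl c y * (X k - X y) \<le> sl a x' * (X k - X y)" using mono[of k y] k ed(1) by (intro neg_mono) auto
    then show "Y k - Y y \<le> sl a x' * (X k - X y)" using ed(5) k unfolding tangent_def by force
  qed (use aK ed lt in auto)
  show "turn_post (Y y - Y c) (U y - U c)" if ge: "sm \<le> U a + U y"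
  proof -
    have "tangent KR a (sl c y)"
      using tangent_other[OF D J1 gR[OF D] refl aK(1) x cmp] .
    then have "supports KR a (Y y - Y c) (U y - U c)" "supports KB c (Y y - Y c) (U y - U c)"
      using tangent_supports[of _ _ c y] ed aK by auto
    then show ?thesis unfolding turn_post_def using ge aK ed(1) by (intro conjI disjI2) (linarith, blast)
  qed
qed

text \<open>Each advance moves \<open>a\<close> or \<open>c\<close> to a larger index, which pays
  the 200 of one step with its guard.\<close>

definition left_over :: "nat \<Rightarrow> nat \<Rightarrow> nat" where
  "left_over a c = 200 * ((mi - a) + (wd D - c))"

lemma turn_runs:
  assumes t: "treeok s0 S" and D: "1 \<le> D"
    and s: "nats s0 ''P'' 0 = mi" "nats s0 ''E'' 0 = wd D" "reals s0 ''S'' 0 = sm"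
    and u: "\<And>i. i \<in> S \<Longrightarrow> reals s0 ''kx'' (nats s0 ''p'' i) = U i"
    and ne: "KR \<noteq> {}" "KB \<noteq> {}"
    and start: "\<And>a c. a \<in> KR \<Longrightarrow> (\<forall>k\<in>KR. a \<le> k) \<Longrightarrow> c \<in> KB \<Longrightarrow> (\<forall>k\<in>KB. c \<le> k) \<Longrightarrow> U a + U c < sm"
    and stop: "\<And>a c. a \<in> KR \<Longrightarrow> (\<forall>k\<in>KR. k \<le> a) \<Longrightarrow> c \<in> KB \<Longrightarrow> (\<forall>k\<in>KB. k \<le> c) \<Longrightarrow> sm \<le> U a + U c"
  shows "runs turn s0 (1000 * 2 ^ D + 50 * D) (\<lambda>s'. turn_post (reals s' ''num'' 0) (reals s' ''den'' 0))"
proof -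
  let ?n = "nats s0 ''n''"
  have tX: "reals s0 ''X'' = X" "reals s0 ''Y'' = Y" "nats s0 ''W'' 0 = W" "nats s0 ''D'' 0 = D" using t by (auto simp: treeok_def)
  define b where "b = (D - 1) * W"
  have wdm: "wd (D - 1) = mi" using D by (simp add: wd_def)
  have lo: "levelok ?n (nats s0 ''q'') S (D - 1)" using t by (simp add: treeok_def)
  have two: "2 ^ (D - (D - 1)) = (2::nat)" using D by simp
  have wd2: "wd D = 2 * mi" by (simp add: wd_def)
  have lR: "lst ?n (nats s0 ''q'') b HR" and lB: "lst ?n (nats s0 ''q'') b HB"
    using lo[unfolded levelok_def two, rule_format, of 0] lo[unfolded levelok_def two, rule_format, of 1]
    unfolding wdm b_def by (simp_all add: wd2 mult_2)
  have finR: "finite HR" "finite HB" using finite_subset[OF UH_sub finite_TT] by blast+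
  let ?F = "For ''d'' (NV ''D'') (''b'' ::= NAdd (NV ''b'') (NV ''W''))"
  define s1 where "s1 = nupd ''d'' 0 1 (nupd ''b'' 0 0 s0)"
  have R1: "runs (''b'' ::= NLit 0 ;; ''d'' ::= NLit 1) s0 10 (\<lambda>s'. s' = s1)" by (simp add: runs_def wp_simps s1_def)
  have R2: "runs ?F s1 (40 * D + 20) (\<lambda>s'. nats s' ''b'' 0 = (D - 1) * W \<and> nats s' ''d'' 0 = D)"
  proof (rule runs_For[where T = "\<lambda>_. 15" and lo = 1 and I = "\<lambda>k s. nats s ''b'' 0 = (k - 1) * W"])
    fix k s' assume "agree ?F s1 s'"
    from agreeN[OF this] show "nval (NV ''D'') s' = D" using tX by (simp add: s1_def)
  next
    fix k s' assume I: "nats s' ''b'' 0 = (k - 1) * W" and ag: "agree ?F s1 s'" and k: "1 \<le> k" "nats s' ''d'' 0 = k"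
    have "nats s' ''W'' 0 = W" using agreeN[OF ag] tX by (simp add: s1_def)
    moreover have "(k - 1) * W + W = k * W" using k by (cases k) auto
    ultimately show "runs (''b'' ::= NAdd (NV ''b'') (NV ''W'')) s' 15 (\<lambda>s''. nats s'' ''d'' 0 = k \<and> nats (nupd ''d'' 0 (Suc k) s'') ''b'' 0 = (Suc k - 1) * W)"
      using I k by (simp add: runs_def wp_simps)
  qed (use D in \<open>auto simp: s1_def\<close>)
  obtain a0 where a0: "cons HR 0 a0" using cons_succ_exists[OF finR(1) UH_ends(1)[OF gR(3)[OF D]] UH_ends(2)[OF gR(3)[OF D]] gR(3)[OF D]] by blast
  obtain c0 where c0: "cons HB mi c0" using cons_succ_exists[OF finR(2) UH_ends(1)[OF gB(3)[OF D]] UH_ends(2)[OF gB(3)[OF D]] gB(3)[OF D]] by blast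
  have na: "?n b = a0" "?n (b + mi) = c0" using lR lB a0 c0 unfolding lst_def by (metis add_0_right)+
  have I0: "turn_inv a0 c0"
  proof -
    note A = cons_first[OF gR[OF D] a0 ne(1)] and C = cons_first[OF gB[OF D] c0 ne(2)]
    show ?thesis unfolding turn_inv_def using A C start[of a0 c0] a0 c0 by (auto simp: cons_def not_less[symmetric])
  qed
  let ?I = "\<lambda>s. if nats s ''done'' 0 = 0 then turn_inv (nats s ''a'' 0) (nats s ''c'' 0) else turn_post (reals s ''num'' 0) (reals s ''den'' 0)"
  let ?mu = "\<lambda>s. if nats s ''done'' 0 = 0 then left_over (nats s ''a'' 0) (nats s ''c'' 0) else 0"
  have R3: "runs (While (NLess (NV ''done'') (NLit 1)) turn_body) s2 (200 * (mi + mi) + 20) (\<lambda>s'. turn_post (reals s' ''num'' 0) (reals s' ''den'' 0))"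
    if s2: "nats s2 ''done'' 0 = 0" "nats s2 ''a'' 0 = a0" "nats s2 ''c'' 0 = c0" "nats s2 ''b'' 0 = b" "nats s2 ''n'' = ?n" "nats s2 ''p'' = nats s0 ''p''"
      "nats s2 ''P'' 0 = mi" "nats s2 ''E'' 0 = wd D" "reals s2 = reals s0" for s2
  proof (rule runs_While[where I = ?I and \<mu> = ?mu])
    show "?I s2" using I0 s2 by simp
    fix s3 assume I: "?I s3" and ag: "agree turn_body s2 s3"
    show "turn_post (reals s3 ''num'' 0) (reals s3 ''den'' 0)" if "\<not> bval (NLess (NV ''done'') (NLit 1)) s3" using that I by auto
    assume "bval (NLess (NV ''done'') (NLit 1)) s3"
    then have d0: "nats s3 ''done'' 0 = 0" by simp
    define a c where "a = nats s3 ''a'' 0" and "c = nats s3 ''c'' 0"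
    have I': "turn_inv a c" using I d0 by (simp add: a_def c_def)
    have fr: "nats s3 ''b'' 0 = b" "nats s3 ''n'' = ?n" "nats s3 ''p'' = nats s0 ''p''" "nats s3 ''P'' 0 = mi" "nats s3 ''E'' 0 = wd D"
      "reals s3 ''X'' = X" "reals s3 ''Y'' = Y" "reals s3 ''kx'' = reals s0 ''kx''" "reals s3 ''S'' 0 = sm"
      using agreeN[OF ag] agreeR[OF ag] s2 tX s by simp_all
    have aK: "a \<in> KR" "a \<in> HR" "c \<in> KB" "c \<in> HB" "a < mi" "c < wd D" using I' by (auto simp: turn_inv_def)
    obtain x where x: "cons HR a x" "x \<le> mi" using cons_succ_exists[OF finR(1) aK(2) UH_ends(2)[OF gR(3)[OF D]] aK(5)] by blast
    obtain y where y: "cons HB c y" "y \<le> wd D" using cons_succ_exists[OF finR(2) aK(4) UH_ends(2)[OF gB(3)[OF D]] aK(6)] by blast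
    have nx: "?n (b + a) = x" "?n (b + c) = y" using lR lB x y unfolding lst_def by blast+
    \<comment> \<open>With both lists exhausted, the invariant would contradict the assumption on
      the last pair.\<close>
    have nend: "x < mi \<or> y < wd D"
    proof (rule ccontr)
      assume "\<not> (x < mi \<or> y < wd D)"
      then have "x = mi" "y = wd D" using x y by auto
      then have "cons HR a mi" "cons HB c (wd D)" using x y by auto
      then have "sm \<le> U a + U c" using stop[of a c] cons_last[OF gR[OF D] _ ne(1), of a] cons_last[OF gB[OF D] _ ne(2), of c] by blast
      then show False using I' by (simp add: turn_inv_def)
    qed
    have steep: "(Y x - Y a) * (X y - X c) < (X x - X a) * (Y y - Y c) \<longleftrightarrow> sl a x < sl c y" if "x < mi" "y < wd D"
      using cons_edge(3)[OF gR[OF D] x(1) aK(1) that(1)] cons_edge(3)[OF gB[OF D] y(1) aK(3) that(2)]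
      by (simp add: sl_def field_simps)
    have ua: "reals s0 ''kx'' (nats s0 ''p'' a) = U a" "reals s0 ''kx'' (nats s0 ''p'' c) = U c" using u aK by auto
    have ux: "reals s0 ''kx'' (nats s0 ''p'' x) = U x" if "x < mi" using u cons_edge(1)[OF gR[OF D] x(1) aK(1) that] by auto
    have uy: "reals s0 ''kx'' (nats s0 ''p'' y) = U y" if "y < wd D" using u cons_edge(1)[OF gB[OF D] y(1) aK(3) that] by auto
    have ax: "a < x" "c < y" using x y by (auto simp: cons_def)
    define s4 where "s4 = nupd ''y'' 0 y (nupd ''x'' 0 x s3)"
    have sE: "bval steeperE s4 \<longleftrightarrow> (Y x - Y a) * (X y - X c) < (X x - X a) * (Y y - Y c)" "bcost steeperE = 31"
      by (simp_all add: steeperE_def s4_def fr a_def c_def)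
    have uEv: "rval (uE ''x'') s4 = reals s0 ''kx'' (nats s0 ''p'' x)" "rval (uE ''y'') s4 = reals s0 ''kx'' (nats s0 ''p'' y)"
      "rval (uE ''a'') s4 = U a" "rval (uE ''c'') s4 = U c" "rcost (uE z) = 4" for z
      by (simp_all add: uE_def s4_def fr ua a_def[symmetric] c_def[symmetric])
    have uEn: "rval (uE z) (rupd ''num'' 0 w s4) = rval (uE z) s4" for z w by (simp add: uE_def)
    have first: "wp turn_body s3 Q = wp (Cond (BAnd (NLess (NV ''x'') (NV ''P'')) (BNot (BAnd (NLess (NV ''y'') (NV ''E'')) steeperE)))
       (Cond (RLess (RAdd (uE ''x'') (uE ''c'')) (RV ''S'')) (''a'' ::= NV ''x'')
         (''num'' ::=r RSub (ry ''x'') (ry ''a'') ;; ''den'' ::=r RSub (uE ''x'') (uE ''a'') ;; ''done'' ::= NLit 1))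
       (Cond (RLess (RAdd (uE ''a'') (uE ''y'')) (RV ''S'')) (''c'' ::= NV ''y'')
         (''num'' ::=r RSub (ry ''y'') (ry ''c'') ;; ''den'' ::=r RSub (uE ''y'') (uE ''c'') ;; ''done'' ::= NLit 1))) s4
       (\<lambda>t. Q (8 + (8 + t)))" for Q
      unfolding turn_body_def s4_def wp_Seq wp_NSet by (simp add: fr nx a_def[symmetric] c_def[symmetric] del: One_nat_def)
    let ?P = "\<lambda>s''. ?I s'' \<and> ?mu s'' + 200 \<le> ?mu s3"
    have s4v: "nats s4 ''x'' 0 = x" "nats s4 ''y'' 0 = y" "nats s4 ''a'' 0 = a" "nats s4 ''c'' 0 = c" "nats s4 ''P'' 0 = mi" "nats s4 ''E'' 0 = wd D"
      "nats s4 ''done'' 0 = 0" "reals s4 ''X'' = X" "reals s4 ''Y'' = Y" "reals s4 ''S'' 0 = sm"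
      by (simp_all add: s4_def fr a_def c_def d0)
    have mua: "left_over x c + 200 \<le> left_over a c" "left_over a y + 200 \<le> left_over a c" "200 \<le> left_over a c"
      unfolding left_over_def using ax aK x(2) y(2) by auto
    have mu3: "?mu s3 = left_over a c" using d0 by (simp add: a_def c_def)
    have "runs turn_body s3 190 ?P"
    proof (cases "x < mi \<and> \<not> (y < wd D \<and> sl a x < sl c y)")
      case True
      have cmp: "y < wd D \<Longrightarrow> sl c y \<le> sl a x" using True by auto
      note st = turn_step_red[OF D I' x(1) _ y(1) cmp]
      have cd: "\<not> (y < wd D \<and> bval steeperE s4)" using True steep sE by auto
      have ux': "reals s0 ''kx'' (nats s0 ''p'' x) = U x" using ux True by simp
      show ?thesis unfolding runs_def first mu3
        using True st cd mua by (cases "U x + U c < sm") (simp_all add: wp_simps uEv uEn s4v sE(2) ux' not_less)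
    next
      case False
      then have yl: "y < wd D" using nend by auto
      have cmp: "x < mi \<Longrightarrow> sl a x \<le> sl c y" using False by auto
      note st = turn_step_blue[OF D I' y(1) yl x(1) cmp]
      have cd: "\<not> (x < mi \<and> \<not> bval steeperE s4)" using False steep[OF _ yl] sE by auto
      have uy': "reals s0 ''kx'' (nats s0 ''p'' y) = U y" using uy yl by simp
      show ?thesis unfolding runs_def first mu3
        using st cd mua yl by (cases "U a + U y < sm"; cases "x < mi") (simp_all add: wp_simps uEv uEn s4v sE(2) uy' not_less)
    qed
    then show "\<exists>T. runs turn_body s3 T (\<lambda>s''. ?I s'' \<and> 1 + bcost (NLess (NV ''done'') (NLit 1)) + T + ?mu s'' \<le> ?mu s3)"
      by (intro exI[of _ 190]) (erule runs_conseq, auto)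
  next
    have "c0 \<in> HB" using c0 by (simp add: cons_def)
    then have "mi < c0" using c0 by (simp add: cons_def)
    then show "?mu s2 + 1 + bcost (NLess (NV ''done'') (NLit 1)) \<le> 200 * (mi + mi) + 20" using s2 wd2 by (simp add: left_over_def)
  qed
  let ?mid = "''a'' ::= NGet ''n'' (NV ''b'') ;; ''c'' ::= NGet ''n'' (NAdd (NV ''b'') (NV ''P'')) ;; ''done'' ::= NLit 0"
  let ?L = "While (NLess (NV ''done'') (NLit 1)) turn_body"
  have "runs ((''b'' ::= NLit 0 ;; ''d'' ::= NLit 1) ;; ?F ;; ?mid ;; ?L) s0 (10 + ((40 * D + 20) + (30 + (200 * (mi + mi) + 20))))
     (\<lambda>s'. turn_post (reals s' ''num'' 0) (reals s' ''den'' 0))"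
  proof (rule runs_Seq[OF R1 _ order.refl], simp only:, rule runs_Seq_agree[OF R2 _ order.refl])
    fix s2 assume s2: "nats s2 ''b'' 0 = (D - 1) * W \<and> nats s2 ''d'' 0 = D" and ag: "agree ?F s1 s2"
    have fr: "nats s2 ''n'' = ?n" "nats s2 ''p'' = nats s0 ''p''" "nats s2 ''P'' 0 = mi" "nats s2 ''E'' 0 = wd D" "reals s2 = reals s0"
      using agreeN[OF ag] agreeR[OF ag] s by (simp_all add: s1_def fun_eq_iff)
    have bb: "nats s2 ''b'' 0 = b" using s2 b_def by simp
    have "runs (?mid) s2 30 (\<lambda>s'. s' = nupd ''done'' 0 0 (nupd ''c'' 0 c0 (nupd ''a'' 0 a0 s2)))"
      by (simp add: runs_def wp_simps fr bb na)
    then show "runs ((?mid) ;; ?L) s2 (30 + (200 * (mi + mi) + 20)) (\<lambda>s'. turn_post (reals s' ''num'' 0) (reals s' ''den'' 0))"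
      by (rule runs_Seq[OF _ _ order.refl]) (rule R3, auto simp: fr bb)
  qed
  then have "runs turn s0 (10 + ((40 * D + 20) + (30 + (200 * (mi + mi) + 20)))) (\<lambda>s'. turn_post (reals s' ''num'' 0) (reals s' ''den'' 0))"
    unfolding turn_def runs_def by (simp add: wp_simps add.assoc)
  moreover have "10 + ((40 * D + 20) + (30 + (200 * (mi + mi) + 20))) \<le> 1000 * mi + 50 * D"
  proof -
    have "10 + ((40 * D + 20) + (30 + (200 * (q + q) + 20))) \<le> 1000 * q + 50 * D" if "1 \<le> q" for q :: nat
      using that by (simp only: mult_2[symmetric])
    moreover have "1 \<le> mi" by simp
    ultimately show ?thesis by blast
  qed
  ultimately show ?thesis by (rule runs_conseq) simp_all
qed

end

section \<open>Changes of coordinates\<close>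

definition load_red :: com where
  "load_red = (RSet ''px'' (NV ''i'') (RGet ''red_x'' (NV ''i'')) ;; RSet ''py'' (NV ''i'') (RGet ''red_y'' (NV ''i'')) ;;
     ''srx'' ::=r RAdd (RV ''srx'') (RGet ''red_x'' (NV ''i'')) ;; ''sry'' ::=r RAdd (RV ''sry'') (RGet ''red_y'' (NV ''i'')) ;;
     ''nr'' ::=r RAdd (RV ''nr'') (RLit 1))"

definition load_blue :: com where
  "load_blue = (RSet ''px'' (NAdd (NV ''R'') (NV ''i'')) (RGet ''blue_x'' (NV ''i'')) ;;
     RSet ''py'' (NAdd (NV ''R'') (NV ''i'')) (RGet ''blue_y'' (NV ''i'')) ;;
     ''sbx'' ::=r RAdd (RV ''sbx'') (RGet ''blue_x'' (NV ''i'')) ;; ''sby'' ::=r RAdd (RV ''sby'') (RGet ''blue_y'' (NV ''i'')) ;;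
     ''nb'' ::=r RAdd (RV ''nb'') (RLit 1))"

text \<open>The class sizes \<open>nr\<close> and \<open>nb\<close> are counted as reals while
  loading, since naturals cannot be converted.\<close>

definition load :: com where
  "load =
    (''i'' ::= NLit 0 ;; For ''i'' (NV ''R'') load_red ;; ''i'' ::= NLit 0 ;; For ''i'' (NV ''B'') load_blue ;;
     ''dx'' ::=r RSub (RMul (RV ''nr'') (RV ''sbx'')) (RMul (RV ''nb'') (RV ''srx'')) ;;
     ''dy'' ::=r RSub (RMul (RV ''nr'') (RV ''sby'')) (RMul (RV ''nb'') (RV ''sry'')) ;; ''S'' ::=r RLit 2 ;; ''i'' ::= NLit 0)"

abbreviation ri :: "string \<Rightarrow> rexp" where "ri a \<equiv> RGet a (NV ''i'')"

definition rotate_pt :: com where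
  "rotate_pt = (RSet ''pu'' (NV ''i'') (RSub (RMul (RV ''dx'') (ri ''py'')) (RMul (RV ''dy'') (ri ''px''))) ;;
     RSet ''pv'' (NV ''i'') (RAdd (RMul (RV ''dx'') (ri ''px'')) (RMul (RV ''dy'') (ri ''py''))) ;;
     ''S'' ::=r RAdd (RV ''S'') (RMul (ri ''pu'') (ri ''pu'')))"

text \<open>The blue points are reflected in the point with coordinates \<open>S / 2\<close> and 0,
  which sends them to the right of all red points. Their upper hull in the hierarchy is then that of
  \<open>- B\<close>, up to a translation.\<close>

definition reflect_pt :: com where
  "reflect_pt = Cond (NLess (NV ''i'') (NV ''R''))
     (RSet ''kx'' (NV ''i'') (ri ''pu'') ;; RSet ''ky'' (NV ''i'') (ri ''pv''))
     (RSet ''kx'' (NV ''i'') (RSub (RV ''S'') (ri ''pu'')) ;; RSet ''ky'' (NV ''i'') (RSub (RLit 0) (ri ''pv'')))"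

definition frame1 :: com where
  "frame1 = (load ;; For ''i'' (NV ''N'') rotate_pt ;; ''i'' ::= NLit 0 ;; For ''i'' (NV ''N'') reflect_pt)"

text \<open>The new abscissa is constant along lines of the slope found, so sorting by it sorts
  across the separating direction.\<close>

definition tilt_pt :: com where
  "tilt_pt = (RSet ''kx'' (NV ''i'') (RSub (ri ''pv'') (RMul (RV ''m2'') (ri ''pu''))) ;; RSet ''ky'' (NV ''i'') (ri ''pu''))"

definition frame2 :: com where
  "frame2 = (''m2'' ::=r RDiv (RV ''num'') (RV ''den'') ;; ''i'' ::= NLit 0 ;; For ''i'' (NV ''N'') tilt_pt)"

lemma frame_mods [simp]:
  "nmods load_red = {}" "rmods load_red = {''px'', ''py'', ''srx'', ''sry'', ''nr''}"
  "nmods load_blue = {}" "rmods load_blue = {''px'', ''py'', ''sbx'', ''sby'', ''nb''}"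
  "nmods load = {''i''}" "rmods load = {''px'', ''py'', ''srx'', ''sry'', ''nr'', ''sbx'', ''sby'', ''nb'', ''dx'', ''dy'', ''S''}"
  "nmods rotate_pt = {}" "rmods rotate_pt = {''pu'', ''pv'', ''S''}"
  "nmods reflect_pt = {}" "rmods reflect_pt = {''kx'', ''ky''}"
  "nmods frame1 = {''i''}" "rmods frame1 = {''px'', ''py'', ''srx'', ''sry'', ''nr'', ''sbx'', ''sby'', ''nb'', ''dx'', ''dy'', ''S'', ''pu'', ''pv'', ''kx'', ''ky''}"
  "nmods tilt_pt = {}" "rmods tilt_pt = {''kx'', ''ky''}"
  "nmods frame2 = {''i''}" "rmods frame2 = {''kx'', ''ky'', ''m2''}"
  by (auto simp: load_red_def load_blue_def load_def rotate_pt_def reflect_pt_def frame1_def tilt_pt_def frame2_def)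

text \<open>The mean over the blue points minus the mean over the red ones, multiplied by both class
  sizes to avoid divisions.\<close>

definition mean_diff :: "(point \<Rightarrow> real) \<Rightarrow> point list \<Rightarrow> point list \<Rightarrow> real" where
  "mean_diff f rs bs = real (length rs) * (\<Sum>i<length bs. f (bs ! i)) - real (length bs) * (\<Sum>i<length rs. f (rs ! i))"

definition input_ok :: "point list \<Rightarrow> point list \<Rightarrow> ram \<Rightarrow> bool" where
  "input_ok rs bs s \<longleftrightarrow> (\<forall>i<length rs. reals s ''red_x'' i = fst (rs ! i) \<and> reals s ''red_y'' i = snd (rs ! i)) \<and>
     (\<forall>i<length bs. reals s ''blue_x'' i = fst (bs ! i) \<and> reals s ''blue_y'' i = snd (bs ! i)) \<and>
     (\<forall>a\<in>{''srx'', ''sry'', ''nr'', ''sbx'', ''sby'', ''nb''}. reals s a 0 = 0) \<and>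
     nats s ''R'' 0 = length rs \<and> nats s ''B'' 0 = length bs \<and> nats s ''N'' 0 = length rs + length bs"

lemma load_runs:
  assumes ok: "input_ok rs bs s0"
  shows "runs load s0 (60 * (length rs + length bs) + 100) (\<lambda>s'. nats s' ''i'' 0 = 0 \<and> reals s' ''S'' 0 = 2 \<and>
     (\<forall>i<length rs + length bs. reals s' ''px'' i = fst ((rs @ bs) ! i) \<and> reals s' ''py'' i = snd ((rs @ bs) ! i)) \<and>
     reals s' ''dx'' 0 = mean_diff fst rs bs \<and> reals s' ''dy'' 0 = mean_diff snd rs bs)"
proof -
  let ?F1 = "For ''i'' (NV ''R'') load_red" and ?F2 = "For ''i'' (NV ''B'') load_blue"
  let ?r = "length rs" and ?b = "length bs"
  define s1 where "s1 = nupd ''i'' 0 0 s0"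
  let ?I1 = "\<lambda>k s. (\<forall>i<k. reals s ''px'' i = fst (rs ! i) \<and> reals s ''py'' i = snd (rs ! i)) \<and>
     reals s ''srx'' 0 = (\<Sum>i<k. fst (rs ! i)) \<and> reals s ''sry'' 0 = (\<Sum>i<k. snd (rs ! i)) \<and> reals s ''nr'' 0 = real k"
  have R1: "runs ?F1 s1 (60 * ?r + 10) (\<lambda>s'. ?I1 ?r s' \<and> nats s' ''i'' 0 = ?r)"
  proof (rule runs_For[where T = "\<lambda>_. 45" and lo = 0 and I = ?I1])
    show "?I1 0 s1" using ok by (simp add: s1_def input_ok_def)
  next
    fix k s' assume "agree ?F1 s1 s'"
    from agreeN[OF this] show "nval (NV ''R'') s' = ?r" using ok by (simp add: s1_def input_ok_def)
  next
    fix k s' assume I: "?I1 k s'" and ag: "agree ?F1 s1 s'" and k: "k < ?r" "nats s' ''i'' 0 = k"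
    have f: "reals s' ''red_x'' k = fst (rs ! k)" "reals s' ''red_y'' k = snd (rs ! k)"
      using agreeR[OF ag] ok k by (simp_all add: s1_def input_ok_def)
    show "runs load_red s' 45 (\<lambda>s''. nats s'' ''i'' 0 = k \<and> ?I1 (Suc k) (nupd ''i'' 0 (Suc k) s''))"
      using I k by (simp add: runs_def wp_simps load_red_def f less_Suc_eq cong: wp_cong)
  qed (simp_all add: s1_def)
  let ?I2 = "\<lambda>k s. (\<forall>i<?r + k. reals s ''px'' i = fst ((rs @ bs) ! i) \<and> reals s ''py'' i = snd ((rs @ bs) ! i)) \<and>
     reals s ''sbx'' 0 = (\<Sum>i<k. fst (bs ! i)) \<and> reals s ''sby'' 0 = (\<Sum>i<k. snd (bs ! i)) \<and> reals s ''nb'' 0 = real k"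
  have R2: "runs ?F2 s2 (60 * ?b + 10) (\<lambda>s'. ?I2 ?b s' \<and> nats s' ''i'' 0 = ?b)"
    if s2: "nats s2 ''i'' 0 = 0" "?I2 0 s2" "nats s2 ''B'' 0 = ?b" "nats s2 ''R'' 0 = ?r"
      "\<forall>i<?b. reals s2 ''blue_x'' i = fst (bs ! i) \<and> reals s2 ''blue_y'' i = snd (bs ! i)" for s2
  proof (rule runs_For[where T = "\<lambda>_. 45" and lo = 0 and I = ?I2])
    fix k s' assume "agree ?F2 s2 s'"
    from agreeN[OF this] show "nval (NV ''B'') s' = ?b" using s2 by simp
  next
    fix k s' assume I: "?I2 k s'" and ag: "agree ?F2 s2 s'" and k: "k < ?b" "nats s' ''i'' 0 = k"
    have f: "reals s' ''blue_x'' k = fst (bs ! k)" "reals s' ''blue_y'' k = snd (bs ! k)" "nats s' ''R'' 0 = ?r"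
      using agreeN[OF ag] agreeR[OF ag] s2 k by simp_all
    have "(rs @ bs) ! (?r + k) = bs ! k" by simp
    then show "runs load_blue s' 45 (\<lambda>s''. nats s'' ''i'' 0 = k \<and> ?I2 (Suc k) (nupd ''i'' 0 (Suc k) s''))"
      using I k by (simp add: runs_def wp_simps load_blue_def f less_Suc_eq cong: wp_cong)
  qed (use s2 in simp_all)
  let ?d = "''dx'' ::=r RSub (RMul (RV ''nr'') (RV ''sbx'')) (RMul (RV ''nb'') (RV ''srx'')) ;;
     ''dy'' ::=r RSub (RMul (RV ''nr'') (RV ''sby'')) (RMul (RV ''nb'') (RV ''sry'')) ;; ''S'' ::=r RLit 2 ;; ''i'' ::= NLit 0"
  show ?thesis unfolding load_def
  proof (rule runs_Seq[where ?Q1.0 = "\<lambda>s'. s' = s1" and ?T1.0 = 3 and ?T2.0 = "60 * (?r + ?b) + 90"])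
    fix s' assume "s' = s1"
    show "runs (?F1 ;; ''i'' ::= NLit 0 ;; ?F2 ;; ?d) s' (60 * (?r + ?b) + 90) (\<lambda>s'. nats s' ''i'' 0 = 0 \<and> reals s' ''S'' 0 = 2 \<and>
     (\<forall>i<?r + ?b. reals s' ''px'' i = fst ((rs @ bs) ! i) \<and> reals s' ''py'' i = snd ((rs @ bs) ! i)) \<and>
     reals s' ''dx'' 0 = mean_diff fst rs bs \<and> reals s' ''dy'' 0 = mean_diff snd rs bs)" unfolding \<open>s' = s1\<close>
    proof (rule runs_Seq_agree[OF R1, where ?T2.0 = "60 * ?b + 80"])
      fix s2 assume s2: "?I1 ?r s2 \<and> nats s2 ''i'' 0 = ?r" and ag2: "agree ?F1 s1 s2"
      have f2: "reals s2 ''sbx'' 0 = 0" "reals s2 ''sby'' 0 = 0" "reals s2 ''nb'' 0 = 0" "nats s2 ''B'' 0 = ?b" "nats s2 ''R'' 0 = ?r"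
        "\<forall>i<?b. reals s2 ''blue_x'' i = fst (bs ! i) \<and> reals s2 ''blue_y'' i = snd (bs ! i)"
        using agreeN[OF ag2] agreeR[OF ag2] ok by (simp_all add: s1_def input_ok_def)
      show "runs (''i'' ::= NLit 0 ;; ?F2 ;; ?d) s2 (60 * ?b + 80) (\<lambda>s'. nats s' ''i'' 0 = 0 \<and> reals s' ''S'' 0 = 2 \<and>
        (\<forall>i<?r + ?b. reals s' ''px'' i = fst ((rs @ bs) ! i) \<and> reals s' ''py'' i = snd ((rs @ bs) ! i)) \<and>
        reals s' ''dx'' 0 = mean_diff fst rs bs \<and> reals s' ''dy'' 0 = mean_diff snd rs bs)"
      proof (rule runs_Seq[where ?Q1.0 = "\<lambda>s'. s' = nupd ''i'' 0 0 s2" and ?T1.0 = 3 and ?T2.0 = "60 * ?b + 70"])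
        fix s3 assume s3: "s3 = nupd ''i'' 0 0 s2"
        have "runs ?F2 s3 (60 * ?b + 10) (\<lambda>s'. ?I2 ?b s' \<and> nats s' ''i'' 0 = ?b)"
          by (rule R2) (use s2 f2 in \<open>auto simp: s3 nth_append\<close>)
        then show "runs (?F2 ;; ?d) s3 (60 * ?b + 70) (\<lambda>s'. nats s' ''i'' 0 = 0 \<and> reals s' ''S'' 0 = 2 \<and>
          (\<forall>i<?r + ?b. reals s' ''px'' i = fst ((rs @ bs) ! i) \<and> reals s' ''py'' i = snd ((rs @ bs) ! i)) \<and>
          reals s' ''dx'' 0 = mean_diff fst rs bs \<and> reals s' ''dy'' 0 = mean_diff snd rs bs)"
        proof (rule runs_Seq_agree[where ?T2.0 = 50])
          fix s4 assume s4: "?I2 ?b s4 \<and> nats s4 ''i'' 0 = ?b" and ag4: "agree ?F2 s3 s4"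
          have f4: "reals s4 ''srx'' 0 = (\<Sum>i<?r. fst (rs ! i))" "reals s4 ''sry'' 0 = (\<Sum>i<?r. snd (rs ! i))" "reals s4 ''nr'' 0 = real ?r"
            using agreeR[OF ag4] s2 by (simp_all add: s3)
          show "runs (?d) s4 50 (\<lambda>s'. nats s' ''i'' 0 = 0 \<and> reals s' ''S'' 0 = 2 \<and>
            (\<forall>i<?r + ?b. reals s' ''px'' i = fst ((rs @ bs) ! i) \<and> reals s' ''py'' i = snd ((rs @ bs) ! i)) \<and>
            reals s' ''dx'' 0 = mean_diff fst rs bs \<and> reals s' ''dy'' 0 = mean_diff snd rs bs)"
            using s4 f4 by (simp add: runs_def wp_simps mean_diff_def cong: wp_cong)
        qed simp
      qed (simp_all add: runs_def wp_simps)
    qed simp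
  qed (simp_all add: runs_def wp_simps s1_def)
qed

text \<open>With \<open>cv\<close> below, the coordinates in a rotated and scaled frame whose
  \<open>v\<close> axis points from the red centroid to the blue one. Both centroids have the same
  \<open>u\<close>.\<close>

definition cu :: "point list \<Rightarrow> point list \<Rightarrow> point \<Rightarrow> real" where
  "cu rs bs w = mean_diff fst rs bs * snd w - mean_diff snd rs bs * fst w"

definition cv :: "point list \<Rightarrow> point list \<Rightarrow> point \<Rightarrow> real" where
  "cv rs bs w = mean_diff fst rs bs * fst w + mean_diff snd rs bs * snd w"

text \<open>As \<open>2 * u\<close> is at most \<open>1 + u ^ 2\<close>, this exceeds the sum of the
  \<open>u\<close> coordinates of any two different points.\<close>

definition shift :: "point list \<Rightarrow> point list \<Rightarrow> real" where
  "shift rs bs = 2 + (\<Sum>i<length rs + length bs. (cu rs bs ((rs @ bs) ! i))\<^sup>2)"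

lemma frame1_runs:
  assumes ok: "input_ok rs bs s0"
  defines "N \<equiv> length rs + length bs"
  shows "runs frame1 s0 (200 * N + 200) (\<lambda>s'. reals s' ''S'' 0 = shift rs bs \<and>
     (\<forall>i<N. reals s' ''pu'' i = cu rs bs ((rs @ bs) ! i) \<and> reals s' ''pv'' i = cv rs bs ((rs @ bs) ! i) \<and>
       reals s' ''kx'' i = (if i < length rs then cu rs bs ((rs @ bs) ! i) else shift rs bs - cu rs bs ((rs @ bs) ! i)) \<and>
       reals s' ''ky'' i = (if i < length rs then cv rs bs ((rs @ bs) ! i) else - cv rs bs ((rs @ bs) ! i))))"
proof -
  let ?F1 = "For ''i'' (NV ''N'') rotate_pt" and ?F2 = "For ''i'' (NV ''N'') reflect_pt"
  let ?u = "\<lambda>i. cu rs bs ((rs @ bs) ! i)" and ?v = "\<lambda>i. cv rs bs ((rs @ bs) ! i)"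
  let ?I1 = "\<lambda>k s. (\<forall>i<k. reals s ''pu'' i = ?u i \<and> reals s ''pv'' i = ?v i) \<and> reals s ''S'' 0 = 2 + (\<Sum>i<k. (?u i)\<^sup>2)"
  let ?I2 = "\<lambda>k s. \<forall>i<k. reals s ''kx'' i = (if i < length rs then ?u i else shift rs bs - ?u i) \<and>
       reals s ''ky'' i = (if i < length rs then ?v i else - ?v i)"
  have Nv: "nats s0 ''N'' 0 = N" "nats s0 ''R'' 0 = length rs" using ok by (simp_all add: input_ok_def N_def)
  have "runs frame1 s0 ((60 * N + 100) + ((60 * N + 10) + (3 + (60 * N + 10)))) (\<lambda>s'. reals s' ''S'' 0 = shift rs bs \<and>
     (\<forall>i<N. reals s' ''pu'' i = ?u i \<and> reals s' ''pv'' i = ?v i \<and>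
       reals s' ''kx'' i = (if i < length rs then ?u i else shift rs bs - ?u i) \<and>
       reals s' ''ky'' i = (if i < length rs then ?v i else - ?v i)))" (is "runs _ _ _ ?post")
    unfolding frame1_def
  proof (rule runs_Seq_agree[OF load_runs[OF ok, folded N_def] _ order.refl])
    fix s1 assume s1: "nats s1 ''i'' 0 = 0 \<and> reals s1 ''S'' 0 = 2 \<and>
     (\<forall>i<N. reals s1 ''px'' i = fst ((rs @ bs) ! i) \<and> reals s1 ''py'' i = snd ((rs @ bs) ! i)) \<and>
     reals s1 ''dx'' 0 = mean_diff fst rs bs \<and> reals s1 ''dy'' 0 = mean_diff snd rs bs" and ag1: "agree load s0 s1"
    have f1: "nats s1 ''N'' 0 = N" "nats s1 ''R'' 0 = length rs" using agreeN[OF ag1] Nv by simp_all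
    have R1: "runs ?F1 s1 (60 * N + 10) (\<lambda>s'. ?I1 N s' \<and> nats s' ''i'' 0 = N)"
    proof (rule runs_For[where T = "\<lambda>_. 46" and lo = 0 and I = ?I1])
      fix k s' assume "agree ?F1 s1 s'"
      from agreeN[OF this] show "nval (NV ''N'') s' = N" using f1 by simp
    next
      fix k s' assume I: "?I1 k s'" and ag: "agree ?F1 s1 s'" and k: "k < N" "nats s' ''i'' 0 = k"
      have f: "reals s' ''px'' k = fst ((rs @ bs) ! k)" "reals s' ''py'' k = snd ((rs @ bs) ! k)"
        "reals s' ''dx'' 0 = mean_diff fst rs bs" "reals s' ''dy'' 0 = mean_diff snd rs bs"
        using agreeR[OF ag] s1 k by simp_all
      show "runs rotate_pt s' 46 (\<lambda>s''. nats s'' ''i'' 0 = k \<and> ?I1 (Suc k) (nupd ''i'' 0 (Suc k) s''))"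
        using I k by (simp add: runs_def wp_simps rotate_pt_def f less_Suc_eq cu_def cv_def power2_eq_square cong: wp_cong)
    qed (use s1 in simp_all)
    show "runs (?F1 ;; ''i'' ::= NLit 0 ;; ?F2) s1 ((60 * N + 10) + (3 + (60 * N + 10))) ?post"
    proof (rule runs_Seq_agree[OF R1 _ order.refl])
      fix s2 assume s2: "?I1 N s2 \<and> nats s2 ''i'' 0 = N" and ag2: "agree ?F1 s1 s2"
      have f2: "nats s2 ''N'' 0 = N" "nats s2 ''R'' 0 = length rs" "reals s2 ''S'' 0 = shift rs bs"
        using agreeN[OF ag2] f1 s2 by (simp_all add: shift_def N_def)
      show "runs (''i'' ::= NLit 0 ;; ?F2) s2 (3 + (60 * N + 10)) ?post"
      proof (rule runs_Seq[where ?Q1.0 = "\<lambda>s'. s' = nupd ''i'' 0 0 s2", OF _ _ order.refl])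
        fix s3 assume s3: "s3 = nupd ''i'' 0 0 s2"
        have "runs ?F2 s3 (60 * N + 10) (\<lambda>s'. ?I2 N s' \<and> nats s' ''i'' 0 = N)"
        proof (rule runs_For[where T = "\<lambda>_. 35" and lo = 0 and I = ?I2])
          fix k s' assume "agree ?F2 s3 s'"
          from agreeN[OF this] show "nval (NV ''N'') s' = N" using f2 by (simp add: s3)
        next
          fix k s' assume I: "?I2 k s'" and ag: "agree ?F2 s3 s'" and k: "k < N" "nats s' ''i'' 0 = k"
          have f: "reals s' ''pu'' k = ?u k" "reals s' ''pv'' k = ?v k" "reals s' ''S'' 0 = shift rs bs" "nats s' ''R'' 0 = length rs"
            using agreeN[OF ag] agreeR[OF ag] s2 f2 k by (simp_all add: s3)
          show "runs reflect_pt s' 35 (\<lambda>s''. nats s'' ''i'' 0 = k \<and> ?I2 (Suc k) (nupd ''i'' 0 (Suc k) s''))"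
            using I k by (cases "k < length rs") (simp_all add: runs_def wp_simps reflect_pt_def f less_Suc_eq cong: wp_cong)
        qed (simp_all add: s3)
        then show "runs ?F2 s3 (60 * N + 10) ?post"
        proof (rule runs_conseq[OF runs_agree])
          fix s4 assume s4: "(?I2 N s4 \<and> nats s4 ''i'' 0 = N) \<and> agree ?F2 s3 s4"
          have "reals s4 ''pu'' = reals s2 ''pu''" "reals s4 ''pv'' = reals s2 ''pv''" "reals s4 ''S'' 0 = shift rs bs"
            using agreeR[OF conjunct2[OF s4]] f2 by (simp_all add: s3)
          then show "?post s4" using s4 s2 by auto
        qed simp
      qed (simp add: runs_def wp_simps)
    qed
  qed
  then show ?thesis by (rule runs_conseq) simp_all
qed

lemma frame2_runs:
  assumes N: "nats s0 ''N'' 0 = N"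
  shows "runs frame2 s0 (40 * N + 40) (\<lambda>s'. \<forall>i<N. reals s' ''kx'' i = reals s0 ''pv'' i - reals s0 ''num'' 0 / reals s0 ''den'' 0 * reals s0 ''pu'' i \<and>
      reals s' ''ky'' i = reals s0 ''pu'' i)"
proof -
  let ?F = "For ''i'' (NV ''N'') tilt_pt"
  let ?m = "reals s0 ''num'' 0 / reals s0 ''den'' 0"
  define s1 where "s1 = nupd ''i'' 0 0 (rupd ''m2'' 0 ?m s0)"
  let ?I = "\<lambda>k s. \<forall>i<k. reals s ''kx'' i = reals s0 ''pv'' i - ?m * reals s0 ''pu'' i \<and> reals s ''ky'' i = reals s0 ''pu'' i"
  have R1: "runs (''m2'' ::=r RDiv (RV ''num'') (RV ''den'') ;; ''i'' ::= NLit 0) s0 12 (\<lambda>s'. s' = s1)"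
    by (simp add: runs_def wp_simps s1_def)
  have R2: "runs ?F s1 (40 * N + 20) (\<lambda>s'. ?I N s' \<and> nats s' ''i'' 0 = N)"
  proof (rule runs_For[where T = "\<lambda>_. 25" and lo = 0 and I = ?I])
    fix k s' assume "agree ?F s1 s'"
    from agreeN[OF this] show "nval (NV ''N'') s' = N" using N by (simp add: s1_def)
  next
    fix k s' assume I: "?I k s'" and ag: "agree ?F s1 s'" and k: "k < N" "nats s' ''i'' 0 = k"
    have f: "reals s' ''pu'' = reals s0 ''pu''" "reals s' ''pv'' = reals s0 ''pv''" "reals s' ''m2'' 0 = ?m"
      using agreeR[OF ag] by (simp_all add: s1_def)
    show "runs tilt_pt s' 25 (\<lambda>s''. nats s'' ''i'' 0 = k \<and> ?I (Suc k) (nupd ''i'' 0 (Suc k) s''))"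
      using I k by (simp add: runs_def wp_simps tilt_pt_def f less_Suc_eq cong: wp_cong)
  qed (simp_all add: s1_def)
  have "runs ((''m2'' ::=r RDiv (RV ''num'') (RV ''den'') ;; ''i'' ::= NLit 0) ;; ?F) s0 (12 + (40 * N + 20)) (?I N)"
    by (rule runs_Seq[OF R1 _ order.refl], simp only:, rule runs_conseq[OF R2]) auto
  then have "runs frame2 s0 (12 + (40 * N + 20)) (?I N)"
    unfolding frame2_def runs_def by (simp add: wp_simps add.assoc)
  then show ?thesis by (rule runs_conseq) simp_all
qed

section \<open>Orientations, weighted means and ranks\<close>

definition cross :: "point \<Rightarrow> point \<Rightarrow> point \<Rightarrow> real" where
  "cross p q r = (fst q - fst p) * (snd r - snd p) - (snd q - snd p) * (fst r - fst p)"

lemma cross_zero_collinear: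
  assumes "cross p q r = 0" shows "collinear {p, q, r}"
proof (cases "p = r")
  case True
  then show ?thesis by (simp add: insert_commute)
next
  case False
  have *: "(fst q - fst p) * (snd r - snd p) = (snd q - snd p) * (fst r - fst p)" using assms by (simp add: cross_def)
  have "\<exists>u. q = u *\<^sub>R p + (1 - u) *\<^sub>R r"
  proof (cases "fst p = fst r")
    case True
    then have s: "snd p - snd r \<noteq> 0" using False by (simp add: prod_eq_iff)
    then have f: "fst q = fst p" using * True by simp
    define u where "u = (snd q - snd r) / (snd p - snd r)"
    have "u * (snd p - snd r) = snd q - snd r" using s by (simp add: u_def)
    then have "snd q = u * snd p + (1 - u) * snd r" by (simp add: algebra_simps)
    moreover have "fst q = u * fst p + (1 - u) * fst r" using f True by (simp add: algebra_simps)
    ultimately show ?thesis by (intro exI[of _ u]) (simp add: prod_eq_iff)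
  next
    case F: False
    then have s: "fst p - fst r \<noteq> 0" by simp
    define u where "u = (fst q - fst r) / (fst p - fst r)"
    have u: "u * (fst p - fst r) = fst q - fst r" using s by (simp add: u_def)
    then have fq: "fst q = u * fst p + (1 - u) * fst r" by (simp add: algebra_simps)
    have "fst q - fst p = (u - 1) * (fst p - fst r)" using u by (simp add: algebra_simps)
    then have "(u - 1) * (fst p - fst r) * (snd r - snd p) = (snd q - snd p) * (fst r - fst p)" using * by simp
    then have "(fst p - fst r) * ((u - 1) * (snd r - snd p) + (snd q - snd p)) = 0" by (simp add: algebra_simps)
    then have "(u - 1) * (snd r - snd p) + (snd q - snd p) = 0" using s by simp
    then have "snd q = u * snd p + (1 - u) * snd r" by (simp add: algebra_simps)
    then show ?thesis using fq by (intro exI[of _ u]) (simp add: prod_eq_iff)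
  qed
  then show ?thesis by (simp add: collinear_3_expand)
qed

lemma mean_diff_linear:
  "mean_diff (\<lambda>w. \<alpha> * f w + \<beta> * g w) rs bs = \<alpha> * mean_diff f rs bs + \<beta> * mean_diff g rs bs"
  by (simp add: mean_diff_def sum.distrib sum_distrib_left[symmetric] algebra_simps)

lemma mean_diff_pos:
  assumes "rs \<noteq> []" "bs \<noteq> []" "\<forall>r\<in>set rs. f r < c" "\<forall>b\<in>set bs. c < f b"
  shows "0 < mean_diff f rs bs"
proof -
  have "(\<Sum>i<length rs. f (rs ! i)) < (\<Sum>i<length rs. c)" using assms by (intro sum_strict_mono) auto
  moreover have "(\<Sum>i<length bs. c) < (\<Sum>i<length bs. f (bs ! i))" using assms by (intro sum_strict_mono) auto
  ultimately have a: "(\<Sum>i<length rs. f (rs ! i)) < real (length rs) * c" "real (length bs) * c < (\<Sum>i<length bs. f (bs ! i))" by auto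
  have "real (length bs) * (\<Sum>i<length rs. f (rs ! i)) < real (length bs) * (real (length rs) * c)"
    using a(1) assms by (intro mult_strict_left_mono) auto
  moreover have "real (length rs) * (real (length bs) * c) < real (length rs) * (\<Sum>i<length bs. f (bs ! i))"
    using a(2) assms by (intro mult_strict_left_mono) auto
  ultimately show ?thesis unfolding mean_diff_def by (simp add: algebra_simps)
qed

text \<open>Up to sign, the weighted difference of means is the double sum of all
  \<open>f r - f b\<close>. If these are nonnegative with sum zero, each of them vanishes.\<close>

lemma mean_diff_zero:
  assumes "mean_diff f rs bs = 0" "\<And>r b. r \<in> set rs \<Longrightarrow> b \<in> set bs \<Longrightarrow> f b \<le> f r" "r \<in> set rs" "b \<in> set bs"
  shows "f r = f b"
proof -
  have "(\<Sum>i<length rs. \<Sum>j<length bs. f (rs ! i) - f (bs ! j)) = - mean_diff f rs bs"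
    by (simp add: mean_diff_def sum_subtractf sum_distrib_left)
  then have z: "(\<Sum>i<length rs. \<Sum>j<length bs. f (rs ! i) - f (bs ! j)) = 0" using assms(1) by simp
  have le: "f (bs ! j) \<le> f (rs ! i)" if "i < length rs" "j < length bs" for i j using assms(2) nth_mem that by blast
  obtain i j where ij: "i < length rs" "r = rs ! i" "j < length bs" "b = bs ! j" using assms(3,4) by (metis in_set_conv_nth)
  have "\<forall>i\<in>{..<length rs}. (\<Sum>j<length bs. f (rs ! i) - f (bs ! j)) = 0"
    using z le by (subst (asm) sum_nonneg_eq_0_iff) (auto intro!: sum_nonneg)
  then have "(\<Sum>j<length bs. f (rs ! i) - f (bs ! j)) = 0" using ij by blast
  then have "\<forall>j\<in>{..<length bs}. f (rs ! i) - f (bs ! j) = 0"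
    using le ij by (subst (asm) sum_nonneg_eq_0_iff) auto
  then show ?thesis using ij by auto
qed

text \<open>Points 1 and 2 are on the low side of a line that is not vertical, hence so is the point
  of their segment over \<open>p3\<close>. Point 3 is on the high side, and the sign of
  \<open>n2\<close> makes high mean above.\<close>

lemma mid_sep:
  assumes "0 < (n2::real)" "n1 * p1 + n2 * q1 < k" "n1 * p2 + n2 * q2 < k" "k < n1 * p3 + n2 * q3" "p1 \<le> p3" "p3 \<le> p2" "p1 < p2"
  shows "(p2 - p1) * q1 + (q2 - q1) * (p3 - p1) < (p2 - p1) * q3"
proof -
  have "(p2 - p3) * (n1 * p1 + n2 * q1) \<le> (p2 - p3) * k" using assms by (intro mult_left_mono) auto
  moreover have "(p3 - p1) * (n1 * p2 + n2 * q2) \<le> (p3 - p1) * k" using assms by (intro mult_left_mono) auto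
  moreover have "(p2 - p1) * k < (p2 - p1) * (n1 * p3 + n2 * q3)" using assms by (intro mult_strict_left_mono) auto
  ultimately have "n2 * ((p2 - p1) * q1 + (q2 - q1) * (p3 - p1)) < n2 * ((p2 - p1) * q3)" by (simp add: algebra_simps)
  then show ?thesis using assms(1) by simp
qed

lemma sorted_out_inj:
  assumes so: "sorted_out N (lex x y) ot"
  shows "inj_on ot {..<N}" "ot ` {..<N} = {..<N}"
proof -
  show inj: "inj_on ot {..<N}"
  proof (rule inj_onI)
    fix i j assume ij: "i \<in> {..<N}" "j \<in> {..<N}" "ot i = ot j"
    show "i = j"
    proof (rule ccontr)
      assume "i \<noteq> j"
      then have "lex x y (ot i) (ot j) \<or> lex x y (ot j) (ot i)" using so ij unfolding sorted_out_def by (metis lessThan_iff linorder_neqE_nat)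
      then show False using ij(3) by (auto simp: lex_def)
    qed
  qed
  show "ot ` {..<N} = {..<N}"
    using so inj by (intro card_subset_eq) (auto simp: sorted_out_def card_image)
qed

lemma sorted_out_le:
  assumes "sorted_out N (lex x y) ot" "r \<le> r'" "r' < N" shows "x (ot r) \<le> x (ot r')"
proof (cases "r = r'")
  case False
  then have "lex x y (ot r) (ot r')" using assms unfolding sorted_out_def by simp
  then show ?thesis unfolding lex_def by linarith
qed simp

text \<open>Colour is decided by original numbers, position by rank. The ranks of red numbers are
  downward closed and there are \<open>R\<close> of them, so they are the first \<open>R\<close>
  ranks.\<close>

lemma rank_color:
  assumes so: "sorted_out N (lex x y) ot" and RN: "R \<le> N"
    and lt: "\<And>i j. i < R \<Longrightarrow> R \<le> j \<Longrightarrow> j < N \<Longrightarrow> x i < x j" and r: "r < N"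
  shows "ot r < R \<longleftrightarrow> r < R"
proof -
  note inj = sorted_out_inj(1)[OF so] and im = sorted_out_inj(2)[OF so]
  let ?A = "{r. r < N \<and> ot r < R}"
  have "ot ` ?A = {..<R}"
  proof (intro equalityI subsetI)
    fix i assume "i \<in> {..<R}"
    then have "i \<in> ot ` {..<N}" using im RN by auto
    then show "i \<in> ot ` ?A" using \<open>i \<in> {..<R}\<close> by auto
  qed auto
  moreover have "inj_on ot ?A" using inj by (rule inj_on_subset) auto
  ultimately have cA: "card ?A = R" by (metis card_image card_lessThan)
  have down: "ot r' < R" if "r' < r" "r < N" "ot r < R" for r r'
  proof (rule ccontr)
    assume "\<not> ot r' < R"
    then have "x (ot r) < x (ot r')" using lt[of "ot r" "ot r'"] that so by (auto simp: sorted_out_def)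
    moreover have "lex x y (ot r') (ot r)" using so that by (auto simp: sorted_out_def)
    ultimately show False by (auto simp: lex_def)
  qed
  have sub: "?A \<subseteq> {..<R}"
  proof
    fix r assume r: "r \<in> ?A"
    then have "{..r} \<subseteq> ?A" using down by (auto simp: le_less)
    then have "card {..r} \<le> card ?A" by (intro card_mono) auto
    then show "r \<in> {..<R}" using cA by simp
  qed
  then have "?A = {..<R}" using cA by (intro card_subset_eq) auto
  then show ?thesis using r by auto
qed

section \<open>Why the edge found separates the colours\<close>

locale config =
  fixes rs bs :: "point list" and av :: point and ac :: real
  assumes ne: "rs \<noteq> []" "bs \<noteq> []" and three: "3 \<le> length rs + length bs" and dis: "distinct rs" "distinct bs"
    and gp: "general_position (set rs \<union> set bs)"
    and sepr: "\<And>w. w \<in> set rs \<Longrightarrow> av \<bullet> w < ac" and sepb: "\<And>w. w \<in> set bs \<Longrightarrow> ac < av \<bullet> w"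
begin

abbreviation "ps \<equiv> rs @ bs"
abbreviation "N \<equiv> length rs + length bs"
abbreviation "Rn \<equiv> length rs"
definition "dx = mean_diff fst rs bs"
definition "dy = mean_diff snd rs bs"
definition "uu i = cu rs bs (ps ! i)"
definition "vv i = cv rs bs (ps ! i)"

lemma inner_pt: "av \<bullet> w = fst av * fst w + snd av * snd w"
  by (simp add: inner_prod_def)

text \<open>\<open>av\<close> and \<open>ac\<close> are a separating line that exists in the proof
  only; the program never sees it. Its normal has a positive component along the difference of the
  centroids, which therefore do not coincide.\<close>

lemma d_pos: "0 < fst av * dx + snd av * dy"
proof -
  have "0 < mean_diff (\<lambda>w. fst av * fst w + snd av * snd w) rs bs"
    using sepr sepb inner_pt by (intro mean_diff_pos[OF ne, where c = ac]) auto
  then show ?thesis by (simp add: mean_diff_linear dx_def dy_def)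
qed

lemma dd_pos: "0 < dx * dx + dy * dy"
proof -
  have "dx \<noteq> 0 \<or> dy \<noteq> 0" using d_pos by auto
  then show ?thesis by (simp add: sum_squares_gt_zero_iff)
qed

lemma uv_back: "(dx * dx + dy * dy) * fst w = dx * cv rs bs w - dy * cu rs bs w"
  "(dx * dx + dy * dy) * snd w = dy * cv rs bs w + dx * cu rs bs w"
  by (simp_all add: cu_def cv_def dx_def dy_def algebra_simps)

lemma uv_inj: "cu rs bs w = cu rs bs w' \<Longrightarrow> cv rs bs w = cv rs bs w' \<Longrightarrow> w = w'"
  using uv_back[of w] uv_back[of w'] mult_left_cancel[OF less_imp_neq[OF dd_pos, symmetric]]
  by (metis prod_eq_iff)

text \<open>With \<open>n2\<close>, the coefficients of the normal \<open>av\<close> in the rotated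
  frame. That \<open>n2\<close> is positive means that the unknown line is not vertical there and
  has the blue points above it.\<close>

definition "n1 = (snd av * dx - fst av * dy) / (dx * dx + dy * dy)"
definition "n2 = (fst av * dx + snd av * dy) / (dx * dx + dy * dy)"

lemma n2_pos: "0 < n2"
  using d_pos dd_pos by (simp add: n2_def)

lemma normal_uv: "n1 * cu rs bs w + n2 * cv rs bs w = av \<bullet> w"
proof -
  have "(dx * dx + dy * dy) * (n1 * cu rs bs w + n2 * cv rs bs w) =
      (snd av * dx - fst av * dy) * cu rs bs w + (fst av * dx + snd av * dy) * cv rs bs w"
  proof -
    have "(dx * dx + dy * dy) * n1 = snd av * dx - fst av * dy" "(dx * dx + dy * dy) * n2 = fst av * dx + snd av * dy"
      by (simp_all only: n1_def n2_def times_divide_eq_right nonzero_mult_div_cancel_left[OF less_imp_neq[OF dd_pos, symmetric]])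
    then show ?thesis by (simp only: distrib_left mult.assoc[symmetric])
  qed
  also have "\<dots> = (dx * dx + dy * dy) * (av \<bullet> w)"
    unfolding inner_pt cu_def cv_def dx_def[symmetric] dy_def[symmetric] by algebra
  finally show ?thesis using mult_left_cancel[OF less_imp_neq[OF dd_pos, symmetric]] by blast
qed

lemma mean_u: "mean_diff (cu rs bs) rs bs = 0"
proof -
  have "cu rs bs = (\<lambda>w. dx * snd w + (- dy) * fst w)" by (auto simp: cu_def dx_def dy_def)
  then show ?thesis by (simp only: mean_diff_linear) (simp add: dx_def[symmetric] dy_def[symmetric])
qed

lemma ps_in: "i < N \<Longrightarrow> ps ! i \<in> set rs \<union> set bs" "i < Rn \<Longrightarrow> ps ! i \<in> set rs" "Rn \<le> i \<Longrightarrow> i < N \<Longrightarrow> ps ! i \<in> set bs"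
  by (auto simp: nth_append)

lemma ps_distinct: "distinct ps"
  using dis sepr sepb by force

lemma cross_uv:
  "(cu rs bs q - cu rs bs p) * (cv rs bs r - cv rs bs p) - (cv rs bs q - cv rs bs p) * (cu rs bs r - cu rs bs p)
     = - (dx * dx + dy * dy) * cross p q r"
  unfolding cu_def cv_def cross_def dx_def[symmetric] dy_def[symmetric] by algebra

text \<open>Equal \<open>u\<close> throughout would put all points on one line, and there are at
  least three points in general position. This supplies the strict inequality with which the turning
  starts.\<close>

lemma u_not_const: "\<not> (\<forall>r\<in>set rs. \<forall>b\<in>set bs. cu rs bs r = cu rs bs b)"
proof
  assume c: "\<forall>r\<in>set rs. \<forall>b\<in>set bs. cu rs bs r = cu rs bs b"
  obtain r0 b0 where rb: "r0 \<in> set rs" "b0 \<in> set bs" using ne by (metis list.set_intros(1) neq_Nil_conv)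
  have eq: "cu rs bs w = cu rs bs r0" if "w \<in> set ps" for w using that c rb by auto metis
  have "ps ! 0 \<noteq> ps ! 1" "ps ! 0 \<noteq> ps ! 2" "ps ! 1 \<noteq> ps ! 2"
    using nth_eq_iff_index_eq[OF ps_distinct, of 0 1] nth_eq_iff_index_eq[OF ps_distinct, of 0 2]
      nth_eq_iff_index_eq[OF ps_distinct, of 1 2] three ne by simp_all
  moreover have in3: "ps ! 0 \<in> set ps" "ps ! 1 \<in> set ps" "ps ! 2 \<in> set ps" using three by (auto intro!: nth_mem simp del: set_append)
  ultimately have "\<not> collinear {ps ! 0, ps ! 1, ps ! 2}" using gp unfolding general_position_def by (metis set_append)
  moreover have "- (dx * dx + dy * dy) * cross (ps ! 0) (ps ! 1) (ps ! 2) = 0"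
    unfolding cross_uv[symmetric] using eq in3 by simp
  ultimately show False using cross_zero_collinear dd_pos by auto
qed

abbreviation "sm \<equiv> shift rs bs"

lemma shift_gt:
  assumes "i < N" "j < N" "i \<noteq> j"
  shows "uu i + uu j < sm"
proof -
  have "(\<Sum>k\<in>{i, j}. (uu k)\<^sup>2) \<le> (\<Sum>i<N. (uu i)\<^sup>2)" using assms by (intro sum_mono2) auto
  then have "(uu i)\<^sup>2 + (uu j)\<^sup>2 + 2 \<le> sm" using assms(3) by (simp add: shift_def uu_def)
  moreover have "2 * uu i \<le> 1 + (uu i)\<^sup>2" "2 * uu j \<le> 1 + (uu j)\<^sup>2"
    using sum_squares_bound[of "uu i" 1] sum_squares_bound[of "uu j" 1] by simp_all
  ultimately show ?thesis using zero_le_power2[of "uu i"] zero_le_power2[of "uu j"] by linarith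
qed

definition frame1_keys :: "(nat \<Rightarrow> real) \<Rightarrow> (nat \<Rightarrow> real) \<Rightarrow> bool" where
  "frame1_keys x y \<longleftrightarrow> (\<forall>i<N. x i = (if i < Rn then uu i else sm - uu i) \<and> y i = (if i < Rn then vv i else - vv i))"

lemma uv_idx: "i < N \<Longrightarrow> j < N \<Longrightarrow> uu i = uu j \<Longrightarrow> vv i = vv j \<Longrightarrow> i = j"
  using uv_inj[of "ps ! i" "ps ! j"] nth_eq_iff_index_eq[OF ps_distinct] by (simp add: uu_def vv_def)

lemma frame1_red_blue:
  assumes "frame1_keys x y" "i < Rn" "Rn \<le> j" "j < N" shows "x i < x j"
  using assms shift_gt[of i j] by (auto simp: frame1_keys_def)

lemma frame1_distinct:
  assumes k: "frame1_keys x y" shows "lex_distinct N x y"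
proof
  fix i j assume ij: "i < N" "j < N" "i \<noteq> j"
  show "x i \<noteq> x j \<or> y i \<noteq> y j"
  proof (cases "(i < Rn) = (j < Rn)")
    case True
    then show ?thesis using k ij uv_idx[of i j] by (auto simp: frame1_keys_def)
  next
    case False
    then show ?thesis using frame1_red_blue[OF k, of i j] frame1_red_blue[OF k, of j i] ij by force
  qed
qed

lemma normal_idx: "i < Rn \<Longrightarrow> n1 * uu i + n2 * vv i < ac" "Rn \<le> i \<Longrightarrow> i < N \<Longrightarrow> ac < n1 * uu i + n2 * vv i"
  using sepr[of "ps ! i"] sepb[of "ps ! i"] ps_in(2,3)[of i] normal_uv[of "ps ! i"] by (auto simp: uu_def vv_def)

definition slope_sep :: "real \<Rightarrow> bool" where
  "slope_sep m \<longleftrightarrow> (\<forall>i j. i < Rn \<and> Rn \<le> j \<and> j < N \<longrightarrow> vv i - m * uu i < vv j - m * uu j)"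

text \<open>\<open>a\<close> is the extreme red point and \<open>c\<close> the extreme blue one in
  the direction of slope \<open>num / den\<close>, and \<open>mid\<close> puts \<open>c\<close>
  strictly above the line through \<open>a\<close>.\<close>

lemma slope_sepI:
  assumes den: "0 < den" and a: "a < Rn" and c: "Rn \<le> c" "c < N"
    and ra: "\<And>k. k < Rn \<Longrightarrow> (vv k - vv a) * den \<le> num * (uu k - uu a)"
    and bc: "\<And>k. Rn \<le> k \<Longrightarrow> k < N \<Longrightarrow> (vv c - vv k) * den \<le> num * (uu c - uu k)"
    and mid: "den * vv a + num * (uu c - uu a) < den * vv c"
  shows "slope_sep (num / den)"
  unfolding slope_sep_def
proof (intro allI impI)
  fix i j assume ij: "i < Rn \<and> Rn \<le> j \<and> j < N"
  have "(vv i - vv a) * den \<le> num * (uu i - uu a)" "(vv c - vv j) * den \<le> num * (uu c - uu j)" using ra bc ij by blast+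
  then have "den * vv i - num * uu i < den * vv j - num * uu j" using mid by (simp add: algebra_simps)
  then have "(den * vv i - num * uu i) / den < (den * vv j - num * uu j) / den" using den by (simp add: divide_strict_right_mono)
  then show "vv i - num / den * uu i < vv j - num / den * uu j" using den by (simp add: diff_divide_distrib)
qed

end

text \<open>The same pass runs twice: on the red and the reflected blue points to find the
  direction, and then on all points in sorted position, where it leaves the hierarchy and the first
  bridge ready.\<close>

definition prep :: com where
  "prep = (sizes ;; frame1 ;; pass ;; turn ;; frame2 ;; pass)"

context config begin

text \<open>In terms of \<open>u\<close>, the least red value is below the greatest blue one, and
  the least blue value is at most the greatest red one. Otherwise the equal means would force all
  values to coincide in the first case, and would be strictly separated in the second.\<close>

lemma extremes:
  assumes k: "frame1_keys x y" and so: "sorted_out N (lex x y) ot"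
  shows "x (ot 0) + x (ot Rn) < sm" "sm \<le> x (ot (Rn - 1)) + x (ot (N - 1))"
proof -
  have R1: "1 \<le> Rn" "Rn < N" using ne by (cases rs; cases bs; simp)+
  have col: "r < N \<Longrightarrow> ot r < Rn \<longleftrightarrow> r < Rn" for r
    using rank_color[OF so _ frame1_red_blue[OF k]] by simp
  have pre: "\<exists>r<N. ot r = i" if "i < N" for i
    using sorted_out_inj(2)[OF so] that by (metis imageE lessThan_iff)
  have otN: "ot r < N" if "r < N" for r using so that by (simp add: sorted_out_def)
  have xr: "x (ot r) = uu (ot r)" if "r < Rn" for r using k col[of r] otN[of r] that R1 by (simp add: frame1_keys_def)
  have xb: "x (ot r) = sm - uu (ot r)" if "Rn \<le> r" "r < N" for r using k col[of r] otN[of r] that by (simp add: frame1_keys_def)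
  have red: "uu (ot 0) \<le> uu i" "uu i \<le> uu (ot (Rn - 1))" if "i < Rn" for i
  proof -
    have "i < N" using that by simp
    then obtain r where r: "r < N" "ot r = i" using pre[of i] by blast
    then have "r < Rn" using col that by blast
    then show "uu (ot 0) \<le> uu i" "uu i \<le> uu (ot (Rn - 1))"
      using sorted_out_le[OF so, of 0 r] sorted_out_le[OF so, of r "Rn - 1"] xr[of 0] xr[of r] xr[of "Rn - 1"] r R1 ne by auto
  qed
  have blue: "uu i \<le> uu (ot Rn)" "uu (ot (N - 1)) \<le> uu i" if "Rn \<le> i" "i < N" for i
  proof -
    have "i < N" using that by simp
    then obtain r where r: "r < N" "ot r = i" using pre[of i] by blast
    then have "Rn \<le> r" using col that by (metis not_less)
    then show "uu i \<le> uu (ot Rn)" "uu (ot (N - 1)) \<le> uu i"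
      using sorted_out_le[OF so, of Rn r] sorted_out_le[OF so, of r "N - 1"] xb[of Rn] xb[of r] xb[of "N - 1"] r R1 ne by auto
  qed
  have ired: "\<exists>i<Rn. cu rs bs w = uu i" if "w \<in> set rs" for w
    using that by (auto simp: in_set_conv_nth uu_def nth_append)
  have iblue: "\<exists>i. Rn \<le> i \<and> i < N \<and> cu rs bs w = uu i" if w: "w \<in> set bs" for w
  proof -
    obtain j where "j < length bs" "w = bs ! j" using w by (metis in_set_conv_nth)
    then show ?thesis by (intro exI[of _ "Rn + j"]) (simp add: uu_def)
  qed
  have "uu (ot 0) < uu (ot Rn)"
  proof (rule ccontr)
    assume "\<not> uu (ot 0) < uu (ot Rn)"
    then have le: "cu rs bs b \<le> cu rs bs r" if "r \<in> set rs" "b \<in> set bs" for r b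
      using ired[OF that(1)] iblue[OF that(2)] red(1) blue(1) by (metis linorder_not_less order.trans)
    then show False using mean_diff_zero[OF mean_u le] u_not_const by blast
  qed
  then show "x (ot 0) + x (ot Rn) < sm" using xr[of 0] xb[of Rn] R1 ne by simp
  have "uu (ot (N - 1)) \<le> uu (ot (Rn - 1))"
  proof (rule ccontr)
    assume n: "\<not> uu (ot (N - 1)) \<le> uu (ot (Rn - 1))"
    define c where "c = (uu (ot (N - 1)) + uu (ot (Rn - 1))) / 2"
    have "cu rs bs r < c" if "r \<in> set rs" for r using ired[OF that] red(2) n unfolding c_def by force
    moreover have "c < cu rs bs b" if "b \<in> set bs" for b using iblue[OF that] blue(2) n unfolding c_def by force
    ultimately have "0 < mean_diff (cu rs bs) rs bs" by (intro mean_diff_pos[OF ne]) auto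
    then show False using mean_u by simp
  qed
  moreover have "Rn \<le> N - 1" "N - 1 < N" "Rn - 1 < Rn" using R1 by linarith+
  ultimately show "sm \<le> x (ot (Rn - 1)) + x (ot (N - 1))" using xr[of "Rn - 1"] xb[of "N - 1"] by linarith
qed

text \<open>The offset \<open>lo\<close> makes the middle sentinel the exact boundary between the
  ranks of the two colours.\<close>

lemma KR_KB:
  assumes "1 \<le> D" "Rn \<le> 2 ^ (D - 1)" "length bs \<le> 2 ^ (D - 1)" "lo = 2 ^ (D - 1) - Rn"
  shows "pt lo ` {..<N} \<inter> {0<..<2 ^ D} = pt lo ` {..<Rn}" "pt lo ` {..<N} \<inter> {2 ^ D<..<wd D} = pt lo ` {Rn..<N}"
    "lo + N \<le> 2 ^ D" "\<And>r. r < N \<Longrightarrow> pt lo r < 2 ^ D \<longleftrightarrow> r < Rn"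
proof -
  have p: "(2::nat) ^ D = 2 * 2 ^ (D - 1)" using assms(1) by (cases D) auto
  show l: "lo + N \<le> 2 ^ D" using assms p by simp
  show c: "pt lo r < 2 ^ D \<longleftrightarrow> r < Rn" if "r < N" for r using assms p by (auto simp: pt_def)
  have w: "pt lo r < wd D" if "r < N" for r using l that by (simp add: pt_def wd_def)
  have n: "pt lo r \<noteq> 2 ^ D" for r
  proof -
    have "odd (pt lo r)" "even ((2::nat) ^ D)" using p by (simp_all add: pt_def)
    then show ?thesis by metis
  qed
  have z: "0 < pt lo r" for r by (simp add: pt_def)
  have RN: "Rn \<le> N" by simp
  show "pt lo ` {..<N} \<inter> {0<..<2 ^ D} = pt lo ` {..<Rn}"
  proof (intro equalityI subsetI)
    fix q assume "q \<in> pt lo ` {..<N} \<inter> {0<..<2 ^ D}"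
    then obtain r where "q = pt lo r" "r < N" "pt lo r < 2 ^ D" by auto
    then show "q \<in> pt lo ` {..<Rn}" using c by blast
  next
    fix q assume "q \<in> pt lo ` {..<Rn}"
    then obtain r where "q = pt lo r" "r < Rn" by auto
    then show "q \<in> pt lo ` {..<N} \<inter> {0<..<2 ^ D}" using c[of r] z[of r] RN by simp
  qed
  show "pt lo ` {..<N} \<inter> {2 ^ D<..<wd D} = pt lo ` {Rn..<N}"
  proof (intro equalityI subsetI)
    fix q assume "q \<in> pt lo ` {..<N} \<inter> {2 ^ D<..<wd D}"
    then obtain r where "q = pt lo r" "r < N" "2 ^ D < pt lo r" by auto
    then show "q \<in> pt lo ` {Rn..<N}" using c[of r] by (intro image_eqI[of _ _ r]) simp_all
  next
    fix q assume "q \<in> pt lo ` {Rn..<N}"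
    then obtain r where r: "q = pt lo r" "Rn \<le> r" "r < N" by auto
    then have "2 ^ D < pt lo r" using c[of r] n[of r] by simp
    then show "q \<in> pt lo ` {..<N} \<inter> {2 ^ D<..<wd D}" using r w[of r] by simp
  qed
qed

lemma turn_ok:
  assumes k: "frame1_keys x y" and ar: "arranged D lo N x y ot H eps s0" and kx: "reals s0 ''kx'' = x" "reals s0 ''S'' 0 = sm"
    and sz: "sized D lo N s0" and D: "1 \<le> D" "Rn \<le> 2 ^ (D - 1)" "length bs \<le> 2 ^ (D - 1)" "lo = 2 ^ (D - 1) - Rn"
  shows "runs turn s0 (1000 * 2 ^ D + 50 * D) (\<lambda>s'. slope_sep (reals s' ''num'' 0 / reals s' ''den'' 0))"
proof -
  let ?S = "pt lo ` {..<N}"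
  define U where "U = (\<lambda>i. x (nats s0 ''p'' i))"
  have so: "sorted_out N (lex x y) ot" and ge: "geometry D lo N x y ot s0 H eps"
    and t: "lev.treeok (reals s0 ''X'') (reals s0 ''Y'') D s0 ?S" using ar by (auto simp: arranged_def)
  have pts: "r < N \<Longrightarrow> reals s0 ''X'' (pt lo r) = x (ot r) + eps * y (ot r) \<and> reals s0 ''Y'' (pt lo r) = y (ot r) \<and> nats s0 ''p'' (pt lo r) = ot r" for r
    using ge by (simp add: geometry_def)
  have L: "lev (reals s0 ''X'') (reals s0 ''Y'') (gapset D) ?S H D" using ge by (simp add: geometry_def)
  interpret far_lev "reals s0 ''X''" "reals s0 ''Y''" "gapset D" ?S H D U eps sm
    using L ge pts by (intro far_lev.intro far_lev_axioms.intro) (auto simp: geometry_def U_def)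
  note K = KR_KB[OF D]
  have R1: "1 \<le> Rn" "Rn < N" using ne by (cases rs; cases bs; simp)+
  have Upt: "U (pt lo r) = x (ot r)" if "r < N" for r using pts[OF that] by (simp add: U_def)
  have Ypt: "reals s0 ''Y'' (pt lo r) = y (ot r)" if "r < N" for r using pts[OF that] by simp
  have pinj: "pt lo r \<le> pt lo r' \<longleftrightarrow> r \<le> r'" for r r' by (simp add: pt_def)
  note ex = extremes[OF k so]
  have run: "runs turn s0 (1000 * 2 ^ D + 50 * D) (\<lambda>s'. turn_post (reals s' ''num'' 0) (reals s' ''den'' 0))"
  proof (rule turn_runs[OF t D(1)])
    show "nats s0 ''P'' 0 = 2 ^ D" "nats s0 ''E'' 0 = wd D" using sz by (auto simp: sized_def)
    show "reals s0 ''S'' 0 = sm" by (rule kx(2))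
    show "reals s0 ''kx'' (nats s0 ''p'' i) = U i" for i by (simp add: kx U_def)
    have "pt lo 0 \<in> pt lo ` {..<Rn}" "pt lo Rn \<in> pt lo ` {Rn..<N}" using R1 by auto
    then show "?S \<inter> {0<..<2 ^ D} \<noteq> {}" "?S \<inter> {2 ^ D<..<wd D} \<noteq> {}" unfolding K(1,2) by blast+
    show "U a + U c < sm" if h: "a \<in> ?S \<inter> {0<..<2 ^ D}" "\<forall>k\<in>?S \<inter> {0<..<2 ^ D}. a \<le> k"
      "c \<in> ?S \<inter> {2 ^ D<..<wd D}" "\<forall>k\<in>?S \<inter> {2 ^ D<..<wd D}. c \<le> k" for a c
    proof -
      have "a \<le> pt lo 0" "c \<le> pt lo Rn" using h(2,4) unfolding K(1,2) using R1 by auto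
      then have "a = pt lo 0" "c = pt lo Rn" using h(1,3) unfolding K(1,2) by (auto simp: pinj)
      then show ?thesis using ex(1) Upt R1 by simp
    qed
    show "sm \<le> U a + U c" if h: "a \<in> ?S \<inter> {0<..<2 ^ D}" "\<forall>k\<in>?S \<inter> {0<..<2 ^ D}. k \<le> a"
      "c \<in> ?S \<inter> {2 ^ D<..<wd D}" "\<forall>k\<in>?S \<inter> {2 ^ D<..<wd D}. k \<le> c" for a c
    proof -
      have "Rn \<le> N - 1" "N - 1 < N" "Rn - 1 < Rn" using R1 by linarith+
      then have "Rn - 1 \<in> {..<Rn}" "N - 1 \<in> {Rn..<N}" by (auto simp only: atLeastLessThan_iff lessThan_iff)
      then have "pt lo (Rn - 1) \<le> a" "pt lo (N - 1) \<le> c" using h(2,4) unfolding K(1,2) by blast+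
      moreover obtain r where r: "a = pt lo r" "r < Rn" using h(1) unfolding K(1) by auto
      moreover obtain r' where r': "c = pt lo r'" "Rn \<le> r'" "r' < N" using h(3) unfolding K(2) by auto
      ultimately have "r = Rn - 1" "r' = N - 1" by (auto simp: pinj)
      then show ?thesis using ex(2) Upt[of "Rn - 1"] Upt[of "N - 1"] R1 r r' by simp
    qed
  qed
  have col: "r < N \<Longrightarrow> ot r < Rn \<longleftrightarrow> r < Rn" for r
    using rank_color[OF so _ frame1_red_blue[OF k]] by simp
  have otN: "ot r < N" if "r < N" for r using so that by (simp add: sorted_out_def)
  have pre: "\<exists>r<N. ot r = i" if "i < N" for i
    using sorted_out_inj(2)[OF so] that by (metis imageE lessThan_iff)
  have red: "\<exists>i<Rn. U z = uu i \<and> reals s0 ''Y'' z = vv i" if z: "z \<in> ?S \<inter> {0<..<2 ^ D}" for z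
  proof -
    obtain r where r: "z = pt lo r" "r < Rn" using z unfolding K(1) by auto
    then show ?thesis using Upt[of r] Ypt[of r] col[of r] otN[of r] k R1 by (intro exI[of _ "ot r"]) (auto simp: frame1_keys_def)
  qed
  have blue: "\<exists>i. Rn \<le> i \<and> i < N \<and> U z = sm - uu i \<and> reals s0 ''Y'' z = - vv i" if z: "z \<in> ?S \<inter> {2 ^ D<..<wd D}" for z
  proof -
    obtain r where r: "z = pt lo r" "Rn \<le> r" "r < N" using z unfolding K(2) by auto
    then show ?thesis using Upt[of r] Ypt[of r] col[of r] otN[of r] k by (intro exI[of _ "ot r"]) (auto simp: frame1_keys_def)
  qed
  have redc: "\<exists>z\<in>?S \<inter> {0<..<2 ^ D}. U z = uu i \<and> reals s0 ''Y'' z = vv i" if "i < Rn" for i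
  proof -
    have "i < N" using that by simp
    then obtain r where r: "r < N" "ot r = i" using pre[of i] by blast
    then have "r < Rn" using col that by blast
    then show ?thesis unfolding K(1) using Upt[OF r(1)] Ypt[OF r(1)] k r that by (intro bexI[of _ "pt lo r"]) (auto simp: frame1_keys_def)
  qed
  have bluec: "\<exists>z\<in>?S \<inter> {2 ^ D<..<wd D}. U z = sm - uu i \<and> reals s0 ''Y'' z = - vv i" if "Rn \<le> i" "i < N" for i
  proof -
    have "i < N" using that by simp
    then obtain r where r: "r < N" "ot r = i" using pre[of i] by blast
    then have "Rn \<le> r" using col that by (metis not_less)
    then show ?thesis unfolding K(2) using Upt[OF r(1)] Ypt[OF r(1)] k r that by (intro bexI[of _ "pt lo r"]) (auto simp: frame1_keys_def)
  qed
  have "slope_sep (num / den)" if tp: "turn_post num den" for num den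
  proof -
    have den: "0 < den" using tp by (simp add: turn_post_def)
    have ra: "(vv i - vv ia) * den \<le> num * (uu i - uu ia)"
      if "supports (?S \<inter> {0<..<2 ^ D}) a num den" "U a = uu ia" "reals s0 ''Y'' a = vv ia" "i < Rn" for a ia i
    proof -
      note ex = redc[OF that(4)]
      then obtain z where "z \<in> ?S \<inter> {0<..<2 ^ D}" "U z = uu i" "reals s0 ''Y'' z = vv i" by blast
      then show ?thesis using that(1-3) unfolding supports_def by force
    qed
    have bc: "(vv ic - vv i) * den \<le> num * (uu ic - uu i)"
      if "supports (?S \<inter> {2 ^ D<..<wd D}) c num den" "U c = sm - uu ic" "reals s0 ''Y'' c = - vv ic" "Rn \<le> i" "i < N" for c ic i
    proof -
      note ex = bluec[OF that(4,5)]
      then obtain z where "z \<in> ?S \<inter> {2 ^ D<..<wd D}" "U z = sm - uu i" "reals s0 ''Y'' z = - vv i" by blast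
      then have "(- vv i - - vv ic) * den \<le> num * ((sm - uu i) - (sm - uu ic))" using that(1-3) unfolding supports_def by force
      then show ?thesis by (simp add: algebra_simps)
    qed
    from tp[unfolded turn_post_def] show ?thesis
    proof (elim conjE disjE exE)
      fix a z c assume h: "{a, z} \<subseteq> ?S \<inter> {0<..<2 ^ D}" "c \<in> ?S \<inter> {2 ^ D<..<wd D}" "num = reals s0 ''Y'' z - reals s0 ''Y'' a" "den = U z - U a"
        "U a + U c < sm" "sm \<le> U z + U c" "supports (?S \<inter> {0<..<2 ^ D}) a num den" "supports (?S \<inter> {2 ^ D<..<wd D}) c num den"
      obtain ia where ia: "ia < Rn" "U a = uu ia" "reals s0 ''Y'' a = vv ia" using red[of a] h(1) by auto
      obtain iz where iz: "iz < Rn" "U z = uu iz" "reals s0 ''Y'' z = vv iz" using red[of z] h(1) by auto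
      obtain ic where ic: "Rn \<le> ic" "ic < N" "U c = sm - uu ic" "reals s0 ''Y'' c = - vv ic" using blue[OF h(2)] by blast
      \<comment> \<open>The sum of abscissae passes \<open>sm\<close> on this edge, so the
        \<open>u\<close> of the blue point lies between those of the ends of the red edge.
        Separability then puts the blue point strictly above the edge.\<close>
      have "(uu iz - uu ia) * vv ia + (vv iz - vv ia) * (uu ic - uu ia) < (uu iz - uu ia) * vv ic"
        by (rule mid_sep[OF n2_pos normal_idx(1)[OF ia(1)] normal_idx(1)[OF iz(1)] normal_idx(2)[OF ic(1,2)]])
          (use h ia iz ic den in auto)
      then have "den * vv ia + num * (uu ic - uu ia) < den * vv ic" using h ia iz by simp
      then show ?thesis using slope_sepI[OF den ia(1) ic(1,2) ra[OF h(7) ia(2,3)] bc[OF h(8) ic(3,4)]] by blast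
    next
      fix c z a assume h: "{c, z} \<subseteq> ?S \<inter> {2 ^ D<..<wd D}" "a \<in> ?S \<inter> {0<..<2 ^ D}" "num = reals s0 ''Y'' z - reals s0 ''Y'' c" "den = U z - U c"
        "U a + U c < sm" "sm \<le> U a + U z" "supports (?S \<inter> {2 ^ D<..<wd D}) c num den" "supports (?S \<inter> {0<..<2 ^ D}) a num den"
      obtain ia where ia: "ia < Rn" "U a = uu ia" "reals s0 ''Y'' a = vv ia" using red[OF h(2)] by auto
      obtain ic where ic: "Rn \<le> ic" "ic < N" "U c = sm - uu ic" "reals s0 ''Y'' c = - vv ic" using blue[of c] h(1) by auto
      obtain iz where iz: "Rn \<le> iz" "iz < N" "U z = sm - uu iz" "reals s0 ''Y'' z = - vv iz" using blue[of z] h(1) by auto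
      \<comment> \<open>For a blue edge and a red point the same argument is used with the
        \<open>v\<close> axis turned over, which changes the signs of \<open>n1\<close> and
        \<open>ac\<close>.\<close>
      have "(uu ic - uu iz) * (- vv iz) + (- vv ic - - vv iz) * (uu ia - uu iz) < (uu ic - uu iz) * (- vv ia)"
        by (rule mid_sep[of n2 "- n1" _ _ "- ac"])
          (use n2_pos normal_idx(2)[OF ic(1,2)] normal_idx(2)[OF iz(1,2)] normal_idx(1)[OF ia(1)] h ia ic iz den in auto)
      moreover have nd: "num = vv ic - vv iz" "den = uu ic - uu iz" using h ic iz by auto
      ultimately have "den * vv ia + num * (uu ic - uu ia) < den * vv ic" unfolding nd by (simp add: algebra_simps)
      then show ?thesis using slope_sepI[OF den ia(1) ic(1,2) ra[OF h(8) ia(2,3)] bc[OF h(7) ic(3,4)]] by blast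
    qed
  qed
  then show ?thesis by (intro runs_conseq[OF run]) auto
qed

text \<open>The final coordinates, shear included, are an invertible linear image of the input
  points. All orientations thus differ from the true ones by one nonzero factor, and the shear
  cannot affect which segments cross.\<close>

definition ready :: "nat \<Rightarrow> nat \<Rightarrow> (nat \<Rightarrow> nat) \<Rightarrow> real \<Rightarrow> ram \<Rightarrow> bool" where
  "ready D lo ot H s \<longleftrightarrow> 1 \<le> D \<and> Rn \<le> 2 ^ (D - 1) \<and> length bs \<le> 2 ^ (D - 1) \<and> lo = 2 ^ (D - 1) - Rn \<and> 2 ^ D \<le> 4 * N \<and>
     (\<exists>x y eps. arranged D lo N x y ot H eps s) \<and>
     (\<exists>a1 b1 a2 b2. a1 * b2 - b1 * a2 \<noteq> 0 \<and> (\<forall>r<N. reals s ''X'' (pt lo r) = a1 * fst (ps ! ot r) + b1 * snd (ps ! ot r) \<and>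
         reals s ''Y'' (pt lo r) = a2 * fst (ps ! ot r) + b2 * snd (ps ! ot r))) \<and>
     (\<forall>r<N. ot r < Rn \<longleftrightarrow> r < Rn) \<and> nats s ''R'' 0 = Rn \<and> nats s ''B'' 0 = length bs \<and> nats s ''D'' 0 = D"

lemma prep_runs:
  "\<exists>D. 2 ^ D \<le> 4 * N \<and> 1 \<le> D \<and> runs prep (input_ram rs bs) (7500 * D * 2 ^ D) (\<lambda>s. \<exists>lo ot H. ready D lo ot H s)"
proof -
  define s0 where "s0 = input_ram rs bs"
  have R1: "1 \<le> Rn" "1 \<le> length bs" using ne by (cases rs; cases bs; simp)+
  have i0: "nats s0 ''red_count'' 0 = Rn" "nats s0 ''blue_count'' 0 = length bs" by (simp_all add: s0_def input_ram_def)
  let ?D = "\<lambda>D s'. 1 \<le> D \<and> sized D (2 ^ (D - 1) - Rn) N s' \<and> Rn \<le> 2 ^ (D - 1) \<and> length bs \<le> 2 ^ (D - 1) \<and>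
     2 ^ D \<le> 4 * N \<and> nats s' ''R'' 0 = Rn \<and> nats s' ''B'' 0 = length bs"
  from runs_agree[OF sizes_runs[OF i0 R1]] obtain t0 s1 D where
    ex0: "exec sizes s0 t0 s1" "t0 \<le> 100 * N + 100" "?D D s1" and ag0: "agree sizes s0 s1"
    unfolding runs_def wp_def by blast
  have D: "1 \<le> D" "Rn \<le> 2 ^ (D - 1)" "length bs \<le> 2 ^ (D - 1)" and sz1: "sized D (2 ^ (D - 1) - Rn) N s1"
    and DN: "2 ^ D \<le> 4 * N" using ex0 by auto
  define lo where "lo = 2 ^ (D - 1) - Rn"
  note sz1 = sz1[folded lo_def]
  have loP: "lo + N \<le> 2 ^ D" using KR_KB(3)[OF D lo_def] .
  have N1: "1 \<le> N" using R1 by simp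
  have ok: "input_ok rs bs s1"
    using agreeN[OF ag0] agreeR[OF ag0] ex0(3) by (simp add: input_ok_def s0_def input_ram_def sized_def)
  let ?Q = "\<lambda>s. \<exists>lo ot H. ready D lo ot H s"
  let ?t = "(200 * N + 200) + (2500 * D * 2 ^ D + ((1000 * 2 ^ D + 50 * D) + ((40 * N + 40) + 2500 * D * 2 ^ D)))"
  have "runs (frame1 ;; pass ;; turn ;; frame2 ;; pass) s1 ?t ?Q"
  proof (rule runs_Seq_agree[OF frame1_runs[OF ok] _ order.refl])
    fix s2 assume s2: "reals s2 ''S'' 0 = sm \<and>
     (\<forall>i<N. reals s2 ''pu'' i = cu rs bs (ps ! i) \<and> reals s2 ''pv'' i = cv rs bs (ps ! i) \<and>
       reals s2 ''kx'' i = (if i < Rn then cu rs bs (ps ! i) else sm - cu rs bs (ps ! i)) \<and>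
       reals s2 ''ky'' i = (if i < Rn then cv rs bs (ps ! i) else - cv rs bs (ps ! i)))" and ag2: "agree frame1 s1 s2"
    define x y where "x = reals s2 ''kx''" and "y = reals s2 ''ky''"
    have k: "frame1_keys x y" using s2 by (simp add: frame1_keys_def x_def y_def uu_def vv_def)
    have sz2: "sized D lo N s2" using sz1 agreeN[OF ag2] agreeR[OF ag2] by (simp add: sized_def)
    show "runs (pass ;; turn ;; frame2 ;; pass) s2 (2500 * D * 2 ^ D + ((1000 * 2 ^ D + 50 * D) + ((40 * N + 40) + 2500 * D * 2 ^ D))) ?Q"
    proof (rule runs_Seq_agree[OF pass_runs[OF sz2 x_def[symmetric] y_def[symmetric] frame1_distinct[OF k] loP N1 D(1)] _ order.refl])
      fix s3 assume "\<exists>ot H eps. arranged D lo N x y ot H eps s3" and ag3: "agree pass s2 s3"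
      then obtain ot H eps where ar: "arranged D lo N x y ot H eps s3" by blast
      have sz3: "sized D lo N s3" using sz2 agreeN[OF ag3] agreeR[OF ag3] by (simp add: sized_def)
      have f3: "reals s3 ''kx'' = x" "reals s3 ''S'' 0 = sm" "reals s3 ''pu'' = reals s2 ''pu''" "reals s3 ''pv'' = reals s2 ''pv''"
        using agreeR[OF ag3] s2 by (simp_all add: x_def)
      show "runs (turn ;; frame2 ;; pass) s3 ((1000 * 2 ^ D + 50 * D) + ((40 * N + 40) + 2500 * D * 2 ^ D)) ?Q"
      proof (rule runs_Seq_agree[OF turn_ok[OF k ar f3(1,2) sz3 D lo_def] _ order.refl])
        fix s4 assume sl: "slope_sep (reals s4 ''num'' 0 / reals s4 ''den'' 0)" and ag4: "agree turn s3 s4"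
        define m where "m = reals s4 ''num'' 0 / reals s4 ''den'' 0"
        have sz4: "sized D lo N s4" using sz3 agreeN[OF ag4] agreeR[OF ag4] by (simp add: sized_def)
        have f4: "reals s4 ''pu'' = reals s2 ''pu''" "reals s4 ''pv'' = reals s2 ''pv''" "nats s4 ''N'' 0 = N"
          using agreeR[OF ag4] f3 sz4 by (simp_all add: sized_def)
        show "runs (frame2 ;; pass) s4 ((40 * N + 40) + 2500 * D * 2 ^ D) ?Q"
        proof (rule runs_Seq_agree[OF frame2_runs[OF f4(3)] _ order.refl])
          fix s5 assume s5: "\<forall>i<N. reals s5 ''kx'' i = reals s4 ''pv'' i - reals s4 ''num'' 0 / reals s4 ''den'' 0 * reals s4 ''pu'' i \<and>
            reals s5 ''ky'' i = reals s4 ''pu'' i" and ag5: "agree frame2 s4 s5"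
          define x2 y2 where "x2 = reals s5 ''kx''" and "y2 = reals s5 ''ky''"
          have k2: "x2 i = vv i - m * uu i" "y2 i = uu i" if "i < N" for i
            using s5 s2 that by (simp_all add: x2_def y2_def m_def f4 uu_def vv_def)
          have rb: "x2 i < x2 j" if "i < Rn" "Rn \<le> j" "j < N" for i j
            using sl that k2[of i] k2[of j] unfolding slope_sep_def m_def[symmetric] by simp
          have dist: "lex_distinct N x2 y2"
          proof
            fix i j assume ij: "i < N" "j < N" "i \<noteq> j"
            then show "x2 i \<noteq> x2 j \<or> y2 i \<noteq> y2 j" using uv_idx[of i j] k2 by force
          qed
          have sz5: "sized D lo N s5" using sz4 agreeN[OF ag5] agreeR[OF ag5] by (simp add: sized_def)
          show "runs pass s5 (2500 * D * 2 ^ D) ?Q"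
          proof (rule runs_conseq[OF runs_agree[OF pass_runs[OF sz5 x2_def[symmetric] y2_def[symmetric] dist loP N1 D(1)]]])
            fix s6 assume s6: "(\<exists>ot H eps. arranged D lo N x2 y2 ot H eps s6) \<and> agree pass s5 s6"
            then obtain ot H eps where ar: "arranged D lo N x2 y2 ot H eps s6" and ag6: "agree pass s5 s6" by blast
            have so: "sorted_out N (lex x2 y2) ot" and ge: "geometry D lo N x2 y2 ot s6 H eps" using ar by (auto simp: arranged_def)
            have col: "r < N \<Longrightarrow> ot r < Rn \<longleftrightarrow> r < Rn" for r using rank_color[OF so _ rb] by simp
            have co: "reals s6 ''X'' (pt lo r) = (dx - (m - eps) * (- dy)) * fst (ps ! ot r) + (dy - (m - eps) * dx) * snd (ps ! ot r) \<and>
              reals s6 ''Y'' (pt lo r) = (- dy) * fst (ps ! ot r) + dx * snd (ps ! ot r)" if "r < N" for r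
            proof -
              have "ot r < N" using so that by (simp add: sorted_out_def)
              then have "reals s6 ''X'' (pt lo r) = vv (ot r) - m * uu (ot r) + eps * uu (ot r)" "reals s6 ''Y'' (pt lo r) = uu (ot r)"
                using ge that k2[of "ot r"] by (simp_all add: geometry_def)
              then show ?thesis by (simp add: uu_def vv_def cu_def cv_def dx_def dy_def algebra_simps)
            qed
            \<comment> \<open>Tilt and shear have determinant of absolute value 1, so what remains
              is the squared length of the centroid vector.\<close>
            have det: "(dx - (m - eps) * (- dy)) * dx - (dy - (m - eps) * dx) * (- dy) \<noteq> 0"
            proof -
              have "(dx - (m - eps) * (- dy)) * dx - (dy - (m - eps) * dx) * (- dy) = dx * dx + dy * dy" by algebra
              then show ?thesis using dd_pos by linarith
            qed
            have "nats s6 ''R'' 0 = Rn" "nats s6 ''B'' 0 = length bs" "nats s6 ''D'' 0 = D"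
              using agreeN[OF ag6] agreeN[OF ag5] agreeN[OF ag4] agreeN[OF ag3] agreeN[OF ag2] ex0(3) sz5 by (simp_all add: sized_def)
            then have "ready D lo ot H s6"
              unfolding ready_def using D lo_def DN ar co det col by blast
            then show "?Q s6" by blast
          qed simp
        qed
      qed
    qed
  qed
  note rest = this
  have first: "runs sizes s0 (100 * N + 100) (\<lambda>s. s = s1)" unfolding runs_def wp_def using ex0 by blast
  have "runs prep s0 (100 * N + 100 + ?t) ?Q"
    unfolding prep_def by (rule runs_Seq[OF first _ order.refl], simp only:, rule rest)
  moreover have "100 * N + 100 + ?t \<le> 7500 * D * 2 ^ D"
  proof -
    have a: "N \<le> D * 2 ^ D" "1 \<le> D * 2 ^ D" "2 ^ D \<le> D * 2 ^ D" "D \<le> D * 2 ^ D" using loP D(1) by (auto intro: order_trans[OF _ mult_le_mono1[of 1 D]])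
    have "100 * n + 100 + ((200 * n + 200) + (2500 * q + ((1000 * p + 50 * D) + ((40 * n + 40) + 2500 * q)))) \<le> 7500 * q"
      if "n \<le> q" "1 \<le> q" "p \<le> q" "D \<le> q" for n q p :: nat using that by linarith
    from this[OF a] show ?thesis by (simp only: mult.assoc)
  qed
  ultimately have "runs prep s0 (7500 * D * 2 ^ D) ?Q" by (rule runs_conseq) simp_all
  then show ?thesis using DN D(1) unfolding s0_def by blast
qed

end

section \<open>Peeling off stars along the bridge\<close>

text \<open>Unrolls one round. The list of stars grows at its head, which suits induction on the
  number of rounds better than an invariant.\<close>

lemma runs_While_unfold:
  assumes "bval b s" "runs c s T1 Q1" "\<And>s'. Q1 s' \<Longrightarrow> agree c s s' \<Longrightarrow> runs (While b c) s' T2 Q" "1 + bcost b + T1 + T2 \<le> T"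
  shows "runs (While b c) s T Q"
proof -
  from assms(2) obtain t s1 where 1: "exec c s t s1" "t \<le> T1" "Q1 s1" unfolding runs_def wp_def by blast
  from assms(3)[OF 1(3) exec_agree[OF 1(1)]] obtain u s2 where 2: "exec (While b c) s1 u s2" "u \<le> T2" "Q s2" unfolding runs_def wp_def by blast
  have "exec (While b c) s (1 + bcost b + t + u) s2" using exec.WhileTrue[OF assms(1) 1(1) 2(1)] .
  then show ?thesis unfolding runs_def wp_def using 1 2 assms(4) by (intro exI[of _ "1 + bcost b + t + u"] exI[of _ s2]) auto
qed

definition take_pt :: "string \<Rightarrow> string \<Rightarrow> com" where
  "take_pt v cnt = (''i'' ::= NV v ;; NSet ''out'' (NV ''k'') (NGet ''p'' (NV ''i'')) ;; ''k'' ::= NAdd (NV ''k'') (NLit 1) ;;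
     cnt ::= NSub (NV cnt) (NLit 1) ;; delete_pt)"

abbreviation "takeR \<equiv> take_pt ''a'' ''cr''"
abbreviation "takeB \<equiv> take_pt ''c'' ''cb''"

text \<open>With \<open>3 * g + h\<close> red and \<open>3 * h + g\<close> blue points left, the
  test amounts to \<open>0 < h\<close>. So the stars with three blue leaves are cut first.\<close>

definition peel_body :: com where
  "peel_body = Cond (NLess (NV ''cr'') (NAdd (NAdd (NV ''cb'') (NV ''cb'')) (NV ''cb'')))
     (takeB ;; takeB ;; takeB ;; takeR) (takeR ;; takeR ;; takeR ;; takeB)"

definition peel_loop :: com where
  "peel_loop = While (NLess (NLit 0) (NV ''cr'')) peel_body"

definition peel :: com where
  "peel = (''cr'' ::= NV ''R'' ;; ''cb'' ::= NV ''B'' ;; ''k'' ::= NLit 0 ;; peel_loop)"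

lemma take_mods [simp]:
  "nmods (take_pt v cnt) = {''i'', ''out'', ''k'', cnt, ''d'', ''b0'', ''b'', ''a'', ''c'', ''m'', ''done'', ''x'', ''y'', ''n'', ''q''}" "rmods (take_pt v cnt) = {}"
  "nmods peel_body = {''cr'', ''cb'', ''i'', ''out'', ''k'', ''d'', ''b0'', ''b'', ''a'', ''c'', ''m'', ''done'', ''x'', ''y'', ''n'', ''q''}" "rmods peel_body = {}"
  by (auto simp: take_pt_def peel_body_def)

locale peeling = far_lev +
  assumes gpo: "i \<in> S \<Longrightarrow> j \<in> S \<Longrightarrow> k \<in> S \<Longrightarrow> i \<noteq> j \<Longrightarrow> i \<noteq> k \<Longrightarrow> j \<noteq> k \<Longrightarrow> ori X Y i j k \<noteq> 0"
    and D1: "1 \<le> D"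
begin

text \<open>Makes the facts on hull ends available for the points that are left after some
  removals.\<close>

lemma sub_far_lev:
  assumes "A \<subseteq> S" shows "far_lev X Y G A H D U eps"
proof unfold_locales
  show "X i < X j" if "i \<in> G \<union> A" "j \<in> G \<union> A" "i < j" for i j using mono[of i j] that assms by blast
  show "Y g = - H" if "g \<in> G" for g using gapY that .
  show "- H < Y p" if "p \<in> A" for p using ptY that assms by blast
  show "G = {g. even g \<and> g \<le> wd D}" by (rule Gdef)
  show "A \<subseteq> {i. odd i \<and> i < wd D}" using Sodd assms by blast
  show "ori X Y j k g < 0" if "j \<in> A" "k \<in> A" "g \<in> G" "j < k" for j k g using far[of j k g] that assms by blast
  show "X i = U i + eps * Y i" if "i \<in> A" for i using shear[of i] that assms by blast
qed

lemma pot_mono: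
  assumes "odd i" "A \<subseteq> S" shows "pot \<delta> (A - {i}) \<le> pot \<delta> A"
proof -
  have "A - {i} - onh \<delta> (A - {i}) \<subseteq> A - onh \<delta> A"
  proof
    fix j assume j: "j \<in> A - {i} - onh \<delta> (A - {i})"
    then have "j \<notin> hl A (j div wd \<delta> * wd \<delta>) (Suc (j div wd \<delta>) * wd \<delta>)"
      using hl_delete_keeps[OF assms(1), of "j div wd \<delta> * wd \<delta>" "Suc (j div wd \<delta>) * wd \<delta>" A] wd_simps(4)[of \<delta>]
      by (auto simp: onh_def)
    then show "j \<in> A - onh \<delta> A" using j by (auto simp: onh_def)
  qed
  then show ?thesis unfolding pot_def using finS assms(2) by (intro card_mono) (auto intro: finite_subset)
qed

text \<open>The potential of all levels together. The cost of a whole run of deletions telescopes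
  against it.\<close>

definition Pot :: "nat set \<Rightarrow> nat" where "Pot A = (\<Sum>\<delta>=1..<Suc D. pot \<delta> A)"

lemma Pot_diff:
  assumes "odd i" "A \<subseteq> S"
  shows "(\<Sum>\<delta>=1..<Suc D. 300 * (pot \<delta> A - pot \<delta> (A - {i})) + 400) + 300 * Pot (A - {i}) = 300 * Pot A + 400 * D"
proof -
  have "(\<Sum>\<delta>=1..<Suc D. 300 * (pot \<delta> A - pot \<delta> (A - {i})) + 400) + 300 * Pot (A - {i})
      = (\<Sum>\<delta>=1..<Suc D. (300 * (pot \<delta> A - pot \<delta> (A - {i})) + 400) + 300 * pot \<delta> (A - {i}))"
    by (simp only: Pot_def sum_distrib_left sum.distrib)
  also have "\<dots> = (\<Sum>\<delta>=1..<Suc D. 300 * pot \<delta> A + 400)"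
  proof (intro sum.cong refl)
    fix \<delta> show "(300 * (pot \<delta> A - pot \<delta> (A - {i})) + 400) + 300 * pot \<delta> (A - {i}) = 300 * pot \<delta> A + 400"
      using pot_mono[OF assms, of \<delta>] by linarith
  qed
  also have "\<dots> = 300 * Pot A + 400 * D" by (simp only: Pot_def sum_distrib_left sum.distrib) simp
  finally show ?thesis .
qed

text \<open>A bridge may end in a sentinel once a colour is used up. As long as a colour is present,
  its end is a real point, because the extreme points are on the hull.\<close>

lemma bridge_facts:
  assumes A: "A \<subseteq> S" and br: "bridge A a c"
  shows "\<exists>z\<in>A. z < mi \<Longrightarrow> a \<in> A" "\<exists>z\<in>A. mi < z \<Longrightarrow> c \<in> A"
    "\<And>z. z \<in> A \<Longrightarrow> ori X Y a c z \<le> 0" "a < mi" "mi < c"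
    "a \<in> A \<Longrightarrow> \<exists>a1. cons (hl A 0 (wd D)) a1 a" "c \<in> A \<Longrightarrow> \<exists>c1. cons (hl A 0 (wd D)) c c1"
proof -
  interpret A: far_lev X Y G A H D U eps using sub_far_lev[OF A] .
  have g: "0 \<in> G" "wd D \<in> G" "0 < wd D" by (auto simp: Gdef wd_simps)
  have cs: "cons (hl A 0 (wd D)) a c" and side: "a < mi" "mi < c" using br by (auto simp: bridge_def)
  then show "a < mi" "mi < c" by auto
  have AK: "A \<inter> {0<..<wd D} = A"
  proof -
    have "z \<in> {0<..<wd D}" if "z \<in> A" for z
    proof -
      have "odd z" "z < wd D" using A.Sodd that by auto
      then show ?thesis by (cases z) auto
    qed
    then show ?thesis by blast
  qed
  have tt: "a \<in> TT A 0 (wd D)" "c \<in> TT A 0 (wd D)" using cs UH_sub by (auto simp: cons_def)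
  have m2: "mi < wd D" "0 < mi" by (auto simp: wd_def)
  show "a \<in> A" if ex: "\<exists>z\<in>A. z < mi"
  proof (rule ccontr)
    assume "a \<notin> A"
    then have "a = 0" using tt(1) side m2 by (auto simp: TT_def)
    then have "cons (hl A 0 (wd D)) 0 c" using cs by simp
    from A.cons_first(2)[OF g this] ex AK side show False by fastforce
  qed
  show "c \<in> A" if ex: "\<exists>z\<in>A. mi < z"
  proof (rule ccontr)
    assume "c \<notin> A"
    then have "c = wd D" using tt(2) side m2 by (auto simp: TT_def)
    then have "cons (hl A 0 (wd D)) a (wd D)" using cs by simp
    from A.cons_last(2)[OF g this] ex AK side show False by fastforce
  qed
  have sub: "TT A 0 (wd D) \<subseteq> G \<union> S" using g A by (auto simp: TT_def)
  show "ori X Y a c z \<le> 0" if "z \<in> A" for z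
    using edge_supports[OF finite_TT sub cs, of z] that AK by (auto simp: TT_def)
  have fin: "finite (hl A 0 (wd D))" using finite_subset[OF UH_sub finite_TT] .
  have hh: "a \<in> hl A 0 (wd D)" "c \<in> hl A 0 (wd D)" using cs by (auto simp: cons_def)
  show "\<exists>a1. cons (hl A 0 (wd D)) a1 a" if "a \<in> A"
  proof -
    have "a \<in> {0<..<wd D}" using that AK by blast
    then show ?thesis using cons_pred_exists[OF fin hh(1) UH_ends(1)[OF g(3)]] by auto
  qed
  show "\<exists>c1. cons (hl A 0 (wd D)) c c1" if "c \<in> A"
  proof -
    have "c \<in> {0<..<wd D}" using that AK by blast
    then show ?thesis using cons_succ_exists[OF fin hh(2) UH_ends(2)[OF g(3)]] by auto
  qed
qed

text \<open>If the old endpoint were not above the new bridge, the two bridge lines would cross above both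
  colour classes on either side of the separating line, hence coincide.\<close>

lemma removed_above:
  assumes A: "A \<subseteq> S" "A' \<subseteq> A" and br: "bridge A a c" "bridge A' a' c'" and real: "a \<in> A" "c \<in> A" "a' \<in> A'" "c' \<in> A'"
    and i: "i \<notin> A'" "(i = c \<and> a \<in> A') \<or> (i = a \<and> c \<in> A')"
  shows "0 < ori X Y a' c' i"
proof (rule ccontr)
  assume n: "\<not> 0 < ori X Y a' c' i"
  have A'S: "A' \<subseteq> S" using A by blast
  note F = bridge_facts[OF A(1) br(1)] and F' = bridge_facts[OF A'S br(2)]
  have lt: "a < c" "a' < c'" "a < c'" "a' < c" using F(4,5) F'(4,5) by auto
  have iS: "i \<in> S" "a \<in> S" "c \<in> S" "a' \<in> S" "c' \<in> S" using real A i by auto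
  have xs: "X a < X c" "X a' < X c'" "X a < X c'" "X a' < X c" using mono lt iS by blast+
  \<comment> \<open>At abscissa \<open>X z\<close>, the height of the new bridge line over the old
    one is \<open>p + q * X z\<close>.\<close>
  define p q where "p = (Y a' - sl a' c' * X a') - (Y a - sl a c * X a)" and "q = sl a' c' - sl a c"
  have below: "0 \<le> p + q * X z" if "ori X Y a' c' z \<le> 0" "ori X Y a c z = 0" for z
  proof -
    have "ori X Y a c z = (X c - X a) * (Y z - Y a - sl a c * (X z - X a))"
      using xs by (simp add: ori_def sl_def field_simps)
    then have "Y z - Y a = sl a c * (X z - X a)" using that(2) xs by simp
    then show ?thesis using that(1) sl_ori(1)[OF xs(2), of z] by (simp add: p_def q_def algebra_simps)
  qed
  have above: "p + q * X z \<le> 0" if "ori X Y a c z \<le> 0" "ori X Y a' c' z = 0" for z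
  proof -
    have "ori X Y a' c' z = (X c' - X a') * (Y z - Y a' - sl a' c' * (X z - X a'))"
      using xs by (simp add: ori_def sl_def field_simps)
    then have "Y z - Y a' = sl a' c' * (X z - X a')" using that(2) xs by simp
    then show ?thesis using that(1) sl_ori(1)[OF xs(1), of z] by (simp add: p_def q_def algebra_simps)
  qed
  have "ori X Y a' c' a \<le> 0" "ori X Y a' c' c \<le> 0" using n i F'(3) by auto
  then have P: "0 \<le> p + q * X a" "0 \<le> p + q * X c" using below by auto
  have N: "p + q * X a' \<le> 0" "p + q * X c' \<le> 0" using above F(3) real A by auto
  have "q = 0"
  proof (rule ccontr)
    assume "q \<noteq> 0"
    then consider "0 < q" | "q < 0" by linarith
    then show False
    proof cases
      case 1
      then have "q * X a < q * X c'" using xs by simp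
      then show False using P(1) N(2) by linarith
    next
      case 2
      then have "q * X c < q * X a'" using xs by simp
      then show False using P(2) N(1) by linarith
    qed
  qed
  then have "p = 0" using P N by simp
  have "Y i - Y a = sl a c * (X i - X a)"
    using i(2) xs by (auto simp: sl_def)
  then have "Y i - Y a' = sl a' c' * (X i - X a')" using \<open>q = 0\<close> \<open>p = 0\<close> by (simp add: p_def q_def algebra_simps)
  moreover have "ori X Y a' c' i = (X c' - X a') * (Y i - Y a' - sl a' c' * (X i - X a'))"
    using xs by (simp add: ori_def sl_def field_simps)
  ultimately have "ori X Y a' c' i = 0" by simp
  moreover have "i \<noteq> a'" "i \<noteq> c'" "a' \<noteq> c'" using real i lt by auto
  ultimately show False using gpo[of a' c' i] iS by blast
qed

definition state_ok :: "nat set \<Rightarrow> ram \<Rightarrow> bool" where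
  "state_ok A s \<longleftrightarrow> A \<subseteq> S \<and> treeok s A \<and> bridge A (nats s ''a'' 0) (nats s ''c'' 0)"

text \<open>The potential drop enters the time through truncated subtraction, so monotonicity of the
  potential is stated along with it.\<close>

lemma take_runs:
  assumes ok: "state_ok A s0" and side: "(v = ''a'' \<and> cnt = ''cr'') \<or> (v = ''c'' \<and> cnt = ''cb'')"
    and i: "i = nats s0 v 0" "i \<in> A"
  shows "runs (take_pt v cnt) s0 (300 * (Pot A - Pot (A - {i})) + 400 * D + 100) (\<lambda>s'. state_ok (A - {i}) s' \<and>
     nats s' ''k'' 0 = nats s0 ''k'' 0 + 1 \<and> nats s' cnt 0 = nats s0 cnt 0 - 1 \<and>
     nats s' ''out'' = (nats s0 ''out'')(nats s0 ''k'' 0 := nats s0 ''p'' i)) \<and> Pot (A - {i}) \<le> Pot A"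
proof -
  have A: "A \<subseteq> S" and t: "treeok s0 A" and br: "bridge A (nats s0 ''a'' 0) (nats s0 ''c'' 0)" using ok by (auto simp: state_ok_def)
  have odd: "odd i" using A i Sodd by auto
  define s1 where "s1 = nupd cnt 0 (nats s0 cnt 0 - 1) (nupd ''k'' 0 (nats s0 ''k'' 0 + 1)
     (nupd ''out'' (nats s0 ''k'' 0) (nats s0 ''p'' i) (nupd ''i'' 0 i s0)))"
  have R1: "runs (''i'' ::= NV v ;; NSet ''out'' (NV ''k'') (NGet ''p'' (NV ''i'')) ;; ''k'' ::= NAdd (NV ''k'') (NLit 1) ;;
     cnt ::= NSub (NV cnt) (NLit 1)) s0 40 (\<lambda>s'. s' = s1)"
    using side i by (auto simp: runs_def wp_simps s1_def)
  have t1: "treeok s1 A" using t side by (auto simp: treeok_def s1_def)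
  have i1: "nats s1 ''i'' 0 = i" using side by (auto simp: s1_def)
  note F = bridge_facts[OF A br]
  have "\<exists>a1 c1. cons (hl A 0 (wd D)) a1 i \<and> cons (hl A 0 (wd D)) i c1 \<and> a1 < mi \<and> mi < c1"
  proof -
    have cs: "cons (hl A 0 (wd D)) (nats s0 ''a'' 0) (nats s0 ''c'' 0)" using br by (simp add: bridge_def)
    from side show ?thesis
    proof
      assume "v = ''a'' \<and> cnt = ''cr''"
      then have ia: "i = nats s0 ''a'' 0" using i by simp
      then obtain a1 where a1: "cons (hl A 0 (wd D)) a1 i" using F(6) i(2) by blast
      then have "a1 < mi" using F(4) ia by (auto simp: cons_def)
      then show ?thesis using a1 cs F(5) ia by blast
    next
      assume "v = ''c'' \<and> cnt = ''cb''"
      then have ia: "i = nats s0 ''c'' 0" using i by simp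
      then obtain c1 where c1: "cons (hl A 0 (wd D)) i c1" using F(7) i(2) by blast
      then have "mi < c1" using F(5) ia by (auto simp: cons_def)
      then show ?thesis using c1 cs F(4) ia by blast
    qed
  qed
  then obtain a1 c1 where ac: "cons (hl A 0 (wd D)) a1 i" "cons (hl A 0 (wd D)) i c1" "a1 < mi" "mi < c1" by blast
  have PP: "(\<Sum>\<delta>=1..<Suc D. 300 * (pot \<delta> A - pot \<delta> (A - {i})) + 400) + 300 * Pot (A - {i}) = 300 * Pot A + 400 * D"
    by (rule Pot_diff[OF odd A])
  have le: "Pot (A - {i}) \<le> Pot A" unfolding Pot_def using pot_mono[OF odd A] by (intro sum_mono) auto
  have tm: "(\<Sum>\<delta>=1..<Suc D. 300 * (pot \<delta> A - pot \<delta> (A - {i})) + 400) + 50 \<le> 300 * (Pot A - Pot (A - {i})) + 400 * D + 50"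
    using PP le by linarith
  note R2 = delete_pt_runs[OF A i(2) t1 i1 ac D1 tm]
  have "runs ((''i'' ::= NV v ;; NSet ''out'' (NV ''k'') (NGet ''p'' (NV ''i'')) ;; ''k'' ::= NAdd (NV ''k'') (NLit 1) ;;
     cnt ::= NSub (NV cnt) (NLit 1)) ;; delete_pt) s0 (300 * (Pot A - Pot (A - {i})) + 400 * D + 100) (\<lambda>s'. state_ok (A - {i}) s' \<and>
     nats s' ''k'' 0 = nats s0 ''k'' 0 + 1 \<and> nats s' cnt 0 = nats s0 cnt 0 - 1 \<and>
     nats s' ''out'' = (nats s0 ''out'')(nats s0 ''k'' 0 := nats s0 ''p'' i))"
  proof (rule runs_Seq[OF R1, where ?T2.0 = "300 * (Pot A - Pot (A - {i})) + 400 * D + 50"], simp only:, rule runs_conseq[OF runs_agree[OF R2]])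
    fix s' assume s': "(treeok s' (A - {i}) \<and> bridge (A - {i}) (nats s' ''a'' 0) (nats s' ''c'' 0)) \<and> agree delete_pt s1 s'"
    have "nats s' ''k'' = nats s1 ''k''" "nats s' ''out'' = nats s1 ''out''" "nats s' cnt = nats s1 cnt"
      using agreeN[OF conjunct2[OF s']] side by auto
    then show "state_ok (A - {i}) s' \<and> nats s' ''k'' 0 = nats s0 ''k'' 0 + 1 \<and> nats s' cnt 0 = nats s0 cnt 0 - 1 \<and>
     nats s' ''out'' = (nats s0 ''out'')(nats s0 ''k'' 0 := nats s0 ''p'' i)"
      using s' A side by (auto simp: state_ok_def s1_def)
  qed simp_all
  then show ?thesis using le unfolding take_pt_def runs_def by (simp add: wp_simps add.assoc)
qed

end

lemma runsE:
  assumes "runs c s T Q"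
  obtains t s' where "exec c s t s'" "t \<le> T" "Q s'" "agree c s s'"
  using assms exec_agree unfolding runs_def wp_def by blast

context peeling begin

definition sepb :: "nat set \<Rightarrow> nat set \<Rightarrow> bool" where
  "sepb Bk Rest \<longleftrightarrow> Rest = {} \<or> (\<exists>p q \<sigma>. p \<in> Bk \<and> q \<notin> Bk \<and> q \<in> S \<and>
     (\<forall>z\<in>Bk - {p}. 0 < \<sigma> * ori X Y p q z) \<and> (\<forall>z\<in>Rest - {q}. \<sigma> * ori X Y p q z < 0))"

definition starlike :: "nat set \<Rightarrow> bool" where
  "starlike Bk \<longleftrightarrow> (\<exists>c\<in>Bk. \<forall>z\<in>Bk - {c}. (z < mi) \<noteq> (c < mi))"

fun peeled :: "nat set \<Rightarrow> nat list list \<Rightarrow> bool" where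
  "peeled A [] \<longleftrightarrow> A = {}"
| "peeled A (b # Bs) \<longleftrightarrow> length b = 4 \<and> distinct b \<and> set b \<subseteq> A \<and> starlike (set b) \<and> sepb (set b) (A - set b) \<and> peeled (A - set b) Bs"

definition sideof :: "string \<Rightarrow> nat \<Rightarrow> bool" where
  "sideof v z \<longleftrightarrow> (if v = ''a'' then z < mi else mi < z)"

definition cls :: "string \<Rightarrow> nat set \<Rightarrow> nat set" where "cls v A = {z \<in> A. sideof v z}"

lemma S_not_mid: "z \<in> S \<Longrightarrow> z \<noteq> mi"
  using Sodd D1 by (cases D) auto

lemma cls_finite: "A \<subseteq> S \<Longrightarrow> finite (cls v A)"
  using finS finite_subset unfolding cls_def by (metis (no_types, lifting) mem_Collect_eq subsetI)

lemma cls_delete: "sideof v i \<Longrightarrow> i \<in> A \<Longrightarrow> A \<subseteq> S \<Longrightarrow> card (cls v (A - {i})) = card (cls v A) - 1"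
proof -
  assume h: "sideof v i" "i \<in> A" "A \<subseteq> S"
  have "cls v (A - {i}) = cls v A - {i}" by (auto simp: cls_def)
  then show ?thesis using h by (simp add: cls_def)
qed

lemma cls_delete_other: "\<not> sideof v i \<Longrightarrow> cls v (A - {i}) = cls v A"
  by (auto simp: cls_def)

lemma end_real:
  assumes "state_ok A s" "v \<in> {''a'', ''c''}" "1 \<le> card (cls v A)"
  shows "nats s v 0 \<in> A" "sideof v (nats s v 0)"
proof -
  have A: "A \<subseteq> S" and br: "bridge A (nats s ''a'' 0) (nats s ''c'' 0)" using assms(1) by (auto simp: state_ok_def)
  have "cls v A \<noteq> {}" using assms(3) by auto
  then obtain z where "z \<in> A" "sideof v z" by (auto simp: cls_def)
  note F = bridge_facts(1,2,4,5)[OF A br]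
  have "nats s v 0 \<in> A \<and> sideof v (nats s v 0)"
  proof (cases "v = ''a''")
    case True
    then have "\<exists>z\<in>A. z < mi" using \<open>z \<in> A\<close> \<open>sideof v z\<close> by (auto simp: sideof_def)
    then show ?thesis using F(1,3) True by (simp add: sideof_def)
  next
    case False
    then have "\<exists>z\<in>A. mi < z" using \<open>z \<in> A\<close> \<open>sideof v z\<close> by (auto simp: sideof_def)
    then show ?thesis using F(2,4) False assms(2) by (simp add: sideof_def)
  qed
  then show "nats s v 0 \<in> A" "sideof v (nats s v 0)" by auto
qed

lemma removed_above':
  assumes ok: "state_ok A s" "state_ok A' s'" "A' \<subseteq> A" and v: "v \<in> {''a'', ''c''}" "w \<in> {''a'', ''c''}" "v \<noteq> w"
    and i: "i = nats s v 0" "i \<notin> A'" and same: "cls w A' = cls w A"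
    and ne: "1 \<le> card (cls v A)" "1 \<le> card (cls w A)" "1 \<le> card (cls v A')"
  shows "0 < ori X Y (nats s' ''a'' 0) (nats s' ''c'' 0) i"
proof -
  have AS: "A \<subseteq> S" and br: "bridge A (nats s ''a'' 0) (nats s ''c'' 0)" "bridge A' (nats s' ''a'' 0) (nats s' ''c'' 0)"
    using ok by (auto simp: state_ok_def)
  have ne': "1 \<le> card (cls w A')" using ne same by simp
  note e = end_real[OF ok(1) v(1) ne(1)] end_real[OF ok(1) v(2) ne(2)] end_real[OF ok(2) v(1) ne(3)] end_real[OF ok(2) v(2) ne']
  have "nats s w 0 \<in> cls w A" using e by (auto simp: cls_def)
  then have wA': "nats s w 0 \<in> A'" using same by (auto simp: cls_def)
  have vw: "(v = ''a'' \<and> w = ''c'') \<or> (v = ''c'' \<and> w = ''a'')" using v by auto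
  show ?thesis
    by (rule removed_above[OF AS ok(3) br]) (use vw e wA' i in auto)
qed

text \<open>The first three removals have one colour, so the other class is unchanged and
  \<open>removed_above\<close> applies to each of them against the bridge that is present before the
  fourth. General position makes all other remaining points strictly lower.\<close>

lemma four_runs:
  assumes ok: "state_ok A s0" and side: "(v = ''a'' \<and> nv = ''cr'' \<and> w = ''c'' \<and> nw = ''cb'') \<or> (v = ''c'' \<and> nv = ''cb'' \<and> w = ''a'' \<and> nw = ''cr'')"
    and cnt: "3 \<le> card (cls v A)" "1 \<le> card (cls w A)"
    and rest: "(card (cls v A) = 3 \<and> card (cls w A) = 1) \<or> (4 \<le> card (cls v A) \<and> 2 \<le> card (cls w A))"
  shows "\<exists>b. length b = 4 \<and> distinct b \<and> set b \<subseteq> A \<and> starlike (set b) \<and> sepb (set b) (A - set b) \<and> Pot (A - set b) \<le> Pot A \<and>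
     card (cls v (A - set b)) = card (cls v A) - 3 \<and> card (cls w (A - set b)) = card (cls w A) - 1 \<and>
     runs (take_pt v nv ;; take_pt v nv ;; take_pt v nv ;; take_pt w nw) s0 (300 * (Pot A - Pot (A - set b)) + 1600 * D + 400)
      (\<lambda>s'. state_ok (A - set b) s' \<and> nats s' ''k'' 0 = nats s0 ''k'' 0 + 4 \<and> nats s' nv 0 = nats s0 nv 0 - 3 \<and> nats s' nw 0 = nats s0 nw 0 - 1 \<and>
        (\<forall>j<4. nats s' ''out'' (nats s0 ''k'' 0 + j) = nats s0 ''p'' (b ! j)) \<and> (\<forall>j<nats s0 ''k'' 0. nats s' ''out'' j = nats s0 ''out'' j))"
proof -
  have vw: "v \<in> {''a'', ''c''}" "w \<in> {''a'', ''c''}" "v \<noteq> w" "nv \<noteq> nw" using side by auto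
  have sv: "(v = ''a'' \<and> nv = ''cr'') \<or> (v = ''c'' \<and> nv = ''cb'')" and sw: "(w = ''a'' \<and> nw = ''cr'') \<or> (w = ''c'' \<and> nw = ''cb'')" using side by auto
  have opp: "\<not> sideof w i" if "sideof v i" for i using that side by (auto simp: sideof_def)
  have opp': "\<not> sideof v i" if "sideof w i" for i using that side by (auto simp: sideof_def)
  have AS: "A \<subseteq> S" using ok by (simp add: state_ok_def)
  define i1 where "i1 = nats s0 v 0"
  have e1: "i1 \<in> A" "sideof v i1" using end_real[OF ok vw(1)] cnt unfolding i1_def by auto
  note T1 = take_runs[OF ok sv i1_def e1(1)]
  obtain t1 s1 where x1: "exec (take_pt v nv) s0 t1 s1" "t1 \<le> 300 * (Pot A - Pot (A - {i1})) + 400 * D + 100" "agree (take_pt v nv) s0 s1"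
    "state_ok (A - {i1}) s1" "nats s1 ''k'' 0 = nats s0 ''k'' 0 + 1" "nats s1 nv 0 = nats s0 nv 0 - 1"
    "nats s1 ''out'' = (nats s0 ''out'')(nats s0 ''k'' 0 := nats s0 ''p'' i1)" using runsE[OF conjunct1[OF T1]] by metis
  define A1 where "A1 = A - {i1}"
  have A1S: "A1 \<subseteq> S" "A1 \<subseteq> A" using AS by (auto simp: A1_def)
  have c1: "card (cls v A1) = card (cls v A) - 1" "cls w A1 = cls w A"
    using cls_delete[OF e1(2,1) AS] cls_delete_other[OF opp[OF e1(2)]] by (auto simp: A1_def)
  note ok1 = x1(4)[folded A1_def]
  define i2 where "i2 = nats s1 v 0"
  have e2: "i2 \<in> A1" "sideof v i2" using end_real[OF ok1 vw(1)] cnt c1 unfolding i2_def by auto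
  note T2 = take_runs[OF ok1 sv i2_def e2(1)]
  obtain t2 s2 where x2: "exec (take_pt v nv) s1 t2 s2" "t2 \<le> 300 * (Pot A1 - Pot (A1 - {i2})) + 400 * D + 100" "agree (take_pt v nv) s1 s2"
    "state_ok (A1 - {i2}) s2" "nats s2 ''k'' 0 = nats s1 ''k'' 0 + 1" "nats s2 nv 0 = nats s1 nv 0 - 1"
    "nats s2 ''out'' = (nats s1 ''out'')(nats s1 ''k'' 0 := nats s1 ''p'' i2)" using runsE[OF conjunct1[OF T2]] by metis
  define A2 where "A2 = A1 - {i2}"
  have A2S: "A2 \<subseteq> S" "A2 \<subseteq> A1" using A1S by (auto simp: A2_def)
  have c2: "card (cls v A2) = card (cls v A) - 2" "cls w A2 = cls w A"
    using cls_delete[OF e2(2,1) A1S(1)] cls_delete_other[OF opp[OF e2(2)]] c1 by (auto simp: A2_def)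
  note ok2 = x2(4)[folded A2_def]
  define i3 where "i3 = nats s2 v 0"
  have e3: "i3 \<in> A2" "sideof v i3" using end_real[OF ok2 vw(1)] cnt c2 unfolding i3_def by auto
  note T3 = take_runs[OF ok2 sv i3_def e3(1)]
  obtain t3 s3 where x3: "exec (take_pt v nv) s2 t3 s3" "t3 \<le> 300 * (Pot A2 - Pot (A2 - {i3})) + 400 * D + 100" "agree (take_pt v nv) s2 s3"
    "state_ok (A2 - {i3}) s3" "nats s3 ''k'' 0 = nats s2 ''k'' 0 + 1" "nats s3 nv 0 = nats s2 nv 0 - 1"
    "nats s3 ''out'' = (nats s2 ''out'')(nats s2 ''k'' 0 := nats s2 ''p'' i3)" using runsE[OF conjunct1[OF T3]] by metis
  define A3 where "A3 = A2 - {i3}"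
  have A3S: "A3 \<subseteq> S" "A3 \<subseteq> A2" using A2S by (auto simp: A3_def)
  have c3: "card (cls v A3) = card (cls v A) - 3" "cls w A3 = cls w A"
    using cls_delete[OF e3(2,1) A2S(1)] cls_delete_other[OF opp[OF e3(2)]] c2 by (auto simp: A3_def)
  note ok3 = x3(4)[folded A3_def]
  define i4 where "i4 = nats s3 w 0"
  have e4: "i4 \<in> A3" "sideof w i4" using end_real[OF ok3 vw(2)] cnt c3 unfolding i4_def by auto
  note T4 = take_runs[OF ok3 sw i4_def e4(1)]
  obtain t4 s4 where x4: "exec (take_pt w nw) s3 t4 s4" "t4 \<le> 300 * (Pot A3 - Pot (A3 - {i4})) + 400 * D + 100" "agree (take_pt w nw) s3 s4"
    "state_ok (A3 - {i4}) s4" "nats s4 ''k'' 0 = nats s3 ''k'' 0 + 1" "nats s4 nw 0 = nats s3 nw 0 - 1"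
    "nats s4 ''out'' = (nats s3 ''out'')(nats s3 ''k'' 0 := nats s3 ''p'' i4)" using runsE[OF conjunct1[OF T4]] by metis
  define A4 where "A4 = A3 - {i4}"
  have c4: "card (cls v A4) = card (cls v A) - 3" "card (cls w A4) = card (cls w A) - 1"
    using cls_delete[OF e4(2,1) A3S(1)] cls_delete_other[OF opp'[OF e4(2)]] c3 by (auto simp: A4_def)
  note ok4 = x4(4)[folded A4_def]
  define b where "b = [i1, i2, i3, i4]"
  have dist: "i1 \<noteq> i2" "i1 \<noteq> i3" "i1 \<noteq> i4" "i2 \<noteq> i3" "i2 \<noteq> i4" "i3 \<noteq> i4"
    using e2 e3 e4 A1_def A2_def A3_def by auto
  have Ab: "A - set b = A4" by (auto simp: b_def A1_def A2_def A3_def A4_def)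
  have bA: "set b \<subseteq> A" using e1 e2 e3 e4 by (auto simp: b_def A1_def A2_def A3_def)
  have star: "starlike (set b)"
    unfolding starlike_def
  proof (intro bexI[of _ i4] ballI)
    fix z assume "z \<in> set b - {i4}"
    then have "sideof v z" using e1 e2 e3 by (auto simp: b_def)
    then show "(z < mi) \<noteq> (i4 < mi)" using e4(2) side by (auto simp: sideof_def)
  qed (simp add: b_def)
  have sep: "sepb (set b) A4"
  proof (cases "A4 = {}")
    case False
    \<comment> \<open>If the star does not take everything, a point of the leaf colour is left after
      three removals, so the bridge then joins two real points.\<close>
    have big: "4 \<le> card (cls v A)" "2 \<le> card (cls w A)"
    proof -
      have "\<not> (card (cls v A) = 3 \<and> card (cls w A) = 1)"
      proof
        assume "card (cls v A) = 3 \<and> card (cls w A) = 1"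
        moreover have "A4 \<subseteq> S" using A3S by (auto simp: A4_def)
        ultimately have "cls v A4 = {}" "cls w A4 = {}" using c4 cls_finite[of A4] by simp_all
        moreover have "mi \<notin> A4" using S_not_mid A3S by (auto simp: A4_def)
        then have "A4 = cls v A4 \<union> cls w A4" using side by (auto simp: cls_def sideof_def)
        ultimately show False using False by auto
      qed
      then show "4 \<le> card (cls v A)" "2 \<le> card (cls w A)" using rest by auto
    qed
    define a c where "a = nats s3 ''a'' 0" and "c = nats s3 ''c'' 0"
    define q where "q = nats s3 v 0"
    have n3: "1 \<le> card (cls v A3)" using big c3 by simp
    have q: "q \<in> A3" "sideof v q" using end_real[OF ok3 vw(1) n3] by (auto simp: q_def)
    have br: "bridge A3 a c" using ok3 by (simp add: state_ok_def a_def c_def)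
    have pos: "0 < ori X Y a c i" if i: "i \<in> {i1, i2, i3}" for i
    proof -
      have "0 < ori X Y a c i1" unfolding a_def c_def
        by (rule removed_above'[OF ok ok3 _ vw(1,2,3) i1_def]) (use A1S A2S A3S c3 cnt n3 in \<open>auto simp: A1_def A2_def A3_def\<close>)
      moreover have "0 < ori X Y a c i2" unfolding a_def c_def
        by (rule removed_above'[OF ok1 ok3 _ vw(1,2,3) i2_def]) (use A1S A2S A3S c1 c3 cnt n3 in \<open>auto simp: A2_def A3_def\<close>)
      moreover have "0 < ori X Y a c i3" unfolding a_def c_def
        by (rule removed_above'[OF ok2 ok3 _ vw(1,2,3) i3_def]) (use A1S A2S A3S c2 c3 cnt n3 in \<open>auto simp: A3_def\<close>)
      ultimately show ?thesis using i by blast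
    qed
    have pq: "(i4 = a \<and> q = c) \<or> (i4 = c \<and> q = a)" using side by (auto simp: i4_def q_def a_def c_def)
    have neg: "ori X Y a c z < 0" if z: "z \<in> A4 - {q}" for z
    proof -
      have zz: "z \<in> A3" "z \<noteq> a" "z \<noteq> c" using z pq by (auto simp: A4_def)
      have "ori X Y a c z \<le> 0" using bridge_facts(3)[OF A3S(1) br zz(1)] .
      moreover have "ori X Y a c z \<noteq> 0"
      proof (rule gpo)
        show "a \<in> S" "c \<in> S" "z \<in> S" using pq q e4 A3S zz by auto
        show "a \<noteq> c" using bridge_facts(4,5)[OF A3S(1) br] by auto
      qed (use zz in auto)
      ultimately show ?thesis by linarith
    qed
    have qb: "q \<notin> set b"
    proof -
      have "q \<noteq> i4" using pq bridge_facts(4,5)[OF A3S(1) br] by auto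
      then show ?thesis using q(1) by (auto simp: b_def A3_def A2_def A1_def)
    qed
    \<comment> \<open>The point removed last is either the left or the right end of the bridge. In
      the second case the line is read backwards, which changes the sign of the orientation.\<close>
    define \<sigma> :: real where "\<sigma> = (if i4 = a then 1 else - 1)"
    have ac: "a \<noteq> c" using bridge_facts(4,5)[OF A3S(1) br] by auto
    have sg: "\<sigma> * ori X Y i4 q z = ori X Y a c z" for z
      using pq ac ori_swap(1)[of X Y a c z] by (auto simp: \<sigma>_def)
    show ?thesis unfolding sepb_def
    proof (intro disjI2 exI conjI ballI)
      show "i4 \<in> set b" by (simp add: b_def)
      show "q \<notin> set b" by (rule qb)
      show "q \<in> S" using q A3S by auto
      show "0 < \<sigma> * ori X Y i4 q z" if "z \<in> set b - {i4}" for z unfolding sg using that pos by (auto simp: b_def)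
      show "\<sigma> * ori X Y i4 q z < 0" if "z \<in> A4 - {q}" for z unfolding sg using that neg by blast
    qed
  qed (simp add: sepb_def)
  have nm: "''p'' \<notin> nmods (take_pt v nv)" "nw \<notin> nmods (take_pt v nv)" "nv \<notin> nmods (take_pt w nw)" using side by auto
  have p: "nats s1 ''p'' = nats s0 ''p''" "nats s2 ''p'' = nats s0 ''p''" "nats s3 ''p'' = nats s0 ''p''"
    "nats s1 nw 0 = nats s0 nw 0" "nats s2 nw 0 = nats s0 nw 0" "nats s3 nw 0 = nats s0 nw 0" "nats s4 nv 0 = nats s3 nv 0"
    by (simp_all only: agreeN[OF x1(3) nm(1)] agreeN[OF x2(3) nm(1)] agreeN[OF x3(3) nm(1)]
      agreeN[OF x1(3) nm(2)] agreeN[OF x2(3) nm(2)] agreeN[OF x3(3) nm(2)] agreeN[OF x4(3) nm(3)])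
  have P: "Pot A1 \<le> Pot A" "Pot A2 \<le> Pot A1" "Pot A3 \<le> Pot A2" "Pot A4 \<le> Pot A3"
    using T1 T2 T3 T4 by (auto simp: A1_def A2_def A3_def A4_def)
  have ex: "exec (take_pt v nv ;; take_pt v nv ;; take_pt v nv ;; take_pt w nw) s0 (t1 + (t2 + (t3 + t4))) s4"
    using x1(1) x2(1) x3(1) x4(1) by (intro exec.Seq)
  have tm: "t1 + (t2 + (t3 + t4)) \<le> 300 * (Pot A - Pot A4) + 1600 * D + 400"
    using x1(2) x2(2) x3(2) x4(2) P unfolding A1_def[symmetric] A2_def[symmetric] A3_def[symmetric] A4_def[symmetric] by linarith
  let ?k = "nats s0 ''k'' 0"
  have out: "nats s4 ''out'' = (nats s0 ''out'')(?k := nats s0 ''p'' i1, ?k + 1 := nats s0 ''p'' i2, ?k + 2 := nats s0 ''p'' i3, ?k + 3 := nats s0 ''p'' i4)"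
    unfolding x4(7) x3(7) x2(7) x1(7) x3(5) x2(5) x1(5) p by (simp add: numeral_eq_Suc)
  have "nats s4 ''out'' (?k + j) = nats s0 ''p'' (b ! j)" if "j < 4" for j
  proof -
    have "j = 0 \<or> j = 1 \<or> j = 2 \<or> j = 3" using that by auto
    then show ?thesis unfolding out b_def by auto
  qed
  moreover have "nats s4 ''out'' j = nats s0 ''out'' j" if "j < ?k" for j unfolding out using that by simp
  moreover have "nats s4 ''k'' 0 = ?k + 4" "nats s4 nv 0 = nats s0 nv 0 - 3" "nats s4 nw 0 = nats s0 nw 0 - 1"
    using x1(5,6) x2(5,6) x3(5,6) x4(5,6) p by simp_all
  ultimately have "runs (take_pt v nv ;; take_pt v nv ;; take_pt v nv ;; take_pt w nw) s0 (300 * (Pot A - Pot A4) + 1600 * D + 400)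
      (\<lambda>s'. state_ok A4 s' \<and> nats s' ''k'' 0 = ?k + 4 \<and> nats s' nv 0 = nats s0 nv 0 - 3 \<and> nats s' nw 0 = nats s0 nw 0 - 1 \<and>
        (\<forall>j<4. nats s' ''out'' (?k + j) = nats s0 ''p'' (b ! j)) \<and> (\<forall>j<?k. nats s' ''out'' j = nats s0 ''out'' j))"
    unfolding runs_def wp_def using ex tm ok4 by blast
  note fin = this
  have lb: "length b = 4" "distinct b" using dist by (auto simp: b_def)
  have PA: "Pot A4 \<le> Pot A" using P by linarith
  show ?thesis unfolding ex_simps
    by (rule exI[of _ b], intro conjI) (use lb bA star sep c4 PA fin in \<open>simp_all only: Ab\<close>)
qed

text \<open>\<open>g\<close> and \<open>hn\<close> count the stars still to be cut with three red
  and with three blue leaves. Both the sets and the program's counters have to match them.\<close>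

definition quota :: "nat \<Rightarrow> nat \<Rightarrow> nat set \<Rightarrow> ram \<Rightarrow> bool" where
  "quota g hn A s \<longleftrightarrow> state_ok A s \<and> card (cls ''a'' A) = 3 * g + hn \<and> card (cls ''c'' A) = 3 * hn + g \<and>
     nats s ''cr'' 0 = 3 * g + hn \<and> nats s ''cb'' 0 = 3 * hn + g"

lemma peel_body_runs:
  assumes q: "quota g hn A s0" and pos: "0 < g + hn"
  shows "\<exists>b g' hn'. g' + hn' + 1 = g + hn \<and> length b = 4 \<and> distinct b \<and> set b \<subseteq> A \<and> starlike (set b) \<and> sepb (set b) (A - set b) \<and> Pot (A - set b) \<le> Pot A \<and>
     runs peel_body s0 (300 * (Pot A - Pot (A - set b)) + 1600 * D + 420)
      (\<lambda>s'. quota g' hn' (A - set b) s' \<and> nats s' ''k'' 0 = nats s0 ''k'' 0 + 4 \<and>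
        (\<forall>j<4. nats s' ''out'' (nats s0 ''k'' 0 + j) = nats s0 ''p'' (b ! j)) \<and> (\<forall>j<nats s0 ''k'' 0. nats s' ''out'' j = nats s0 ''out'' j))"
proof -
  have ok: "state_ok A s0" and c: "card (cls ''a'' A) = 3 * g + hn" "card (cls ''c'' A) = 3 * hn + g"
    "nats s0 ''cr'' 0 = 3 * g + hn" "nats s0 ''cb'' 0 = 3 * hn + g" using q by (auto simp: quota_def)
  show ?thesis
  proof (cases "0 < hn")
    case True
    then obtain hn' where hn': "hn = Suc hn'" by (cases hn) auto
    have "\<exists>b. length b = 4 \<and> distinct b \<and> set b \<subseteq> A \<and> starlike (set b) \<and> sepb (set b) (A - set b) \<and> Pot (A - set b) \<le> Pot A \<and>
     card (cls ''c'' (A - set b)) = card (cls ''c'' A) - 3 \<and> card (cls ''a'' (A - set b)) = card (cls ''a'' A) - 1 \<and>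
     runs (takeB ;; takeB ;; takeB ;; takeR) s0 (300 * (Pot A - Pot (A - set b)) + 1600 * D + 400)
      (\<lambda>s'. state_ok (A - set b) s' \<and> nats s' ''k'' 0 = nats s0 ''k'' 0 + 4 \<and> nats s' ''cb'' 0 = nats s0 ''cb'' 0 - 3 \<and> nats s' ''cr'' 0 = nats s0 ''cr'' 0 - 1 \<and>
        (\<forall>j<4. nats s' ''out'' (nats s0 ''k'' 0 + j) = nats s0 ''p'' (b ! j)) \<and> (\<forall>j<nats s0 ''k'' 0. nats s' ''out'' j = nats s0 ''out'' j))"
      by (rule four_runs[OF ok]) (use c hn' in auto)
    then obtain b where b: "length b = 4" "distinct b" "set b \<subseteq> A" "starlike (set b)" "sepb (set b) (A - set b)" "Pot (A - set b) \<le> Pot A"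
      "card (cls ''c'' (A - set b)) = card (cls ''c'' A) - 3" "card (cls ''a'' (A - set b)) = card (cls ''a'' A) - 1" and
     r: "runs (takeB ;; takeB ;; takeB ;; takeR) s0 (300 * (Pot A - Pot (A - set b)) + 1600 * D + 400)
      (\<lambda>s'. state_ok (A - set b) s' \<and> nats s' ''k'' 0 = nats s0 ''k'' 0 + 4 \<and> nats s' ''cb'' 0 = nats s0 ''cb'' 0 - 3 \<and> nats s' ''cr'' 0 = nats s0 ''cr'' 0 - 1 \<and>
        (\<forall>j<4. nats s' ''out'' (nats s0 ''k'' 0 + j) = nats s0 ''p'' (b ! j)) \<and> (\<forall>j<nats s0 ''k'' 0. nats s' ''out'' j = nats s0 ''out'' j))" by blast
    show ?thesis
    proof (rule exI[of _ b], rule exI[of _ g], rule exI[of _ hn'], intro conjI)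
      show "runs peel_body s0 (300 * (Pot A - Pot (A - set b)) + 1600 * D + 420)
        (\<lambda>s'. quota g hn' (A - set b) s' \<and> nats s' ''k'' 0 = nats s0 ''k'' 0 + 4 \<and>
        (\<forall>j<4. nats s' ''out'' (nats s0 ''k'' 0 + j) = nats s0 ''p'' (b ! j)) \<and> (\<forall>j<nats s0 ''k'' 0. nats s' ''out'' j = nats s0 ''out'' j))"
        unfolding peel_body_def
        by (rule runs_Cond[OF runs_conseq[OF r, OF order.refl]]) (use c b hn' in \<open>auto simp: quota_def\<close>)
    qed (use b hn' in auto)
  next
    case False
    then obtain g' where g': "g = Suc g'" using pos by (cases g) auto
    have h0: "hn = 0" using False by simp
    have "\<exists>b. length b = 4 \<and> distinct b \<and> set b \<subseteq> A \<and> starlike (set b) \<and> sepb (set b) (A - set b) \<and> Pot (A - set b) \<le> Pot A \<and>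
     card (cls ''a'' (A - set b)) = card (cls ''a'' A) - 3 \<and> card (cls ''c'' (A - set b)) = card (cls ''c'' A) - 1 \<and>
     runs (takeR ;; takeR ;; takeR ;; takeB) s0 (300 * (Pot A - Pot (A - set b)) + 1600 * D + 400)
      (\<lambda>s'. state_ok (A - set b) s' \<and> nats s' ''k'' 0 = nats s0 ''k'' 0 + 4 \<and> nats s' ''cr'' 0 = nats s0 ''cr'' 0 - 3 \<and> nats s' ''cb'' 0 = nats s0 ''cb'' 0 - 1 \<and>
        (\<forall>j<4. nats s' ''out'' (nats s0 ''k'' 0 + j) = nats s0 ''p'' (b ! j)) \<and> (\<forall>j<nats s0 ''k'' 0. nats s' ''out'' j = nats s0 ''out'' j))"
      by (rule four_runs[OF ok]) (use c g' h0 in auto)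
    then obtain b where b: "length b = 4" "distinct b" "set b \<subseteq> A" "starlike (set b)" "sepb (set b) (A - set b)" "Pot (A - set b) \<le> Pot A"
      "card (cls ''a'' (A - set b)) = card (cls ''a'' A) - 3" "card (cls ''c'' (A - set b)) = card (cls ''c'' A) - 1" and
     r: "runs (takeR ;; takeR ;; takeR ;; takeB) s0 (300 * (Pot A - Pot (A - set b)) + 1600 * D + 400)
      (\<lambda>s'. state_ok (A - set b) s' \<and> nats s' ''k'' 0 = nats s0 ''k'' 0 + 4 \<and> nats s' ''cr'' 0 = nats s0 ''cr'' 0 - 3 \<and> nats s' ''cb'' 0 = nats s0 ''cb'' 0 - 1 \<and>
        (\<forall>j<4. nats s' ''out'' (nats s0 ''k'' 0 + j) = nats s0 ''p'' (b ! j)) \<and> (\<forall>j<nats s0 ''k'' 0. nats s' ''out'' j = nats s0 ''out'' j))" by blast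
    show ?thesis
    proof (rule exI[of _ b], rule exI[of _ g'], rule exI[of _ 0], intro conjI)
      show "runs peel_body s0 (300 * (Pot A - Pot (A - set b)) + 1600 * D + 420)
        (\<lambda>s'. quota g' 0 (A - set b) s' \<and> nats s' ''k'' 0 = nats s0 ''k'' 0 + 4 \<and>
        (\<forall>j<4. nats s' ''out'' (nats s0 ''k'' 0 + j) = nats s0 ''p'' (b ! j)) \<and> (\<forall>j<nats s0 ''k'' 0. nats s' ''out'' j = nats s0 ''out'' j))"
        unfolding peel_body_def
        by (rule runs_Cond[OF _ runs_conseq[OF r, OF order.refl]]) (use c b g' h0 in \<open>auto simp: quota_def\<close>)
    qed (use b g' h0 in auto)
  qed
qed

lemma peel_loop_runs:
  assumes "quota g hn A s0"
  shows "runs peel_loop s0 (300 * Pot A + (g + hn) * (1600 * D + 430) + 10) (\<lambda>s'. \<exists>Bs. length Bs = g + hn \<and> peeled A Bs \<and>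
     (\<forall>m<g + hn. \<forall>j<4. nats s' ''out'' (nats s0 ''k'' 0 + 4 * m + j) = nats s0 ''p'' (Bs ! m ! j)) \<and>
     (\<forall>j<nats s0 ''k'' 0. nats s' ''out'' j = nats s0 ''out'' j))"
  using assms
proof (induction "g + hn" arbitrary: g hn A s0)
  case 0
  then have "nats s0 ''cr'' 0 = 0" "cls ''a'' A = {}" "cls ''c'' A = {}" "A \<subseteq> S"
    using cls_finite[of A] by (auto simp: quota_def state_ok_def)
  moreover have "A = cls ''a'' A \<union> cls ''c'' A"
    using S_not_mid \<open>A \<subseteq> S\<close> by (auto simp: cls_def sideof_def) (meson linorder_neqE_nat subsetD)
  ultimately have "A = {}" "\<not> bval (NLess (NLit 0) (NV ''cr'')) s0" by auto
  from exec.WhileFalse[OF this(2), of peel_body] show ?case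
    unfolding runs_def wp_def peel_loop_def using 0(1) \<open>A = {}\<close> by (intro exI conjI) auto
next
  case (Suc n)
  have pos: "0 < g + hn" using Suc(2) by linarith
  from peel_body_runs[OF Suc(3) pos] obtain b g' hn' where gh: "g' + hn' + 1 = g + hn" and
    b: "length b = 4" "distinct b" "set b \<subseteq> A" "starlike (set b)" "sepb (set b) (A - set b)" "Pot (A - set b) \<le> Pot A" and
    r: "runs peel_body s0 (300 * (Pot A - Pot (A - set b)) + 1600 * D + 420)
      (\<lambda>s'. quota g' hn' (A - set b) s' \<and> nats s' ''k'' 0 = nats s0 ''k'' 0 + 4 \<and>
        (\<forall>j<4. nats s' ''out'' (nats s0 ''k'' 0 + j) = nats s0 ''p'' (b ! j)) \<and> (\<forall>j<nats s0 ''k'' 0. nats s' ''out'' j = nats s0 ''out'' j))"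
    by blast
  have n: "n = g' + hn'" using gh Suc(2) by simp
  have cr: "bval (NLess (NLit 0) (NV ''cr'')) s0" using Suc(3) pos by (auto simp: quota_def)
  show ?case unfolding peel_loop_def
  proof (rule runs_While_unfold[OF cr r])
    fix s1 assume s1: "quota g' hn' (A - set b) s1 \<and> nats s1 ''k'' 0 = nats s0 ''k'' 0 + 4 \<and>
        (\<forall>j<4. nats s1 ''out'' (nats s0 ''k'' 0 + j) = nats s0 ''p'' (b ! j)) \<and> (\<forall>j<nats s0 ''k'' 0. nats s1 ''out'' j = nats s0 ''out'' j)"
      and ag: "agree peel_body s0 s1"
    have p: "nats s1 ''p'' = nats s0 ''p''" using agreeN[OF ag] by simp
    note IH = Suc(1)[OF n conjunct1[OF s1]]
    show "runs (While (NLess (NLit 0) (NV ''cr'')) peel_body) s1 (300 * Pot (A - set b) + (g' + hn') * (1600 * D + 430) + 10)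
      (\<lambda>s'. \<exists>Bs. length Bs = g + hn \<and> peeled A Bs \<and>
        (\<forall>m<g + hn. \<forall>j<4. nats s' ''out'' (nats s0 ''k'' 0 + 4 * m + j) = nats s0 ''p'' (Bs ! m ! j)) \<and>
        (\<forall>j<nats s0 ''k'' 0. nats s' ''out'' j = nats s0 ''out'' j))"
    proof (rule runs_conseq[OF IH[unfolded peel_loop_def]])
      fix s' assume "\<exists>Bs. length Bs = g' + hn' \<and> peeled (A - set b) Bs \<and>
        (\<forall>m<g' + hn'. \<forall>j<4. nats s' ''out'' (nats s1 ''k'' 0 + 4 * m + j) = nats s1 ''p'' (Bs ! m ! j)) \<and>
        (\<forall>j<nats s1 ''k'' 0. nats s' ''out'' j = nats s1 ''out'' j)"
      then obtain Bs where Bs: "length Bs = g' + hn'" "peeled (A - set b) Bs"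
        "\<And>m j. m < g' + hn' \<Longrightarrow> j < 4 \<Longrightarrow> nats s' ''out'' (nats s1 ''k'' 0 + 4 * m + j) = nats s1 ''p'' (Bs ! m ! j)"
        "\<And>j. j < nats s1 ''k'' 0 \<Longrightarrow> nats s' ''out'' j = nats s1 ''out'' j" by blast
      have "nats s' ''out'' (nats s0 ''k'' 0 + 4 * m + j) = nats s0 ''p'' ((b # Bs) ! m ! j)" if m: "m < g + hn" "j < 4" for m j
      proof (cases m)
        case 0
        then show ?thesis using Bs(4)[of "nats s0 ''k'' 0 + j"] s1 m by simp
      next
        case (Suc m')
        then have "m' < g' + hn'" using m gh by simp
        then show ?thesis using Bs(3)[of m' j] m Suc s1 p by (simp add: algebra_simps)
      qed
      moreover have "nats s' ''out'' j = nats s0 ''out'' j" if "j < nats s0 ''k'' 0" for j using Bs(4)[of j] s1 that by simp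
      moreover have "length (b # Bs) = g + hn" "peeled A (b # Bs)" using Bs(1,2) gh b by auto
      ultimately show "\<exists>Bs. length Bs = g + hn \<and> peeled A Bs \<and>
        (\<forall>m<g + hn. \<forall>j<4. nats s' ''out'' (nats s0 ''k'' 0 + 4 * m + j) = nats s0 ''p'' (Bs ! m ! j)) \<and>
        (\<forall>j<nats s0 ''k'' 0. nats s' ''out'' j = nats s0 ''out'' j)" by blast
    qed simp
  next
    have "(g + hn) * (1600 * D + 430) = (g' + hn') * (1600 * D + 430) + (1600 * D + 430)" unfolding gh[symmetric] by simp
    then show "1 + bcost (NLess (NLit 0) (NV ''cr'')) + (300 * (Pot A - Pot (A - set b)) + 1600 * D + 420) +
      (300 * Pot (A - set b) + (g' + hn') * (1600 * D + 430) + 10) \<le> 300 * Pot A + (g + hn) * (1600 * D + 430) + 10"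
      using b(6) by simp
  qed
qed

end

section \<open>Segments that do not cross\<close>

lemma cross_segment:
  "cross p q ((1 - t) *\<^sub>R x + t *\<^sub>R y) = (1 - t) * cross p q x + t * cross p q y"
  by (simp add: cross_def algebra_simps)

text \<open>The orientation is affine along the segment, and at most one end lies on the line
  through \<open>p\<close> and \<open>q\<close>, namely in \<open>p\<close> itself.\<close>

lemma segment_sign:
  assumes z: "z \<in> closed_segment x y" and "x \<noteq> y"
    and x: "x = p \<or> 0 < \<sigma> * cross p q x" and y: "y = p \<or> 0 < \<sigma> * cross p q y"
  shows "0 < \<sigma> * cross p q z \<or> z = p"
proof -
  obtain t where t: "0 \<le> t" "t \<le> 1" "z = (1 - t) *\<^sub>R x + t *\<^sub>R y" using z by (auto simp: in_segment)
  have e: "\<sigma> * cross p q z = (1 - t) * (\<sigma> * cross p q x) + t * (\<sigma> * cross p q y)"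
    unfolding t(3) cross_segment by (simp add: algebra_simps)
  have p0: "cross p q p = 0" by (simp add: cross_def)
  consider "x = p" "0 < \<sigma> * cross p q y" | "y = p" "0 < \<sigma> * cross p q x" | "0 < \<sigma> * cross p q x" "0 < \<sigma> * cross p q y"
    using x y \<open>x \<noteq> y\<close> by blast
  then show ?thesis
  proof cases
    case 1
    show ?thesis
    proof (cases "t = 0")
      case False
      then have "0 < t" using t by simp
      from mult_pos_pos[OF this 1(2)] have "0 < t * (\<sigma> * cross p q y)" .
      moreover have "\<sigma> * cross p q z = t * (\<sigma> * cross p q y)" unfolding e using 1 p0 by simp
      ultimately show ?thesis by linarith
    qed (use 1 t in simp)
  next
    case 2
    show ?thesis
    proof (cases "t = 1")
      case False
      then have "0 < 1 - t" using t by simp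
      from mult_pos_pos[OF this 2(2)] have "0 < (1 - t) * (\<sigma> * cross p q x)" .
      moreover have "\<sigma> * cross p q z = (1 - t) * (\<sigma> * cross p q x)" unfolding e using 2 p0 by simp
      ultimately show ?thesis by linarith
    qed (use 2 t in simp)
  next
    case 3
    have "0 \<le> (1 - t) * (\<sigma> * cross p q x)" using mult_nonneg_nonneg[of "1 - t" "\<sigma> * cross p q x"] 3 t by linarith
    moreover have "0 \<le> t * (\<sigma> * cross p q y)" using mult_nonneg_nonneg[of t "\<sigma> * cross p q y"] 3 t by linarith
    moreover have "0 < (1 - t) * (\<sigma> * cross p q x) \<or> 0 < t * (\<sigma> * cross p q y)"
    proof (cases "t = 0")
      case False
      then show ?thesis using mult_pos_pos[of t "\<sigma> * cross p q y"] 3(2) t by linarith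
    qed (use 3 in simp)
    ultimately show ?thesis using e by linarith
  qed
qed

text \<open>The two segments lie on opposite sides of the line and meet it at most in the different
  points \<open>p\<close> and \<open>q\<close>.\<close>

lemma segments_disjoint:
  assumes "x \<noteq> y" "x' \<noteq> y'" "p \<noteq> q"
    and "x = p \<or> 0 < \<sigma> * cross p q x" "y = p \<or> 0 < \<sigma> * cross p q y"
    and "x' = q \<or> \<sigma> * cross p q x' < 0" "y' = q \<or> \<sigma> * cross p q y' < 0"
  shows "closed_segment x y \<inter> closed_segment x' y' = {}"
proof (rule ccontr)
  assume "closed_segment x y \<inter> closed_segment x' y' \<noteq> {}"
  then obtain z where z: "z \<in> closed_segment x y" "z \<in> closed_segment x' y'" by blast
  have sw: "\<sigma> * cross q p w = - (\<sigma> * cross p q w)" for w by (simp add: cross_def algebra_simps)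
  have 1: "0 < \<sigma> * cross p q z \<or> z = p" using segment_sign[OF z(1) assms(1,4,5)] .
  have "x' = q \<or> 0 < \<sigma> * cross q p x'" "y' = q \<or> 0 < \<sigma> * cross q p y'" using assms(6,7) unfolding sw by auto
  then have 2: "0 < \<sigma> * cross q p z \<or> z = q" using segment_sign[OF z(2) assms(2)] by blast
  have "cross p q p = 0" "cross p q q = 0" by (simp_all add: cross_def)
  then show False using 1 2 sw[of z] assms(3) by auto
qed

text \<open>A common point is on the line \<open>c p\<close>, so its parameter on the other segment
  is 0.\<close>

lemma segments_common_end:
  assumes "cross c p p' \<noteq> 0"
  shows "closed_segment c p \<inter> closed_segment c p' \<subseteq> {c}"
proof
  fix z assume z: "z \<in> closed_segment c p \<inter> closed_segment c p'"
  obtain t where t: "z = (1 - t) *\<^sub>R c + t *\<^sub>R p" using z by (auto simp: in_segment)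
  obtain r where r: "z = (1 - r) *\<^sub>R c + r *\<^sub>R p'" using z by (auto simp: in_segment)
  have "cross c p z = 0" unfolding t cross_segment by (simp add: cross_def)
  moreover have "cross c p z = r * cross c p p'" unfolding r cross_segment by (simp add: cross_def)
  ultimately have "r = 0" using assms by simp
  then show "z \<in> {c}" using r by simp
qed

context peeling begin

lemma peeled_props:
  assumes "peeled A Bs"
  shows "(\<Union>b\<in>set Bs. set b) = A"
    "\<And>m. m < length Bs \<Longrightarrow> length (Bs ! m) = 4 \<and> distinct (Bs ! m) \<and> starlike (set (Bs ! m)) \<and> set (Bs ! m) \<subseteq> A"
    "\<And>m m'. m < m' \<Longrightarrow> m' < length Bs \<Longrightarrow> set (Bs ! m) \<inter> set (Bs ! m') = {} \<and> sepb (set (Bs ! m)) (set (Bs ! m'))"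
proof -
  have "(\<Union>b\<in>set Bs. set b) = A \<and>
    (\<forall>m < length Bs. length (Bs ! m) = 4 \<and> distinct (Bs ! m) \<and> starlike (set (Bs ! m)) \<and> set (Bs ! m) \<subseteq> A) \<and>
    (\<forall>m m'. m < m' \<and> m' < length Bs \<longrightarrow> set (Bs ! m) \<inter> set (Bs ! m') = {} \<and> sepb (set (Bs ! m)) (set (Bs ! m')))"
    using assms
  proof (induction Bs arbitrary: A)
    case (Cons b Bs)
    have b: "length b = 4" "distinct b" "set b \<subseteq> A" "starlike (set b)" "sepb (set b) (A - set b)" "peeled (A - set b) Bs"
      using Cons.prems by auto
    note IH = Cons.IH[OF b(6)]
    \<comment> \<open>Separation from all that is left over gives separation from each later
      star.\<close>
    have mono: "sepb (set b) R'" if "R' \<subseteq> A - set b" for R'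
      using b(5) that unfolding sepb_def by blast
    show ?case
    proof (intro conjI allI impI)
      show "(\<Union>b\<in>set (b # Bs). set b) = A" using IH b(3) by auto
    next
      fix m assume "m < length (b # Bs)"
      then show "length ((b # Bs) ! m) = 4" "distinct ((b # Bs) ! m)" "starlike (set ((b # Bs) ! m))" "set ((b # Bs) ! m) \<subseteq> A"
        using IH b by (cases m; auto)+
    next
      fix m m' assume m: "m < m' \<and> m' < length (b # Bs)"
      then obtain k' where k': "m' = Suc k'" "k' < length Bs" by (cases m') auto
      have sub: "set (Bs ! k') \<subseteq> A - set b" using IH k' by blast
      show "set ((b # Bs) ! m) \<inter> set ((b # Bs) ! m') = {}" "sepb (set ((b # Bs) ! m)) (set ((b # Bs) ! m'))"
        using IH k' m sub mono[OF sub] by (cases m; auto)+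
    qed
  qed auto
  then show "(\<Union>b\<in>set Bs. set b) = A"
    "\<And>m. m < length Bs \<Longrightarrow> length (Bs ! m) = 4 \<and> distinct (Bs ! m) \<and> starlike (set (Bs ! m)) \<and> set (Bs ! m) \<subseteq> A"
    "\<And>m m'. m < m' \<Longrightarrow> m' < length Bs \<Longrightarrow> set (Bs ! m) \<inter> set (Bs ! m') = {} \<and> sepb (set (Bs ! m)) (set (Bs ! m'))"
    by blast+
qed

text \<open>Edges of different stars are apart by \<open>sepb\<close>. Edges of one star share its
  centre and meet only there by general position, provided that the centre is unique.\<close>

lemma peeled_covering:
  fixes pos :: "nat \<Rightarrow> point"
  assumes pl: "peeled S Bs" and inj: "inj_on pos S"
    and red: "\<And>z. z \<in> S \<Longrightarrow> pos z \<in> Rd \<longleftrightarrow> z < mi" and blue: "\<And>z. z \<in> S \<Longrightarrow> pos z \<in> Bl \<longleftrightarrow> mi < z"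
    and onto: "pos ` S = Rd \<union> Bl" and det: "dt \<noteq> 0"
    and orc: "\<And>i j k. i \<in> S \<Longrightarrow> j \<in> S \<Longrightarrow> k \<in> S \<Longrightarrow> ori X Y i j k = dt * cross (pos i) (pos j) (pos k)"
  shows "K13_covering Rd Bl ((\<lambda>b. pos ` set b) ` set Bs)"
proof -
  note pr = peeled_props[OF pl]
  let ?P = "(\<lambda>b. pos ` set b) ` set Bs"
  have False if w: "w \<in> Rd" "w \<in> Bl" for w
  proof -
    have "w \<in> pos ` S" using onto w by blast
    then obtain z where "z \<in> S" "w = pos z" by blast
    then show False using red[of z] blue[of z] w by simp
  qed
  then have disj: "Rd \<inter> Bl = {}" by blast
  have blk: "length b = 4" "distinct b" "starlike (set b)" "set b \<subseteq> S" if "b \<in> set Bs" for b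
    using pr(2) that by (metis in_set_conv_nth)+
  have inj2: "\<And>i j. i \<in> S \<Longrightarrow> j \<in> S \<Longrightarrow> pos i = pos j \<longleftrightarrow> i = j" using inj by (auto simp: inj_on_def)
  have imd: "pos ` set b \<inter> pos ` set b' = {} \<or> b = b'" if bb: "b \<in> set Bs" "b' \<in> set Bs" for b b'
  proof -
    obtain m m' where m: "b = Bs ! m" "m < length Bs" "b' = Bs ! m'" "m' < length Bs" using bb by (metis in_set_conv_nth)
    have "set b \<inter> set b' = {} \<or> b = b'" using pr(3)[of m m'] pr(3)[of m' m] m by (cases m m' rule: linorder_cases) auto
    moreover have "pos ` set b \<inter> pos ` set b' = pos ` (set b \<inter> set b')"
      using inj_on_image_Int[OF inj blk(4)[OF bb(1)] blk(4)[OF bb(2)]] by simp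
    ultimately show ?thesis by auto
  qed
  have part: "partition_on (Rd \<union> Bl) ?P"
  proof (rule partition_onI)
    have "\<Union>?P = pos ` (\<Union>b\<in>set Bs. set b)" by blast
    then show "\<Union>?P = Rd \<union> Bl" using pr(1) onto by simp
    show "disjnt p p'" if "p \<in> ?P" "p' \<in> ?P" "p \<noteq> p'" for p p' using that imd unfolding disjnt_def by blast
    show "{} \<notin> ?P" using blk(1) by fastforce
  qed
  have card4: "card (pos ` set b) = 4" if "b \<in> set Bs" for b
    using that blk[OF that] inj by (metis card_image distinct_card inj_on_subset)
  have colr: "\<And>z. z \<in> S \<Longrightarrow> \<not> z < mi \<longleftrightarrow> pos z \<in> Bl"
    using blue S_not_mid by (metis linorder_neqE_nat not_less_iff_gr_or_eq)
  have center: "\<exists>c. star_center Rd Bl (pos ` set b) c" if b: "b \<in> set Bs" for b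
  proof -
    obtain c where c: "c \<in> set b" "\<And>z. z \<in> set b - {c} \<Longrightarrow> (z < mi) \<noteq> (c < mi)" using blk(3)[OF b] by (auto simp: starlike_def)
    have S: "\<And>z. z \<in> set b \<Longrightarrow> z \<in> S" using blk(4)[OF b] by blast
    have rest: "\<exists>z\<in>set b - {c}. w = pos z" if "w \<in> pos ` set b - {pos c}" for w using that by auto
    have "star_center Rd Bl (pos ` set b) (pos c)"
    proof (cases "c < mi")
      case True
      then have "pos ` set b - {pos c} \<subseteq> Bl" using rest c(2) colr S by (metis DiffD1 subsetI)
      then show ?thesis using True red S c(1) by (auto simp: star_center_def)
    next
      case False
      then have "pos ` set b - {pos c} \<subseteq> Rd" using rest c(2) red S by (metis DiffD1 subsetI)
      then show ?thesis using False colr S c(1) by (auto simp: star_center_def)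
    qed
    then show ?thesis by blast
  qed
  \<comment> \<open>With two centres of different colours, any third member of the set would have
    both colours.\<close>
  have uniq: "c = c'" if "star_center Rd Bl Q c" "star_center Rd Bl Q c'" "card Q = 4" for Q c c'
  proof (rule ccontr)
    assume "c \<noteq> c'"
    then have "card {c, c'} = 2" by simp
    then have "\<not> Q \<subseteq> {c, c'}" using that(3) card_mono[of "{c, c'}" Q] by auto
    then obtain d where "d \<in> Q" "d \<noteq> c" "d \<noteq> c'" by blast
    then show False using that(1,2) disj \<open>c \<noteq> c'\<close> unfolding star_center_def by blast
  qed
  have gpc: "cross (pos i) (pos j) (pos k) \<noteq> 0" if "i \<in> S" "j \<in> S" "k \<in> S" "i \<noteq> j" "i \<noteq> k" "j \<noteq> k" for i j k
    using gpo[OF that] orc[OF that(1-3)] by auto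
  have far_apart: "closed_segment (pos i) (pos j) \<inter> closed_segment (pos i') (pos j') = {}"
    if ij: "i \<in> set (Bs ! m)" "j \<in> set (Bs ! m)" "i \<noteq> j" "i' \<in> set (Bs ! m')" "j' \<in> set (Bs ! m')" "i' \<noteq> j'" and m: "m < m'" "m' < length Bs" for i j i' j' m m'
  proof -
    have sub: "set (Bs ! m) \<subseteq> S" "set (Bs ! m') \<subseteq> S" using pr(2) m by (meson less_trans)+
    have sb: "sepb (set (Bs ! m)) (set (Bs ! m'))" "set (Bs ! m) \<inter> set (Bs ! m') = {}" using pr(3)[OF m] by auto
    have "set (Bs ! m') \<noteq> {}" using ij(4) by (metis empty_iff)
    with sb(1) have "\<exists>p q \<sigma>. p \<in> set (Bs ! m) \<and> q \<notin> set (Bs ! m) \<and> q \<in> S \<and>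
      (\<forall>z\<in>set (Bs ! m) - {p}. 0 < \<sigma> * ori X Y p q z) \<and> (\<forall>z\<in>set (Bs ! m') - {q}. \<sigma> * ori X Y p q z < 0)"
      by (simp only: sepb_def simp_thms)
    then obtain p q \<sigma> where pq: "p \<in> set (Bs ! m)" "q \<notin> set (Bs ! m)" "q \<in> S"
      "\<forall>z\<in>set (Bs ! m) - {p}. 0 < \<sigma> * ori X Y p q z" "\<forall>z\<in>set (Bs ! m') - {q}. \<sigma> * ori X Y p q z < 0"
      by (elim exE conjE)
    have o: "\<sigma> * ori X Y p q z = (\<sigma> * dt) * cross (pos p) (pos q) (pos z)" if "z \<in> S" for z
      using orc[of p q z] pq sub that by auto
    have side1: "pos z = pos p \<or> 0 < (\<sigma> * dt) * cross (pos p) (pos q) (pos z)" if "z \<in> set (Bs ! m)" for z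
    proof (cases "z = p")
      case False
      then have "z \<in> set (Bs ! m) - {p}" "z \<in> S" using that sub by auto
      then show ?thesis using bspec[OF pq(4)] o[of z] by metis
    qed simp
    have side2: "pos z = pos q \<or> (\<sigma> * dt) * cross (pos p) (pos q) (pos z) < 0" if "z \<in> set (Bs ! m')" for z
    proof (cases "z = q")
      case False
      then have "z \<in> set (Bs ! m') - {q}" "z \<in> S" using that sub by auto
      then show ?thesis using bspec[OF pq(5)] o[of z] by metis
    qed simp
    show ?thesis
      by (rule segments_disjoint[of _ _ _ _ "pos p" "pos q" "\<sigma> * dt"]) (use ij inj2 sub pq side1 side2 in auto)
  qed
  have "closed_segment c p \<inter> closed_segment c' p' \<subseteq> {c, p} \<inter> {c', p'}"
    if e: "(c, p) \<in> star_edges Rd Bl ?P" "(c', p') \<in> star_edges Rd Bl ?P" "(c, p) \<noteq> (c', p')" for c p c' p'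
  proof -
    have blockE: "\<exists>m<length Bs. star_center Rd Bl (pos ` set (Bs ! m)) x \<and> y \<in> pos ` set (Bs ! m) - {x}"
      if xy: "(x, y) \<in> star_edges Rd Bl ?P" for x y
    proof -
      obtain b where b: "b \<in> set Bs" "star_center Rd Bl (pos ` set b) x" "y \<in> pos ` set b - {x}"
        using xy unfolding star_edges_def by blast
      then show ?thesis by (metis in_set_conv_nth)
    qed
    obtain m where m: "m < length Bs" "star_center Rd Bl (pos ` set (Bs ! m)) c" "p \<in> pos ` set (Bs ! m) - {c}"
      using blockE[OF e(1)] by blast
    obtain m' where m': "m' < length Bs" "star_center Rd Bl (pos ` set (Bs ! m')) c'" "p' \<in> pos ` set (Bs ! m') - {c'}"
      using blockE[OF e(2)] by blast
    obtain i j where ij: "c = pos i" "i \<in> set (Bs ! m)" "p = pos j" "j \<in> set (Bs ! m)" "i \<noteq> j"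
      using m by (auto simp: star_center_def)
    obtain i' j' where ij': "c' = pos i'" "i' \<in> set (Bs ! m')" "p' = pos j'" "j' \<in> set (Bs ! m')" "i' \<noteq> j'"
      using m' by (auto simp: star_center_def)
    consider "m < m'" | "m' < m" | "m = m'" by linarith
    then show ?thesis
    proof cases
      case 1
      then show ?thesis using far_apart[OF ij(2,4,5) ij'(2,4,5) 1 m'(1)] ij ij' by simp
    next
      case 2
      then show ?thesis using far_apart[OF ij'(2,4,5) ij(2,4,5) 2 m(1)] ij ij' by (simp add: Int_commute)
    next
      case 3
      have bS: "Bs ! m \<in> set Bs" using m(1) by simp
      have cc: "c' = c" using uniq[OF m'(2)] m(2) card4[OF bS] 3 by metis
      then have "p \<noteq> p'" using e(3) by auto
      have sub: "set (Bs ! m) \<subseteq> S" using blk(4)[OF bS] .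
      have "cross c p p' \<noteq> 0"
        unfolding ij(1,3) ij'(3)
        by (rule gpc) (use ij ij' sub 3 cc inj2 \<open>p \<noteq> p'\<close> m'(3) in auto)
      then show ?thesis using segments_common_end cc by blast
    qed
  qed
  then show ?thesis unfolding K13_covering_def using part card4 center by blast
qed

end

section \<open>The complete program\<close>

lemma (in config) algorithm_runs:
  assumes cnt: "length rs = 3 * g + hn" "length bs = 3 * hn + g"
  shows "\<exists>t s P. exec (prep ;; peel) (input_ram rs bs) t s \<and> t \<le> 40000 * N * (floor_log (4 * N) + 1) + 50 \<and>
    output_family rs bs s P \<and> K13_covering (set rs) (set bs) P"
proof -
  from prep_runs obtain D where D: "2 ^ D \<le> 4 * N" "1 \<le> D" and
    rp: "runs prep (input_ram rs bs) (7500 * D * 2 ^ D) (\<lambda>s. \<exists>lo ot H. ready D lo ot H s)" by blast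
  then obtain t1 s1 lo ot H where e1: "exec prep (input_ram rs bs) t1 s1" "t1 \<le> 7500 * D * 2 ^ D" and rd: "ready D lo ot H s1"
    unfolding runs_def wp_def by blast
  obtain x y eps where ar: "arranged D lo N x y ot H eps s1" using rd by (auto simp: ready_def)
  obtain a1 b1 a2 b2 where det: "a1 * b2 - b1 * a2 \<noteq> 0" and lin: "\<And>r. r < N \<Longrightarrow>
      reals s1 ''X'' (pt lo r) = a1 * fst (ps ! ot r) + b1 * snd (ps ! ot r) \<and>
      reals s1 ''Y'' (pt lo r) = a2 * fst (ps ! ot r) + b2 * snd (ps ! ot r)" using rd unfolding ready_def by blast
  have col: "\<And>r. r < N \<Longrightarrow> ot r < Rn \<longleftrightarrow> r < Rn" and szs: "Rn \<le> 2 ^ (D - 1)" "length bs \<le> 2 ^ (D - 1)" "lo = 2 ^ (D - 1) - Rn"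
    and rb: "nats s1 ''R'' 0 = Rn" "nats s1 ''B'' 0 = length bs" using rd unfolding ready_def by blast+
  have so: "sorted_out N (lex x y) ot" and ge: "geometry D lo N x y ot s1 H eps"
    and tr: "lev.treeok (reals s1 ''X'') (reals s1 ''Y'') D s1 (pt lo ` {..<N})"
    and br: "lev.bridge (reals s1 ''X'') (reals s1 ''Y'') D (pt lo ` {..<N}) (nats s1 ''a'' 0) (nats s1 ''c'' 0)"
    using ar by (auto simp: arranged_def)
  define X Y p where "X = reals s1 ''X''" and "Y = reals s1 ''Y''" and "p = nats s1 ''p''"
  define S where "S = pt lo ` {..<N}"
  define U where "U = (\<lambda>i. x (p i))"
  define pos where "pos = (\<lambda>z. ps ! p z)"
  let ?dt = "a1 * b2 - b1 * a2"
  have pts: "X (pt lo r) = x (ot r) + eps * y (ot r)" "Y (pt lo r) = y (ot r)" "p (pt lo r) = ot r" if "r < N" for r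
    using ge that by (auto simp: geometry_def X_def Y_def p_def)
  have otN: "ot r < N" if "r < N" for r using so that by (simp add: sorted_out_def)
  have orc: "ori X Y i j k = ?dt * cross (pos i) (pos j) (pos k)" if ijk: "i \<in> S" "j \<in> S" "k \<in> S" for i j k
  proof -
    obtain r1 r2 r3 where r: "i = pt lo r1" "j = pt lo r2" "k = pt lo r3" "r1 < N" "r2 < N" "r3 < N"
      using ijk by (auto simp: S_def)
    have po: "pos (pt lo r1) = ps ! ot r1" "pos (pt lo r2) = ps ! ot r2" "pos (pt lo r3) = ps ! ot r3" using r pts by (simp_all add: pos_def)
    show ?thesis unfolding ori_def cross_def r(1-3) po X_def Y_def conjunct1[OF lin[OF r(4)]] conjunct2[OF lin[OF r(4)]]
      conjunct1[OF lin[OF r(5)]] conjunct2[OF lin[OF r(5)]] conjunct1[OF lin[OF r(6)]] conjunct2[OF lin[OF r(6)]] by algebra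
  qed
  have posin: "inj_on pos S"
  proof (rule inj_onI)
    fix i j assume ij: "i \<in> S" "j \<in> S" "pos i = pos j"
    then obtain r1 r2 where r: "i = pt lo r1" "j = pt lo r2" "r1 < N" "r2 < N" by (auto simp: S_def)
    then have "ps ! ot r1 = ps ! ot r2" using ij pts by (simp add: pos_def)
    then have "ot r1 = ot r2" using nth_eq_iff_index_eq[OF ps_distinct] otN r by simp
    then show "i = j" using inj_onD[OF sorted_out_inj(1)[OF so]] r by auto
  qed
  have onto: "pos ` S = set rs \<union> set bs"
  proof -
    have "pos ` S = (!) ps ` ot ` {..<N}" using pts by (auto simp: S_def pos_def image_iff)
    also have "\<dots> = (!) ps ` {..<length ps}" using sorted_out_inj(2)[OF so] by simp
    also have "\<dots> = set ps" by (metis atLeast0LessThan list.set_map map_nth set_upt)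
    finally show ?thesis by simp
  qed
  have gpos: "ori X Y i j k \<noteq> 0" if ijk: "i \<in> S" "j \<in> S" "k \<in> S" "i \<noteq> j" "i \<noteq> k" "j \<noteq> k" for i j k
  proof -
    have "pos i \<noteq> pos j" "pos i \<noteq> pos k" "pos j \<noteq> pos k" using inj_onD[OF posin] ijk by blast+
    moreover have "pos i \<in> set rs \<union> set bs" "pos j \<in> set rs \<union> set bs" "pos k \<in> set rs \<union> set bs" using onto ijk by blast+
    ultimately have "\<not> collinear {pos i, pos j, pos k}" using gp unfolding general_position_def by blast
    then have "cross (pos i) (pos j) (pos k) \<noteq> 0" using cross_zero_collinear by metis
    then show ?thesis using orc[OF ijk(1-3)] det by (metis mult_eq_0_iff)
  qed
  have L: "lev X Y (gapset D) S H D" using ge by (simp add: geometry_def X_def Y_def S_def)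
  have FL: "far_lev X Y (gapset D) S H D U eps"
    using L ge pts by (intro far_lev.intro far_lev_axioms.intro) (auto simp: geometry_def U_def X_def Y_def S_def p_def)
  interpret peeling X Y "gapset D" S H D U eps 0
    using FL gpos D(2) by (intro peeling.intro peeling_axioms.intro) auto
  note K = KR_KB[OF D(2) szs]
  have ptinj: "inj_on (pt lo) Z" for Z by (auto simp: inj_on_def pt_def)
  have clsa: "cls ''a'' S = pt lo ` {..<Rn}"
  proof -
    have "cls ''a'' S = S \<inter> {0<..<2 ^ D}" by (auto simp: cls_def sideof_def S_def pt_def)
    then show ?thesis using K(1) by (simp add: S_def)
  qed
  have clsc: "cls ''c'' S = pt lo ` {Rn..<N}"
  proof -
    have "cls ''c'' S = S \<inter> {2 ^ D<..<wd D}" using Sodd by (auto simp: cls_def sideof_def)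
    then show ?thesis using K(2) by (simp add: S_def)
  qed
  have cards: "card (cls ''a'' S) = 3 * g + hn" "card (cls ''c'' S) = 3 * hn + g"
    unfolding clsa clsc using card_image[OF ptinj] cnt by simp_all
  define s2 where "s2 = nupd ''k'' 0 0 (nupd ''cb'' 0 (length bs) (nupd ''cr'' 0 Rn s1))"
  have R1: "runs (''cr'' ::= NV ''R'' ;; ''cb'' ::= NV ''B'' ;; ''k'' ::= NLit 0) s1 15 (\<lambda>s'. s' = s2)"
    by (simp add: runs_def wp_simps s2_def rb)
  have "treeok s1 S" "bridge S (nats s1 ''a'' 0) (nats s1 ''c'' 0)" using tr br by (simp_all add: X_def Y_def S_def)
  then have tr2: "treeok s2 S" "bridge S (nats s2 ''a'' 0) (nats s2 ''c'' 0)" by (auto simp: treeok_def s2_def)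
  have q: "quota g hn S s2" using tr2 cards cnt by (simp add: quota_def state_ok_def s2_def)
  note R2 = peel_loop_runs[OF q]
  have "runs ((''cr'' ::= NV ''R'' ;; ''cb'' ::= NV ''B'' ;; ''k'' ::= NLit 0) ;; peel_loop) s1 (15 + (300 * Pot S + (g + hn) * (1600 * D + 430) + 10))
     (\<lambda>s'. \<exists>Bs. length Bs = g + hn \<and> peeled S Bs \<and>
     (\<forall>m<g + hn. \<forall>j<4. nats s' ''out'' (nats s2 ''k'' 0 + 4 * m + j) = nats s2 ''p'' (Bs ! m ! j)) \<and>
     (\<forall>j<nats s2 ''k'' 0. nats s' ''out'' j = nats s2 ''out'' j))"
    by (rule runs_Seq[OF R1 _ order.refl], simp only:, rule R2)
  then have "runs peel s1 (15 + (300 * Pot S + (g + hn) * (1600 * D + 430) + 10)) (\<lambda>s'. \<exists>Bs. length Bs = g + hn \<and> peeled S Bs \<and>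
     (\<forall>m<g + hn. \<forall>j<4. nats s' ''out'' (nats s2 ''k'' 0 + 4 * m + j) = nats s2 ''p'' (Bs ! m ! j)) \<and>
     (\<forall>j<nats s2 ''k'' 0. nats s' ''out'' j = nats s2 ''out'' j))"
    unfolding peel_def runs_def by (simp add: wp_simps add.assoc)
  then obtain t2 s3 Bs where e2: "exec peel s1 t2 s3" "t2 \<le> 15 + (300 * Pot S + (g + hn) * (1600 * D + 430) + 10)"
    and Bs: "length Bs = g + hn" "peeled S Bs"
      "\<forall>m<g + hn. \<forall>j<4. nats s3 ''out'' (nats s2 ''k'' 0 + 4 * m + j) = nats s2 ''p'' (Bs ! m ! j)"
    unfolding runs_def wp_def by blast
  have out: "nats s3 ''out'' (4 * m + j) = p (Bs ! m ! j)" if "m < g + hn" "j < 4" for m j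
    using Bs(3) that by (simp add: s2_def p_def)
  note pr = peeled_props[OF Bs(2)]
  have N4: "N = 4 * (g + hn)" using cnt by simp
  let ?P = "(\<lambda>b. pos ` set b) ` set Bs"
  have mem: "Bs ! m ! j \<in> S" if "m < g + hn" "j < 4" for m j
  proof -
    have "Bs ! m ! j \<in> set (Bs ! m)" using pr(2)[of m] that Bs(1) by simp
    then show ?thesis using pr(2)[of m] that Bs(1) by auto
  qed
  have fam: "output_family rs bs s3 ?P"
    unfolding output_family_def Let_def
  proof (intro conjI allI impI)
    fix i assume "i < length ps"
    then have i: "i div 4 < g + hn" "i mod 4 < 4" "i = 4 * (i div 4) + i mod 4" using N4 by auto
    obtain r where "Bs ! (i div 4) ! (i mod 4) = pt lo r" "r < N" using mem[OF i(1,2)] by (auto simp: S_def)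
    then have "p (Bs ! (i div 4) ! (i mod 4)) < N" using pts(3) otN by simp
    then show "nats s3 ''out'' i < length ps" using out[OF i(1,2)] i(3) by simp
  next
    have blk: "(\<lambda>j. ps ! nats s3 ''out'' (4 * m + j)) ` {..<4} = pos ` set (Bs ! m)" if m: "m < g + hn" for m
    proof -
      have l: "length (Bs ! m) = 4" using pr(2)[of m] m Bs(1) by simp
      have "(\<lambda>j. ps ! nats s3 ''out'' (4 * m + j)) ` {..<4} = (\<lambda>j. pos (Bs ! m ! j)) ` {..<4}"
        using out[OF m] by (intro image_cong) (auto simp: pos_def)
      also have "\<dots> = pos ` (!) (Bs ! m) ` {..<length (Bs ! m)}" by (simp add: l image_image)
      also have "(!) (Bs ! m) ` {..<length (Bs ! m)} = set (Bs ! m)" by (metis atLeast0LessThan list.set_map map_nth set_upt)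
      finally show ?thesis .
    qed
    have "length ps div 4 = g + hn" using N4 by simp
    then have "(\<lambda>k. (\<lambda>j. ps ! nats s3 ''out'' (4 * k + j)) ` {..<4}) ` {..<length ps div 4} = (\<lambda>m. pos ` set (Bs ! m)) ` {..<length Bs}"
      using blk Bs(1) image_cong[of "{..<g + hn}" "{..<g + hn}" "\<lambda>k. (\<lambda>j. ps ! nats s3 ''out'' (4 * k + j)) ` {..<4}" "\<lambda>m. pos ` set (Bs ! m)"] by simp
    also have "\<dots> = (\<lambda>b. pos ` set b) ` (!) Bs ` {..<length Bs}" by (simp add: image_image)
    also have "(!) Bs ` {..<length Bs} = set Bs" by (metis atLeast0LessThan list.set_map map_nth set_upt)
    finally show "?P = (\<lambda>k. (\<lambda>j. ps ! nats s3 ''out'' (4 * k + j)) ` {..<4}) ` {..<length ps div 4}" by simp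
  qed
  have disj: "set rs \<inter> set bs = {}" using sepr sepb by force
  have colo: "pos z \<in> set rs \<longleftrightarrow> z < 2 ^ D" "pos z \<in> set bs \<longleftrightarrow> 2 ^ D < z" if z: "z \<in> S" for z
  proof -
    obtain r where r: "z = pt lo r" "r < N" using z by (auto simp: S_def)
    have c: "ot r < Rn \<longleftrightarrow> z < 2 ^ D" using col[OF r(2)] K(4)[OF r(2)] r(1) by simp
    have "pos z = ps ! ot r" using pts(3)[OF r(2)] r by (simp add: pos_def)
    then have "pos z \<in> set rs \<longleftrightarrow> ot r < Rn" "pos z \<in> set bs \<longleftrightarrow> \<not> ot r < Rn"
      using ps_in(2,3)[of "ot r"] otN[OF r(2)] disj by (auto simp: not_less) 
    then show "pos z \<in> set rs \<longleftrightarrow> z < 2 ^ D" "pos z \<in> set bs \<longleftrightarrow> 2 ^ D < z"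
      using c S_not_mid[OF z] by auto
  qed
  have cov: "K13_covering (set rs) (set bs) ?P"
    by (rule peeled_covering[OF Bs(2) posin colo onto det orc])
  have cS: "card S = N" unfolding S_def using card_image[OF ptinj] by simp
  \<comment> \<open>Each level has at most \<open>N\<close> points off their hulls, which bounds the
    initial potential and with it all walks during the peeling.\<close>
  have "Pot S \<le> (\<Sum>\<delta>=1..<Suc D. N)"
    unfolding Pot_def pot_def using finS cS by (intro sum_mono) (metis card_mono Diff_subset)
  then have Pt: "Pot S \<le> D * N" by simp
  have DL: "D \<le> floor_log (4 * N)" using floor_log_le_iff[OF D(1)] by simp
  have tt: "t1 + t2 \<le> 40000 * N * (floor_log (4 * N) + 1) + 50"
  proof -
    have "7500 * D * 2 ^ D \<le> 7500 * D * (4 * N)" using D(1) by (rule mult_le_mono2)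
    also have "\<dots> = 30000 * (D * N)" by simp
    finally have 1: "t1 \<le> 30000 * (D * N)" using e1(2) by linarith
    have "(g + hn) * (1600 * D + 430) \<le> N * (1600 * D + 430)" using N4 by (intro mult_le_mono1) simp
    then have 2: "t2 \<le> 25 + 300 * (D * N) + (1600 * (D * N) + 430 * N)" using e2(2) Pt by (simp add: algebra_simps)
    have 3: "D * N \<le> floor_log (4 * N) * N" using DL by (rule mult_le_mono1)
    have "40000 * N * (floor_log (4 * N) + 1) = 40000 * (floor_log (4 * N) * N) + 40000 * N" by (simp add: algebra_simps)
    then show ?thesis using 1 2 3 by linarith
  qed
  show ?thesis
    using exec.Seq[OF e1(1) e2(1)] tt fam cov by blast
qed

text \<open>A red count of \<open>3 * g + h = 0\<close> forces both numbers to be 0, so this test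
  catches exactly the empty input, for which there are no centroids.\<close>

definition covering_program :: com where
  "covering_program = Cond (NLess (NLit 0) (NV ''red_count'')) (prep ;; peel) Skip"

definition time_bound :: "nat \<Rightarrow> nat" where
  "time_bound N = 40000 * N * (floor_log (4 * N) + 1) + 100"

lemma time_bound_bigo: "(\<lambda>N. real (time_bound N)) \<in> O(\<lambda>N. real N * ln (real N))"
\<comment> \<open>From \<open>N = 2\<close> on, \<open>floor_log (4 * N) + 1\<close> is at most
  \<open>3 + log 2 N\<close>, hence at most \<open>4 * log 2 N\<close>. This gives
  \<open>4 * 40000\<close>, and the additive constant contributes 100 more.\<close>
proof (rule bigoI[where c = "160100 / ln 2"])
  show "eventually (\<lambda>N. norm (real (time_bound N)) \<le> 160100 / ln 2 * norm (real N * ln (real N))) at_top"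
  proof (rule eventually_at_top_linorderI[of 2])
    fix N :: nat assume N: "2 \<le> N"
    have l2: "0 < ln (2::real)" by simp
    have lN: "ln 2 \<le> ln (real N)" using N by simp
    then have one: "1 \<le> ln (real N) / ln 2" using l2 by simp
    have "real (floor_log (4 * N)) \<le> log 2 (real (4 * N))"
    proof -
      have "2 ^ floor_log (4 * N) \<le> 4 * N" using floor_log_exp2_le[of "4 * N"] N by simp
      then have "real (2 ^ floor_log (4 * N)) \<le> real (4 * N)" by (rule of_nat_mono)
      then have "(2::real) ^ floor_log (4 * N) \<le> real (4 * N)" by simp
      then show ?thesis using N by (simp add: le_log_iff powr_realpow)
    qed
    also have "\<dots> = 2 + ln (real N) / ln 2"
    proof -
      have "ln (4::real) = 2 * ln 2" using ln_realpow[of "2::real" 2] by simp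
      then show ?thesis using N l2 by (simp add: log_def ln_mult add_divide_distrib)
    qed
    finally have fl: "real (floor_log (4 * N)) + 1 \<le> 4 * (ln (real N) / ln 2)" using one by linarith
    have "real (time_bound N) = 40000 * real N * (real (floor_log (4 * N)) + 1) + 100" by (simp add: time_bound_def distrib_left)
    also have "40000 * real N * (real (floor_log (4 * N)) + 1) \<le> 40000 * real N * (4 * (ln (real N) / ln 2))"
      using fl by (intro mult_left_mono) auto
    also have "(100::real) \<le> 100 * (real N * (ln (real N) / ln 2))"
    proof -
      have "1 * 1 \<le> real N * (ln (real N) / ln 2)" using one N by (intro mult_mono) auto
      then show ?thesis by linarith
    qed
    finally have "real (time_bound N) \<le> 40000 * real N * (4 * (ln (real N) / ln 2)) + 100 * (real N * (ln (real N) / ln 2))" by simp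
    also have "\<dots> = 160100 / ln 2 * (real N * ln (real N))" by (simp add: field_simps)
    finally show "norm (real (time_bound N)) \<le> 160100 / ln 2 * norm (real N * ln (real N))"
      using less_le_trans[OF l2 lN] by (simp add: abs_mult)
  qed
qed

lemma covering_program_correct:
  assumes "card R = 3 * g + hn" "card B = 3 * hn + g" "general_position (R \<union> B)" "separated_by_line R B"
    "distinct rs" "set rs = R" "distinct bs" "set bs = B"
  shows "\<exists>t s P. exec covering_program (input_ram rs bs) t s \<and> t \<le> time_bound (4 * (g + hn)) \<and>
    output_family rs bs s P \<and> K13_covering R B P"
proof -
  have len: "length rs = 3 * g + hn" "length bs = 3 * hn + g" using assms distinct_card by metis+
  have rc: "nats (input_ram rs bs) ''red_count'' 0 = length rs" by (simp add: input_ram_def)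
  show ?thesis
  proof (cases "g + hn = 0")
    case True
    then have e: "rs = []" "bs = []" using len by auto
    have "exec covering_program (input_ram rs bs) (1 + bcost (NLess (NLit 0) (NV ''red_count'')) + 1) (input_ram rs bs)"
      unfolding covering_program_def using rc e by (intro exec.CondFalse exec.Skip) simp
    moreover have "output_family rs bs (input_ram rs bs) {}" using e by (simp add: output_family_def)
    moreover have "K13_covering R B {}"
      using e assms(6,8) by (auto simp: K13_covering_def partition_on_def star_edges_def)
    ultimately show ?thesis by (intro exI conjI) (auto simp: time_bound_def)
  next
    case False
    then have ne: "rs \<noteq> []" "bs \<noteq> []" using len by auto
    obtain av ac where sep: "\<forall>r\<in>R. av \<bullet> r < ac" "\<forall>b\<in>B. ac < av \<bullet> b" using assms(4) by (auto simp: separated_by_line_def)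
    interpret config rs bs av ac
      using ne len False sep assms by unfold_locales auto
    from algorithm_runs[OF len] obtain t s P where a: "exec (prep ;; peel) (input_ram rs bs) t s"
      "t \<le> 40000 * N * (floor_log (4 * N) + 1) + 50" "output_family rs bs s P" "K13_covering (set rs) (set bs) P" by blast
    have N: "N = 4 * (g + hn)" using len by simp
    have "exec covering_program (input_ram rs bs) (1 + bcost (NLess (NLit 0) (NV ''red_count'')) + t) s"
      unfolding covering_program_def using rc ne a(1) by (intro exec.CondTrue) simp_all
    moreover have "1 + bcost (NLess (NLit 0) (NV ''red_count'')) + t \<le> time_bound (4 * (g + hn))"
      using a(2) unfolding N time_bound_def by simp
    ultimately show ?thesis using a(3,4) assms(6,8) by blast
  qed
qed

theorem theorem7:
  "\<exists>(prog :: com) (T :: nat \<Rightarrow> nat).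
     (\<lambda>N. real (T N)) \<in> O(\<lambda>N. real N * ln (real N)) \<and>
     (\<forall>(g :: nat) (h :: nat) (R :: point set) (B :: point set) (rs :: point list) (bs :: point list).
        finite R \<and> card R = 3 * g + h \<and>
        finite B \<and> card B = 3 * h + g \<and>
        general_position (R \<union> B) \<and> separated_by_line R B \<and>
        distinct rs \<and> set rs = R \<and> distinct bs \<and> set bs = B \<longrightarrow>
        (\<exists>t s P. exec prog (input_ram rs bs) t s \<and> t \<le> T (4 * (g + h)) \<and>
           output_family rs bs s P \<and> K13_covering R B P))"
proof (rule exI[of _ covering_program], rule exI[of _ time_bound], intro conjI allI impI)
  show "(\<lambda>N. real (time_bound N)) \<in> O(\<lambda>N. real N * ln (real N))" by (rule time_bound_bigo)
  fix g h :: nat and R B :: "point set" and rs bs :: "point list"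
  assume "finite R \<and> card R = 3 * g + h \<and> finite B \<and> card B = 3 * h + g \<and> general_position (R \<union> B) \<and> separated_by_line R B \<and>
    distinct rs \<and> set rs = R \<and> distinct bs \<and> set bs = B"
  then show "\<exists>t s P. exec covering_program (input_ram rs bs) t s \<and> t \<le> time_bound (4 * (g + h)) \<and>
           output_family rs bs s P \<and> K13_covering R B P"
    by (intro covering_program_correct) auto
qed

end
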